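(* Let $N\ge 3$, $2^*=\frac{2N}{N-2}$, and let $F:\mathbb R\to\mathbb R$ be an even $C^2$ function with $F(0)=F'(0)=F''(0)=0$ satisfying: (i) $|F'(s)|\le c_1|s|^{q-1}+c_2|s|^{p-1}$ for all $s\in\mathbb R$, for some constants $c_1,c_2\ge0$ and some $2<q\le p<2^*$; (ii) $F(s)\ge -c_1 s^2-c_2|s|^{\gamma}$ for all $s\in\mathbb R$, for some $c_1,c_2\ge 0$ and some $\gamma<2+\frac4N$; (iii) there exists $s_0\in\mathbb R$ with $F(s_0)<0$. Let $J(u)=\int_{\mathbb R^N}\frac12|\nabla u|^2+F(u)\,dx$ for $u\in H^1(\mathbb R^N)$. Then there exists $\bar\rho>0$ such that for every $\rho>\bar\rho$ there exists $\bar u\in H^1(\mathbb R^N)$ with $\|\bar u\|_{L^2}=\rho$ and $$J(\bar u)=\inf\{J(v):\ v\in H^1(\mathbb R^N),\ \|v\|_{L^2}=\rho\}.$$ Moreover, there exist $\lambda<0$ and such a $\bar u$, positive and radially symmetric, solving $-\Delta \bar u+F'(\bar u)=\lambda \bar u$ in $\mathbb R^N$.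
   Context: $H^1(\mathbb R^N)$ denotes the real Sobolev space; $\lambda$ is the Lagrange multiplier of the constrained minimization problem. *)

theory Defs
  imports "HOL-Analysis.Analysis"
begin

definition L2norm :: "(real^'n::finite \<Rightarrow> real) \<Rightarrow> real" where
  "L2norm u = sqrt (LINT x|lborel. (u x)^2)"

definition testfun :: "(real^'n::finite \<Rightarrow> real) \<Rightarrow> (real^'n \<Rightarrow> real^'n) \<Rightarrow> bool" where
  "testfun phi Dphi \<longleftrightarrow>
     (\<forall>x. (phi has_derivative (\<lambda>h. Dphi x \<bullet> h)) (at x)) \<and>
     continuous_on UNIV Dphi \<and> compact (closure {x. phi x \<noteq> 0})"

definition weak_grad :: "(real^'n::finite \<Rightarrow> real) \<Rightarrow> (real^'n \<Rightarrow> real^'n) \<Rightarrow> bool" where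
  "weak_grad u g \<longleftrightarrow>
     (\<forall>phi Dphi i. testfun phi Dphi \<longrightarrow>
        (LINT x|lborel. u x * (Dphi x $ i)) = - (LINT x|lborel. (g x $ i) * phi x))"

definition sqL2 :: "(real^'n::finite \<Rightarrow> real) \<Rightarrow> bool" where
  "sqL2 u \<longleftrightarrow> u \<in> borel_measurable lborel \<and> integrable lborel (\<lambda>x. (u x)^2)"

definition H1 :: "(real^'n::finite \<Rightarrow> real) set" where
  "H1 = {u. sqL2 u \<and> (\<exists>g. (\<forall>i. sqL2 (\<lambda>x. g x $ i)) \<and> weak_grad u g)}"

definition wgrad :: "(real^'n::finite \<Rightarrow> real) \<Rightarrow> (real^'n \<Rightarrow> real^'n)" where
  "wgrad u = (SOME g. (\<forall>i. sqL2 (\<lambda>x. g x $ i)) \<and> weak_grad u g)"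

definition J :: "(real \<Rightarrow> real) \<Rightarrow> (real^'n::finite \<Rightarrow> real) \<Rightarrow> real" where
  "J F u = (LINT x|lborel. (1/2) * (norm (wgrad u x))^2 + F (u x))"

definition weak_solution :: "(real \<Rightarrow> real) \<Rightarrow> real \<Rightarrow> (real^'n::finite \<Rightarrow> real) \<Rightarrow> bool" where
  "weak_solution F' lam u \<longleftrightarrow>
     (\<forall>phi Dphi. testfun phi Dphi \<longrightarrow>
        (LINT x|lborel. wgrad u x \<bullet> Dphi x + F' (u x) * phi x) = lam * (LINT x|lborel. u x * phi x))"

end

theory Submission
  imports Defs "HOL-Complex_Analysis.Great_Picard" "HOL-Probability.Helly_Selection"
begin

text \<open>
  A bound A on the Dirichlet integral is expressed by the requirement (\<open>energy_le u A\<close>) that for all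
  e > 0 the integral of \<open>(u (x + e y) - u x)\<^sup>2\<close> over all x and |y| < 1 is at most a fixed multiple of
  \<open>A e\<^sup>2\<close>; a square-integrable u satisfies it if and only if it has a weak gradient with squared norm
  at most A. In this form the energy is visibly lower semicontinuous and does not increase under
  contractions and polarisations.

  A function in \<open>H\<^sup>1\<close> can be approximated in energy by Lipschitz functions of compact support, and these
  can be made radially decreasing by polarisation. Radial decrease together with the energy bound gives
  pointwise decay, hence coercivity below the mass-critical exponent and, by Helly's selection theorem
  and dominated convergence, a radially decreasing limit of a minimising sequence. For large mass the
  infimum is negative, so if mass were lost in the limit, a dilation would beat the infimum.

  The equation is the first variation on the sphere of radius \<open>\<rho>\<close>. Stationarity along mass-preserving
  dilations gives \<open>\<lambda> \<rho>\<^sup>2 = 2 J(u) - (2/N) \<integral> |\<nabla>u|\<^sup>2 < 0\<close>, and testing the equation just inside the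
  boundary of the support shows that the minimiser is positive.
\<close>

subsection \<open>Square-integrable functions\<close>

text \<open>The increments are averaged over a whole ball because polarisation respects distances
  but not directions: a kernel that depends only on the distance and decreases with it reduces the
  gain to a rearrangement inequality for four numbers, and no chain rule for weak derivatives of
  maxima or truncations is needed. Likewise the minimisation runs over pairs of a function and an
  upper bound A for its energy, since such bounds survive approximation, rearrangement and pointwise
  limits; a weak gradient is extracted from the bound where one is wanted.

  Mass can be lost because the exponent 2 is an endpoint: the decay |x|^(-N/2) forced by the mass
  just fails to be square integrable at infinity, and the decay |x|^(-(N-2)/2) forced by the energy
  just fails at the critical exponent. Strictly in between there is an integrable majorant, so the
  potential passes to the limit and the mass need not. Negativity of the infimum m repairs this:
  under u(x/t) with t > 1 mass and potential grow by t^N, the Dirichlet term only by t^(N-2), so the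
  energy becomes at most t^N m < m.\<close>

lemma integrable_mult_squares:
  fixes f g :: "'a \<Rightarrow> real"
  assumes [measurable]: "f \<in> borel_measurable M" "g \<in> borel_measurable M"
    and "integrable M (\<lambda>x. (f x)\<^sup>2)" "integrable M (\<lambda>x. (g x)\<^sup>2)"
  shows "integrable M (\<lambda>x. f x * g x)"
proof (rule Bochner_Integration.integrable_bound)
  show "integrable M (\<lambda>x. (f x)\<^sup>2 + (g x)\<^sup>2)" using assms by simp
  show "AE x in M. norm (f x * g x) \<le> norm ((f x)\<^sup>2 + (g x)\<^sup>2)"
  proof (rule AE_I2)
    fix x
    have "0 \<le> (\<bar>f x\<bar> - \<bar>g x\<bar>)\<^sup>2" by simp
    then have "2 * (\<bar>f x\<bar> * \<bar>g x\<bar>) \<le> (f x)\<^sup>2 + (g x)\<^sup>2" by (simp add: power2_diff)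
    moreover have "0 \<le> \<bar>f x\<bar> * \<bar>g x\<bar>" by simp
    ultimately have "\<bar>f x\<bar> * \<bar>g x\<bar> \<le> (f x)\<^sup>2 + (g x)\<^sup>2" by linarith
    then show "norm (f x * g x) \<le> norm ((f x)\<^sup>2 + (g x)\<^sup>2)"
      by (simp add: abs_mult)
  qed
qed simp

lemma integrable_add_square:
  fixes f g :: "'a \<Rightarrow> real"
  assumes [measurable]: "f \<in> borel_measurable M" "g \<in> borel_measurable M"
    and "integrable M (\<lambda>x. (f x)\<^sup>2)" "integrable M (\<lambda>x. (g x)\<^sup>2)"
  shows "integrable M (\<lambda>x. (f x + g x)\<^sup>2)"
proof -
  have "integrable M (\<lambda>x. (f x)\<^sup>2 + (g x)\<^sup>2 + 2 * (f x * g x))"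
    using assms integrable_mult_squares[OF assms] by (intro Bochner_Integration.integrable_add integrable_mult_right)
  then show ?thesis by (simp add: power2_sum mult.assoc)
qed

lemma integrable_diff_square:
  fixes f g :: "'a \<Rightarrow> real"
  assumes [measurable]: "f \<in> borel_measurable M" "g \<in> borel_measurable M"
    and "integrable M (\<lambda>x. (f x)\<^sup>2)" "integrable M (\<lambda>x. (g x)\<^sup>2)"
  shows "integrable M (\<lambda>x. (f x - g x)\<^sup>2)"
  using integrable_add_square[of f M "\<lambda>x. - g x"] assms by simp

lemma Cauchy_Schwarz_integral:
  fixes f g :: "'a \<Rightarrow> real"
  assumes [measurable]: "f \<in> borel_measurable M" "g \<in> borel_measurable M"
    and f2: "integrable M (\<lambda>x. (f x)\<^sup>2)" and g2: "integrable M (\<lambda>x. (g x)\<^sup>2)"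
  shows "\<bar>\<integral>x. f x * g x \<partial>M\<bar> \<le> sqrt (\<integral>x. (f x)\<^sup>2 \<partial>M) * sqrt (\<integral>x. (g x)\<^sup>2 \<partial>M)"
proof -
  let ?a = "\<integral>x. (f x)\<^sup>2 \<partial>M" and ?b = "\<integral>x. f x * g x \<partial>M" and ?c = "\<integral>x. (g x)\<^sup>2 \<partial>M"
  have fg: "integrable M (\<lambda>x. f x * g x)" by (rule integrable_mult_squares) fact+
  have q: "0 \<le> ?a + 2 * t * ?b + t\<^sup>2 * ?c" for t
  proof -
    have "0 \<le> (\<integral>x. (f x + t * g x)\<^sup>2 \<partial>M)" by simp
    also have "\<dots> = (\<integral>x. (f x)\<^sup>2 + (2 * t) * (f x * g x) + t\<^sup>2 * (g x)\<^sup>2 \<partial>M)"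
      by (rule Bochner_Integration.integral_cong) (auto simp: power2_sum power_mult_distrib)
    also have "\<dots> = ?a + 2 * t * ?b + t\<^sup>2 * ?c" using f2 g2 fg by simp
    finally show ?thesis .
  qed
  have "?b\<^sup>2 \<le> ?a * ?c"
  proof (cases "?c = 0")
    case True
    have "AE x in M. (g x)\<^sup>2 = 0"
      using integral_nonneg_eq_0_iff_AE[OF g2] True by simp
    then have "?b = (\<integral>x. 0 \<partial>M)" by (intro integral_cong_AE) auto
    then show ?thesis using True by simp
  next
    case False
    then have c: "?c > 0" by (simp add: less_le)
    \<comment> \<open>The quadratic in t is evaluated at its minimiser -\<open>?b\<close> /
      \<open>?c\<close>.\<close>
    have "0 \<le> ?a + 2 * (- ?b / ?c) * ?b + (- ?b / ?c)\<^sup>2 * ?c" by (rule q)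
    also have "\<dots> = ?a - ?b\<^sup>2 / ?c" using c by (simp add: power2_eq_square field_simps)
    finally show ?thesis using c by (simp add: field_simps)
  qed
  then have "sqrt (?b\<^sup>2) \<le> sqrt (?a * ?c)" by (rule real_sqrt_le_mono)
  then show ?thesis by (simp add: real_sqrt_mult)
qed

text \<open>A subsequence with summable increments converges almost everywhere; Fatou then gives
  convergence in mean of the whole sequence. It supplies the limit in the Riesz representation of
  the weak gradient.\<close>

lemma Riesz_Fischer:
  fixes f :: "nat \<Rightarrow> 'a \<Rightarrow> real"
  assumes [measurable]: "\<And>n. f n \<in> borel_measurable M"
    and f2: "\<And>n. integrable M (\<lambda>x. (f n x)\<^sup>2)"
    and Cauchy: "\<And>e. e > 0 \<Longrightarrow> \<exists>N. \<forall>m\<ge>N. \<forall>n\<ge>N. (\<integral>x. (f m x - f n x)\<^sup>2 \<partial>M) < e"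
  obtains g where "g \<in> borel_measurable M" "integrable M (\<lambda>x. (g x)\<^sup>2)"
    "(\<lambda>n. \<integral>x. (f n x - g x)\<^sup>2 \<partial>M) \<longlonglongrightarrow> 0"
proof -
  have d2: "integrable M (\<lambda>x. (f m x - f n x)\<^sup>2)" for m n
    by (rule integrable_diff_square) (use f2 in auto)
  have "\<exists>N. \<forall>m\<ge>N. \<forall>n\<ge>N. (\<integral>x. (f m x - f n x)\<^sup>2 \<partial>M) < (1/4)^k" for k :: nat
    by (rule Cauchy) simp
  then obtain N where N: "\<And>k m n. m \<ge> N k \<Longrightarrow> n \<ge> N k \<Longrightarrow> (\<integral>x. (f m x - f n x)\<^sup>2 \<partial>M) < (1/4)^k"
    by metis
  define r where "r k = (\<Sum>i\<le>k. Suc (N i))" for k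
  have r_ge: "N k \<le> r k" for k
    unfolding r_def by (cases k) auto
  have rS: "r k < r (Suc k)" for k unfolding r_def by simp
  then have r_mono: "strict_mono r" by (simp add: strict_mono_Suc_iff)
  have step: "(\<integral>x. (f (r (Suc k)) x - f (r k) x)\<^sup>2 \<partial>M) < (1/4)^k" for k
    by (rule N) (use r_ge[of k] rS[of k] in auto)
  \<comment> \<open>The weight 2^k leaves integrals below 2^(-k), still summable. Where the sum of
    the \<open>h k x\<close> is finite, the increments are at most a constant times 2^(-k/2), so
    their own series converges.\<close>
  define h where "h k x = 2^k * (f (r (Suc k)) x - f (r k) x)\<^sup>2" for k x
  have [measurable]: "h k \<in> borel_measurable M" for k unfolding h_def by measurable
  have "(\<integral>\<^sup>+x. (\<Sum>k. ennreal (h k x)) \<partial>M) = (\<Sum>k. \<integral>\<^sup>+x. ennreal (h k x) \<partial>M)"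
    by (rule nn_integral_suminf) simp
  also have "\<dots> \<le> (\<Sum>k. ennreal ((1/2)^k))"
  proof (rule suminf_le)
    fix k
    have "(\<integral>\<^sup>+x. ennreal (h k x) \<partial>M) = ennreal (\<integral>x. h k x \<partial>M)"
      by (rule nn_integral_eq_integral) (use d2 in \<open>auto simp: h_def\<close>)
    also have "(\<integral>x. h k x \<partial>M) \<le> 2^k * (1/4)^k"
      unfolding h_def using step[of k] by simp
    also have "(2::real)^k * (1/4)^k = (1/2)^k" by (simp flip: power_mult_distrib)
    finally show "(\<integral>\<^sup>+x. ennreal (h k x) \<partial>M) \<le> ennreal ((1/2)^k)"
      by (simp add: ennreal_leI)
  qed auto
  also have "\<dots> = ennreal (\<Sum>k. (1/2)^k)" by (rule suminf_ennreal_eq[OF _ summable_sums]) auto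
  also have "\<dots> < \<infinity>" by simp
  finally have fin: "(\<integral>\<^sup>+x. (\<Sum>k. ennreal (h k x)) \<partial>M) \<noteq> \<infinity>" by simp
  have "AE x in M. (\<Sum>k. ennreal (h k x)) \<noteq> \<infinity>"
    by (rule nn_integral_PInf_AE) (use fin in auto)
  then have conv: "AE x in M. convergent (\<lambda>k. f (r k) x)"
  proof (rule AE_mp, intro AE_I2 impI)
    fix x assume fx: "(\<Sum>k. ennreal (h k x)) \<noteq> \<infinity>"
    have hn: "h k x \<ge> 0" for k by (simp add: h_def)
    have "summable (\<lambda>k. h k x)"
      using fx hn by (intro summable_suminf_not_top) auto
    then have "(\<lambda>k. h k x) \<longlonglongrightarrow> 0" by (rule summable_LIMSEQ_zero)
    then have "Bseq (\<lambda>k. h k x)" by (rule convergent_imp_Bseq[OF convergentI])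
    then obtain B where B: "B > 0" "\<And>k. norm (h k x) \<le> B" unfolding Bseq_def by auto
    have "norm (f (r (Suc k)) x - f (r k) x) \<le> sqrt B * (1 / sqrt 2)^k" for k
    proof -
      have "h k x \<le> B" using B(2)[of k] by simp
      then have "(f (r (Suc k)) x - f (r k) x)\<^sup>2 \<le> B * (1/2)^k"
        by (simp add: h_def power_one_over field_simps)
      then have "sqrt ((f (r (Suc k)) x - f (r k) x)\<^sup>2) \<le> sqrt (B * (1/2)^k)"
        by (rule real_sqrt_le_mono)
      moreover have "sqrt ((1/2)^k) = (1 / sqrt 2)^k" by (simp add: real_sqrt_power real_sqrt_divide)
      ultimately show ?thesis by (simp only: real_sqrt_abs real_sqrt_mult real_norm_def)
    qed
    then have bd: "\<exists>N. \<forall>k\<ge>N. norm (f (r (Suc k)) x - f (r k) x) \<le> sqrt B * (1 / sqrt 2)^k"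
      by blast
    have "summable (\<lambda>k. f (r (Suc k)) x - f (r k) x)"
      by (rule summable_comparison_test[OF bd], intro summable_mult summable_geometric) simp
    then have "convergent (\<lambda>n. (\<Sum>k<n. f (r (Suc k)) x - f (r k) x) + f (r 0) x)"
      by (intro convergent_add convergent_const) (simp add: summable_iff_convergent)
    moreover have "(\<Sum>k<n. f (r (Suc k)) x - f (r k) x) = f (r n) x - f (r 0) x" for n
      by (rule sum_lessThan_telescope)
    ultimately have "convergent (\<lambda>n. (f (r n) x - f (r 0) x) + f (r 0) x)" by simp
    then show "convergent (\<lambda>k. f (r k) x)" by simp
  qed
  define g where "g x = lim (\<lambda>k. f (r k) x)" for x
  have g[measurable]: "g \<in> borel_measurable M" unfolding g_def by measurable
  have lim: "AE x in M. (\<lambda>k. f (r k) x) \<longlonglongrightarrow> g x"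
    using conv by eventually_elim (simp add: g_def convergent_LIMSEQ_iff)
  \<comment> \<open>Only the second index runs to its limit, along the subsequence \<open>r\<close>;
    since n is arbitrary, the full sequence is controlled.\<close>
  have Fatou: "(\<integral>\<^sup>+x. ennreal ((f n x - g x)\<^sup>2) \<partial>M) \<le> ennreal e"
    if "\<And>m. m \<ge> N0 \<Longrightarrow> (\<integral>x. (f n x - f m x)\<^sup>2 \<partial>M) \<le> e" for n e N0
  proof -
    have "(\<integral>\<^sup>+x. ennreal ((f n x - g x)\<^sup>2) \<partial>M)
        = (\<integral>\<^sup>+x. liminf (\<lambda>k. ennreal ((f n x - f (r k) x)\<^sup>2)) \<partial>M)"
    proof (rule nn_integral_cong_AE, use lim in eventually_elim)
      fix x assume "(\<lambda>k. f (r k) x) \<longlonglongrightarrow> g x"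
      then have "(\<lambda>k. ennreal ((f n x - f (r k) x)\<^sup>2)) \<longlonglongrightarrow> ennreal ((f n x - g x)\<^sup>2)"
        by (intro tendsto_intros tendsto_ennrealI)
      then show "ennreal ((f n x - g x)\<^sup>2) = liminf (\<lambda>k. ennreal ((f n x - f (r k) x)\<^sup>2))"
        by (intro lim_imp_Liminf[symmetric]) auto
    qed
    also have "\<dots> \<le> liminf (\<lambda>k. \<integral>\<^sup>+x. ennreal ((f n x - f (r k) x)\<^sup>2) \<partial>M)"
      by (rule nn_integral_liminf) simp
    also have "\<dots> \<le> liminf (\<lambda>k. ennreal e)"
    proof (rule Liminf_mono)
      show "\<forall>\<^sub>F k in sequentially. (\<integral>\<^sup>+x. ennreal ((f n x - f (r k) x)\<^sup>2) \<partial>M) \<le> ennreal e"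
        using eventually_ge_at_top[of N0]
      proof eventually_elim
        case (elim k)
        have "r k \<ge> N0" using elim seq_suble[OF r_mono, of k] by simp
        then show ?case
          using that[of "r k"] d2[of n "r k"] by (simp add: nn_integral_eq_integral ennreal_leI)
      qed
    qed
    finally show ?thesis by (simp add: Liminf_const)
  qed
  obtain N1 where N1: "\<And>m n. m \<ge> N1 \<Longrightarrow> n \<ge> N1 \<Longrightarrow> (\<integral>x. (f m x - f n x)\<^sup>2 \<partial>M) < 1"
    using Cauchy[of 1] by auto
  have N1g: "integrable M (\<lambda>x. (f N1 x - g x)\<^sup>2)"
    using Fatou[of N1 N1 1] N1
    by (intro integrableI_bounded) (auto simp: less_eq_real_def top_unique less_top[symmetric] intro: le_less_trans)
  have "integrable M (\<lambda>x. (f N1 x - (f N1 x - g x))\<^sup>2)"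
    by (rule integrable_diff_square[OF _ _ f2 N1g]) auto
  then have g2: "integrable M (\<lambda>x. (g x)\<^sup>2)" by simp
  have dg: "integrable M (\<lambda>x. (f n x - g x)\<^sup>2)" for n
    by (intro integrable_diff_square) (use f2 g2 in auto)
  have "(\<lambda>n. \<integral>x. (f n x - g x)\<^sup>2 \<partial>M) \<longlonglongrightarrow> 0"
  proof (rule LIMSEQ_I)
    fix e :: real assume e: "e > 0"
    then obtain N2 where N2: "\<And>m n. m \<ge> N2 \<Longrightarrow> n \<ge> N2 \<Longrightarrow> (\<integral>x. (f m x - f n x)\<^sup>2 \<partial>M) < e/2"
      using Cauchy[of "e/2"] by auto
    have "(\<integral>x. (f n x - g x)\<^sup>2 \<partial>M) \<le> e/2" if "n \<ge> N2" for n
    proof -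
      have "ennreal (\<integral>x. (f n x - g x)\<^sup>2 \<partial>M) \<le> ennreal (e/2)"
        using Fatou[of N2 n "e/2"] N2[OF that] dg[of n] by (simp add: nn_integral_eq_integral less_eq_real_def)
      then show ?thesis using e by (simp add: ennreal_le_iff)
    qed
    then show "\<exists>no. \<forall>n\<ge>no. norm ((\<integral>x. (f n x - g x)\<^sup>2 \<partial>M) - 0) < e"
      using e by (intro exI[of _ N2]) force
  qed
  then show ?thesis using that g g2 by blast
qed

text \<open>Dominated convergence for the difference quotients, which the mean value inequality
  bounds by G. It differentiates pairings with translated test functions and the potential along a
  variation.\<close>

lemma has_derivative_integral_param:
  fixes f f' :: "real \<Rightarrow> 'a \<Rightarrow> real"
  assumes d: "d > 0"
    and int: "\<And>t. \<bar>t - t0\<bar> < d \<Longrightarrow> integrable M (f t)"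
    and der: "\<And>t x. \<bar>t - t0\<bar> < d \<Longrightarrow> ((\<lambda>t. f t x) has_real_derivative f' t x) (at t)"
    and bd: "\<And>t x. \<bar>t - t0\<bar> < d \<Longrightarrow> \<bar>f' t x\<bar> \<le> G x"
    and G: "integrable M G"
    and [measurable]: "f' t0 \<in> borel_measurable M"
  shows "((\<lambda>t. \<integral>x. f t x \<partial>M) has_real_derivative (\<integral>x. f' t0 x \<partial>M)) (at t0)"
  unfolding has_field_derivative_iff
proof (rule tendsto_at_iff_sequentially[THEN iffD2], intro allI impI)
  fix X :: "nat \<Rightarrow> real" assume X: "\<forall>i. X i \<in> UNIV - {t0}" and Xlim: "X \<longlonglongrightarrow> t0"
  from Xlim have ev: "\<forall>\<^sub>F n in sequentially. \<bar>X n - t0\<bar> < d"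
    using d by (auto simp: tendsto_iff dist_real_def)
  then obtain n0 where n0: "\<And>n. n \<ge> n0 \<Longrightarrow> \<bar>X n - t0\<bar> < d" by (auto simp: eventually_sequentially)
  have [simp]: "\<bar>t0 - t0\<bar> < d" using d by simp
  let ?q = "\<lambda>n x. (f (X (n + n0)) x - f t0 x) / (X (n + n0) - t0)"
  have qi: "integrable M (?q n)" for n
    using int[OF n0[of "n+n0"]] int[of t0] d by simp
  have lim: "(\<lambda>n. \<integral>x. ?q n x \<partial>M) \<longlonglongrightarrow> (\<integral>x. f' t0 x \<partial>M)"
  proof (rule integral_dominated_convergence[where w=G])
    show "?q n \<in> borel_measurable M" for n using qi by blast
    show "AE x in M. (\<lambda>n. ?q n x) \<longlonglongrightarrow> f' t0 x"
    proof (rule AE_I2)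
      fix x
      have "((\<lambda>t. (f t x - f t0 x) / (t - t0)) \<longlongrightarrow> f' t0 x) (at t0)"
        using der[of t0 x] d by (simp add: has_field_derivative_iff)
      then have "(\<lambda>n. (f (X n) x - f t0 x) / (X n - t0)) \<longlonglongrightarrow> f' t0 x"
        using X Xlim by (force simp: tendsto_at_iff_sequentially o_def)
      then show "(\<lambda>n. ?q n x) \<longlonglongrightarrow> f' t0 x" by (rule LIMSEQ_ignore_initial_segment)
    qed
    show "AE x in M. norm (?q n x) \<le> G x" for n
    proof (rule AE_I2)
      fix x
      let ?t = "X (n + n0)"
      have tn: "?t \<noteq> t0" using X by auto
      have td: "\<bar>?t - t0\<bar> < d" by (rule n0) simp
      have "norm (f ?t x - f t0 x) \<le> G x * norm (?t - t0)"
      proof (rule field_differentiable_bound[where S="{t. \<bar>t - t0\<bar> < d}" and f'="\<lambda>t. f' t x"])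
        have "{t. \<bar>t - t0\<bar> < d} = ball t0 d" by (auto simp: dist_real_def)
        then show "convex {t. \<bar>t - t0\<bar> < d}" by simp
      qed (use der bd td in \<open>auto intro: has_field_derivative_at_within\<close>)
      then show "norm (?q n x) \<le> G x" using tn by (simp add: field_simps)
    qed
  qed (use G in auto)
  have "(\<lambda>n. ((\<integral>x. f (X (n+n0)) x \<partial>M) - (\<integral>x. f t0 x \<partial>M)) / (X (n+n0) - t0)) \<longlonglongrightarrow> (\<integral>x. f' t0 x \<partial>M)"
  proof (rule tendsto_cong[THEN iffD1, OF _ lim], rule always_eventually, rule allI)
    fix n show "(\<integral>x. ?q n x \<partial>M) = ((\<integral>x. f (X (n+n0)) x \<partial>M) - (\<integral>x. f t0 x \<partial>M)) / (X (n+n0) - t0)"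
      using int[OF n0[of "n+n0"]] int[of t0] d by simp
  qed
  then show "((\<lambda>t. ((\<integral>x. f t x \<partial>M) - (\<integral>x. f t0 x \<partial>M)) / (t - t0)) \<circ> X) \<longlonglongrightarrow> (\<integral>x. f' t0 x \<partial>M)"
    unfolding o_def by (rule LIMSEQ_offset)
qed

subsection \<open>Invariance of Lebesgue measure\<close>

lemma nn_integral_lborel_affine:
  fixes f :: "'a::euclidean_space \<Rightarrow> ennreal"
  assumes [measurable]: "f \<in> borel_measurable borel" and c: "c \<noteq> 0"
  shows "(\<integral>\<^sup>+x. f x \<partial>lborel) = ennreal (\<bar>c\<bar> ^ DIM('a)) * (\<integral>\<^sup>+x. f (t + c *\<^sub>R x) \<partial>lborel)"
  by (subst lborel_affine[OF c, of t])
     (simp add: nn_integral_density nn_integral_distr nn_integral_cmult)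

lemma nn_integral_lborel_translate:
  fixes f :: "'a::euclidean_space \<Rightarrow> ennreal"
  assumes "f \<in> borel_measurable borel"
  shows "(\<integral>\<^sup>+x. f (x + t) \<partial>lborel) = (\<integral>\<^sup>+x. f x \<partial>lborel)"
  using nn_integral_lborel_affine[OF assms, of 1 t] by (simp add: add.commute)

lemma
  fixes f :: "'a::euclidean_space \<Rightarrow> real"
  assumes c: "c \<noteq> 0" and f: "integrable lborel f"
  shows integrable_lborel_affine: "integrable lborel (\<lambda>x. f (t + c *\<^sub>R x))"
    and integral_lborel_affine:
      "(\<integral>x. f (t + c *\<^sub>R x) \<partial>lborel) = (\<integral>x. f x \<partial>lborel) / \<bar>c\<bar> ^ DIM('a)"
proof -
  have [measurable]: "f \<in> borel_measurable borel" using f by auto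
  let ?M = "density (distr lborel borel (\<lambda>x. t + c *\<^sub>R x)) (\<lambda>_. ennreal (\<bar>c\<bar> ^ DIM('a)))"
  have eq: "lborel = ?M" using lborel_affine[OF c, of t] by simp
  have "integrable ?M f" using f eq by simp
  then have "integrable lborel (\<lambda>x. \<bar>c\<bar> ^ DIM('a) * f (t + c *\<^sub>R x))"
    by (simp add: integrable_density integrable_distr_eq)
  then show i: "integrable lborel (\<lambda>x. f (t + c *\<^sub>R x))" using c by simp
  have "(\<integral>x. f x \<partial>lborel) = (\<integral>x. f x \<partial>?M)" using eq by simp
  also have "\<dots> = \<bar>c\<bar> ^ DIM('a) * (\<integral>x. f (t + c *\<^sub>R x) \<partial>lborel)"
    by (simp add: integral_density integral_distr)
  finally show "(\<integral>x. f (t + c *\<^sub>R x) \<partial>lborel) = (\<integral>x. f x \<partial>lborel) / \<bar>c\<bar> ^ DIM('a)"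
    using c by (simp add: field_simps)
qed

lemma
  fixes f :: "'a::euclidean_space \<Rightarrow> real"
  assumes f: "integrable lborel f"
  shows integrable_lborel_translate: "integrable lborel (\<lambda>x. f (x + t))"
    and integral_lborel_translate: "(\<integral>x. f (x + t) \<partial>lborel) = (\<integral>x. f x \<partial>lborel)"
  using integrable_lborel_affine[OF _ f, of 1 t] integral_lborel_affine[OF _ f, of 1 t]
  by (simp_all add: add.commute)

lemma AE_lborel_translate:
  fixes P :: "'a::euclidean_space \<Rightarrow> bool"
  assumes "AE x in lborel. P x"
  shows "AE x in lborel. P (x + t)"
proof -
  have "AE x in distr lborel borel ((+) t). P x"
    using assms by (subst lborel_distr_plus)
  then have "AE x in lborel. P (t + x)"
    by (rule AE_distrD[rotated]) simp
  then show ?thesis by (simp add: add.commute)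
qed

text \<open>Both sides are translation invariant, so Fubini compares them through the unit ball,
  which is preserved.\<close>

lemma distr_lborel_orthogonal_transformation:
  fixes T :: "'a::euclidean_space \<Rightarrow> 'a"
  assumes T: "orthogonal_transformation T"
  shows "distr lborel borel T = lborel"
proof -
  obtain S where S: "orthogonal_transformation S" "\<And>x. T (S x) = x" "\<And>x. S (T x) = x"
    using T by (metis orthogonal_transformation_bij orthogonal_transformation_inv
        bij_inv_eq_iff)
  have "linear T" "linear S" using T S(1) by (auto simp: orthogonal_transformation_linear)
  then have cont: "continuous_on UNIV T" "continuous_on UNIV S"
    by (auto intro: linear_continuous_on simp: linear_linear)
  have [measurable]: "T \<in> borel_measurable borel" "S \<in> borel_measurable borel"
    using cont by (auto intro: borel_measurable_continuous_onI)
  have [measurable]: "ball (0::'a) 1 \<in> sets borel" by simp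
  let ?b = "emeasure lborel (ball (0::'a) 1)"
  have b: "?b \<noteq> 0" "?b \<noteq> \<infinity>"
    using unit_ball_vol_pos[of "real DIM('a)"] by (simp_all add: emeasure_ball del: unit_ball_vol_pos)
  have "emeasure (distr lborel borel T) A = emeasure lborel A" if A[measurable]: "A \<in> sets borel" for A
  proof -
    let ?i = "\<lambda>y::'a. indicator (ball 0 1) y :: ennreal"
    let ?a = "\<lambda>y. indicator A y :: ennreal"
    have "?b * emeasure (distr lborel borel T) A = (\<integral>\<^sup>+y. ?i y * (\<integral>\<^sup>+x. ?a (T x) \<partial>lborel) \<partial>lborel)"
    proof -
      have "(\<integral>\<^sup>+x. ?a (T x) \<partial>lborel) = emeasure (distr lborel borel T) A"
      proof -
        have "emeasure (distr lborel borel T) A = (\<integral>\<^sup>+x. ?a x \<partial>distr lborel borel T)" by simp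
        also have "\<dots> = (\<integral>\<^sup>+x. ?a (T x) \<partial>lborel)" by (rule nn_integral_distr) auto
        finally show ?thesis by simp
      qed
      then show ?thesis by (subst nn_integral_multc) auto
    qed
    also have "\<dots> = (\<integral>\<^sup>+y. \<integral>\<^sup>+x. ?i y * ?a (T x + y) \<partial>lborel \<partial>lborel)"
    proof (rule nn_integral_cong)
      fix y
      have "(\<integral>\<^sup>+x. ?a (T x) \<partial>lborel) = (\<integral>\<^sup>+x. ?a (T (x + S y)) \<partial>lborel)"
        by (rule nn_integral_lborel_translate[symmetric]) measurable
      also have "\<dots> = (\<integral>\<^sup>+x. ?a (T x + y) \<partial>lborel)"
        using \<open>linear T\<close> S by (simp add: linear_add)
      finally show "?i y * (\<integral>\<^sup>+x. ?a (T x) \<partial>lborel) = (\<integral>\<^sup>+x. ?i y * ?a (T x + y) \<partial>lborel)"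
        by (simp add: nn_integral_cmult)
    qed
    also have "\<dots> = (\<integral>\<^sup>+x. \<integral>\<^sup>+y. ?i y * ?a (T x + y) \<partial>lborel \<partial>lborel)"
      by (rule lborel_pair.Fubini') measurable
    also have "\<dots> = (\<integral>\<^sup>+x. \<integral>\<^sup>+y. ?i (y - T x) * ?a y \<partial>lborel \<partial>lborel)"
    proof (rule nn_integral_cong)
      fix x
      have "(\<integral>\<^sup>+y. ?i (y - T x) * ?a y \<partial>lborel) = (\<integral>\<^sup>+y. ?i (y + T x - T x) * ?a (y + T x) \<partial>lborel)"
        by (rule nn_integral_lborel_translate[symmetric]) measurable
      then show "(\<integral>\<^sup>+y. ?i y * ?a (T x + y) \<partial>lborel) = (\<integral>\<^sup>+y. ?i (y - T x) * ?a y \<partial>lborel)"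
        by (simp add: add.commute)
    qed
    also have "\<dots> = (\<integral>\<^sup>+y. \<integral>\<^sup>+x. ?i (y - T x) * ?a y \<partial>lborel \<partial>lborel)"
      by (rule lborel_pair.Fubini'[symmetric]) measurable
    also have "\<dots> = (\<integral>\<^sup>+y. ?b * ?a y \<partial>lborel)"
    proof (rule nn_integral_cong)
      fix y
      \<comment> \<open>As T preserves norms, the x for which y - T x lies in the unit ball form the
        unit ball around S y, so the inner integral is the constant \<open>?b\<close>.\<close>
      have "norm (y - T x) = dist (S y) x" for x
      proof -
        have "y - T x = T (S y - x)" using \<open>linear T\<close> S by (simp add: linear_diff)
        then show ?thesis using orthogonal_transformation_norm[OF T] by (simp add: dist_norm)
      qed
      then have "?i (y - T x) = indicator (ball (S y) 1) x" for x
        by (simp add: indicator_def)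
      then have "(\<integral>\<^sup>+x. ?i (y - T x) \<partial>lborel) = ?b"
        by (simp add: emeasure_ball)
      then show "(\<integral>\<^sup>+x. ?i (y - T x) * ?a y \<partial>lborel) = ?b * ?a y"
        by (subst nn_integral_multc) (auto)
    qed
    also have "\<dots> = ?b * emeasure lborel A" by (simp add: nn_integral_cmult)
    finally show ?thesis using b by (auto simp: ennreal_mult_cancel_left)
  qed
  then show ?thesis by (intro measure_eqI) auto
qed

text \<open>For a unit vector e this is the reflection in the hyperplane
  \<open>x \<bullet> e = s\<close>. The formula does not normalise e, hence the hypothesis
  \<open>norm e = 1\<close> below.\<close>

definition reflect :: "'a::real_inner \<Rightarrow> real \<Rightarrow> 'a \<Rightarrow> 'a" where
  "reflect e s x = x - (2 * (x \<bullet> e - s)) *\<^sub>R e"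

lemma reflect_reflect [simp]: "norm e = 1 \<Longrightarrow> reflect e s (reflect e s x) = x"
  by (simp add: reflect_def inner_diff_left dot_square_norm algebra_simps)

lemma dist_reflect [simp]:
  assumes "norm e = 1" shows "dist (reflect e s x) (reflect e s y) = dist x y"
proof -
  have "e \<bullet> e = 1" using assms by (simp add: dot_square_norm)
  then have "(norm (reflect e s x - reflect e s y))\<^sup>2 = (norm (x - y))\<^sup>2"
    unfolding power2_norm_eq_inner reflect_def
    by (simp add: inner_simps algebra_simps inner_commute)
  then show ?thesis by (simp add: dist_norm)
qed

lemma continuous_reflect [continuous_intros]:
  "continuous_on S f \<Longrightarrow> continuous_on S (\<lambda>x. reflect e s (f x))"
  unfolding reflect_def by (intro continuous_intros)

lemma measurable_reflect [measurable]: "reflect (e::'a::euclidean_space) s \<in> borel_measurable borel"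
  unfolding reflect_def by measurable

text \<open>The reflection at level s is the linear one at level 0 followed by the translation by 2
  s e.\<close>

lemma distr_lborel_reflect:
  fixes e :: "'a::euclidean_space"
  assumes "norm e = 1"
  shows "distr lborel borel (reflect e s) = lborel"
proof -
  have ee: "e \<bullet> e = 1" using assms by (simp add: dot_square_norm)
  have "orthogonal_transformation (reflect e 0)"
    unfolding orthogonal_transformation_def
  proof
    show "linear (reflect e 0)"
      by (rule linearI) (simp_all add: reflect_def inner_simps algebra_simps)
    show "\<forall>v w. reflect e 0 v \<bullet> reflect e 0 w = v \<bullet> w"
      using ee by (simp add: reflect_def inner_simps algebra_simps inner_commute)
  qed
  then have r0: "distr lborel borel (reflect e 0) = lborel"
    by (rule distr_lborel_orthogonal_transformation)
  have "distr lborel borel (reflect e s) = distr lborel borel ((+) ((2 * s) *\<^sub>R e) \<circ> reflect e 0)"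
    by (rule distr_cong) (auto simp: reflect_def algebra_simps)
  also have "\<dots> = distr (distr lborel borel (reflect e 0)) borel ((+) ((2 * s) *\<^sub>R e))"
    by (rule distr_distr[symmetric]) auto
  also have "\<dots> = lborel" by (simp add: r0 lborel_distr_plus)
  finally show ?thesis .
qed

lemma nn_integral_reflect:
  fixes e :: "'a::euclidean_space"
  assumes "norm e = 1" and [measurable]: "f \<in> borel_measurable borel"
  shows "(\<integral>\<^sup>+x. f (reflect e s x) \<partial>lborel) = (\<integral>\<^sup>+x. f x \<partial>lborel)"
  by (subst (2) distr_lborel_reflect[OF assms(1), of s, symmetric])
     (simp add: nn_integral_distr)

lemma
  fixes e :: "'a::euclidean_space" and f :: "'a \<Rightarrow> real"
  assumes e: "norm e = 1" and f: "integrable lborel f"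
  shows integrable_reflect: "integrable lborel (\<lambda>x. f (reflect e s x))"
    and integral_reflect: "(\<integral>x. f (reflect e s x) \<partial>lborel) = (\<integral>x. f x \<partial>lborel)"
proof -
  have [measurable]: "f \<in> borel_measurable borel" using f by auto
  have "integrable (distr lborel borel (reflect e s)) f"
    using f by (simp add: distr_lborel_reflect[OF e])
  then show "integrable lborel (\<lambda>x. f (reflect e s x))"
    by (simp add: integrable_distr_eq)
  show "(\<integral>x. f (reflect e s x) \<partial>lborel) = (\<integral>x. f x \<partial>lborel)"
    by (subst (2) distr_lborel_reflect[OF e, of s, symmetric]) (simp add: integral_distr)
qed

subsection \<open>A nonlocal description of the Dirichlet energy\<close>


lemma integrable_indicator_ball:
  fixes f :: "'a::euclidean_space \<Rightarrow> real"
  assumes "continuous_on UNIV f"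
  shows "integrable lborel (\<lambda>x. indicator (ball a r) x * f x)"
proof -
  have "set_integrable lborel (cball a r) f"
    unfolding set_integrable_def
    by (rule borel_integrable_compact) (use assms continuous_on_subset in auto)
  then have "set_integrable lborel (ball a r) f"
    by (rule set_integrable_subset) auto
  then show ?thesis by (simp add: set_integrable_def)
qed

text \<open>The integral of \<open>(e \<bullet> y)\<^sup>2\<close> over the unit ball for any unit
  vector e: dividing by the dimension distributes the moment of the norm evenly over the
  coordinates.\<close>

definition ball_moment :: "'a::euclidean_space itself \<Rightarrow> real" where
  "ball_moment _ = (\<integral>y. indicator (ball 0 1) y * (norm (y::'a))\<^sup>2 \<partial>lborel) / real DIM('a)"

lemma ball_moment_pos: "ball_moment TYPE('a::euclidean_space) > 0"
proof -
  let ?f = "\<lambda>y::'a. indicator (ball 0 1) y * (norm y)\<^sup>2 :: real"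
  have i: "integrable lborel ?f"
    by (rule integrable_indicator_ball) (intro continuous_intros)
  \<comment> \<open>A multiple of the indicator of the shell 1/2 <= |y| < 1, on which |y|^2 is at
    least 1/4.\<close>
  let ?g = "\<lambda>y::'a. (indicator (ball 0 1) y - indicator (ball 0 (1/2)) y) * (1/4) :: real"
  have vp: "unit_ball_vol (real DIM('a)) > 0" by simp
  have iB: "integrable lborel (\<lambda>y::'a. indicator (ball 0 r) y :: real)" for r
    using integrable_indicator_ball[of "\<lambda>_. 1" 0 r] by simp
  have "(\<integral>y. ?g y \<partial>lborel) = (unit_ball_vol (real DIM('a)) * (1 - (1/2) ^ DIM('a))) * (1/4)"
    using iB by (simp add: content_ball algebra_simps)
  also have "\<dots> > 0" using vp by (simp add: power_less_one_iff)
  finally have "0 < (\<integral>y. ?g y \<partial>lborel)" .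
  also have "\<dots> \<le> (\<integral>y. ?f y \<partial>lborel)"
  proof (rule integral_mono[OF _ i])
    show "integrable lborel ?g" using iB by simp
    fix y :: 'a
    show "?g y \<le> ?f y"
    proof (cases "norm y < 1/2")
      case False
      then have "(1/2)\<^sup>2 \<le> (norm y)\<^sup>2" by (intro power_mono) auto
      then show ?thesis by (auto simp: indicator_def power2_eq_square)
    qed (auto simp: indicator_def)
  qed
  finally show ?thesis by (simp add: ball_moment_def)
qed

text \<open>Reflections preserve the ball, so the quadratic form takes equal values on vectors of
  equal norm and is a multiple of the squared norm; summing over \<open>Basis\<close> fixes the
  factor. The bilinear version follows from the polarisation identity.\<close>

lemma integral_ball_inner_mult:
  fixes a b :: "'a::euclidean_space"
  shows "(\<integral>y. indicator (ball 0 1) y * ((a \<bullet> y) * (b \<bullet> y)) \<partial>lborel) = ball_moment TYPE('a) * (a \<bullet> b)"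
proof -
  have i: "integrable lborel (\<lambda>y::'a. indicator (ball 0 1) y * ((a \<bullet> y) * (b \<bullet> y)))" for a b :: 'a
    by (rule integrable_indicator_ball) (intro continuous_intros)
  define m where "m a = (\<integral>y. indicator (ball 0 1) y * (a \<bullet> y)\<^sup>2 \<partial>lborel)" for a :: 'a
  have i2: "integrable lborel (\<lambda>y::'a. indicator (ball 0 1) y * (a \<bullet> y)\<^sup>2)" for a :: 'a
    using i[of a a] by (simp add: power2_eq_square)
  have m_eq: "m a = m b" if ab: "norm a = norm b" for a b
  proof (cases "a = b")
    case False
    \<comment> \<open>The reflection in the hyperplane orthogonal to a - b exchanges a and b,
      because their norms agree.\<close>
    define e where "e = (a - b) /\<^sub>R norm (a - b)"
    have e: "norm e = 1" using False by (simp add: e_def)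
    have aa: "a \<bullet> a = b \<bullet> b" using ab by (simp add: norm_eq)
    let ?r = "reflect e 0"
    have "norm (?r y) = norm y" for y
      using dist_reflect[OF e, of 0 y 0] by (simp add: reflect_def)
    moreover have "b \<bullet> ?r y = a \<bullet> y" for y
    proof -
      have n: "(norm (a - b))\<^sup>2 = 2 * (b \<bullet> b - a \<bullet> b)"
        using aa by (simp add: power2_norm_eq_inner inner_simps inner_commute)
      have nz: "(norm (a - b))\<^sup>2 \<noteq> 0" using False by simp
      have "b \<bullet> ?r y = b \<bullet> y - 2 * (y \<bullet> (a - b)) * (b \<bullet> (a - b)) / (norm (a - b))\<^sup>2"
        by (simp add: reflect_def e_def inner_diff_right power2_eq_square divide_inverse)
      also have "b \<bullet> (a - b) = - (norm (a - b))\<^sup>2 / 2" using n by (simp add: inner_simps inner_commute)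
      finally show ?thesis using nz by (simp add: inner_simps inner_commute field_simps)
    qed
    ultimately have "(\<integral>y. indicator (ball 0 1) (?r y) * (b \<bullet> ?r y)\<^sup>2 \<partial>lborel) = m a"
      by (simp add: m_def indicator_def)
    then show ?thesis using integral_reflect[OF e i2[of b], of 0] by (simp add: m_def)
  qed simp
  have "(\<Sum>b\<in>Basis. m b) = (\<integral>y. (\<Sum>b\<in>Basis. indicator (ball 0 1) y * (b \<bullet> (y::'a))\<^sup>2) \<partial>lborel)"
    unfolding m_def using i2 by (subst Bochner_Integration.integral_sum) auto
  also have "\<dots> = (\<integral>y. indicator (ball 0 1) y * (norm (y::'a))\<^sup>2 \<partial>lborel)"
    unfolding power2_norm_eq_inner
    by (subst euclidean_inner) (simp add: power2_eq_square inner_commute sum_distrib_left)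
  also have "\<dots> = ball_moment TYPE('a) * real DIM('a)" by (simp add: ball_moment_def)
  finally have s: "(\<Sum>b\<in>Basis. m b) = ball_moment TYPE('a) * real DIM('a)" .
  have m1: "m a = ball_moment TYPE('a)" if "norm a = 1" for a
  proof -
    have "(\<Sum>b\<in>Basis. m b) = (\<Sum>b\<in>(Basis::'a set). m a)"
      by (rule sum.cong) (auto intro!: m_eq simp: that)
    then show ?thesis using s by simp
  qed
  have m: "m a = ball_moment TYPE('a) * (a \<bullet> a)" for a
  proof (cases "a = 0")
    case False
    have "m a = (norm a)\<^sup>2 * m (a /\<^sub>R norm a)"
      using False by (simp add: m_def power_mult_distrib power_divide field_simps flip: integral_mult_right_zero)
    also have "m (a /\<^sub>R norm a) = ball_moment TYPE('a)" by (rule m1) (use False in simp)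
    finally show ?thesis by (simp add: power2_norm_eq_inner)
  qed (simp add: m_def)
  have "(\<integral>y. indicator (ball 0 1) y * ((a \<bullet> y) * (b \<bullet> y)) \<partial>lborel)
     = (\<integral>y. (indicator (ball 0 1) y * ((a + b) \<bullet> y)\<^sup>2 - indicator (ball 0 1) y * ((a - b) \<bullet> y)\<^sup>2) / 4 \<partial>lborel)"
    by (rule Bochner_Integration.integral_cong) (auto simp: inner_simps power2_eq_square algebra_simps)
  also have "\<dots> = (m (a + b) - m (a - b)) / 4"
    using i2 by (simp add: m_def)
  also have "\<dots> = ball_moment TYPE('a) * (a \<bullet> b)"
    unfolding m by (simp add: inner_simps inner_commute algebra_simps)
  finally show ?thesis .
qed

lemma nn_integral_ball_inner_square:
  fixes a :: "'a::euclidean_space"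
  shows "(\<integral>\<^sup>+y. indicator (ball 0 1) y * ennreal ((a \<bullet> y)\<^sup>2) \<partial>lborel) = ennreal (ball_moment TYPE('a) * (norm a)\<^sup>2)"
proof -
  have "(\<integral>\<^sup>+y. indicator (ball 0 1) y * ennreal ((a \<bullet> y)\<^sup>2) \<partial>lborel)
     = (\<integral>\<^sup>+y. ennreal (indicator (ball 0 1) y * ((a \<bullet> y) * (a \<bullet> y))) \<partial>lborel)"
    by (rule nn_integral_cong) (auto simp: indicator_def power2_eq_square)
  also have "\<dots> = ennreal (\<integral>y. indicator (ball 0 1) y * ((a \<bullet> y) * (a \<bullet> y)) \<partial>lborel)"
    by (rule nn_integral_eq_integral, rule integrable_indicator_ball) (auto intro!: continuous_intros)
  finally show ?thesis by (simp add: integral_ball_inner_mult power2_norm_eq_inner)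
qed

lemma nn_integral_ball_norm_square:
  "(\<integral>\<^sup>+y. indicator (ball 0 1) y * ennreal ((norm (y::'a::euclidean_space))\<^sup>2) \<partial>lborel)
     = ennreal (ball_moment TYPE('a) * real DIM('a))"
proof -
  have "(\<integral>\<^sup>+y. indicator (ball 0 1) y * ennreal ((norm (y::'a))\<^sup>2) \<partial>lborel)
     = (\<integral>\<^sup>+y. ennreal (indicator (ball 0 1) y * (norm (y::'a))\<^sup>2) \<partial>lborel)"
    by (rule nn_integral_cong) (auto simp: indicator_def)
  also have "\<dots> = ennreal (\<integral>y. indicator (ball 0 1) y * (norm (y::'a))\<^sup>2 \<partial>lborel)"
    by (rule nn_integral_eq_integral, rule integrable_indicator_ball) (auto intro!: continuous_intros)
  finally show ?thesis by (simp add: ball_moment_def)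
qed

section \<open>Averaged increments and energy bounds\<close>

definition avg_energy :: "('a::euclidean_space \<Rightarrow> real) \<Rightarrow> real \<Rightarrow> ennreal" where
  "avg_energy u \<epsilon> = (\<integral>\<^sup>+y. indicator (ball 0 1) y *
     (\<integral>\<^sup>+x. ennreal ((u (x + \<epsilon> *\<^sub>R y) - u x)\<^sup>2) \<partial>lborel) \<partial>lborel)"

text \<open>To first order the increment of a smooth u is \<epsilon> times the derivative in
  direction y, and averaging its square over the ball produces exactly the factor
  \<open>ball_moment\<close>; so A bounds the Dirichlet integral without further constants. Values
  in \<open>ennreal\<close> let Fatou and Fubini apply before anything is known to be finite. For
  negative A the right-hand side collapses to 0, hence the separate hypotheses A >= 0 below.\<close>

definition energy_le :: "('a::euclidean_space \<Rightarrow> real) \<Rightarrow> real \<Rightarrow> bool" where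
  "energy_le u A \<longleftrightarrow> (\<forall>\<epsilon>>0. avg_energy u \<epsilon> \<le> ennreal (ball_moment TYPE('a) * \<epsilon>\<^sup>2 * A))"

lemma energy_leD: "energy_le (u::'a::euclidean_space \<Rightarrow> real) A \<Longrightarrow> \<epsilon> > 0 \<Longrightarrow> avg_energy u \<epsilon> \<le> ennreal (ball_moment TYPE('a) * \<epsilon>\<^sup>2 * A)"
  by (simp add: energy_le_def)

lemma energy_le_mono: "energy_le u A \<Longrightarrow> A \<le> B \<Longrightarrow> energy_le u B"
  unfolding energy_le_def using ball_moment_pos[where 'a='a]
  by (meson ennreal_leI mult_left_mono order_trans less_imp_le mult_nonneg_nonneg zero_le_power2)

lemma avg_energy_mono:
  assumes "\<And>x y. (v y - v x)\<^sup>2 \<le> (u y - u x)\<^sup>2"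
  shows "avg_energy v \<epsilon> \<le> avg_energy u \<epsilon>"
  unfolding avg_energy_def by (intro nn_integral_mono mult_left_mono ennreal_leI assms) auto

lemma energy_le_contraction:
  assumes "energy_le u A" "\<And>s t. \<bar>T s - T t\<bar> \<le> \<bar>s - t\<bar>"
  shows "energy_le (\<lambda>x. T (u x)) A"
  unfolding energy_le_def
  using assms(1) avg_energy_mono[of "\<lambda>x. T (u x)" u] assms(2) unfolding energy_le_def
  by (meson abs_le_square_iff order_trans)

lemma energy_le_cmult:
  fixes u :: "'a::euclidean_space \<Rightarrow> real"
  assumes [measurable]: "u \<in> borel_measurable borel" and "energy_le u A"
  shows "energy_le (\<lambda>x. a * u x) (a\<^sup>2 * A)"
  unfolding energy_le_def
proof (intro allI impI)
  fix \<epsilon> :: real assume e: "\<epsilon> > 0"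
  have [measurable]: "ball (0::'a) 1 \<in> sets borel" by simp
  have "avg_energy (\<lambda>x. a * u x) \<epsilon> = (\<integral>\<^sup>+y. ennreal (a\<^sup>2) * (indicator (ball 0 1) y *
     (\<integral>\<^sup>+x. ennreal ((u (x + \<epsilon> *\<^sub>R y) - u x)\<^sup>2) \<partial>lborel)) \<partial>lborel)"
    unfolding avg_energy_def
  proof (rule nn_integral_cong)
    fix y :: 'a
    have "(\<integral>\<^sup>+x. ennreal ((a * u (x + \<epsilon> *\<^sub>R y) - a * u x)\<^sup>2) \<partial>lborel)
        = (\<integral>\<^sup>+x. ennreal (a\<^sup>2) * ennreal ((u (x + \<epsilon> *\<^sub>R y) - u x)\<^sup>2) \<partial>lborel)"
      by (simp add: ennreal_mult[symmetric] power_mult_distrib[symmetric] right_diff_distrib)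
    also have "\<dots> = ennreal (a\<^sup>2) * (\<integral>\<^sup>+x. ennreal ((u (x + \<epsilon> *\<^sub>R y) - u x)\<^sup>2) \<partial>lborel)"
      by (rule nn_integral_cmult) measurable
    finally show "indicator (ball 0 1) y * (\<integral>\<^sup>+x. ennreal ((a * u (x + \<epsilon> *\<^sub>R y) - a * u x)\<^sup>2) \<partial>lborel)
       = ennreal (a\<^sup>2) * (indicator (ball 0 1) y * (\<integral>\<^sup>+x. ennreal ((u (x + \<epsilon> *\<^sub>R y) - u x)\<^sup>2) \<partial>lborel))"
      by (simp add: mult_ac)
  qed
  also have "\<dots> = ennreal (a\<^sup>2) * avg_energy u \<epsilon>"
    unfolding avg_energy_def by (rule nn_integral_cmult) measurable
  also have "\<dots> \<le> ennreal (a\<^sup>2) * ennreal (ball_moment TYPE('a) * \<epsilon>\<^sup>2 * A)"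
    using assms(2) e by (intro mult_left_mono energy_leD) auto
  also have "\<dots> = ennreal (ball_moment TYPE('a) * \<epsilon>\<^sup>2 * (a\<^sup>2 * A))"
    by (simp add: ennreal_mult'[symmetric] mult_ac)
  finally show "avg_energy (\<lambda>x. a * u x) \<epsilon> \<le> ennreal (ball_moment TYPE('a) * \<epsilon>\<^sup>2 * (a\<^sup>2 * A))" .
qed

text \<open>Fatou is applied first in x and then in y. Convergence is needed both at x and at its
  translate, which for fixed y still excludes only a null set.\<close>

lemma avg_energy_liminf:
  fixes u :: "'a::euclidean_space \<Rightarrow> real"
  assumes [measurable]: "\<And>n. v n \<in> borel_measurable borel" "u \<in> borel_measurable borel"
    and lim: "AE x in lborel. (\<lambda>n. v n x) \<longlonglongrightarrow> u x"
  shows "avg_energy u \<epsilon> \<le> liminf (\<lambda>n. avg_energy (v n) \<epsilon>)"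
proof -
  have [measurable]: "ball (0::'a) 1 \<in> sets borel" by simp
  let ?E = "\<lambda>w y. indicator (ball 0 1) y * (\<integral>\<^sup>+x. ennreal ((w (x + \<epsilon> *\<^sub>R y) - w x)\<^sup>2) \<partial>lborel)"
  have "avg_energy u \<epsilon> \<le> (\<integral>\<^sup>+y. liminf (\<lambda>n. ?E (v n) y) \<partial>lborel)"
    unfolding avg_energy_def
  proof (rule nn_integral_mono)
    fix y :: 'a
    have "(\<integral>\<^sup>+x. ennreal ((u (x + \<epsilon> *\<^sub>R y) - u x)\<^sup>2) \<partial>lborel)
       = (\<integral>\<^sup>+x. liminf (\<lambda>n. ennreal ((v n (x + \<epsilon> *\<^sub>R y) - v n x)\<^sup>2)) \<partial>lborel)"
    proof (rule nn_integral_cong_AE, use lim AE_lborel_translate[OF lim, of "\<epsilon> *\<^sub>R y"] in eventually_elim)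
      fix x assume "(\<lambda>n. v n x) \<longlonglongrightarrow> u x" "(\<lambda>n. v n (x + \<epsilon> *\<^sub>R y)) \<longlonglongrightarrow> u (x + \<epsilon> *\<^sub>R y)"
      then have "(\<lambda>n. ennreal ((v n (x + \<epsilon> *\<^sub>R y) - v n x)\<^sup>2)) \<longlonglongrightarrow> ennreal ((u (x + \<epsilon> *\<^sub>R y) - u x)\<^sup>2)"
        by (intro tendsto_intros tendsto_ennrealI)
      then show "ennreal ((u (x + \<epsilon> *\<^sub>R y) - u x)\<^sup>2) = liminf (\<lambda>n. ennreal ((v n (x + \<epsilon> *\<^sub>R y) - v n x)\<^sup>2))"
        by (intro lim_imp_Liminf[symmetric]) auto
    qed
    also have "\<dots> \<le> liminf (\<lambda>n. \<integral>\<^sup>+x. ennreal ((v n (x + \<epsilon> *\<^sub>R y) - v n x)\<^sup>2) \<partial>lborel)"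
      by (rule nn_integral_liminf) measurable
    finally have *: "(\<integral>\<^sup>+x. ennreal ((u (x + \<epsilon> *\<^sub>R y) - u x)\<^sup>2) \<partial>lborel)
        \<le> liminf (\<lambda>n. \<integral>\<^sup>+x. ennreal ((v n (x + \<epsilon> *\<^sub>R y) - v n x)\<^sup>2) \<partial>lborel)" .
    show "?E u y \<le> liminf (\<lambda>n. ?E (v n) y)"
      using * by (cases "y \<in> ball 0 1") auto
  qed
  also have "\<dots> \<le> liminf (\<lambda>n. \<integral>\<^sup>+y. ?E (v n) y \<partial>lborel)"
    by (rule nn_integral_liminf) measurable
  finally show ?thesis by (simp add: avg_energy_def)
qed

text \<open>Lower semicontinuity with varying bounds. Applied to constant sequences it also says
  that a bound depends on u only up to null sets.\<close>

lemma energy_le_limit: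
  fixes u :: "'a::euclidean_space \<Rightarrow> real"
  assumes "\<And>n. v n \<in> borel_measurable borel" "u \<in> borel_measurable borel"
    and "AE x in lborel. (\<lambda>n. v n x) \<longlonglongrightarrow> u x"
    and en: "\<And>n. energy_le (v n) (A n)" and A: "A \<longlonglongrightarrow> A'"
  shows "energy_le u A'"
  unfolding energy_le_def
proof (intro allI impI)
  fix \<epsilon> :: real assume e: "\<epsilon> > 0"
  have "avg_energy u \<epsilon> \<le> liminf (\<lambda>n. avg_energy (v n) \<epsilon>)"
    by (rule avg_energy_liminf) fact+
  also have "\<dots> \<le> liminf (\<lambda>n. ennreal (ball_moment TYPE('a) * \<epsilon>\<^sup>2 * A n))"
    by (intro Liminf_mono always_eventually allI energy_leD en e)
  also have "\<dots> = ennreal (ball_moment TYPE('a) * \<epsilon>\<^sup>2 * A')"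
    by (intro lim_imp_Liminf tendsto_ennrealI tendsto_intros A) auto
  finally show "avg_energy u \<epsilon> \<le> ennreal (ball_moment TYPE('a) * \<epsilon>\<^sup>2 * A')" .
qed

text \<open>Substituting z = x + \<epsilon> y turns directions into pairs of points, with a kernel
  that depends on \<open>dist x z\<close> only. In this form isometries act on the energy.\<close>

lemma avg_energy_eq_kernel:
  fixes u :: "'a::euclidean_space \<Rightarrow> real"
  assumes [measurable]: "u \<in> borel_measurable borel" and e: "\<epsilon> > 0"
  shows "ennreal (\<epsilon> ^ DIM('a)) * avg_energy u \<epsilon>
    = (\<integral>\<^sup>+x. \<integral>\<^sup>+z. ennreal (indicator {..<\<epsilon>} (dist x z) * (u z - u x)\<^sup>2) \<partial>lborel \<partial>lborel)"
proof -
  have [measurable]: "ball (0::'a) 1 \<in> sets borel" by simp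
  let ?f = "\<lambda>x y. indicator (ball 0 1) y * ennreal ((u (x + \<epsilon> *\<^sub>R y) - u x)\<^sup>2)"
  have "avg_energy u \<epsilon> = (\<integral>\<^sup>+y. \<integral>\<^sup>+x. ?f x y \<partial>lborel \<partial>lborel)"
    unfolding avg_energy_def by (intro nn_integral_cong, subst nn_integral_cmult) auto
  also have "\<dots> = (\<integral>\<^sup>+x. \<integral>\<^sup>+y. ?f x y \<partial>lborel \<partial>lborel)"
    by (rule lborel_pair.Fubini') measurable
  finally have "ennreal (\<epsilon> ^ DIM('a)) * avg_energy u \<epsilon> = (\<integral>\<^sup>+x. ennreal (\<epsilon> ^ DIM('a)) * (\<integral>\<^sup>+y. ?f x y \<partial>lborel) \<partial>lborel)"
    by (subst nn_integral_cmult) auto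
  also have "\<dots> = (\<integral>\<^sup>+x. \<integral>\<^sup>+z. ennreal (indicator {..<\<epsilon>} (dist x z) * (u z - u x)\<^sup>2) \<partial>lborel \<partial>lborel)"
  proof (rule nn_integral_cong)
    fix x :: 'a
    have "(\<integral>\<^sup>+z. ennreal (indicator {..<\<epsilon>} (dist x z) * (u z - u x)\<^sup>2) \<partial>lborel)
      = ennreal (\<bar>\<epsilon>\<bar> ^ DIM('a)) * (\<integral>\<^sup>+y. ennreal (indicator {..<\<epsilon>} (dist x (x + \<epsilon> *\<^sub>R y)) * (u (x + \<epsilon> *\<^sub>R y) - u x)\<^sup>2) \<partial>lborel)"
      by (rule nn_integral_lborel_affine) (use e in auto)
    also have "(\<integral>\<^sup>+y. ennreal (indicator {..<\<epsilon>} (dist x (x + \<epsilon> *\<^sub>R y)) * (u (x + \<epsilon> *\<^sub>R y) - u x)\<^sup>2) \<partial>lborel) = (\<integral>\<^sup>+y. ?f x y \<partial>lborel)"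
      using e by (intro nn_integral_cong) (auto simp: indicator_def dist_norm)
    finally show "ennreal (\<epsilon> ^ DIM('a)) * (\<integral>\<^sup>+y. ?f x y \<partial>lborel)
      = (\<integral>\<^sup>+z. ennreal (indicator {..<\<epsilon>} (dist x z) * (u z - u x)\<^sup>2) \<partial>lborel)"
      using e by simp
  qed
  finally show ?thesis .
qed

text \<open>The product rule for increments combined with Young's inequality. The factor 1 + \<eta>
  on A can be taken close to 1, and the remainder is small for a cutoff with small slope, so cutting
  off far out costs little energy.\<close>

lemma energy_le_mult_cutoff:
  fixes u :: "'a::euclidean_space \<Rightarrow> real"
  assumes [measurable]: "u \<in> borel_measurable borel" "\<zeta> \<in> borel_measurable borel"
    and u2: "integrable lborel (\<lambda>x. (u x)\<^sup>2)"
    and en: "energy_le u A" and A: "A \<ge> 0" and \<zeta>: "\<And>x. \<bar>\<zeta> x\<bar> \<le> 1" and L: "\<And>x y. \<bar>\<zeta> x - \<zeta> y\<bar> \<le> L * dist x y"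
    and \<eta>: "\<eta> > 0"
  shows "energy_le (\<lambda>x. u x * \<zeta> x) ((1 + \<eta>) * A + (1 + 1/\<eta>) * L\<^sup>2 * real DIM('a) * (\<integral>x. (u x)\<^sup>2 \<partial>lborel))"
  unfolding energy_le_def
proof (intro allI impI)
  fix \<epsilon> :: real assume e: "\<epsilon> > 0"
  have [measurable]: "ball (0::'a) 1 \<in> sets borel" by simp
  let ?c = "ball_moment TYPE('a)"
  have c: "?c > 0" by (rule ball_moment_pos)
  let ?U = "\<integral>x. (u x)\<^sup>2 \<partial>lborel"
  have pw: "(u z * \<zeta> z - u x * \<zeta> x)\<^sup>2 \<le> (1 + \<eta>) * (u z - u x)\<^sup>2 + (1 + 1/\<eta>) * (L\<^sup>2 * (dist z x)\<^sup>2) * (u x)\<^sup>2" for x z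
  proof -
    \<comment> \<open>\<open>a + b\<close> is the increment of the product: \<open>a\<close> carries
      the increment of u and \<open>b\<close> that of the cutoff.\<close>
    define a b where "a = (u z - u x) * \<zeta> z" and "b = u x * (\<zeta> z - \<zeta> x)"
    have "0 \<le> (\<eta> * a - b)\<^sup>2 / \<eta>" using \<eta> by simp
    also have "\<dots> = \<eta> * a\<^sup>2 - 2 * a * b + b\<^sup>2 / \<eta>" using \<eta> by (simp add: power2_eq_square field_simps)
    finally have "(a + b)\<^sup>2 \<le> (1 + \<eta>) * a\<^sup>2 + (1 + 1/\<eta>) * b\<^sup>2"
      by (simp add: power2_sum algebra_simps)
    moreover have "a\<^sup>2 \<le> (u z - u x)\<^sup>2"
    proof -
      have "(\<zeta> z)\<^sup>2 \<le> 1" using \<zeta>[of z] by (simp add: abs_square_le_1)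
      then show ?thesis unfolding a_def power_mult_distrib by (simp add: mult_left_le)
    qed
    moreover have "b\<^sup>2 \<le> (L\<^sup>2 * (dist z x)\<^sup>2) * (u x)\<^sup>2"
    proof -
      have "(\<zeta> z - \<zeta> x)\<^sup>2 \<le> (L * dist z x)\<^sup>2" using L[of z x] by (metis abs_ge_zero abs_le_square_iff abs_of_nonneg order_trans)
      then show ?thesis unfolding b_def power_mult_distrib by (simp add: mult_left_mono mult.commute)
    qed
    ultimately have "(a + b)\<^sup>2 \<le> (1 + \<eta>) * (u z - u x)\<^sup>2 + (1 + 1/\<eta>) * ((L\<^sup>2 * (dist z x)\<^sup>2) * (u x)\<^sup>2)"
      using \<eta> by (smt (verit) mult_left_mono divide_nonneg_pos)
    moreover have "a + b = u z * \<zeta> z - u x * \<zeta> x" by (simp add: a_def b_def algebra_simps)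
    ultimately show ?thesis by (simp add: mult_ac)
  qed
  have inner: "(\<integral>\<^sup>+x. ennreal ((u (x + \<epsilon> *\<^sub>R y) * \<zeta> (x + \<epsilon> *\<^sub>R y) - u x * \<zeta> x)\<^sup>2) \<partial>lborel)
     \<le> ennreal (1 + \<eta>) * (\<integral>\<^sup>+x. ennreal ((u (x + \<epsilon> *\<^sub>R y) - u x)\<^sup>2) \<partial>lborel)
       + ennreal ((1 + 1/\<eta>) * L\<^sup>2 * \<epsilon>\<^sup>2 * ?U) * ennreal ((norm y)\<^sup>2)" for y
  proof -
    have "(\<integral>\<^sup>+x. ennreal ((u (x + \<epsilon> *\<^sub>R y) * \<zeta> (x + \<epsilon> *\<^sub>R y) - u x * \<zeta> x)\<^sup>2) \<partial>lborel)
      \<le> (\<integral>\<^sup>+x. ennreal (1 + \<eta>) * ennreal ((u (x + \<epsilon> *\<^sub>R y) - u x)\<^sup>2)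
          + ennreal ((1 + 1/\<eta>) * L\<^sup>2 * \<epsilon>\<^sup>2 * (norm y)\<^sup>2) * ennreal ((u x)\<^sup>2) \<partial>lborel)"
    proof (rule nn_integral_mono)
      fix x
      have "(u (x + \<epsilon> *\<^sub>R y) * \<zeta> (x + \<epsilon> *\<^sub>R y) - u x * \<zeta> x)\<^sup>2
          \<le> (1 + \<eta>) * (u (x + \<epsilon> *\<^sub>R y) - u x)\<^sup>2 + ((1 + 1/\<eta>) * L\<^sup>2 * \<epsilon>\<^sup>2 * (norm y)\<^sup>2) * (u x)\<^sup>2"
        using pw[of "x + \<epsilon> *\<^sub>R y" x] e by (simp add: dist_norm power_mult_distrib mult_ac)
      then show "ennreal ((u (x + \<epsilon> *\<^sub>R y) * \<zeta> (x + \<epsilon> *\<^sub>R y) - u x * \<zeta> x)\<^sup>2) \<le> ennreal (1 + \<eta>) * ennreal ((u (x + \<epsilon> *\<^sub>R y) - u x)\<^sup>2)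
          + ennreal ((1 + 1/\<eta>) * L\<^sup>2 * \<epsilon>\<^sup>2 * (norm y)\<^sup>2) * ennreal ((u x)\<^sup>2)"
        using \<eta> by (simp add: ennreal_mult[symmetric] ennreal_plus[symmetric] ennreal_leI del: ennreal_plus)
    qed
    also have "\<dots> = ennreal (1 + \<eta>) * (\<integral>\<^sup>+x. ennreal ((u (x + \<epsilon> *\<^sub>R y) - u x)\<^sup>2) \<partial>lborel)
         + ennreal ((1 + 1/\<eta>) * L\<^sup>2 * \<epsilon>\<^sup>2 * (norm y)\<^sup>2) * (\<integral>\<^sup>+x. ennreal ((u x)\<^sup>2) \<partial>lborel)"
      by (simp add: nn_integral_add nn_integral_cmult)
    also have "(\<integral>\<^sup>+x. ennreal ((u x)\<^sup>2) \<partial>lborel) = ennreal ?U"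
      by (rule nn_integral_eq_integral) (use u2 in auto)
    finally show ?thesis using \<eta> by (simp add: ennreal_mult[symmetric] mult_ac)
  qed
  have "avg_energy (\<lambda>x. u x * \<zeta> x) \<epsilon> \<le> (\<integral>\<^sup>+y. ennreal (1 + \<eta>) * (indicator (ball 0 1) y * (\<integral>\<^sup>+x. ennreal ((u (x + \<epsilon> *\<^sub>R y) - u x)\<^sup>2) \<partial>lborel))
      + ennreal ((1 + 1/\<eta>) * L\<^sup>2 * \<epsilon>\<^sup>2 * ?U) * (indicator (ball 0 1) y * ennreal ((norm y)\<^sup>2)) \<partial>lborel)"
    unfolding avg_energy_def
    by (rule nn_integral_mono) (use inner in \<open>auto simp: indicator_def\<close>)
  also have "\<dots> = ennreal (1 + \<eta>) * avg_energy u \<epsilon> + ennreal ((1 + 1/\<eta>) * L\<^sup>2 * \<epsilon>\<^sup>2 * ?U) * ennreal (?c * real DIM('a))"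
    unfolding avg_energy_def nn_integral_ball_norm_square[symmetric]
    by (subst nn_integral_add) (auto simp: nn_integral_cmult)
  also have "\<dots> \<le> ennreal (1 + \<eta>) * ennreal (?c * \<epsilon>\<^sup>2 * A) + ennreal ((1 + 1/\<eta>) * L\<^sup>2 * \<epsilon>\<^sup>2 * ?U) * ennreal (?c * real DIM('a))"
    by (intro add_right_mono mult_left_mono energy_leD en e) auto
  also have "\<dots> = ennreal (?c * \<epsilon>\<^sup>2 * ((1 + \<eta>) * A + (1 + 1/\<eta>) * L\<^sup>2 * real DIM('a) * ?U))"
    using \<eta> c A by (simp add: ennreal_mult[symmetric] ennreal_plus[symmetric] del: ennreal_plus) (simp add: algebra_simps)
  finally show "avg_energy (\<lambda>x. u x * \<zeta> x) \<epsilon> \<le> ennreal (?c * \<epsilon>\<^sup>2 * ((1 + \<eta>) * A + (1 + 1/\<eta>) * L\<^sup>2 * real DIM('a) * ?U))" .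
qed

lemma Lipschitz_energy_le:
  fixes u :: "'a::euclidean_space \<Rightarrow> real"
  assumes L: "\<And>x y. \<bar>u x - u y\<bar> \<le> L * dist x y" and supp: "\<And>x. norm x \<ge> R \<Longrightarrow> u x = 0"
  obtains A where "A \<ge> 0" "energy_le u A"
proof -
  have [measurable]: "ball (0::'a) r \<in> sets borel" for r by simp
  let ?c = "ball_moment TYPE('a)" and ?V = "measure lborel (ball (0::'a) R)"
  have c: "?c > 0" by (rule ball_moment_pos)
  have V: "emeasure lborel (ball (0::'a) R) = ennreal ?V"
    using emeasure_lborel_ball_finite[of "0::'a" R] by (intro emeasure_eq_ennreal_measure) auto
  \<comment> \<open>The factor 2 counts the two balls in which x or x + h must lie for the increment
    to be nonzero; the dimension comes from integrating |y|^2 over the unit ball.\<close>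
  let ?A = "2 * L\<^sup>2 * real DIM('a) * ?V"
  have inner: "(\<integral>\<^sup>+x. ennreal ((u (x + h) - u x)\<^sup>2) \<partial>lborel) \<le> ennreal (2 * L\<^sup>2 * ?V * (norm h)\<^sup>2)" for h
  proof -
    have "(\<integral>\<^sup>+x. ennreal ((u (x + h) - u x)\<^sup>2) \<partial>lborel)
      \<le> (\<integral>\<^sup>+x. ennreal (L\<^sup>2 * (norm h)\<^sup>2) * (indicator (ball 0 R) x + indicator (ball 0 R) (x + h)) \<partial>lborel)"
    proof (rule nn_integral_mono)
      fix x
      show "ennreal ((u (x + h) - u x)\<^sup>2) \<le> ennreal (L\<^sup>2 * (norm h)\<^sup>2) * (indicator (ball 0 R) x + indicator (ball 0 R) (x + h))"
      proof (cases "norm x < R \<or> norm (x + h) < R")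
        case True
        have "\<bar>u (x + h) - u x\<bar> \<le> \<bar>L * norm h\<bar>" using L[of "x + h" x] by (simp add: dist_norm)
        then have "(u (x + h) - u x)\<^sup>2 \<le> L\<^sup>2 * (norm h)\<^sup>2" by (simp add: abs_le_square_iff power_mult_distrib)
        then have "ennreal ((u (x + h) - u x)\<^sup>2) \<le> ennreal (L\<^sup>2 * (norm h)\<^sup>2) * 1" by (simp add: ennreal_leI)
        also have "\<dots> \<le> ennreal (L\<^sup>2 * (norm h)\<^sup>2) * (indicator (ball 0 R) x + indicator (ball 0 R) (x + h))"
          by (rule mult_left_mono) (use True in \<open>auto simp: indicator_def\<close>)
        finally show ?thesis .
      qed (use supp in \<open>auto simp: not_less\<close>)
    qed
    also have "\<dots> = ennreal (L\<^sup>2 * (norm h)\<^sup>2) * ((\<integral>\<^sup>+x. indicator (ball 0 R) (x::'a) \<partial>lborel) + (\<integral>\<^sup>+x. indicator (ball 0 R) (x + h) \<partial>lborel))"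
      by (subst nn_integral_cmult) (auto simp: nn_integral_add simp del: nn_integral_indicator)
    also have "(\<integral>\<^sup>+x. indicator (ball 0 R) (x + h) \<partial>lborel) = (\<integral>\<^sup>+x. indicator (ball 0 R) (x::'a) \<partial>lborel)"
      by (rule nn_integral_lborel_translate) measurable
    finally show ?thesis
      by (simp add: V ennreal_plus[symmetric] ennreal_mult[symmetric] mult_ac del: ennreal_plus)
  qed
  have "energy_le u ?A"
    unfolding energy_le_def
  proof (intro allI impI)
    fix \<epsilon> :: real assume e: "\<epsilon> > 0"
    have "avg_energy u \<epsilon> \<le> (\<integral>\<^sup>+y. ennreal (2 * L\<^sup>2 * ?V * \<epsilon>\<^sup>2) * (indicator (ball 0 1) y * ennreal ((norm (y::'a))\<^sup>2)) \<partial>lborel)"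
      unfolding avg_energy_def
    proof (rule nn_integral_mono)
      fix y :: 'a
      show "indicator (ball 0 1) y * (\<integral>\<^sup>+x. ennreal ((u (x + \<epsilon> *\<^sub>R y) - u x)\<^sup>2) \<partial>lborel)
        \<le> ennreal (2 * L\<^sup>2 * ?V * \<epsilon>\<^sup>2) * (indicator (ball 0 1) y * ennreal ((norm y)\<^sup>2))"
        using inner[of "\<epsilon> *\<^sub>R y"] by (auto simp: indicator_def power_mult_distrib ennreal_mult[symmetric] mult_ac)
    qed
    also have "\<dots> = ennreal (2 * L\<^sup>2 * ?V * \<epsilon>\<^sup>2) * ennreal (?c * real DIM('a))"
      by (subst nn_integral_cmult) (auto simp: nn_integral_ball_norm_square)
    also have "\<dots> = ennreal (?c * \<epsilon>\<^sup>2 * ?A)" using c by (simp add: ennreal_mult[symmetric] mult_ac)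
    finally show "avg_energy u \<epsilon> \<le> ennreal (?c * \<epsilon>\<^sup>2 * ?A)" .
  qed
  then show ?thesis using that[of ?A] by simp
qed

subsection \<open>Polarisation and radial rearrangement\<close>

lemma integrable_continuous_support:
  fixes f :: "'a::euclidean_space \<Rightarrow> real"
  assumes "continuous_on UNIV f" "\<And>x. norm x \<ge> R \<Longrightarrow> f x = 0"
  shows "integrable lborel f"
proof -
  have "f = (\<lambda>x. indicator (ball 0 R) x * f x)"
    using assms(2) by (auto simp: indicator_def fun_eq_iff not_less)
  then show ?thesis using integrable_indicator_ball[OF assms(1), of 0 R] by simp
qed

lemma Lipschitz_continuous_on:
  fixes u :: "'a::metric_space \<Rightarrow> real"
  assumes L: "\<And>x y. \<bar>u x - u y\<bar> \<le> L * dist x y"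
  shows "continuous_on S u"
proof -
  \<comment> \<open>The sign of L is left open: on a one-point space it may be negative. In every
    case |L| + 1 is a Lipschitz constant.\<close>
  have "L \<ge> 0 \<or> (\<forall>x y::'a. dist x y = 0)"
  proof (rule disjCI)
    assume "\<not> (\<forall>x y::'a. dist x y = 0)"
    then obtain x y :: 'a where "dist x y > 0" by (auto simp: less_le)
    moreover have "0 \<le> L * dist x y" using L[of x y] by linarith
    ultimately show "L \<ge> 0" by (simp add: zero_le_mult_iff)
  qed
  then have "\<bar>u x - u y\<bar> \<le> (\<bar>L\<bar> + 1) * dist x y" for x y
  proof
    assume "L \<ge> 0"
    then have "L * dist x y \<le> (\<bar>L\<bar> + 1) * dist x y" by (intro mult_right_mono) auto
    then show ?thesis using L[of x y] by linarith
  next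
    assume "\<forall>x y::'a. dist x y = 0"
    then have "x = y" by auto
    then show ?thesis by simp
  qed
  then have "(\<bar>L\<bar> + 1)-lipschitz_on S u"
    by (intro lipschitz_onI) (auto simp: dist_real_def)
  then show ?thesis by (rule lipschitz_on_continuous_on)
qed

text \<open>The larger of the two values at mirror points is placed in the half-space
  \<open>x \<bullet> e \<le> s\<close>, which contains the origin when s >= 0.\<close>

definition polarize :: "'a::real_inner \<Rightarrow> real \<Rightarrow> ('a \<Rightarrow> real) \<Rightarrow> 'a \<Rightarrow> real" where
  "polarize e s u x = (if x \<bullet> e \<le> s then max (u x) (u (reflect e s x)) else min (u x) (u (reflect e s x)))"

lemma reflect_inner: "norm e = 1 \<Longrightarrow> reflect e s x \<bullet> e = 2 * s - x \<bullet> e"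
  by (simp add: reflect_def inner_simps dot_square_norm)

lemma norm_reflect_square:
  assumes "norm e = 1" shows "(norm (reflect e s x))\<^sup>2 = (norm x)\<^sup>2 + 4 * s * (s - x \<bullet> e)"
proof -
  have "e \<bullet> e = 1" using assms by (simp add: dot_square_norm)
  then show ?thesis
    unfolding power2_norm_eq_inner reflect_def by (simp add: inner_simps inner_commute[of e x] algebra_simps)
qed

lemma dist_reflect_square:
  assumes "norm e = 1" shows "(dist x (reflect e s z))\<^sup>2 = (dist x z)\<^sup>2 + 4 * (x \<bullet> e - s) * (z \<bullet> e - s)"
proof -
  have "e \<bullet> e = 1" using assms by (simp add: dot_square_norm)
  then show ?thesis
    unfolding dist_norm power2_norm_eq_inner reflect_def
    by (simp add: inner_simps inner_commute[of e x] inner_commute[of e z] inner_commute[of z x] algebra_simps)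
qed

lemma polarize_reflect:
  assumes e: "norm e = 1"
  shows "polarize e s u (reflect e s x) = (if x \<bullet> e \<le> s then min (u x) (u (reflect e s x)) else max (u x) (u (reflect e s x)))"
proof (cases "x \<bullet> e = s")
  case True
  then have "reflect e s x = x" by (simp add: reflect_def)
  then show ?thesis using True by (simp add: polarize_def)
next
  case False
  then show ?thesis using e by (auto simp: polarize_def reflect_inner max.commute min.commute)
qed

lemma measurable_polarize [measurable]:
  fixes u :: "'a::euclidean_space \<Rightarrow> real"
  assumes [measurable]: "u \<in> borel_measurable borel"
  shows "polarize e s u \<in> borel_measurable borel"
  unfolding polarize_def by measurable

text \<open>a, b are the values at a point and its mirror image, c, d those at a second such pair;
  \<open>k1\<close> weighs the uncrossed pairs and \<open>k2\<close> the crossed ones. Sorting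
  preserves sums and sums of squares, so only the cross products change, by \<open>?D\<close> and
  its negative. The sign of \<open>?D\<close> is that of a rearrangement of two pairs and matches
  the sign of \<open>k1 - k2\<close>.\<close>

lemma polarize_four_points:
  fixes a b c d k1 k2 :: real
  assumes "if same then k1 \<ge> k2 else k1 \<le> k2"
    and "a' = (if px then max a b else min a b)" "b' = (if px then min a b else max a b)"
    and "c' = (if pz then max c d else min c d)" "d' = (if pz then min c d else max c d)"
    and "same \<longleftrightarrow> (px \<longleftrightarrow> pz)"
  shows "k1 * (c' - a')\<^sup>2 + k1 * (d' - b')\<^sup>2 + k2 * (d' - a')\<^sup>2 + k2 * (c' - b')\<^sup>2
    \<le> k1 * (c - a)\<^sup>2 + k1 * (d - b)\<^sup>2 + k2 * (d - a)\<^sup>2 + k2 * (c - b)\<^sup>2"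
proof -
  have sum: "a' + b' = a + b" "c' + d' = c + d" and sq: "a'\<^sup>2 + b'\<^sup>2 = a\<^sup>2 + b\<^sup>2" "c'\<^sup>2 + d'\<^sup>2 = c\<^sup>2 + d\<^sup>2"
    using assms by (auto simp: max_def min_def)
  let ?D = "a' * c' + b' * d' - a * c - b * d"
  have cross: "a' * d' + b' * c' - a * d - b * c = - ?D"
  proof -
    have "(a' + b') * (c' + d') = (a + b) * (c + d)" using sum by simp
    then show ?thesis by (simp add: algebra_simps)
  qed
  have split: "k1 * (c - a)\<^sup>2 + k1 * (d - b)\<^sup>2 + k2 * (d - a)\<^sup>2 + k2 * (c - b)\<^sup>2
     = (k1 + k2) * ((a\<^sup>2 + b\<^sup>2) + (c\<^sup>2 + d\<^sup>2)) - 2 * k1 * (a * c + b * d) - 2 * k2 * (a * d + b * c)" for a b c d :: real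
    by (simp add: power2_eq_square algebra_simps)
  have "k1 * (c - a)\<^sup>2 + k1 * (d - b)\<^sup>2 + k2 * (d - a)\<^sup>2 + k2 * (c - b)\<^sup>2
    - (k1 * (c' - a')\<^sup>2 + k1 * (d' - b')\<^sup>2 + k2 * (d' - a')\<^sup>2 + k2 * (c' - b')\<^sup>2)
    = 2 * k1 * ?D + 2 * k2 * (a' * d' + b' * c' - a * d - b * c)"
    unfolding split sq by (simp add: algebra_simps)
  also have "\<dots> = 2 * ((k1 - k2) * ?D)" unfolding cross by (simp add: algebra_simps)
  also have "\<dots> \<ge> 0"
  proof -
    have rearr: "0 \<le> (max a b - min a b) * (max c d - min c d)" by (intro mult_nonneg_nonneg) auto
    show ?thesis
    proof (cases same)
      case True
      then have "?D \<ge> 0"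
        using assms rearr by (cases "a \<le> b"; cases "c \<le> d"; cases px) (auto simp: max_def min_def algebra_simps)
      then show ?thesis using True assms(1) by simp
    next
      case False
      then have "?D \<le> 0"
        using assms rearr by (cases "a \<le> b"; cases "c \<le> d"; cases px) (auto simp: max_def min_def algebra_simps)
      then show ?thesis using False assms(1) by (simp add: mult_nonpos_nonpos)
    qed
  qed
  finally show ?thesis by simp
qed

text \<open>The double integral is symmetrised: replacing x, z or both by their mirror images does
  not change it, and on each quadruple obtained in this way the four-point inequality
  applies.\<close>

lemma avg_energy_polarize:
  fixes u :: "'a::euclidean_space \<Rightarrow> real"
  assumes um[measurable]: "u \<in> borel_measurable borel" and eps: "\<epsilon> > 0" and e: "norm e = 1"
  shows "avg_energy (polarize e s u) \<epsilon> \<le> avg_energy u \<epsilon>"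
proof -
  let ?r = "reflect e s" and ?p = "polarize e s u"
  define W where "W v x z = ennreal (indicator {..<\<epsilon>} (dist x z) * (v z - v x)\<^sup>2)" for v and x z :: 'a
  define I where "I v = (\<integral>\<^sup>+x. \<integral>\<^sup>+z. W v x z \<partial>lborel \<partial>lborel)" for v
  define S where "S v x z = W v x z + W v (?r x) (?r z) + W v x (?r z) + W v (?r x) z" for v x z
  have four: "(\<integral>\<^sup>+x. \<integral>\<^sup>+z. S v x z \<partial>lborel \<partial>lborel) = 4 * I v" if [measurable]: "v \<in> borel_measurable borel" for v
  proof -
    have W[measurable]: "(\<lambda>x. W v (f x) (g x)) \<in> borel_measurable M"
      if [measurable]: "f \<in> borel_measurable M" "g \<in> borel_measurable M" for f g and M :: "'c measure"
      unfolding W_def by measurable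
    have a: "(\<integral>\<^sup>+z. W v x (?r z) \<partial>lborel) = (\<integral>\<^sup>+z. W v x z \<partial>lborel)" for x
      by (rule nn_integral_reflect[OF e]) measurable
    have b: "(\<integral>\<^sup>+x. \<integral>\<^sup>+z. W v (?r x) z \<partial>lborel \<partial>lborel) = I v"
      unfolding I_def by (rule nn_integral_reflect[OF e, where f="\<lambda>x. \<integral>\<^sup>+z. W v x z \<partial>lborel"]) measurable
    have "(\<integral>\<^sup>+z. S v x z \<partial>lborel) = (\<integral>\<^sup>+z. W v x z \<partial>lborel) + (\<integral>\<^sup>+z. W v (?r x) z \<partial>lborel)
        + (\<integral>\<^sup>+z. W v x z \<partial>lborel) + (\<integral>\<^sup>+z. W v (?r x) z \<partial>lborel)" for x
      unfolding S_def by (simp add: nn_integral_add a)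
    then have "(\<integral>\<^sup>+x. \<integral>\<^sup>+z. S v x z \<partial>lborel \<partial>lborel) = I v + I v + I v + I v"
      by (simp add: nn_integral_add b) (simp add: I_def)
    also have "\<dots> = 2 * (2 * I v)" by (simp only: mult_2 add.assoc)
    also have "\<dots> = 4 * I v" by (simp flip: mult.assoc)
    finally show ?thesis .
  qed
  have "S ?p x z \<le> S u x z" for x z
  proof -
    let ?k1 = "indicator {..<\<epsilon>} (dist x z) :: real" and ?k2 = "indicator {..<\<epsilon>} (dist x (?r z)) :: real"
    have d2: "dist (?r x) z = dist x (?r z)"
      using dist_reflect[OF e, of s x "?r z"] e by simp
    define px pz where "px \<longleftrightarrow> x \<bullet> e \<le> s" and "pz \<longleftrightarrow> z \<bullet> e \<le> s"
    have Seq: "S v x z = ennreal (?k1 * (v z - v x)\<^sup>2 + ?k1 * (v (?r z) - v (?r x))\<^sup>2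
        + ?k2 * (v (?r z) - v x)\<^sup>2 + ?k2 * (v z - v (?r x))\<^sup>2)" for v
      unfolding S_def W_def using e by (simp add: d2 ennreal_plus[symmetric] del: ennreal_plus)
    \<comment> \<open>A point is at least as close to one on its own side of the hyperplane as to
      the mirror image of that one, and the kernel decreases with the distance.\<close>
    have k: "if (px \<longleftrightarrow> pz) then ?k1 \<ge> ?k2 else ?k1 \<le> ?k2"
    proof (cases "px \<longleftrightarrow> pz")
      case True
      then have "0 \<le> 4 * (x \<bullet> e - s) * (z \<bullet> e - s)"
        by (cases px) (auto simp: px_def pz_def zero_le_mult_iff)
      then have "(dist x z)\<^sup>2 \<le> (dist x (?r z))\<^sup>2" using dist_reflect_square[OF e, of x s z] by simp
      then have "dist x z \<le> dist x (?r z)" by (rule power2_le_imp_le) simp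
      then show ?thesis using True by (auto simp: indicator_def)
    next
      case False
      then have "4 * (x \<bullet> e - s) * (z \<bullet> e - s) \<le> 0"
        by (cases px) (auto simp: px_def pz_def mult_le_0_iff)
      then have "(dist x (?r z))\<^sup>2 \<le> (dist x z)\<^sup>2" using dist_reflect_square[OF e, of x s z] by simp
      then have "dist x (?r z) \<le> dist x z" by (rule power2_le_imp_le) simp
      then show ?thesis using False by (auto simp: indicator_def)
    qed
    show ?thesis
      unfolding Seq
      by (rule ennreal_leI, rule polarize_four_points[OF k, where px=px and pz=pz])
         (simp_all add: polarize_reflect[OF e] px_def pz_def polarize_def[of e s u x] polarize_def[of e s u z])
  qed
  then have "(\<integral>\<^sup>+x. \<integral>\<^sup>+z. S ?p x z \<partial>lborel \<partial>lborel) \<le> (\<integral>\<^sup>+x. \<integral>\<^sup>+z. S u x z \<partial>lborel \<partial>lborel)"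
    by (intro nn_integral_mono) auto
  then have "4 * I ?p \<le> 4 * I u" using four[of u] four[of ?p] by simp
  then have "I ?p \<le> I u" by (simp add: ennreal_mult_le_mult_iff)
  then have "ennreal (\<epsilon> ^ DIM('a)) * avg_energy ?p \<epsilon> \<le> ennreal (\<epsilon> ^ DIM('a)) * avg_energy u \<epsilon>"
    using eps by (simp add: avg_energy_eq_kernel I_def W_def)
  then show ?thesis using eps by (simp add: ennreal_mult_le_mult_iff)
qed

text \<open>Sorting may compare u at x with u at the mirror image of y only if x and y lie on
  opposite sides; then that image is at most as far from x as y is, so the crossed differences obey
  the same bound.\<close>

lemma polarize_Lipschitz:
  fixes u :: "'a::euclidean_space \<Rightarrow> real"
  assumes L: "\<And>x y. \<bar>u x - u y\<bar> \<le> L * dist x y" "L \<ge> 0" and e: "norm e = 1"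
  shows "\<bar>polarize e s u x - polarize e s u y\<bar> \<le> L * dist x y"
proof -
  let ?r = "reflect e s"
  have 1: "\<bar>u x - u y\<bar> \<le> L * dist x y" "\<bar>u (?r x) - u (?r y)\<bar> \<le> L * dist x y"
    using L(1)[of x y] L(1)[of "?r x" "?r y"] e by auto
  have d2: "dist (?r x) y = dist x (?r y)"
    using dist_reflect[OF e, of s x "?r y"] e by simp
  have 2: "\<bar>u x - u (?r y)\<bar> \<le> L * dist x y" "\<bar>u (?r x) - u y\<bar> \<le> L * dist x y"
    if "(x \<bullet> e \<le> s) \<noteq> (y \<bullet> e \<le> s)"
  proof -
    have "4 * (x \<bullet> e - s) * (y \<bullet> e - s) \<le> 0"
      using that by (cases "x \<bullet> e \<le> s") (auto simp: mult_le_0_iff)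
    then have "(dist x (?r y))\<^sup>2 \<le> (dist x y)\<^sup>2" using dist_reflect_square[OF e, of x s y] by simp
    then have "dist x (?r y) \<le> dist x y" by (rule power2_le_imp_le) simp
    then have "L * dist x (?r y) \<le> L * dist x y" using L(2) by (rule mult_left_mono)
    then show "\<bar>u x - u (?r y)\<bar> \<le> L * dist x y" "\<bar>u (?r x) - u y\<bar> \<le> L * dist x y"
      using L(1)[of x "?r y"] L(1)[of "?r x" y] d2 by auto
  qed
  show ?thesis
    using 1 2 by (cases "(x \<bullet> e \<le> s) = (y \<bullet> e \<le> s)"; cases "x \<bullet> e \<le> s") (auto simp: polarize_def max_def min_def abs_if split: if_splits)
qed

section \<open>Rearrangement by minimising the second moment\<close>

lemma continuous_AE_eq_0:
  fixes f :: "'a::euclidean_space \<Rightarrow> real"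
  assumes f: "continuous_on UNIV f" and ae: "AE x in lborel. f x = 0"
  shows "f x = 0"
proof (rule ccontr)
  assume "f x \<noteq> 0"
  have "open {x. f x \<noteq> 0}"
    using f by (simp add: open_Collect_neq)
  then obtain r where r: "r > 0" "ball x r \<subseteq> {x. f x \<noteq> 0}"
    using \<open>f x \<noteq> 0\<close> by (auto simp: open_contains_ball)
  have "AE x' in lborel. x' \<notin> ball x r" using ae by eventually_elim (use r in auto)
  then have "ball x r \<in> null_sets lborel" by (subst (asm) AE_iff_null_sets[symmetric]) auto
  moreover have "emeasure lborel (ball x r) \<noteq> 0"
    using r unit_ball_vol_pos[of "real DIM('a)"] by (simp add: emeasure_ball del: unit_ball_vol_pos)
  ultimately show False by auto
qed

text \<open>Among all Lipschitz functions with the same constant that are equimeasurable with u and have no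
  larger energy, one minimises the second moment; it equals all its polarisations with respect to
  half-spaces containing the origin, and hence is radially decreasing.\<close>

lemma radial_rearrangement:
  fixes u :: "'a::euclidean_space \<Rightarrow> real"
  assumes u0: "\<And>x. 0 \<le> u x" and L: "\<And>x y. \<bar>u x - u y\<bar> \<le> L * dist x y" "L \<ge> 0"
    and supp: "\<And>x. norm x \<ge> R \<Longrightarrow> u x = 0" "R > 0"
  obtains v :: "'a \<Rightarrow> real" where "\<And>x. 0 \<le> v x" "\<And>x y. \<bar>v x - v y\<bar> \<le> L * dist x y" "\<And>x. norm x \<ge> R \<Longrightarrow> v x = 0"
    "\<And>G::real \<Rightarrow> real. continuous_on UNIV G \<Longrightarrow> G 0 = 0 \<Longrightarrow> (\<integral>x. G (v x) \<partial>lborel) = (\<integral>x. G (u x) \<partial>lborel)"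
    "\<And>x y. norm x \<le> norm y \<Longrightarrow> v y \<le> v x" "\<And>A. energy_le u A \<Longrightarrow> energy_le v A"
proof -
  \<comment> \<open>Equimeasurability is expressed by the integrals of G(v) for continuous G with G
    0 = 0, the form in which it is used later. Every clause is preserved by polarisation and by
    pointwise limits, and the common Lipschitz constant and support make the class compact.\<close>
  define K where "K v \<longleftrightarrow> (\<forall>x. 0 \<le> v x) \<and> (\<forall>x y. \<bar>v x - v y\<bar> \<le> L * dist x y) \<and> (\<forall>x. norm x \<ge> R \<longrightarrow> v x = 0)
     \<and> (\<forall>G::real\<Rightarrow>real. continuous_on UNIV G \<longrightarrow> G 0 = 0 \<longrightarrow> (\<integral>x. G (v x) \<partial>lborel) = (\<integral>x. G (u x) \<partial>lborel))
     \<and> (\<forall>\<epsilon>>0. avg_energy v \<epsilon> \<le> avg_energy u \<epsilon>)" for v :: "'a \<Rightarrow> real"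
  define M where "M v = (\<integral>x. v x * (norm x)\<^sup>2 \<partial>lborel)" for v :: "'a \<Rightarrow> real"
  have Ku: "K u" unfolding K_def using u0 L supp by blast
  have K0: "0 \<le> v x" if "K v" for v x using that unfolding K_def by blast
  have KL: "\<bar>v x - v y\<bar> \<le> L * dist x y" if "K v" for v x y using that unfolding K_def by blast
  have KS: "v x = 0" if "K v" "norm x \<ge> R" for v x using that unfolding K_def by blast
  have KI: "(\<integral>x. G (v x) \<partial>lborel) = (\<integral>x. G (u x) \<partial>lborel)"
    if "K v" "continuous_on UNIV G" "G 0 = 0" for v and G :: "real \<Rightarrow> real"
    using that unfolding K_def by blast
  have KE: "avg_energy v \<epsilon> \<le> avg_energy u \<epsilon>" if "K v" "\<epsilon> > 0" for v \<epsilon> using that unfolding K_def by blast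
  have Kc: "continuous_on UNIV v" if "K v" for v
    by (rule Lipschitz_continuous_on[OF KL[OF that]])
  have Km: "v \<in> borel_measurable borel" if "K v" for v
    using Kc[OF that] by (rule borel_measurable_continuous_onI)
  have Kb: "v x \<le> 2 * L * R" if "K v" for v x
  proof (cases "norm x \<ge> R")
    case False
    obtain b :: 'a where b: "b \<in> Basis" using nonempty_Basis by blast
    \<comment> \<open>From inside the ball a step of length 2 R leads outside it, where v
      vanishes.\<close>
    let ?y = "x + (2 * R) *\<^sub>R b"
    have "norm ((2 * R) *\<^sub>R b) \<le> norm ?y + norm x" by (metis add_diff_cancel_left' norm_triangle_ineq4)
    then have "norm ?y \<ge> R" using b False supp(2) by simp
    then have "v ?y = 0" by (rule KS[OF that])
    moreover have "\<bar>v x - v ?y\<bar> \<le> L * dist x ?y" by (rule KL[OF that])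
    moreover have "dist x ?y = 2 * R" using b supp(2) by (simp add: dist_norm)
    ultimately show ?thesis by (simp add: mult_ac)
  qed (use KS[OF that] L supp in auto)
  have KM: "integrable lborel (\<lambda>x. v x * (norm x)\<^sup>2)" if "K v" for v
    by (rule integrable_continuous_support[of _ R]) (use KS[OF that] Kc[OF that] in \<open>auto intro!: continuous_intros\<close>)
  have KG: "integrable lborel (\<lambda>x. G (v x))" if "K v" "continuous_on UNIV G" "G 0 = 0" for v and G :: "real \<Rightarrow> real"
    by (rule integrable_continuous_support[of _ R])
       (use KS[OF that(1)] that(3) in \<open>auto intro: continuous_on_compose2[OF that(2) Kc[OF that(1)]]\<close>)
  have M0: "0 \<le> M v" if "K v" for v
    unfolding M_def using K0[OF that] by (intro integral_nonneg_AE) auto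
  define m where "m = Inf (M ` {v. K v})"
  have bdd: "bdd_below (M ` {v. K v})" using M0 by (intro bdd_belowI[of _ 0]) auto
  have m_le: "m \<le> M v" if "K v" for v unfolding m_def using that bdd by (intro cInf_lower) auto
  have "\<exists>v. K v \<and> M v < m + 1 / real (Suc n)" for n
  proof -
    have "\<exists>y\<in>M ` {v. K v}. y < m + 1 / real (Suc n)"
      unfolding m_def by (subst cInf_less_iff[symmetric]) (use Ku bdd in auto)
    then show ?thesis by auto
  qed
  then obtain V where V: "\<And>n. K (V n)" "\<And>n. M (V n) < m + 1 / real (Suc n)" by metis
  \<comment> \<open>Arzela-Ascoli on the closed ball of radius R; outside it all the functions
    vanish.\<close>
  obtain g k where g: "continuous_on (cball 0 R) g" "strict_mono (k::nat\<Rightarrow>nat)"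
    "\<And>e. 0 < e \<Longrightarrow> \<exists>N. \<forall>n x. n \<ge> N \<and> x \<in> cball 0 R \<longrightarrow> norm (V (k n) x - g x) < e"
  proof (rule Arzela_Ascoli[of "cball (0::'a) R" V "2 * L * R"])
    show "norm (V n x) \<le> 2 * L * R" for n x
      using Kb[OF V(1), of n x] K0[OF V(1), of n x] by simp
    show "\<exists>d>0. \<forall>n y. y \<in> cball 0 R \<and> norm (x - y) < d \<longrightarrow> norm (V n x - V n y) < e" if "e > 0" for x and e :: real
    proof (intro exI conjI allI impI)
      show "e / (L + 1) > 0" using that L by simp
      fix n y assume "y \<in> cball 0 R \<and> norm (x - y) < e / (L + 1)"
      then have "(L + 1) * norm (x - y) < e" using L by (simp add: field_simps)
      moreover have "\<bar>V n x - V n y\<bar> \<le> L * norm (x - y)" using KL[OF V(1), of n x y] by (simp add: dist_norm)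
      moreover have "L * norm (x - y) \<le> (L + 1) * norm (x - y)" by (intro mult_right_mono) auto
      ultimately show "norm (V n x - V n y) < e" by simp
    qed
  qed auto
  define v where "v x = (if norm x \<le> R then g x else 0)" for x
  have lim: "(\<lambda>n. V (k n) x) \<longlonglongrightarrow> v x" for x
  proof (cases "norm x \<le> R")
    case True
    show ?thesis
    proof (rule LIMSEQ_I)
      fix d :: real assume "d > 0"
      from g(3)[OF this] obtain N where "\<And>n x. n \<ge> N \<Longrightarrow> x \<in> cball 0 R \<Longrightarrow> norm (V (k n) x - g x) < d" by blast
      then show "\<exists>no. \<forall>n\<ge>no. norm (V (k n) x - v x) < d"
        using True by (intro exI[of _ N]) (simp add: v_def)
    qed
  next
    case False
    then have "V n x = 0" for n using KS[OF V(1), of x n] by simp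
    then show ?thesis using False by (simp add: v_def)
  qed
  have v0: "0 \<le> v x" for x
    by (rule LIMSEQ_le_const[OF lim]) (use K0[OF V(1)] in auto)
  have vL: "\<bar>v x - v y\<bar> \<le> L * dist x y" for x y
    by (rule LIMSEQ_le_const2[OF tendsto_rabs[OF tendsto_diff[OF lim lim]]]) (use KL[OF V(1)] in auto)
  have vsupp: "v x = 0" if "norm x \<ge> R" for x
  proof (rule LIMSEQ_unique[OF lim])
    show "(\<lambda>n. V (k n) x) \<longlonglongrightarrow> 0" using KS[OF V(1) that] by simp
  qed
  have vc: "continuous_on UNIV v" by (rule Lipschitz_continuous_on[OF vL])
  have vm[measurable]: "v \<in> borel_measurable borel" by (rule borel_measurable_continuous_onI[OF vc])
  have [measurable]: "V n \<in> borel_measurable borel" for n by (rule Km[OF V(1)])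
  have "K v"
    unfolding K_def
  proof (intro conjI allI impI)
    fix G :: "real \<Rightarrow> real" assume G: "continuous_on UNIV G" "G 0 = 0"
    have [measurable]: "G \<in> borel_measurable borel" by (rule borel_measurable_continuous_onI[OF G(1)])
    obtain B where B: "\<And>s. s \<in> {0..2*L*R} \<Longrightarrow> norm (G s) \<le> B"
      using compact_continuous_image[of "{0..2*L*R}" G] continuous_on_subset[OF G(1)] compact_imp_bounded
      by (metis bounded_iff compact_Icc imageI subset_UNIV)
    have "(\<lambda>n. \<integral>x. G (V (k n) x) \<partial>lborel) \<longlonglongrightarrow> (\<integral>x. G (v x) \<partial>lborel)"
    proof (rule integral_dominated_convergence[where w="\<lambda>x. indicator (ball 0 R) x * B"])
      show "integrable lborel (\<lambda>x::'a. indicator (ball 0 R) x * B)" by (rule integrable_indicator_ball) simp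
      show "AE x in lborel. (\<lambda>n. G (V (k n) x)) \<longlonglongrightarrow> G (v x)"
      proof (rule AE_I2)
        fix x
        have "isCont G (v x)" using G(1) by (simp add: continuous_on_eq_continuous_at)
        then show "(\<lambda>n. G (V (k n) x)) \<longlonglongrightarrow> G (v x)" by (rule isCont_tendsto_compose[OF _ lim])
      qed
      show "AE x in lborel. norm (G (V (k n) x)) \<le> indicator (ball 0 R) x * B" for n
      proof (rule AE_I2)
        fix x
        show "norm (G (V (k n) x)) \<le> indicator (ball 0 R) x * B"
          using B[of "V (k n) x"] Kb[OF V(1), of "k n" x] K0[OF V(1), of "k n" x] KS[OF V(1), of x "k n"] G(2)
          by (cases "norm x < R") auto
      qed
    qed measurable
    moreover have "(\<integral>x. G (V (k n) x) \<partial>lborel) = (\<integral>x. G (u x) \<partial>lborel)" for n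
      by (rule KI[OF V(1) G])
    ultimately show "(\<integral>x. G (v x) \<partial>lborel) = (\<integral>x. G (u x) \<partial>lborel)"
      by (simp add: LIMSEQ_const_iff)
  next
    fix \<epsilon> :: real assume eps: "\<epsilon> > 0"
    have "avg_energy v \<epsilon> \<le> liminf (\<lambda>n. avg_energy (V (k n)) \<epsilon>)"
      by (rule avg_energy_liminf) (use lim in auto)
    also have "\<dots> \<le> liminf (\<lambda>n. avg_energy u \<epsilon>)"
      by (intro Liminf_mono always_eventually allI KE[OF V(1) eps])
    finally show "avg_energy v \<epsilon> \<le> avg_energy u \<epsilon>" by (simp add: Liminf_const)
  qed (use v0 vL vsupp in auto)
  have "(\<lambda>n. M (V (k n))) \<longlonglongrightarrow> M v"
    unfolding M_def
  proof (rule integral_dominated_convergence[where w="\<lambda>x. indicator (ball 0 R) x * (2 * L * R * (norm x)\<^sup>2)"])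
    show "integrable lborel (\<lambda>x::'a. indicator (ball 0 R) x * (2 * L * R * (norm x)\<^sup>2))"
      by (rule integrable_indicator_ball) (intro continuous_intros)
    show "AE x in lborel. norm (V (k n) x * (norm x)\<^sup>2) \<le> indicator (ball 0 R) x * (2 * L * R * (norm x)\<^sup>2)" for n
    proof (rule AE_I2)
      fix x
      show "norm (V (k n) x * (norm x)\<^sup>2) \<le> indicator (ball 0 R) x * (2 * L * R * (norm x)\<^sup>2)"
        using Kb[OF V(1), of "k n" x] K0[OF V(1), of "k n" x] KS[OF V(1), of x "k n"]
        by (cases "norm x < R") (auto simp: abs_mult intro!: mult_right_mono)
    qed
  qed (auto intro!: tendsto_intros lim)
  moreover have "(\<lambda>n. m + 1 / real (Suc (k n))) \<longlonglongrightarrow> m + 0"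
    by (intro tendsto_intros LIMSEQ_subseq_LIMSEQ[OF _ g(2), unfolded o_def, of "\<lambda>n. 1 / real (Suc n)"])
       (use LIMSEQ_inverse_real_of_nat in \<open>simp add: inverse_eq_divide\<close>)
  ultimately have "M v \<le> m + 0"
    by (rule LIMSEQ_le) (use V(2) in \<open>auto intro: less_imp_le\<close>)
  then have Mv: "M v = m" using m_le[OF \<open>K v\<close>] by simp
  have half: "v (reflect e s x) \<le> v x" if e: "norm e = 1" and s: "s > 0" and x: "x \<bullet> e < s" for e s x
  proof -
    let ?r = "reflect e s" and ?p = "polarize e s v"
    have nr: "norm x \<le> norm (?r x) \<longleftrightarrow> x \<bullet> e \<le> s" for x
    proof -
      have "norm x \<le> norm (?r x) \<longleftrightarrow> (norm x)\<^sup>2 \<le> (norm (?r x))\<^sup>2"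
        using abs_le_square_iff[of "norm x" "norm (?r x)"] by simp
      also have "\<dots> \<longleftrightarrow> 0 \<le> 4 * s * (s - x \<bullet> e)" unfolding norm_reflect_square[OF e] by simp
      also have "\<dots> \<longleftrightarrow> x \<bullet> e \<le> s" using s by (simp add: zero_le_mult_iff)
      finally show ?thesis .
    qed
    have pL: "\<bar>?p x - ?p y\<bar> \<le> L * dist x y" for x y by (rule polarize_Lipschitz[OF vL L(2) e])
    have p0: "0 \<le> ?p x" for x using v0 by (simp add: polarize_def le_max_iff_disj)
    have psupp: "?p x = 0" if "norm x \<ge> R" for x
    proof (cases "x \<bullet> e \<le> s")
      case True
      then have "norm (?r x) \<ge> R" using nr[of x] that by simp
      then show ?thesis using True that vsupp by (simp add: polarize_def)
    next
      case False
      then show ?thesis using that vsupp[of x] v0[of "?r x"] by (simp add: polarize_def)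
    qed
    have pc: "continuous_on UNIV ?p" by (rule Lipschitz_continuous_on[OF pL])
    \<comment> \<open>Polarisation only permutes the two values at mirror points; integrated over
      all pairs this gives equimeasurability.\<close>
    have sum2: "G (?p x) + G (?p (?r x)) = G (v x) + G (v (?r x))" for G :: "real \<Rightarrow> real" and x
      unfolding polarize_reflect[OF e] by (simp add: polarize_def max_def min_def)
    have "K ?p"
      unfolding K_def
    proof (intro conjI allI impI)
      fix G :: "real \<Rightarrow> real" assume G: "continuous_on UNIV G" "G 0 = 0"
      have ip: "integrable lborel (\<lambda>x. G (?p x))"
        by (rule integrable_continuous_support[of _ R])
           (use psupp G in \<open>auto intro: continuous_on_compose2[OF G(1) pc]\<close>)
      have iv: "integrable lborel (\<lambda>x. G (v x))" by (rule KG[OF \<open>K v\<close> G])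
      have "2 * (\<integral>x. G (?p x) \<partial>lborel) = (\<integral>x. G (?p x) + G (?p (?r x)) \<partial>lborel)"
        using ip integrable_reflect[OF e ip, of s] integral_reflect[OF e ip, of s] by simp
      also have "\<dots> = 2 * (\<integral>x. G (v x) \<partial>lborel)"
        unfolding sum2 using iv integrable_reflect[OF e iv, of s] integral_reflect[OF e iv, of s] by simp
      finally have "(\<integral>x. G (?p x) \<partial>lborel) = (\<integral>x. G (v x) \<partial>lborel)" by simp
      also have "\<dots> = (\<integral>x. G (u x) \<partial>lborel)" by (rule KI[OF \<open>K v\<close> G])
      finally show "(\<integral>x. G (?p x) \<partial>lborel) = (\<integral>x. G (u x) \<partial>lborel)" .
    next
      fix \<epsilon> :: real assume eps: "\<epsilon> > 0"
      have "avg_energy ?p \<epsilon> \<le> avg_energy v \<epsilon>" by (rule avg_energy_polarize[OF vm eps e])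
      also have "\<dots> \<le> avg_energy u \<epsilon>" by (rule KE[OF \<open>K v\<close> eps])
      finally show "avg_energy ?p \<epsilon> \<le> avg_energy u \<epsilon>" .
    qed (use p0 pL psupp in auto)
    define h where "h w x = w x * (norm x)\<^sup>2" for w :: "'a \<Rightarrow> real" and x
    \<comment> \<open>The second moments of v and of its polarisation, compared on x and its mirror
      image. Sorting moves the larger value closer to the origin, so f >= 0, while minimality of v
      makes the integral of f at most 0. Being continuous, f vanishes everywhere.\<close>
    define f where "f x = (h v x + h v (?r x)) - (h ?p x + h ?p (?r x))" for x
    have ih: "integrable lborel (h w)" if "K w" for w unfolding h_def by (rule KM[OF that])
    note ihv = ih[OF \<open>K v\<close>] and ihp = ih[OF \<open>K ?p\<close>]
    have fi: "integrable lborel f"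
      unfolding f_def using ihv ihp integrable_reflect[OF e ihv, of s] integrable_reflect[OF e ihp, of s] by simp
    have "(\<integral>x. f x \<partial>lborel) = 2 * M v - 2 * M ?p"
      unfolding f_def using ihv ihp integrable_reflect[OF e ihv, of s] integrable_reflect[OF e ihp, of s]
        integral_reflect[OF e ihv, of s] integral_reflect[OF e ihp, of s]
      by (simp add: M_def h_def[abs_def])
    then have f_le: "(\<integral>x. f x \<partial>lborel) \<le> 0" using Mv m_le[OF \<open>K ?p\<close>] by simp
    have f_eq: "f x = (if (x \<bullet> e \<le> s) = (v x \<ge> v (?r x)) then 0 else \<bar>v x - v (?r x)\<bar> * \<bar>(norm (?r x))\<^sup>2 - (norm x)\<^sup>2\<bar>)" for x
    proof -
      define a b where "a = (norm x)\<^sup>2" and "b = (norm (?r x))\<^sup>2"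
      have "a \<le> b \<longleftrightarrow> x \<bullet> e \<le> s"
        using nr[of x] by (simp add: a_def b_def power_mono_iff)
      then show ?thesis
        unfolding f_def h_def polarize_reflect[OF e] a_def[symmetric] b_def[symmetric] by (auto simp: polarize_def max_def min_def abs_if algebra_simps)
    qed
    have f0: "0 \<le> f x" for x unfolding f_eq by auto
    have "AE x in lborel. f x = 0"
    proof -
      have "0 \<le> (\<integral>x. f x \<partial>lborel)" using f0 by (intro integral_nonneg_AE) auto
      then have "(\<integral>x. f x \<partial>lborel) = 0" using f_le by simp
      then show ?thesis using integral_nonneg_eq_0_iff_AE[OF fi] f0 by simp
    qed
    moreover have "continuous_on UNIV f"
      unfolding f_def h_def
      by (intro continuous_intros continuous_on_compose2[OF vc] continuous_on_compose2[OF pc]) auto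
    ultimately have "f x = 0" by (intro continuous_AE_eq_0)
    moreover have "(norm (?r x))\<^sup>2 - (norm x)\<^sup>2 > 0" using norm_reflect_square[OF e, of s x] s x by simp
    ultimately show ?thesis using x unfolding f_eq by (auto split: if_splits)
  qed
  have strict: "v y \<le> v x" if xy: "norm x < norm y" for x y
  proof -
    have ne: "y \<noteq> x" using xy by auto
    \<comment> \<open>The hyperplane is the perpendicular bisector of x and y; its level s is
      positive exactly because y is farther from the origin.\<close>
    define e where "e = (y - x) /\<^sub>R norm (y - x)"
    define s where "s = ((norm y)\<^sup>2 - (norm x)\<^sup>2) / (2 * norm (y - x))"
    have e: "norm e = 1" using ne by (simp add: e_def)
    have "(norm x)\<^sup>2 < (norm y)\<^sup>2" using xy by (intro power_strict_mono) auto
    then have s: "s > 0" using ne by (simp add: s_def)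
    have n2: "(norm (y - x))\<^sup>2 = y \<bullet> y - 2 * (x \<bullet> y) + x \<bullet> x"
      by (simp add: power2_norm_eq_inner inner_simps inner_commute)
    have xe: "x \<bullet> e - s = - norm (y - x) / 2"
    proof -
      have "x \<bullet> e - s = (2 * (x \<bullet> y - x \<bullet> x) - (y \<bullet> y - x \<bullet> x)) / (2 * norm (y - x))"
        using ne by (simp add: e_def s_def power2_norm_eq_inner inner_simps field_simps)
      also have "\<dots> = - (norm (y - x))\<^sup>2 / (2 * norm (y - x))" unfolding n2 by (simp add: algebra_simps)
      also have "\<dots> = - norm (y - x) / 2" using ne by (simp add: power2_eq_square)
      finally show ?thesis .
    qed
    have "reflect e s x = y" unfolding reflect_def xe using ne by (simp add: e_def)
    moreover have "x \<bullet> e < s" using xe ne by (smt (verit) divide_neg_pos neg_0_less_iff_less zero_less_norm_iff right_minus_eq)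
    ultimately show ?thesis using half[OF e s, of x] by simp
  qed
  have mono: "v y \<le> v x" if xy: "norm x \<le> norm y" for x y
  proof (cases "norm x < norm y \<or> x = 0")
    case True
    then show ?thesis using strict[of x y] xy by (cases "y = 0") auto
  next
    case False
    then have eq: "norm x = norm y" and x: "x \<noteq> 0" using xy by auto
    show ?thesis
    proof (rule field_le_epsilon)
      fix d :: real assume d: "d > 0"
      \<comment> \<open>Points of equal norm are compared by shrinking x slightly, with t so small
        that by the Lipschitz bound v changes by at most d. The summand 1 covers L = 0.\<close>
      define t where "t = min (1/2) (d / ((L + 1) * norm x))"
      have t: "0 < t" "t < 1" using d x L by (auto simp: t_def min_def)
      have "(1 - t) * norm x < 1 * norm x" using t x by (intro mult_strict_right_mono) auto
      then have "norm ((1 - t) *\<^sub>R x) < norm y" using t eq by simp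
      then have "v y \<le> v ((1 - t) *\<^sub>R x)" by (rule strict)
      also have "\<dots> \<le> v x + L * dist ((1 - t) *\<^sub>R x) x" using vL[of "(1 - t) *\<^sub>R x" x] by linarith
      also have "dist ((1 - t) *\<^sub>R x) x = t * norm x" using t by (simp add: dist_norm algebra_simps)
      also have "L * (t * norm x) \<le> (L + 1) * (t * norm x)" using t by (intro mult_right_mono) auto
      also have "\<dots> \<le> d"
      proof -
        have "t \<le> d / ((L + 1) * norm x)" by (simp add: t_def)
        moreover have "(L + 1) * norm x > 0" using x L(2) by (intro mult_pos_pos) auto
        ultimately have "t * ((L + 1) * norm x) \<le> d" by (metis pos_le_divide_eq)
        then show ?thesis by (simp only: mult_ac)
      qed
      finally show "v y \<le> v x + d" by simp
    qed
  qed
  show ?thesis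
  proof (rule that[of v])
    show "energy_le v A" if "energy_le u A" for A
      using that KE[OF \<open>K v\<close>] unfolding energy_le_def by (meson order_trans)
  qed (use v0 vL vsupp mono KI[OF \<open>K v\<close>] in auto)
qed

subsection \<open>Approximation by Lipschitz functions\<close>

definition tent :: "'a::euclidean_space \<Rightarrow> real" where "tent y = max 0 (1 - norm y)"

definition tent_mass :: "'a::euclidean_space itself \<Rightarrow> real" where
  "tent_mass _ = (\<integral>y. tent (y::'a) \<partial>lborel)"

text \<open>Written as an average of translates of w, so that increments of the mollification are
  averages of increments of w. The Lipschitz bound uses instead the form with x inside the kernel,
  reached by a change of variables.\<close>

definition mollify :: "real \<Rightarrow> ('a::euclidean_space \<Rightarrow> real) \<Rightarrow> 'a \<Rightarrow> real" where
  "mollify \<delta> w x = (\<integral>y. tent y / tent_mass TYPE('a) * w (x + \<delta> *\<^sub>R y) \<partial>lborel)"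

lemma tent_nonneg [simp]: "0 \<le> tent y" by (simp add: tent_def)

lemma tent_le: "tent y \<le> indicator (ball 0 1) y"
  by (auto simp: tent_def indicator_def)

lemma continuous_tent: "continuous_on UNIV tent"
  unfolding tent_def by (intro continuous_intros)

lemma measurable_tent [measurable]: "tent \<in> borel_measurable borel"
  by (rule borel_measurable_continuous_onI[OF continuous_tent])

lemma integrable_tent [simp]: "integrable lborel tent"
  by (rule integrable_continuous_support[OF continuous_tent, of 1]) (simp add: tent_def)

lemma tent_mass_pos: "tent_mass TYPE('a::euclidean_space) > 0"
proof -
  have i: "integrable lborel (\<lambda>y::'a. indicator (ball 0 (1/2)) y * (1/2) :: real)"
    by (rule integrable_indicator_ball) simp
  have "0 < unit_ball_vol (real DIM('a)) * (1/2) ^ DIM('a) * (1/2)" by simp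
  also have "\<dots> = (\<integral>y. indicator (ball 0 (1/2)) (y::'a) * (1/2) \<partial>lborel)"
    by (simp add: content_ball)
  also have "\<dots> \<le> tent_mass TYPE('a)"
    unfolding tent_mass_def
    by (rule integral_mono[OF i integrable_tent]) (auto simp: tent_def indicator_def)
  finally show ?thesis .
qed

lemma tent_Lipschitz: "\<bar>tent x - tent y\<bar> \<le> dist x y"
proof -
  have "\<bar>norm x - norm y\<bar> \<le> dist x y" by (simp add: dist_norm norm_triangle_ineq3)
  then show ?thesis by (auto simp: tent_def max_def)
qed

lemma integrable_tent_mult:
  fixes f :: "'a::euclidean_space \<Rightarrow> real"
  assumes [measurable]: "f \<in> borel_measurable borel" and b: "\<And>y. \<bar>f y\<bar> \<le> B"
  shows "integrable lborel (\<lambda>y. tent y / c * f y)"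
proof (rule Bochner_Integration.integrable_bound)
  show "integrable lborel (\<lambda>y::'a. tent y * (\<bar>1 / c\<bar> * B))" by simp
  show "AE y in lborel. norm (tent y / c * f y) \<le> norm (tent y * (\<bar>1 / c\<bar> * B))"
  proof (rule AE_I2)
    fix y
    have "B \<ge> 0" using b[of y] by linarith
    have "\<bar>1/c\<bar> * \<bar>f y\<bar> \<le> \<bar>1/c\<bar> * B" by (intro mult_left_mono b) auto
    then have "tent y * (\<bar>1/c\<bar> * \<bar>f y\<bar>) \<le> tent y * (\<bar>1/c\<bar> * B)" by (rule mult_left_mono) simp
    moreover have "norm (tent y / c * f y) = tent y * (\<bar>1/c\<bar> * \<bar>f y\<bar>)" by (simp add: abs_mult)
    moreover have "norm (tent y * (\<bar>1 / c\<bar> * B)) = tent y * (\<bar>1/c\<bar> * B)" using \<open>B \<ge> 0\<close> by (simp add: abs_mult)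
    ultimately show "norm (tent y / c * f y) \<le> norm (tent y * (\<bar>1 / c\<bar> * B))" by linarith
  qed
qed measurable

text \<open>Jensen's inequality for the square, obtained as Cauchy-Schwarz for the square root of
  the probability density and its product with f.\<close>

lemma tent_Jensen:
  fixes f :: "'a::euclidean_space \<Rightarrow> real"
  assumes [measurable]: "f \<in> borel_measurable borel" and b: "\<And>y. \<bar>f y\<bar> \<le> B"
  shows "ennreal ((\<integral>y. tent y / tent_mass TYPE('a) * f y \<partial>lborel)\<^sup>2)
    \<le> (\<integral>\<^sup>+y. ennreal (tent y / tent_mass TYPE('a)) * ennreal ((f y)\<^sup>2) \<partial>lborel)"
proof -
  let ?Z = "tent_mass TYPE('a)" and ?k = "\<lambda>y::'a. tent y / tent_mass TYPE('a)"
  have Z: "?Z > 0" by (rule tent_mass_pos)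
  have k1: "(\<integral>y. ?k y \<partial>lborel) = 1" using Z by (simp add: tent_mass_def)
  have ki: "integrable lborel ?k" by simp
  have b2: "\<bar>(f y)\<^sup>2\<bar> \<le> B\<^sup>2" for y using b[of y] by (simp add: abs_le_square_iff[symmetric])
  have kf2: "integrable lborel (\<lambda>y. ?k y * (f y)\<^sup>2)"
    by (rule integrable_tent_mult[OF _ b2]) measurable
  have sk: "sqrt (?k y) * (sqrt (?k y) * f y) = ?k y * f y" "(sqrt (?k y))\<^sup>2 = ?k y" "(sqrt (?k y) * f y)\<^sup>2 = ?k y * (f y)\<^sup>2" for y
  proof -
    have "?k y \<ge> 0" using Z by simp
    then have *: "sqrt (?k y) * sqrt (?k y) = ?k y" by (rule real_sqrt_mult_self[THEN trans, OF abs_of_nonneg])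
    show "sqrt (?k y) * (sqrt (?k y) * f y) = ?k y * f y" by (simp only: mult.assoc[symmetric] *)
    show **: "(sqrt (?k y))\<^sup>2 = ?k y" using * by (simp only: power2_eq_square)
    show "(sqrt (?k y) * f y)\<^sup>2 = ?k y * (f y)\<^sup>2" by (simp only: power_mult_distrib **)
  qed
  have "\<bar>\<integral>y. sqrt (?k y) * (sqrt (?k y) * f y) \<partial>lborel\<bar> \<le> sqrt (\<integral>y. (sqrt (?k y))\<^sup>2 \<partial>lborel) * sqrt (\<integral>y. (sqrt (?k y) * f y)\<^sup>2 \<partial>lborel)"
    by (rule Cauchy_Schwarz_integral) (simp_all only: sk ki kf2, measurable)
  then have "\<bar>\<integral>y. ?k y * f y \<partial>lborel\<bar> \<le> sqrt (\<integral>y. ?k y * (f y)\<^sup>2 \<partial>lborel)"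
    by (simp only: sk k1 real_sqrt_one mult_1)
  then have "\<bar>\<integral>y. ?k y * f y \<partial>lborel\<bar>\<^sup>2 \<le> (sqrt (\<integral>y. ?k y * (f y)\<^sup>2 \<partial>lborel))\<^sup>2"
    by (rule power_mono) simp
  then have "(\<integral>y. ?k y * f y \<partial>lborel)\<^sup>2 \<le> (sqrt (\<integral>y. ?k y * (f y)\<^sup>2 \<partial>lborel))\<^sup>2"
    by (simp only: power2_abs)
  also have "\<dots> = (\<integral>y. ?k y * (f y)\<^sup>2 \<partial>lborel)"
    using Z by (intro real_sqrt_pow2 integral_nonneg_AE) auto
  finally have "ennreal ((\<integral>y. ?k y * f y \<partial>lborel)\<^sup>2) \<le> ennreal (\<integral>y. ?k y * (f y)\<^sup>2 \<partial>lborel)"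
    by (rule ennreal_leI)
  also have "\<dots> = (\<integral>\<^sup>+y. ennreal (?k y * (f y)\<^sup>2) \<partial>lborel)"
    by (rule nn_integral_eq_integral[symmetric]) (use kf2 Z in auto)
  also have "\<dots> = (\<integral>\<^sup>+y. ennreal (?k y) * ennreal ((f y)\<^sup>2) \<partial>lborel)"
    using Z by (intro nn_integral_cong, subst ennreal_mult[symmetric]) auto
  finally show ?thesis .
qed

lemma nn_integral_tent: "(\<integral>\<^sup>+y. ennreal (tent y / tent_mass TYPE('a::euclidean_space)) \<partial>(lborel::'a measure)) = 1"
proof -
  have "(\<integral>\<^sup>+y. ennreal (tent y / tent_mass TYPE('a)) \<partial>(lborel::'a measure))
      = ennreal (\<integral>y. tent y / tent_mass TYPE('a) \<partial>(lborel::'a measure))"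
    using tent_mass_pos[where 'a='a] by (intro nn_integral_eq_integral) auto
  then show ?thesis using tent_mass_pos[where 'a='a] by (simp add: tent_mass_def)
qed

text \<open>Jensen moves the square inside the average, and translation invariance removes the shift
  by \<delta> z.\<close>

lemma mollify_energy:
  fixes w :: "'a::euclidean_space \<Rightarrow> real"
  assumes [measurable]: "w \<in> borel_measurable borel" and b: "\<And>y. \<bar>w y\<bar> \<le> B"
  shows "avg_energy (mollify \<delta> w) \<epsilon> \<le> avg_energy w \<epsilon>"
  unfolding avg_energy_def
proof (rule nn_integral_mono, rule mult_left_mono)
  fix y :: 'a
  let ?Z = "tent_mass TYPE('a)" and ?k = "\<lambda>y::'a. tent y / tent_mass TYPE('a)"
  let ?h = "\<epsilon> *\<^sub>R y"
  let ?d = "\<lambda>x. w (x + ?h) - w x"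
  have Z: "?Z > 0" by (rule tent_mass_pos)
  have i: "integrable lborel (\<lambda>z. ?k z * w (x + \<delta> *\<^sub>R z))" for x
    by (rule integrable_tent_mult[of _ B]) (use b in auto)
  have bd: "\<bar>?d x\<bar> \<le> 2 * B" for x using b[of x] b[of "x + ?h"] by linarith
  have "(\<integral>\<^sup>+x. ennreal ((mollify \<delta> w (x + ?h) - mollify \<delta> w x)\<^sup>2) \<partial>lborel)
     \<le> (\<integral>\<^sup>+x. \<integral>\<^sup>+z. ennreal (?k z) * ennreal ((?d (x + \<delta> *\<^sub>R z))\<^sup>2) \<partial>lborel \<partial>lborel)"
  proof (rule nn_integral_mono)
    fix x
    have "mollify \<delta> w (x + ?h) - mollify \<delta> w x = (\<integral>z. ?k z * ?d (x + \<delta> *\<^sub>R z) \<partial>lborel)"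
      unfolding mollify_def using i[of "x + ?h"] i[of x]
      by (subst Bochner_Integration.integral_diff[symmetric]) (auto simp: algebra_simps)
    then show "ennreal ((mollify \<delta> w (x + ?h) - mollify \<delta> w x)\<^sup>2)
        \<le> (\<integral>\<^sup>+z. ennreal (?k z) * ennreal ((?d (x + \<delta> *\<^sub>R z))\<^sup>2) \<partial>lborel)"
      using tent_Jensen[of "\<lambda>z. ?d (x + \<delta> *\<^sub>R z)" "2 * B"] bd by simp
  qed
  also have "\<dots> = (\<integral>\<^sup>+z. \<integral>\<^sup>+x. ennreal (?k z) * ennreal ((?d (x + \<delta> *\<^sub>R z))\<^sup>2) \<partial>lborel \<partial>lborel)"
    by (rule lborel_pair.Fubini'[symmetric]) measurable
  also have "\<dots> = (\<integral>\<^sup>+z. ennreal (?k z) * (\<integral>\<^sup>+x. ennreal ((?d x)\<^sup>2) \<partial>lborel) \<partial>lborel)"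
  proof (rule nn_integral_cong)
    fix z
    have "(\<integral>\<^sup>+x. ennreal ((?d (x + \<delta> *\<^sub>R z))\<^sup>2) \<partial>lborel) = (\<integral>\<^sup>+x. ennreal ((?d x)\<^sup>2) \<partial>lborel)"
      by (rule nn_integral_lborel_translate) measurable
    then show "(\<integral>\<^sup>+x. ennreal (?k z) * ennreal ((?d (x + \<delta> *\<^sub>R z))\<^sup>2) \<partial>lborel)
        = ennreal (?k z) * (\<integral>\<^sup>+x. ennreal ((?d x)\<^sup>2) \<partial>lborel)"
      by (subst nn_integral_cmult) auto
  qed
  also have "\<dots> = (\<integral>\<^sup>+x. ennreal ((?d x)\<^sup>2) \<partial>lborel)"
    by (subst nn_integral_multc) (auto simp: nn_integral_tent)
  finally show "(\<integral>\<^sup>+x. ennreal ((mollify \<delta> w (x + ?h) - mollify \<delta> w x)\<^sup>2) \<partial>lborel) \<le> (\<integral>\<^sup>+x. ennreal ((?d x)\<^sup>2) \<partial>lborel)" .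
qed simp

text \<open>The error is an average of increments of w at scale \<delta>, so the averaged energy
  itself measures it; under an energy bound it is of order \<delta>^2.\<close>

lemma mollify_L2_close:
  fixes w :: "'a::euclidean_space \<Rightarrow> real"
  assumes [measurable]: "w \<in> borel_measurable borel" and b: "\<And>y. \<bar>w y\<bar> \<le> B"
  shows "(\<integral>\<^sup>+x. ennreal ((mollify \<delta> w x - w x)\<^sup>2) \<partial>lborel) \<le> ennreal (1 / tent_mass TYPE('a)) * avg_energy w \<delta>"
proof -
  let ?Z = "tent_mass TYPE('a)" and ?k = "\<lambda>y::'a. tent y / tent_mass TYPE('a)"
  have [measurable]: "ball (0::'a) 1 \<in> sets borel" by simp
  have Z: "?Z > 0" by (rule tent_mass_pos)
  have k1: "(\<integral>y. ?k y \<partial>lborel) = 1" using Z by (simp add: tent_mass_def)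
  have i: "integrable lborel (\<lambda>z. ?k z * w (x + \<delta> *\<^sub>R z))" for x
    by (rule integrable_tent_mult[of _ B]) (use b in auto)
  have ki: "integrable lborel ?k" by simp
  have "(\<integral>\<^sup>+x. ennreal ((mollify \<delta> w x - w x)\<^sup>2) \<partial>lborel)
      \<le> (\<integral>\<^sup>+x. \<integral>\<^sup>+y. ennreal (?k y) * ennreal ((w (x + \<delta> *\<^sub>R y) - w x)\<^sup>2) \<partial>lborel \<partial>lborel)"
  proof (rule nn_integral_mono)
    fix x
    have "mollify \<delta> w x - w x = (\<integral>y. ?k y * w (x + \<delta> *\<^sub>R y) \<partial>lborel) - (\<integral>y. ?k y * w x \<partial>lborel)"
      using k1 by (simp add: mollify_def)
    also have "\<dots> = (\<integral>y. ?k y * (w (x + \<delta> *\<^sub>R y) - w x) \<partial>lborel)"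
      using i[of x] ki by (subst Bochner_Integration.integral_diff[symmetric]) (auto simp: algebra_simps)
    finally show "ennreal ((mollify \<delta> w x - w x)\<^sup>2) \<le> (\<integral>\<^sup>+y. ennreal (?k y) * ennreal ((w (x + \<delta> *\<^sub>R y) - w x)\<^sup>2) \<partial>lborel)"
    proof (simp only:, intro tent_Jensen[where B="2*B"])
      show "\<bar>w (x + \<delta> *\<^sub>R y) - w x\<bar> \<le> 2 * B" for y using b[of "x + \<delta> *\<^sub>R y"] b[of x] by linarith
    qed measurable
  qed
  also have "\<dots> = (\<integral>\<^sup>+y. \<integral>\<^sup>+x. ennreal (?k y) * ennreal ((w (x + \<delta> *\<^sub>R y) - w x)\<^sup>2) \<partial>lborel \<partial>lborel)"
    by (rule lborel_pair.Fubini'[symmetric]) measurable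
  also have "\<dots> \<le> (\<integral>\<^sup>+y. ennreal (1 / ?Z) * (indicator (ball 0 1) y * (\<integral>\<^sup>+x. ennreal ((w (x + \<delta> *\<^sub>R y) - w x)\<^sup>2) \<partial>lborel)) \<partial>lborel)"
  proof (rule nn_integral_mono)
    fix y :: 'a
    have "(\<integral>\<^sup>+x. ennreal (?k y) * ennreal ((w (x + \<delta> *\<^sub>R y) - w x)\<^sup>2) \<partial>lborel)
        = ennreal (?k y) * (\<integral>\<^sup>+x. ennreal ((w (x + \<delta> *\<^sub>R y) - w x)\<^sup>2) \<partial>lborel)"
      by (rule nn_integral_cmult) measurable
    also have "\<dots> \<le> (ennreal (1 / ?Z) * indicator (ball 0 1) y) * (\<integral>\<^sup>+x. ennreal ((w (x + \<delta> *\<^sub>R y) - w x)\<^sup>2) \<partial>lborel)"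
    proof (rule mult_right_mono)
      have "?k y \<le> 1 / ?Z * indicator (ball 0 1) y" using tent_le[of y] Z by (simp add: field_simps)
      then have "ennreal (?k y) \<le> ennreal (1 / ?Z * indicator (ball 0 1) y)" by (rule ennreal_leI)
      also have "\<dots> = ennreal (1 / ?Z) * indicator (ball 0 1) y" by (simp add: indicator_def)
      finally show "ennreal (?k y) \<le> ennreal (1 / ?Z) * indicator (ball 0 1) y" .
    qed simp
    finally show "(\<integral>\<^sup>+x. ennreal (?k y) * ennreal ((w (x + \<delta> *\<^sub>R y) - w x)\<^sup>2) \<partial>lborel)
      \<le> ennreal (1 / ?Z) * (indicator (ball 0 1) y * (\<integral>\<^sup>+x. ennreal ((w (x + \<delta> *\<^sub>R y) - w x)\<^sup>2) \<partial>lborel))"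
      by (simp add: mult.assoc)
  qed
  also have "\<dots> = ennreal (1 / ?Z) * avg_energy w \<delta>"
    unfolding avg_energy_def by (rule nn_integral_cmult) measurable
  finally show ?thesis .
qed

lemma mollify_bounds:
  fixes w :: "'a::euclidean_space \<Rightarrow> real"
  assumes [measurable]: "w \<in> borel_measurable borel" and b: "\<And>y. 0 \<le> w y" "\<And>y. w y \<le> B"
  shows "0 \<le> mollify \<delta> w x" "mollify \<delta> w x \<le> B"
proof -
  let ?k = "\<lambda>y::'a. tent y / tent_mass TYPE('a)"
  have Z: "tent_mass TYPE('a) > 0" by (rule tent_mass_pos)
  have i: "integrable lborel (\<lambda>z. ?k z * w (x + \<delta> *\<^sub>R z))"
    by (rule integrable_tent_mult[of _ B]) (use b in auto)
  show "0 \<le> mollify \<delta> w x"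
    unfolding mollify_def using b Z by (intro integral_nonneg_AE) auto
  have ki: "integrable lborel ?k" by simp
  have "mollify \<delta> w x \<le> (\<integral>y. ?k y * B \<partial>lborel)"
    unfolding mollify_def using i ki b Z by (intro integral_mono) (auto intro!: mult_left_mono divide_right_mono)
  also have "\<dots> = B" using Z by (simp add: tent_mass_def)
  finally show "mollify \<delta> w x \<le> B" .
qed

lemma mollify_Lipschitz:
  fixes w :: "'a::euclidean_space \<Rightarrow> real"
  assumes [measurable]: "w \<in> borel_measurable borel" and b: "\<And>y. \<bar>w y\<bar> \<le> B"
    and supp: "\<And>x. norm x \<ge> R \<Longrightarrow> w x = 0" and \<delta>: "\<delta> > 0"
  obtains L where "L \<ge> 0" "\<And>x x'. \<bar>mollify \<delta> w x - mollify \<delta> w x'\<bar> \<le> L * dist x x'"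
proof -
  let ?Z = "tent_mass TYPE('a)" and ?V = "measure lborel (ball (0::'a) R)"
  have [measurable]: "ball (0::'a) R \<in> sets borel" by simp
  have Z: "?Z > 0" by (rule tent_mass_pos)
  have B: "B \<ge> 0" using b[of 0] by linarith
  have wi: "integrable lborel (\<lambda>z. indicator (ball 0 R) z * B :: real)" by (rule integrable_indicator_ball) simp
  define f where "f x z = tent ((z - x) /\<^sub>R \<delta>) / ?Z * w z" for x z
  have fb: "\<bar>f x z\<bar> \<le> indicator (ball 0 R) z * (B / ?Z)" for x z
  proof (cases "norm z < R")
    case True
    have "tent ((z - x) /\<^sub>R \<delta>) \<le> 1" by (simp add: tent_def)
    then have "tent ((z - x) /\<^sub>R \<delta>) * \<bar>w z\<bar> \<le> 1 * B" using b[of z] B by (intro mult_mono) auto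
    then show ?thesis using True Z by (simp add: f_def abs_mult divide_right_mono)
  qed (use supp in \<open>auto simp: f_def\<close>)
  have fi: "integrable lborel (f x)" for x
  proof (rule Bochner_Integration.integrable_bound)
    show "integrable lborel (\<lambda>z::'a. indicator (ball 0 R) z * (B / ?Z) :: real)" by (rule integrable_indicator_ball) simp
    show "f x \<in> borel_measurable lborel" unfolding f_def by measurable
    show "AE z in lborel. norm (f x z) \<le> norm (indicator (ball 0 R) z * (B / ?Z) :: real)"
      using fb[of x] by (intro AE_I2) (metis abs_ge_self order_trans real_norm_def)
  qed
  have mf: "mollify \<delta> w x = (\<integral>z. f x z \<partial>lborel) / \<delta> ^ DIM('a)" for x
  proof -
    have "(\<integral>z. f x (x + \<delta> *\<^sub>R z) \<partial>lborel) = (\<integral>z. f x z \<partial>lborel) / \<bar>\<delta>\<bar> ^ DIM('a)"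
      by (rule integral_lborel_affine[OF _ fi]) (use \<delta> in simp)
    then show ?thesis using \<delta> by (simp add: mollify_def f_def)
  qed
  \<comment> \<open>1/\<delta> is the Lipschitz constant of the rescaled tent, \<delta>^N the
    Jacobian, and B times the volume bounds the integral of |w|.\<close>
  let ?L = "B * ?V / (?Z * \<delta> * \<delta> ^ DIM('a))"
  have "\<bar>mollify \<delta> w x - mollify \<delta> w x'\<bar> \<le> ?L * dist x x'" for x x'
  proof -
    have "\<bar>(\<integral>z. f x z \<partial>lborel) - (\<integral>z. f x' z \<partial>lborel)\<bar> = \<bar>\<integral>z. f x z - f x' z \<partial>lborel\<bar>"
      using fi by simp
    also have "\<dots> \<le> (\<integral>z. \<bar>f x z - f x' z\<bar> \<partial>lborel)" by (rule integral_abs_bound)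
    also have "\<dots> \<le> (\<integral>z. indicator (ball 0 R) (z::'a) * (B * dist x x' / (?Z * \<delta>)) \<partial>lborel)"
    proof (rule integral_mono)
      show "integrable lborel (\<lambda>z. \<bar>f x z - f x' z\<bar>)" using fi by simp
      show "integrable lborel (\<lambda>z::'a. indicator (ball 0 R) z * (B * dist x x' / (?Z * \<delta>)) :: real)" by (rule integrable_indicator_ball) simp
      fix z
      show "\<bar>f x z - f x' z\<bar> \<le> indicator (ball 0 R) z * (B * dist x x' / (?Z * \<delta>))"
      proof (cases "norm z < R")
        case True
        have "dist ((z - x) /\<^sub>R \<delta>) ((z - x') /\<^sub>R \<delta>) = dist x x' / \<delta>"
        proof -
          have "(z - x) /\<^sub>R \<delta> - (z - x') /\<^sub>R \<delta> = (x' - x) /\<^sub>R \<delta>" by (simp add: algebra_simps)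
          then show ?thesis using \<delta> by (simp add: dist_norm norm_minus_commute divide_inverse)
        qed
        then have "\<bar>tent ((z - x) /\<^sub>R \<delta>) - tent ((z - x') /\<^sub>R \<delta>)\<bar> \<le> dist x x' / \<delta>"
          using tent_Lipschitz[of "(z - x) /\<^sub>R \<delta>" "(z - x') /\<^sub>R \<delta>"] by simp
        then have "\<bar>tent ((z - x) /\<^sub>R \<delta>) - tent ((z - x') /\<^sub>R \<delta>)\<bar> * \<bar>w z\<bar> \<le> dist x x' / \<delta> * B"
          using b[of z] \<delta> by (intro mult_mono) auto
        then have "\<bar>tent ((z - x) /\<^sub>R \<delta>) - tent ((z - x') /\<^sub>R \<delta>)\<bar> * \<bar>w z\<bar> / ?Z \<le> dist x x' / \<delta> * B / ?Z"
          using Z by (intro divide_right_mono) auto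
        moreover have "f x z - f x' z = (tent ((z - x) /\<^sub>R \<delta>) - tent ((z - x') /\<^sub>R \<delta>)) * w z / ?Z"
          by (simp add: f_def diff_divide_distrib algebra_simps)
        ultimately have "\<bar>f x z - f x' z\<bar> \<le> dist x x' / \<delta> * B / ?Z" using Z by (simp add: abs_mult)
        then show ?thesis using True by (simp add: mult_ac)
      qed (use supp in \<open>auto simp: f_def\<close>)
    qed
    also have "\<dots> = ?V * (B * dist x x' / (?Z * \<delta>))" by simp
    finally have "\<bar>(\<integral>z. f x z \<partial>lborel) - (\<integral>z. f x' z \<partial>lborel)\<bar> / \<delta> ^ DIM('a) \<le> ?V * (B * dist x x' / (?Z * \<delta>)) / \<delta> ^ DIM('a)"
      using \<delta> by (intro divide_right_mono) auto
    then show ?thesis unfolding mf using \<delta> by (simp add: diff_divide_distrib[symmetric] abs_mult mult_ac)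
  qed
  moreover have "?L \<ge> 0" using B Z \<delta> by simp
  ultimately show ?thesis using that by blast
qed

text \<open>A slow cutoff followed by mollification. The cutoff raises the energy bound by at most d
  and mollification not at all; the squared L2 errors are at most d/4 and d/8, and (a + b)^2 <= 2
  a^2 + 2 b^2 joins them to less than d.\<close>

lemma Lipschitz_approximation:
  fixes w :: "'a::euclidean_space \<Rightarrow> real"
  assumes w[measurable]: "w \<in> borel_measurable borel" and b: "\<And>y. 0 \<le> w y" "\<And>y. w y \<le> B"
    and w2: "integrable lborel (\<lambda>x. (w x)\<^sup>2)" and en: "energy_le w A" "A \<ge> 0" and d: "d > 0"
  obtains v L R where "\<And>y. 0 \<le> v y" "\<And>y. v y \<le> B" "L \<ge> 0" "\<And>x y. \<bar>v x - v y\<bar> \<le> L * dist x y"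
    "R > 0" "\<And>x. norm x \<ge> R \<Longrightarrow> v x = 0"
    "integrable lborel (\<lambda>x. (v x - w x)\<^sup>2)" "(\<integral>x. (v x - w x)\<^sup>2 \<partial>lborel) < d" "energy_le v (A + d)"
proof -
  let ?Z = "tent_mass TYPE('a)" and ?c = "ball_moment TYPE('a)" and ?U = "\<integral>x. (w x)\<^sup>2 \<partial>lborel"
  have Z: "?Z > 0" and c: "?c > 0" by (rule tent_mass_pos ball_moment_pos)+
  \<comment> \<open>Makes the loss caused by the factor 1 + \<eta> at most d/2, leaving d/2 for the
    slope of the cutoff; A + 1 avoids a division by 0.\<close>
  define \<eta> where "\<eta> = d / (2 * (A + 1))"
  have \<eta>: "\<eta> > 0" "\<eta> * A \<le> d / 2"
    using d en(2) by (auto simp: \<eta>_def field_simps)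
  define z :: "nat \<Rightarrow> 'a \<Rightarrow> real" where "z n x = max 0 (min 1 (2 - norm x / real (Suc n)))" for n x
  have z01: "0 \<le> z n x" "z n x \<le> 1" for n x by (auto simp: z_def)
  have zm[measurable]: "z n \<in> borel_measurable borel" for n unfolding z_def by measurable
  have zL: "\<bar>z n x - z n y\<bar> \<le> 1 / real (Suc n) * dist x y" for n x y
  proof -
    have "\<bar>z n x - z n y\<bar> \<le> \<bar>norm x / real (Suc n) - norm y / real (Suc n)\<bar>"
    proof -
      have "\<bar>max 0 (min 1 (2 - a)) - max 0 (min 1 (2 - b))\<bar> \<le> \<bar>a - b\<bar>" for a b :: real
        by (auto simp: max_def min_def)
      then show ?thesis unfolding z_def .
    qed
    also have "\<dots> = \<bar>norm x - norm y\<bar> / real (Suc n)" by (simp add: diff_divide_distrib[symmetric])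
    also have "\<dots> \<le> dist x y / real (Suc n)"
      by (intro divide_right_mono) (auto simp: dist_norm norm_triangle_ineq3)
    finally show ?thesis by simp
  qed
  have zsupp: "z n x = 0" if "norm x \<ge> 2 * real (Suc n)" for n x
    using that by (simp add: z_def field_simps)
  have lim1: "(\<lambda>n. \<integral>x. (w x * z n x - w x)\<^sup>2 \<partial>lborel) \<longlonglongrightarrow> (\<integral>x. 0 \<partial>(lborel::'a measure))"
  proof (rule integral_dominated_convergence[where w="\<lambda>x. (w x)\<^sup>2"])
    show "AE x in lborel. (\<lambda>n. (w x * z n x - w x)\<^sup>2) \<longlonglongrightarrow> 0"
    proof (rule AE_I2, rule tendsto_eventually)
      fix x :: 'a
      obtain N where N: "norm x \<le> real N" using real_arch_simple by blast
      show "\<forall>\<^sub>F n in sequentially. (w x * z n x - w x)\<^sup>2 = 0"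
        using eventually_ge_at_top[of N]
      proof eventually_elim
        case (elim n)
        then have "norm x \<le> real (Suc n)" using N by simp
        then show ?case by (simp add: z_def field_simps)
      qed
    qed
    show "AE x in lborel. norm ((w x * z n x - w x)\<^sup>2) \<le> (w x)\<^sup>2" for n
    proof (rule AE_I2)
      fix x
      have "(w x * z n x - w x)\<^sup>2 = (w x)\<^sup>2 * (1 - z n x)\<^sup>2" by (simp add: power2_eq_square algebra_simps)
      also have "\<dots> \<le> (w x)\<^sup>2 * 1" using z01[of n x] by (intro mult_left_mono) (auto simp: abs_square_le_1)
      finally show "norm ((w x * z n x - w x)\<^sup>2) \<le> (w x)\<^sup>2" by simp
    qed
  qed (use w2 in auto)
  have "(\<lambda>n. (1 + 1/\<eta>) * (1 / real (Suc n))\<^sup>2 * real DIM('a) * ?U) \<longlonglongrightarrow> (1 + 1/\<eta>) * 0\<^sup>2 * real DIM('a) * ?U"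
    by (intro tendsto_intros) (use LIMSEQ_inverse_real_of_nat in \<open>simp add: inverse_eq_divide\<close>)
  then have "\<forall>\<^sub>F n in sequentially. (1 + 1/\<eta>) * (1 / real (Suc n))\<^sup>2 * real DIM('a) * ?U < d / 2"
    using d by (intro order_tendstoD(2)) auto
  moreover have "\<forall>\<^sub>F n in sequentially. (\<integral>x. (w x * z n x - w x)\<^sup>2 \<partial>lborel) < d / 4"
    using lim1 d by (intro order_tendstoD(2)) auto
  ultimately obtain n where n: "(1 + 1/\<eta>) * (1 / real (Suc n))\<^sup>2 * real DIM('a) * ?U < d / 2"
      "(\<integral>x. (w x * z n x - w x)\<^sup>2 \<partial>lborel) < d / 4"
    using eventually_happens[OF eventually_conj] by (metis (no_types, lifting) sequentially_bot)
  define g where "g x = w x * z n x" for x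
  have gm[measurable]: "g \<in> borel_measurable borel" unfolding g_def by measurable
  have g0: "0 \<le> g x" for x using b(1)[of x] z01 by (simp add: g_def)
  have gB: "g x \<le> B" for x using mult_left_le[OF z01(2), of "w x" n x] b(1,2)[of x] by (simp add: g_def)
  have gab: "\<bar>g x\<bar> \<le> B" for x using g0 gB by simp
  define R where "R = 2 * real (Suc n)"
  have gsupp: "g x = 0" if "norm x \<ge> R" for x using zsupp that by (simp add: g_def R_def)
  have g_en: "energy_le g (A + d)"
  proof (rule energy_le_mono)
    show "energy_le g ((1 + \<eta>) * A + (1 + 1/\<eta>) * (1 / real (Suc n))\<^sup>2 * real DIM('a) * ?U)"
      unfolding g_def by (rule energy_le_mult_cutoff) (use w2 en z01 zL \<eta> in auto)
    show "(1 + \<eta>) * A + (1 + 1/\<eta>) * (1 / real (Suc n))\<^sup>2 * real DIM('a) * ?U \<le> A + d"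
    proof -
      have "(1 + \<eta>) * A = A + \<eta> * A" by (simp add: algebra_simps)
      then show ?thesis using n(1) \<eta>(2) d by linarith
    qed
  qed
  have g2: "integrable lborel (\<lambda>x. (g x)\<^sup>2)"
  proof (rule Bochner_Integration.integrable_bound[OF w2])
    show "AE x in lborel. norm ((g x)\<^sup>2) \<le> norm ((w x)\<^sup>2)"
    proof (rule AE_I2)
      fix x
      have "g x \<le> w x" using mult_left_le[OF z01(2), of "w x" n x] b(1)[of x] by (simp add: g_def)
      then show "norm ((g x)\<^sup>2) \<le> norm ((w x)\<^sup>2)" using g0[of x] by (simp add: power_mono)
    qed
  qed measurable
  have gw: "integrable lborel (\<lambda>x. (g x - w x)\<^sup>2)" by (rule integrable_diff_square) (use g2 w2 in auto)
  define K where "K = 1 / ?Z * (?c * (A + d))"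
  have K: "K > 0" using Z c d en(2) by (simp add: K_def)
  \<comment> \<open>\<open>K\<close> times \<delta>^2 bounds the squared error of mollification, and
    this choice makes it d/8.\<close>
  define \<delta> where "\<delta> = sqrt (d / (8 * K))"
  have \<delta>: "\<delta> > 0" "\<delta>\<^sup>2 * K = d / 8" using d K by (auto simp: \<delta>_def)
  define v where "v = mollify \<delta> g"
  obtain L where L: "L \<ge> 0" "\<And>x y. \<bar>v x - v y\<bar> \<le> L * dist x y"
    unfolding v_def using mollify_Lipschitz[OF gm gab gsupp \<delta>(1)] by metis
  have vm[measurable]: "v \<in> borel_measurable borel"
    by (rule borel_measurable_continuous_onI[OF Lipschitz_continuous_on[OF L(2)]])
  have "(\<integral>\<^sup>+x. ennreal ((v x - g x)\<^sup>2) \<partial>lborel) \<le> ennreal (1 / ?Z) * avg_energy g \<delta>"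
    unfolding v_def by (rule mollify_L2_close[OF gm gab])
  also have "\<dots> \<le> ennreal (1 / ?Z) * ennreal (?c * \<delta>\<^sup>2 * (A + d))"
    by (intro mult_left_mono energy_leD g_en \<delta>) auto
  also have "\<dots> = ennreal (\<delta>\<^sup>2 * K)" using Z c by (simp add: ennreal_mult'[symmetric] K_def mult_ac)
  finally have close: "(\<integral>\<^sup>+x. ennreal ((v x - g x)\<^sup>2) \<partial>lborel) \<le> ennreal (d / 8)" using \<delta> by simp
  have vg: "integrable lborel (\<lambda>x. (v x - g x)\<^sup>2)"
    by (rule integrableI_bounded) (use close in \<open>auto intro: le_less_trans\<close>)
  have vg_le: "(\<integral>x. (v x - g x)\<^sup>2 \<partial>lborel) \<le> d / 8"
  proof -
    have "ennreal (\<integral>x. (v x - g x)\<^sup>2 \<partial>lborel) \<le> ennreal (d / 8)"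
      using close vg by (subst nn_integral_eq_integral[symmetric]) auto
    then show ?thesis using d by (simp add: ennreal_le_iff)
  qed
  have sum2: "(v x - w x)\<^sup>2 \<le> 2 * (v x - g x)\<^sup>2 + 2 * (g x - w x)\<^sup>2" for x
  proof -
    have "0 \<le> ((v x - g x) - (g x - w x))\<^sup>2" by simp
    then show ?thesis by (simp add: power2_eq_square algebra_simps)
  qed
  have vw: "integrable lborel (\<lambda>x. (v x - w x)\<^sup>2)"
  proof (rule Bochner_Integration.integrable_bound)
    show "integrable lborel (\<lambda>x. 2 * (v x - g x)\<^sup>2 + 2 * (g x - w x)\<^sup>2)" using vg gw by simp
  qed (use sum2 in auto)
  have "(\<integral>x. (v x - w x)\<^sup>2 \<partial>lborel) \<le> (\<integral>x. 2 * (v x - g x)\<^sup>2 + 2 * (g x - w x)\<^sup>2 \<partial>lborel)"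
    by (rule integral_mono) (use vw vg gw sum2 in auto)
  also have "\<dots> = 2 * (\<integral>x. (v x - g x)\<^sup>2 \<partial>lborel) + 2 * (\<integral>x. (g x - w x)\<^sup>2 \<partial>lborel)"
    using vg gw by simp
  also have "\<dots> < d" using vg_le n(2) d by (simp add: g_def)
  finally have vw_lt: "(\<integral>x. (v x - w x)\<^sup>2 \<partial>lborel) < d" .
  have v_en: "energy_le v (A + d)"
    unfolding energy_le_def v_def
    using mollify_energy[OF gm gab, of \<delta>] g_en unfolding energy_le_def by (meson order_trans)
  show ?thesis
  proof (rule that[of v L "R + \<delta>"])
    show "0 \<le> v y" "v y \<le> B" for y unfolding v_def by (rule mollify_bounds[OF gm g0 gB])+
    show "R + \<delta> > 0" using \<delta> by (simp add: R_def)
    show "v x = 0" if "norm x \<ge> R + \<delta>" for x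
    proof -
      have "tent y / ?Z * g (x + \<delta> *\<^sub>R y) = 0" for y
      proof (cases "norm y < 1")
        case True
        have "norm x \<le> norm (x + \<delta> *\<^sub>R y) + norm (\<delta> *\<^sub>R y)" by (metis add_diff_cancel norm_triangle_ineq4)
        moreover have "norm (\<delta> *\<^sub>R y) \<le> \<delta>" using True \<delta> by (simp add: mult_left_le)
        ultimately have "norm (x + \<delta> *\<^sub>R y) \<ge> R" using that by linarith
        then show ?thesis using gsupp by simp
      qed (simp add: tent_def)
      then have "v x = (\<integral>y. 0 \<partial>(lborel::'a measure))" unfolding v_def mollify_def by (intro Bochner_Integration.integral_cong) auto
      then show ?thesis by simp
    qed
  qed (use L vw vw_lt v_en in auto)
qed

subsection \<open>Test functions\<close>

lemma testfun_has_derivative: "testfun \<phi> D \<Longrightarrow> (\<phi> has_derivative (\<lambda>h. D x \<bullet> h)) (at x)"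
  by (simp add: testfun_def)

lemma testfun_continuous:
  assumes "testfun \<phi> D" shows "continuous_on UNIV \<phi>" "continuous_on UNIV D"
proof -
  show "continuous_on UNIV \<phi>"
    by (rule has_derivative_continuous_on[where f'="\<lambda>x h. D x \<bullet> h"])
       (rule has_derivative_at_withinI[OF testfun_has_derivative[OF assms]])
  show "continuous_on UNIV D" using assms by (simp add: testfun_def)
qed

lemma testfun_measurable:
  assumes "testfun \<phi> D" shows "\<phi> \<in> borel_measurable borel" "D \<in> borel_measurable borel"
  using testfun_continuous[OF assms] by (auto intro: borel_measurable_continuous_onI)

lemma testfun_support:
  fixes \<phi> :: "real^'n \<Rightarrow> real"
  assumes "testfun \<phi> D"
  obtains R where "R > 0" "\<And>x. norm x \<ge> R \<Longrightarrow> \<phi> x = 0" "\<And>x. norm x \<ge> R \<Longrightarrow> D x = 0"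
proof -
  let ?S = "closure {x. \<phi> x \<noteq> 0}"
  have "compact ?S" using assms by (simp add: testfun_def)
  then obtain R where R: "R > 0" "\<And>x. x \<in> ?S \<Longrightarrow> norm x < R"
    using compact_imp_bounded[of ?S] unfolding bounded_pos_less by blast
  \<comment> \<open>Compact support is only demanded of \<phi>; off its closed support \<phi> is
    locally 0, so the derivative vanishes there too.\<close>
  have D0: "D x = 0" if "norm x \<ge> R" for x
  proof -
    have x: "x \<in> - ?S" using R(2)[of x] that by auto
    have o: "open (- ?S)" by auto
    have z: "\<phi> y = 0" if "y \<in> - ?S" for y using that closure_subset[of "{x. \<phi> x \<noteq> 0}"] by auto
    have "((\<lambda>_. 0) has_derivative (\<lambda>h. D x \<bullet> h)) (at x)"
      by (rule has_derivative_transform_within_open[OF testfun_has_derivative[OF assms] o x]) (rule z)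
    then have "(\<lambda>h. D x \<bullet> h) = (\<lambda>_. 0)"
      by (rule has_derivative_unique) simp
    then have "D x \<bullet> D x = 0" by meson
    then show ?thesis by simp
  qed
  have "\<phi> x = 0" if "norm x \<ge> R" for x
    using R(2)[of x] that closure_subset[of "{x. \<phi> x \<noteq> 0}"] by fastforce
  then show ?thesis using that R(1) D0 by blast
qed

lemma testfunI:
  fixes \<phi> :: "real^'n \<Rightarrow> real"
  assumes "\<And>x. (\<phi> has_derivative (\<lambda>h. D x \<bullet> h)) (at x)" "continuous_on UNIV D"
    and "\<And>x. norm x \<ge> R \<Longrightarrow> \<phi> x = 0"
  shows "testfun \<phi> D"
proof -
  have "{x. \<phi> x \<noteq> 0} \<subseteq> cball 0 R" using assms(3) by (force simp: not_le intro: less_imp_le)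
  then have "bounded {x. \<phi> x \<noteq> 0}" using bounded_cball bounded_subset by blast
  then show ?thesis using assms by (simp add: testfun_def compact_closure)
qed

lemma continuous_support_bounded:
  fixes f :: "'a::euclidean_space \<Rightarrow> 'b::real_normed_vector"
  assumes "continuous_on UNIV f" "\<And>x. norm x \<ge> R \<Longrightarrow> f x = 0"
  obtains B where "B > 0" "\<And>x. norm (f x) \<le> B"
proof -
  have "compact (f ` cball 0 R)"
    using assms(1) by (intro compact_continuous_image) (auto intro: continuous_on_subset)
  then have "bounded (f ` cball 0 R)" by (rule compact_imp_bounded)
  then obtain B where B: "B > 0" "\<forall>y\<in>f ` cball 0 R. norm y \<le> B" unfolding bounded_pos by auto
  have "norm (f x) \<le> B" for x
  proof (cases "norm x \<le> R")
    case True
    then have "f x \<in> f ` cball 0 R" by simp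
    then show ?thesis using B(2) by blast
  qed (use assms(2)[of x] B(1) in simp)
  then show ?thesis using that B(1) by blast
qed

lemma testfun_bounded:
  fixes \<phi> :: "real^'n \<Rightarrow> real"
  assumes "testfun \<phi> D"
  obtains B where "B > 0" "\<And>x. \<bar>\<phi> x\<bar> \<le> B" "\<And>x. norm (D x) \<le> B"
proof -
  obtain R where R: "\<And>x. norm x \<ge> R \<Longrightarrow> \<phi> x = 0" "\<And>x. norm x \<ge> R \<Longrightarrow> D x = 0"
    using testfun_support[OF assms] by metis
  obtain B1 where B1: "B1 > 0" "\<And>x. norm (\<phi> x) \<le> B1"
    using continuous_support_bounded[OF testfun_continuous(1)[OF assms] R(1)] by metis
  obtain B2 where B2: "B2 > 0" "\<And>x. norm (D x) \<le> B2"
    using continuous_support_bounded[OF testfun_continuous(2)[OF assms] R(2)] by metis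
  show ?thesis
  proof (rule that[of "B1 + B2"])
    show "\<bar>\<phi> x\<bar> \<le> B1 + B2" for x using B1(2)[of x] B2(1) by simp
    show "norm (D x) \<le> B1 + B2" for x using B2(2)[of x] B1(1) by simp
  qed (use B1 B2 in simp)
qed

lemma testfun_sqL2:
  fixes \<phi> :: "real^'n \<Rightarrow> real"
  assumes "testfun \<phi> D"
  shows "sqL2 \<phi>" "sqL2 (\<lambda>x. D x $ i)"
proof -
  obtain R where R: "\<And>x. norm x \<ge> R \<Longrightarrow> \<phi> x = 0" "\<And>x. norm x \<ge> R \<Longrightarrow> D x = 0"
    using testfun_support[OF assms] by metis
  note c = testfun_continuous[OF assms]
  have "integrable lborel (\<lambda>x. (\<phi> x)\<^sup>2)"
    by (rule integrable_continuous_support[of _ R]) (use R c in \<open>auto intro!: continuous_intros\<close>)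
  then show "sqL2 \<phi>" using testfun_measurable[OF assms] by (simp add: sqL2_def)
  have "integrable lborel (\<lambda>x. (D x $ i)\<^sup>2)"
    by (rule integrable_continuous_support[of _ R]) (use R c in \<open>auto intro!: continuous_intros\<close>)
  moreover have "(\<lambda>x. D x $ i) \<in> borel_measurable borel"
    by (intro borel_measurable_continuous_onI continuous_intros c)
  ultimately show "sqL2 (\<lambda>x. D x $ i)" by (simp add: sqL2_def)
qed

lemma testfun_translate:
  fixes \<phi> :: "real^'n \<Rightarrow> real"
  assumes "testfun \<phi> D" shows "testfun (\<lambda>x. \<phi> (x - a)) (\<lambda>x. D (x - a))"
proof -
  obtain R where R: "R > 0" "\<And>x. norm x \<ge> R \<Longrightarrow> \<phi> x = 0" using testfun_support[OF assms] by metis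
  show ?thesis
  proof (rule testfunI[where R="R + norm a"])
    show "((\<lambda>x. \<phi> (x - a)) has_derivative (\<lambda>h. D (x - a) \<bullet> h)) (at x)" for x
      by (rule has_derivative_compose[of "\<lambda>x. x - a" "\<lambda>h. h" x UNIV, OF _ testfun_has_derivative[OF assms]])
         (auto intro!: derivative_eq_intros)
    show "continuous_on UNIV (\<lambda>x. D (x - a))"
      by (rule continuous_on_compose2[OF testfun_continuous(2)[OF assms]]) (auto intro!: continuous_intros)
    show "\<phi> (x - a) = 0" if "norm x \<ge> R + norm a" for x
      using that norm_triangle_ineq2[of x a] by (intro R(2)) linarith
  qed
qed

lemma testfun_scale_arg:
  fixes \<phi> :: "real^'n \<Rightarrow> real"
  assumes "testfun \<phi> D" "t > 0" shows "testfun (\<lambda>x. \<phi> (t *\<^sub>R x)) (\<lambda>x. t *\<^sub>R D (t *\<^sub>R x))"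
proof -
  obtain R where R: "R > 0" "\<And>x. norm x \<ge> R \<Longrightarrow> \<phi> x = 0" using testfun_support[OF assms(1)] by metis
  show ?thesis
  proof (rule testfunI[where R="R / t"])
    fix x
    have "((\<lambda>x. \<phi> (t *\<^sub>R x)) has_derivative (\<lambda>h. D (t *\<^sub>R x) \<bullet> (t *\<^sub>R h))) (at x)"
      by (rule has_derivative_compose[of "\<lambda>x. t *\<^sub>R x" "\<lambda>h. t *\<^sub>R h" x UNIV, OF _ testfun_has_derivative[OF assms(1)]])
         (auto intro!: derivative_eq_intros)
    then show "((\<lambda>x. \<phi> (t *\<^sub>R x)) has_derivative (\<lambda>h. (t *\<^sub>R D (t *\<^sub>R x)) \<bullet> h)) (at x)" by simp
    show "continuous_on UNIV (\<lambda>x. t *\<^sub>R D (t *\<^sub>R x))"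
      by (intro continuous_intros continuous_on_compose2[OF testfun_continuous(2)[OF assms(1)]]) auto
    show "\<phi> (t *\<^sub>R x) = 0" if "norm x \<ge> R / t" for x
      using that assms(2) by (intro R(2)) (simp add: field_simps)
  qed
qed

lemma testfun_mult:
  fixes \<phi> f :: "real^'n \<Rightarrow> real"
  assumes "testfun \<phi> D" "\<And>x. (f has_derivative (\<lambda>h. Df x \<bullet> h)) (at x)" "continuous_on UNIV Df"
  shows "testfun (\<lambda>x. f x * \<phi> x) (\<lambda>x. f x *\<^sub>R D x + \<phi> x *\<^sub>R Df x)"
proof -
  obtain R where R: "R > 0" "\<And>x. norm x \<ge> R \<Longrightarrow> \<phi> x = 0" using testfun_support[OF assms(1)] by metis
  show ?thesis
  proof (rule testfunI[where R=R])
    fix x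
    show "((\<lambda>x. f x * \<phi> x) has_derivative (\<lambda>h. (f x *\<^sub>R D x + \<phi> x *\<^sub>R Df x) \<bullet> h)) (at x)"
      by (rule has_derivative_eq_rhs[OF has_derivative_mult[OF assms(2) testfun_has_derivative[OF assms(1)]]])
         (auto simp: fun_eq_iff inner_simps algebra_simps)
    have "continuous_on UNIV f"
      by (rule has_derivative_continuous_on[where f'="\<lambda>x h. Df x \<bullet> h"])
         (rule has_derivative_at_withinI[OF assms(2)])
    then show "continuous_on UNIV (\<lambda>x. f x *\<^sub>R D x + \<phi> x *\<^sub>R Df x)"
      using testfun_continuous[OF assms(1)] assms(3) by (intro continuous_intros)
  qed (use R in auto)
qed

lemma testfun_add:
  fixes \<phi> \<psi> :: "real^'n \<Rightarrow> real"
  assumes "testfun \<phi> D" "testfun \<psi> E"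
  shows "testfun (\<lambda>x. \<phi> x + \<psi> x) (\<lambda>x. D x + E x)"
proof -
  obtain R where R: "R > 0" "\<And>x. norm x \<ge> R \<Longrightarrow> \<phi> x = 0" using testfun_support[OF assms(1)] by metis
  obtain R' where R': "R' > 0" "\<And>x. norm x \<ge> R' \<Longrightarrow> \<psi> x = 0" using testfun_support[OF assms(2)] by metis
  show ?thesis
  proof (rule testfunI[where R="max R R'"])
    fix x
    show "((\<lambda>x. \<phi> x + \<psi> x) has_derivative (\<lambda>h. (D x + E x) \<bullet> h)) (at x)"
      by (rule has_derivative_eq_rhs[OF has_derivative_add[OF testfun_has_derivative[OF assms(1)] testfun_has_derivative[OF assms(2)]]])
         (auto simp: fun_eq_iff inner_simps)
    show "continuous_on UNIV (\<lambda>x. D x + E x)"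
      using testfun_continuous[OF assms(1)] testfun_continuous[OF assms(2)] by (intro continuous_intros)
  qed (use R R' in auto)
qed

lemma testfun_cmult:
  fixes \<phi> :: "real^'n \<Rightarrow> real"
  assumes "testfun \<phi> D" shows "testfun (\<lambda>x. c * \<phi> x) (\<lambda>x. c *\<^sub>R D x)"
  using testfun_mult[OF assms, of "\<lambda>_. c" "\<lambda>_. 0"] by simp

lemma testfun_zero: "testfun (\<lambda>x. 0) (\<lambda>x. 0)"
  by (rule testfunI[of _ _ 0]) auto

text \<open>Stated in terms of \<open>x \<bullet> x\<close> rather than the norm, so that the origin
  causes no loss of smoothness.\<close>

lemma testfun_radial:
  fixes P P' :: "real \<Rightarrow> real"
  assumes "\<And>t. (P has_real_derivative P' t) (at t)" "continuous_on UNIV P'" "\<And>t. t \<ge> b \<Longrightarrow> P t = 0"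
  shows "testfun (\<lambda>x::real^'n. P (x \<bullet> x)) (\<lambda>x. (2 * P' (x \<bullet> x)) *\<^sub>R x)"
proof (rule testfunI[where R="\<bar>b\<bar> + 1"])
  fix x :: "real^'n"
  have "((\<lambda>x. P (x \<bullet> x)) has_derivative (\<lambda>h. (x \<bullet> h + h \<bullet> x) * P' (x \<bullet> x))) (at x)"
    by (rule DERIV_compose_FDERIV[OF assms(1), of "\<lambda>x. x \<bullet> x" "\<lambda>h. x \<bullet> h + h \<bullet> x" x UNIV])
       (rule has_derivative_inner[OF has_derivative_ident has_derivative_ident])
  then show "((\<lambda>x. P (x \<bullet> x)) has_derivative (\<lambda>h. ((2 * P' (x \<bullet> x)) *\<^sub>R x) \<bullet> h)) (at x)"
    by (rule has_derivative_eq_rhs) (auto simp: fun_eq_iff inner_commute algebra_simps)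
  show "continuous_on UNIV (\<lambda>x::real^'n. (2 * P' (x \<bullet> x)) *\<^sub>R x)"
    by (intro continuous_intros continuous_on_compose2[OF assms(2)]) auto
  show "P (x \<bullet> x) = 0" if "norm x \<ge> \<bar>b\<bar> + 1" for x :: "real^'n"
  proof (rule assms(3))
    have "1 * norm x \<le> norm x * norm x" using that by (intro mult_right_mono) auto
    then show "b \<le> x \<bullet> x" using that by (simp add: dot_square_norm power2_eq_square)
  qed
qed

text \<open>The cube of the positive part is twice continuously differentiable; \<open>pos2\<close>
  and \<open>pos1\<close> are its first and second derivative, named after their degree. Two
  derivatives are needed because in the positivity argument the gradient of a test function is
  itself used as a test field.\<close>

definition pos3 :: "real \<Rightarrow> real" where "pos3 s = (max 0 s)^3"
definition pos2 :: "real \<Rightarrow> real" where "pos2 s = 3 * (max 0 s)\<^sup>2"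
definition pos1 :: "real \<Rightarrow> real" where "pos1 s = 6 * max 0 s"

lemma has_real_derivative_max0_power:
  assumes "n \<ge> 1"
  shows "((\<lambda>s::real. (max 0 s)^(Suc n)) has_real_derivative real (Suc n) * (max 0 s)^n) (at s)"
proof (cases "s = 0")
  case True
  have "((\<lambda>h::real. ((max 0 h)^(Suc n) - 0) / (h - 0)) \<longlongrightarrow> 0) (at 0)"
  proof (rule Lim_null_comparison)
    show "\<forall>\<^sub>F h in at (0::real). norm (((max 0 h)^(Suc n) - 0) / (h - 0)) \<le> \<bar>h\<bar>^n"
    proof (rule always_eventually, rule allI)
      fix h :: real
      show "norm (((max 0 h)^(Suc n) - 0) / (h - 0)) \<le> \<bar>h\<bar>^n"
        by (cases "h > 0") (auto simp: max_def)
    qed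
    have "((\<lambda>h::real. \<bar>h\<bar>^n) \<longlongrightarrow> \<bar>0\<bar>^n) (at 0)" by (intro tendsto_intros)
    then show "((\<lambda>h::real. \<bar>h\<bar>^n) \<longlongrightarrow> 0) (at 0)" using assms by (simp add: power_0_left)
  qed
  then show ?thesis using True assms by (simp add: has_field_derivative_iff power_0_left)
next
  case False
  show ?thesis
  proof (cases "s > 0")
    case True
    have "((\<lambda>s::real. s^(Suc n)) has_real_derivative real (Suc n) * s^n) (at s)"
      using DERIV_pow[of "Suc n" s] by simp
    then have "((\<lambda>s::real. (max 0 s)^(Suc n)) has_real_derivative real (Suc n) * s^n) (at s)"
      by (rule DERIV_cong_ev[THEN iffD1, OF refl _ refl, rotated])
         (use eventually_gt_at_top True in \<open>auto simp: eventually_nhds intro!: exI[of _ "{0<..}"]\<close>)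
    then show ?thesis using True by simp
  next
    case neg: False
    have "((\<lambda>s::real. 0) has_real_derivative 0) (at s)" by simp
    then have "((\<lambda>s::real. (max 0 s)^(Suc n)) has_real_derivative 0) (at s)"
      by (rule DERIV_cong_ev[THEN iffD1, OF refl _ refl, rotated])
         (use neg False in \<open>auto simp: eventually_nhds intro!: exI[of _ "{..<0}"]\<close>)
    then show ?thesis using neg False assms by (simp add: power_0_left)
  qed
qed

lemma DERIV_pos3: "(pos3 has_real_derivative pos2 s) (at s)"
  using has_real_derivative_max0_power[of 2 s] unfolding pos3_def[abs_def] pos2_def by (simp add: numeral_3_eq_3 numeral_2_eq_2)

lemma DERIV_pos2: "(pos2 has_real_derivative pos1 s) (at s)"
  using DERIV_cmult[OF has_real_derivative_max0_power[of 1 s], of 3] unfolding pos2_def[abs_def] pos1_def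
  by (simp add: numeral_2_eq_2)

lemma continuous_pos [continuous_intros]:
  "continuous_on S f \<Longrightarrow> continuous_on S (\<lambda>x. pos3 (f x))"
  "continuous_on S f \<Longrightarrow> continuous_on S (\<lambda>x. pos2 (f x))"
  "continuous_on S f \<Longrightarrow> continuous_on S (\<lambda>x. pos1 (f x))"
  unfolding pos3_def pos2_def pos1_def by (auto intro!: continuous_intros)

text \<open>A twice continuously differentiable cutoff: 1 below b and 0 above b + 1.\<close>

definition cut :: "real \<Rightarrow> real \<Rightarrow> real" where "cut b t = pos3 (1 - pos3 (t - b))"
definition cut' :: "real \<Rightarrow> real \<Rightarrow> real" where "cut' b t = - pos2 (1 - pos3 (t - b)) * pos2 (t - b)"
definition cut'' :: "real \<Rightarrow> real \<Rightarrow> real" where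
  "cut'' b t = pos1 (1 - pos3 (t - b)) * (pos2 (t - b))\<^sup>2 - pos2 (1 - pos3 (t - b)) * pos1 (t - b)"

lemma DERIV_cut: "(cut b has_real_derivative cut' b t) (at t)"
proof -
  have "((\<lambda>t. pos3 (1 - pos3 (t - b))) has_real_derivative pos2 (1 - pos3 (t - b)) * (0 - pos2 (t - b) * (1 - 0))) (at t)"
    by (intro DERIV_chain2[OF DERIV_pos3] DERIV_diff DERIV_const DERIV_ident)
  then show ?thesis by (simp add: cut_def[abs_def] cut'_def)
qed

lemma DERIV_cut': "(cut' b has_real_derivative cut'' b t) (at t)"
proof -
  have a: "((\<lambda>t. - pos2 (1 - pos3 (t - b))) has_real_derivative - (pos1 (1 - pos3 (t - b)) * (0 - pos2 (t - b) * (1 - 0)))) (at t)"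
    by (intro DERIV_minus DERIV_chain2[OF DERIV_pos2] DERIV_chain2[OF DERIV_pos3] DERIV_diff DERIV_const DERIV_ident)
  have b: "((\<lambda>t. pos2 (t - b)) has_real_derivative pos1 (t - b) * (1 - 0)) (at t)"
    by (intro DERIV_chain2[OF DERIV_pos2] DERIV_diff DERIV_const DERIV_ident)
  show ?thesis
    unfolding cut'_def[abs_def] cut''_def
    by (rule DERIV_cong[OF DERIV_mult[OF a b]]) (simp add: power2_eq_square algebra_simps)
qed

lemma continuous_cut [continuous_intros]:
  "continuous_on S f \<Longrightarrow> continuous_on S (\<lambda>x. cut b (f x))"
  "continuous_on S f \<Longrightarrow> continuous_on S (\<lambda>x. cut' b (f x))"
  "continuous_on S f \<Longrightarrow> continuous_on S (\<lambda>x. cut'' b (f x))"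
  unfolding cut_def cut'_def cut''_def by (auto intro!: continuous_intros)

lemma cut_eq_1: "t \<le> b \<Longrightarrow> cut b t = 1" "t \<le> b \<Longrightarrow> cut' b t = 0" "t \<le> b \<Longrightarrow> cut'' b t = 0"
  by (simp_all add: cut_def cut'_def cut''_def pos3_def pos2_def pos1_def)

lemma cut_eq_0:
  assumes "t \<ge> b + 1" shows "cut b t = 0" "cut' b t = 0"
proof -
  have "1 \<le> max 0 (t - b)" using assms by simp
  then have "1 \<le> (max 0 (t - b))^3" by (rule one_le_power)
  then show "cut b t = 0" "cut' b t = 0" by (simp_all add: cut_def cut'_def pos3_def pos2_def)
qed

lemma cut_bounds: "0 \<le> cut b t" "cut b t \<le> 1"
  by (auto simp: cut_def pos3_def intro!: power_le_one)

text \<open>Off a null set f is a limit of continuous functions. These are clamped, replaced on a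
  large ball by C1 functions through Stone-Weierstrass, and multiplied by a cutoff; dominated
  convergence does the rest.\<close>

lemma L2_dense_testfun_bounded:
  fixes f :: "real^'n \<Rightarrow> real"
  assumes [measurable]: "f \<in> borel_measurable borel" and fM: "\<And>x. \<bar>f x\<bar> \<le> M" and fR: "\<And>x. norm x > R \<Longrightarrow> f x = 0"
    and R: "R > 0" and e: "e > 0"
  obtains \<phi> D where "testfun \<phi> D" "(\<integral>x. (\<phi> x - f x)\<^sup>2 \<partial>lborel) < e"
proof -
  have M: "M \<ge> 0" using fM[of 0] by linarith
  have "f \<in> borel_measurable lebesgue" by (intro measurable_completion) simp
  then have "f measurable_on UNIV" by (rule lebesgue_measurable_imp_measurable_on_real) simp
  then obtain N g where Ng: "negligible N" "\<And>n. continuous_on UNIV (g n)" "\<And>x. x \<notin> N \<Longrightarrow> (\<lambda>n. g n x) \<longlonglongrightarrow> f x"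
    by (auto simp: measurable_on_def)
  have "AE x in lebesgue. x \<notin> N"
    using Ng(1) by (intro AE_not_in) (simp add: negligible_iff_null_sets)
  then have aeN: "AE x in lborel. x \<notin> N" by (simp add: AE_completion_iff)
  \<comment> \<open>Clamping does not disturb the limit, since |f| <= M, and it provides a constant
    majorant.\<close>
  define G where "G n x = max (- M) (min M (g n x))" for n x
  have Gc: "continuous_on UNIV (G n)" for n unfolding G_def by (intro continuous_intros Ng)
  \<comment> \<open>The algebra for Stone-Weierstrass; linear functionals belong to it and separate
    points.\<close>
  define C1 where "C1 p \<longleftrightarrow> (\<exists>Dp. (\<forall>x. (p has_derivative (\<lambda>h. Dp x \<bullet> h)) (at x)) \<and> continuous_on UNIV Dp)" for p :: "real^'n \<Rightarrow> real"
  have C1c: "continuous_on S p" if C1p: "C1 p" for p S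
  proof -
    obtain Dp where d: "\<And>x. (p has_derivative (\<lambda>h. Dp x \<bullet> h)) (at x)" using C1p unfolding C1_def by blast
    show ?thesis
      by (rule has_derivative_continuous_on[where f'="\<lambda>x h. Dp x \<bullet> h"]) (rule has_derivative_at_withinI[OF d])
  qed
  have C1I: "C1 p" if "\<And>x. (p has_derivative (\<lambda>h. Dp x \<bullet> h)) (at x)" "continuous_on UNIV Dp" for p Dp
    using that unfolding C1_def by blast
  have SW: "\<exists>p. C1 p \<and> (\<forall>x\<in>cball 0 (R + 1). \<bar>G n x - p x\<bar> < 1 / real (Suc n))" for n
  proof (rule Stone_Weierstrass_HOL)
    show "C1 (\<lambda>x. c)" for c
      by (rule C1I[of _ "\<lambda>_. 0"]) (auto intro: has_derivative_eq_rhs[OF has_derivative_const])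
    show "continuous_on (cball 0 (R + 1)) p" if "C1 p" for p using C1c[OF that] .
    show "C1 (\<lambda>x. p x + p' x)" if pp: "C1 p \<and> C1 p'" for p p'
    proof -
      obtain Dp Dp' where d: "\<And>x. (p has_derivative (\<lambda>h. Dp x \<bullet> h)) (at x)" "continuous_on UNIV Dp"
        "\<And>x. (p' has_derivative (\<lambda>h. Dp' x \<bullet> h)) (at x)" "continuous_on UNIV Dp'"
        using pp unfolding C1_def by blast
      show ?thesis
      proof (rule C1I)
        show "((\<lambda>x. p x + p' x) has_derivative (\<lambda>h. (Dp x + Dp' x) \<bullet> h)) (at x)" for x
          by (rule has_derivative_eq_rhs[OF has_derivative_add[OF d(1) d(3)]]) (auto simp: fun_eq_iff inner_simps)
        show "continuous_on UNIV (\<lambda>x. Dp x + Dp' x)" using d by (intro continuous_intros)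
      qed
    qed
    show "C1 (\<lambda>x. p x * p' x)" if pp: "C1 p \<and> C1 p'" for p p'
    proof -
      obtain Dp Dp' where d: "\<And>x. (p has_derivative (\<lambda>h. Dp x \<bullet> h)) (at x)" "continuous_on UNIV Dp"
        "\<And>x. (p' has_derivative (\<lambda>h. Dp' x \<bullet> h)) (at x)" "continuous_on UNIV Dp'"
        using pp unfolding C1_def by blast
      have "((\<lambda>x. p x * p' x) has_derivative (\<lambda>h. (p x *\<^sub>R Dp' x + p' x *\<^sub>R Dp x) \<bullet> h)) (at x)" for x
        by (rule has_derivative_eq_rhs[OF has_derivative_mult[OF d(1) d(3)]]) (auto simp: fun_eq_iff inner_simps algebra_simps)
      moreover have "continuous_on UNIV (\<lambda>x. p x *\<^sub>R Dp' x + p' x *\<^sub>R Dp x)"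
        using d C1c pp by (intro continuous_intros) auto
      ultimately show ?thesis by (rule C1I)
    qed
    show "\<exists>p. C1 p \<and> p x \<noteq> p y" if "x \<in> cball 0 (R+1) \<and> y \<in> cball 0 (R+1) \<and> x \<noteq> y" for x y :: "real^'n"
    proof -
      have "C1 (\<lambda>z. (x - y) \<bullet> z)"
        by (rule C1I[of _ "\<lambda>_. x - y"]) (auto intro: has_derivative_inner_right)
      moreover have "(x - y) \<bullet> x \<noteq> (x - y) \<bullet> y" using that by (metis inner_diff_right inner_eq_zero_iff right_minus_eq)
      ultimately show ?thesis by blast
    qed
  qed (auto intro: continuous_on_subset[OF Gc])
  then obtain p where p: "\<And>n. C1 (p n)" "\<And>n x. x \<in> cball 0 (R + 1) \<Longrightarrow> \<bar>G n x - p n x\<bar> < 1 / real (Suc n)" by metis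
  then obtain Dp where Dp: "\<And>n x. (p n has_derivative (\<lambda>h. Dp n x \<bullet> h)) (at x)" "\<And>n. continuous_on UNIV (Dp n)"
    unfolding C1_def by metis
  define z where "z x = cut (R\<^sup>2) (x \<bullet> x)" for x :: "real^'n"
  define Dz where "Dz x = (2 * cut' (R\<^sup>2) (x \<bullet> x)) *\<^sub>R x" for x :: "real^'n"
  have tz: "testfun z Dz"
    unfolding z_def[abs_def] Dz_def[abs_def]
    by (rule testfun_radial[where b="R\<^sup>2 + 1"]) (auto intro: DERIV_cut cut_eq_0 intro!: continuous_intros)
  have z1: "z x = 1" if "norm x \<le> R" for x
    using that R unfolding z_def dot_square_norm by (intro cut_eq_1 power_mono) auto
  have z0: "z x = 0" if "norm x > R + 1" for x
  proof -
    have "(R + 1)\<^sup>2 \<le> (norm x)\<^sup>2" using that R by (intro power_mono) auto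
    then show ?thesis using R unfolding z_def dot_square_norm by (intro cut_eq_0) (simp add: power2_eq_square algebra_simps)
  qed
  have zb: "0 \<le> z x" "z x \<le> 1" for x by (auto simp: z_def cut_bounds)
  define \<phi> where "\<phi> n x = p n x * z x" for n x
  define D where "D n x = p n x *\<^sub>R Dz x + z x *\<^sub>R Dp n x" for n x
  have t\<phi>: "testfun (\<phi> n) (D n)" for n
    unfolding \<phi>_def D_def by (rule testfun_mult[OF tz Dp])
  note [measurable] = testfun_measurable(1)[OF t\<phi>]
  have lim: "AE x in lborel. (\<lambda>n. (\<phi> n x - f x)\<^sup>2) \<longlonglongrightarrow> 0"
    using aeN
  proof eventually_elim
    fix x assume x: "x \<notin> N"
    show "(\<lambda>n. (\<phi> n x - f x)\<^sup>2) \<longlonglongrightarrow> 0"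
    proof (cases "norm x \<le> R + 1")
      case True
      have "(\<lambda>n. G n x) \<longlonglongrightarrow> max (- M) (min M (f x))"
        unfolding G_def by (intro tendsto_intros Ng(3) x)
      moreover have "max (- M) (min M (f x)) = f x" using fM[of x] by auto
      ultimately have G: "(\<lambda>n. G n x) \<longlonglongrightarrow> f x" by simp
      have "(\<lambda>n. p n x - G n x) \<longlonglongrightarrow> 0"
      proof (rule Lim_null_comparison)
        show "\<forall>\<^sub>F n in sequentially. norm (p n x - G n x) \<le> 1 / real (Suc n)"
          using p(2)[of x] True by (intro always_eventually allI) (simp add: abs_minus_commute less_imp_le)
        show "(\<lambda>n. 1 / real (Suc n)) \<longlonglongrightarrow> 0" using LIMSEQ_inverse_real_of_nat by (simp add: inverse_eq_divide)
      qed
      from tendsto_add[OF this G] have "(\<lambda>n. p n x) \<longlonglongrightarrow> f x" by simp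
      then have "(\<lambda>n. (p n x * z x - f x)\<^sup>2) \<longlonglongrightarrow> (f x * z x - f x)\<^sup>2" by (intro tendsto_intros)
      moreover have "f x * z x = f x" using z1[of x] fR[of x] by (cases "norm x \<le> R") auto
      ultimately show ?thesis by (simp add: \<phi>_def)
    next
      case False
      then show ?thesis using z0[of x] fR[of x] by (simp add: \<phi>_def)
    qed
  qed
  have "(\<lambda>n. \<integral>x. (\<phi> n x - f x)\<^sup>2 \<partial>lborel) \<longlonglongrightarrow> (\<integral>x. 0 \<partial>(lborel :: (real^'n) measure))"
  proof (rule integral_dominated_convergence[where w="\<lambda>x. indicator (ball 0 (R + 2)) x * (2 * M + 1)\<^sup>2"])
    show "integrable lborel (\<lambda>x::real^'n. indicator (ball 0 (R + 2)) x * (2 * M + 1)\<^sup>2 :: real)" by (rule integrable_indicator_ball) simp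
    show "AE x in lborel. norm ((\<phi> n x - f x)\<^sup>2) \<le> indicator (ball 0 (R + 2)) x * (2 * M + 1)\<^sup>2" for n
    proof (rule AE_I2)
      fix x
      show "norm ((\<phi> n x - f x)\<^sup>2) \<le> indicator (ball 0 (R + 2)) x * (2 * M + 1)\<^sup>2"
      proof (cases "norm x \<le> R + 1")
        case True
        have "\<bar>G n x - p n x\<bar> < 1 / real (Suc n)" using p(2) True by simp
        also have "\<dots> \<le> 1" by simp
        finally have "\<bar>p n x\<bar> \<le> M + 1" using M by (auto simp: G_def)
        then have "\<bar>p n x\<bar> * \<bar>z x\<bar> \<le> (M + 1) * 1" using zb[of x] by (intro mult_mono) auto
        then have "\<bar>\<phi> n x - f x\<bar> \<le> 2 * M + 1" using fM[of x] by (simp add: \<phi>_def abs_mult[symmetric])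
        then have "(\<phi> n x - f x)\<^sup>2 \<le> (2 * M + 1)\<^sup>2" using M by (simp add: abs_le_square_iff[symmetric])
        then show ?thesis using True by simp
      next
        case False
        then show ?thesis using z0[of x] fR[of x] by (simp add: \<phi>_def)
      qed
    qed
  qed (use lim in auto)
  then have "\<forall>\<^sub>F n in sequentially. (\<integral>x. (\<phi> n x - f x)\<^sup>2 \<partial>lborel) < e"
    using e by (intro order_tendstoD(2)) auto
  then obtain n where "(\<integral>x. (\<phi> n x - f x)\<^sup>2 \<partial>lborel) < e" using eventually_happens by force
  then show ?thesis using that t\<phi> by blast
qed

lemma sqL2D: assumes "sqL2 u" shows "u \<in> borel_measurable borel" "integrable lborel (\<lambda>x. (u x)\<^sup>2)"
  using assms by (auto simp: sqL2_def)

lemma L2_dense_testfun: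
  fixes f :: "real^'n \<Rightarrow> real"
  assumes f: "sqL2 f" and e: "e > 0"
  obtains \<phi> D where "testfun \<phi> D" "(\<integral>x. (\<phi> x - f x)\<^sup>2 \<partial>lborel) < e"
proof -
  note [measurable] = sqL2D(1)[OF f] and f2 = sqL2D(2)[OF f]
  \<comment> \<open>Truncation in value and in space at once, with an error dominated by
    |f|.\<close>
  define b where "b n x = (if norm x \<le> real (Suc n) then max (- real n) (min (real n) (f x)) else 0)" for n x
  have [measurable]: "b n \<in> borel_measurable borel" for n unfolding b_def by measurable
  have babs: "\<bar>b n x - f x\<bar> \<le> \<bar>f x\<bar>" for n x by (auto simp: b_def)
  have b2: "(b n x - f x)\<^sup>2 \<le> (f x)\<^sup>2" for n x using babs by (simp add: abs_le_square_iff[symmetric])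
  have bi: "integrable lborel (\<lambda>x. (b n x - f x)\<^sup>2)" for n
    by (rule Bochner_Integration.integrable_bound[OF f2]) (use b2 in auto)
  have "(\<lambda>n. \<integral>x. (b n x - f x)\<^sup>2 \<partial>lborel) \<longlonglongrightarrow> (\<integral>x. 0 \<partial>(lborel :: (real^'n) measure))"
  proof (rule integral_dominated_convergence[where w="\<lambda>x. (f x)\<^sup>2"])
    show "AE x in lborel. (\<lambda>n. (b n x - f x)\<^sup>2) \<longlonglongrightarrow> 0"
    proof (rule AE_I2, rule tendsto_eventually)
      fix x
      obtain N where N: "max (norm x) \<bar>f x\<bar> \<le> real N" using real_arch_simple by blast
      show "\<forall>\<^sub>F n in sequentially. (b n x - f x)\<^sup>2 = 0"
        using eventually_ge_at_top[of N]
      proof eventually_elim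
        case (elim n)
        then have "real N \<le> real n" by simp
        then have "norm x \<le> real n" "\<bar>f x\<bar> \<le> real n" using N by auto
        then show ?case by (auto simp: b_def)
      qed
    qed
  qed (use f2 b2 in auto)
  then have "\<forall>\<^sub>F n in sequentially. (\<integral>x. (b n x - f x)\<^sup>2 \<partial>lborel) < e / 4"
    using e by (intro order_tendstoD(2)) auto
  then obtain n where n: "(\<integral>x. (b n x - f x)\<^sup>2 \<partial>lborel) < e / 4" using eventually_happens by force
  obtain \<phi> D where \<phi>: "testfun \<phi> D" "(\<integral>x. (\<phi> x - b n x)\<^sup>2 \<partial>lborel) < e / 4"
    by (rule L2_dense_testfun_bounded[of "b n" "real n" "real (Suc n)" "e / 4"]) (use e in \<open>auto simp: b_def\<close>)
  note [measurable] = testfun_measurable(1)[OF \<phi>(1)]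
  have \<phi>2: "integrable lborel (\<lambda>x. (\<phi> x)\<^sup>2)" using testfun_sqL2(1)[OF \<phi>(1)] by (rule sqL2D)
  have bf: "integrable lborel (\<lambda>x. (b n x)\<^sup>2)"
    using integrable_add_square[of "\<lambda>x. b n x - f x" lborel f] bi f2 by simp
  have i1: "integrable lborel (\<lambda>x. (\<phi> x - b n x)\<^sup>2)" by (rule integrable_diff_square) (use \<phi>2 bf in auto)
  have i2: "integrable lborel (\<lambda>x. (\<phi> x - f x)\<^sup>2)" by (rule integrable_diff_square) (use \<phi>2 f2 in auto)
  have "(\<phi> x - f x)\<^sup>2 \<le> 2 * (\<phi> x - b n x)\<^sup>2 + 2 * (b n x - f x)\<^sup>2" for x
  proof -
    have "0 \<le> ((\<phi> x - b n x) - (b n x - f x))\<^sup>2" by simp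
    then show ?thesis by (simp add: power2_eq_square algebra_simps)
  qed
  then have "(\<integral>x. (\<phi> x - f x)\<^sup>2 \<partial>lborel) \<le> (\<integral>x. 2 * (\<phi> x - b n x)\<^sup>2 + 2 * (b n x - f x)\<^sup>2 \<partial>lborel)"
    by (intro integral_mono) (use i1 i2 bi in auto)
  also have "\<dots> = 2 * (\<integral>x. (\<phi> x - b n x)\<^sup>2 \<partial>lborel) + 2 * (\<integral>x. (b n x - f x)\<^sup>2 \<partial>lborel)" using i1 bi by simp
  also have "\<dots> < e" using n \<phi> by simp
  finally show ?thesis using that \<phi>(1) by blast
qed

text \<open>Pairing f with a test function close to f recovers its norm. In this way estimates for
  weak derivatives, which are known only against test functions, become norm estimates.\<close>

lemma L2_norm_le_by_duality:
  fixes f :: "real^'n \<Rightarrow> real"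
  assumes f: "sqL2 f" and C: "C \<ge> 0"
    and dual: "\<And>\<phi> D. testfun \<phi> D \<Longrightarrow> \<bar>\<integral>x. f x * \<phi> x \<partial>lborel\<bar> \<le> C * sqrt (\<integral>x. (\<phi> x)\<^sup>2 \<partial>lborel)"
  shows "sqrt (\<integral>x. (f x)\<^sup>2 \<partial>lborel) \<le> C"
proof -
  note [measurable] = sqL2D(1)[OF f] and f2 = sqL2D(2)[OF f]
  let ?n = "\<lambda>h. sqrt (\<integral>x. (h x)\<^sup>2 \<partial>(lborel :: (real^'n) measure))"
  \<comment> \<open>For \<phi> within e of f in norm, the pairing of f with \<phi> is the squared
    norm of f up to an error of order e.\<close>
  have main: "(?n f)\<^sup>2 \<le> C * ?n f + (C + ?n f) * e" if e: "e > 0" for e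
  proof -
    obtain \<phi> D where \<phi>: "testfun \<phi> D" "(\<integral>x. (\<phi> x - f x)\<^sup>2 \<partial>lborel) < e\<^sup>2"
      using L2_dense_testfun[OF f, of "e\<^sup>2"] e by auto
    note [measurable] = testfun_measurable(1)[OF \<phi>(1)]
    have \<phi>2: "integrable lborel (\<lambda>x. (\<phi> x)\<^sup>2)" using testfun_sqL2(1)[OF \<phi>(1)] by (rule sqL2D)
    have d2: "integrable lborel (\<lambda>x. (\<phi> x - f x)\<^sup>2)" by (rule integrable_diff_square) (use \<phi>2 f2 in auto)
    have fd: "integrable lborel (\<lambda>x. f x * (\<phi> x - f x))" by (rule integrable_mult_squares) (use d2 f2 in auto)
    have fp: "integrable lborel (\<lambda>x. f x * \<phi> x)" by (rule integrable_mult_squares) (use \<phi>2 f2 in auto)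
    define d where "d = ?n (\<lambda>x. \<phi> x - f x)"
    have de: "d \<le> e" using \<phi>(2) e unfolding d_def by (metis less_imp_le real_le_lsqrt real_sqrt_le_iff real_sqrt_abs abs_of_pos)
    have d0: "d \<ge> 0" by (simp add: d_def)
    have cs: "\<bar>\<integral>x. f x * (\<phi> x - f x) \<partial>lborel\<bar> \<le> ?n f * d"
      unfolding d_def by (rule Cauchy_Schwarz_integral) (use d2 f2 in auto)
    have n\<phi>: "?n \<phi> \<le> ?n f + d"
    proof (rule real_le_lsqrt)
      have "(\<integral>x. (\<phi> x)\<^sup>2 \<partial>lborel) = (\<integral>x. (f x)\<^sup>2 + 2 * (f x * (\<phi> x - f x)) + (\<phi> x - f x)\<^sup>2 \<partial>lborel)"
        by (rule Bochner_Integration.integral_cong) (auto simp: power2_eq_square algebra_simps)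
      also have "\<dots> = (?n f)\<^sup>2 + 2 * (\<integral>x. f x * (\<phi> x - f x) \<partial>lborel) + d\<^sup>2"
        using f2 fd d2 by (simp add: d_def)
      also have "\<dots> \<le> (?n f)\<^sup>2 + 2 * (?n f * d) + d\<^sup>2" using cs by linarith
      finally show "(\<integral>x. (\<phi> x)\<^sup>2 \<partial>lborel) \<le> (?n f + d)\<^sup>2" by (simp add: power2_sum algebra_simps)
    qed (use d0 in auto)
    have "(?n f)\<^sup>2 = (\<integral>x. f x * \<phi> x - f x * (\<phi> x - f x) \<partial>lborel)"
      by (simp add: algebra_simps power2_eq_square)
    also have "\<dots> = (\<integral>x. f x * \<phi> x \<partial>lborel) - (\<integral>x. f x * (\<phi> x - f x) \<partial>lborel)" using fd fp by simp
    also have "\<dots> \<le> C * ?n \<phi> + ?n f * d" using dual[OF \<phi>(1)] cs by linarith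
    also have "\<dots> \<le> C * (?n f + d) + ?n f * d" using n\<phi> C by (intro add_right_mono mult_left_mono)
    also have "\<dots> = C * ?n f + (C + ?n f) * d" by (simp add: algebra_simps)
    also have "\<dots> \<le> C * ?n f + (C + ?n f) * e" using de C by (intro add_left_mono mult_left_mono) auto
    finally show ?thesis .
  qed
  have "(?n f)\<^sup>2 \<le> C * ?n f"
  proof (rule field_le_epsilon)
    fix e :: real assume "e > 0"
    have p: "C + ?n f + 1 > 0" using C by (simp add: add_nonneg_pos)
    then have "e / (C + ?n f + 1) > 0" using \<open>e > 0\<close> by simp
    from main[OF this] have "(?n f)\<^sup>2 \<le> C * ?n f + (C + ?n f) * (e / (C + ?n f + 1))" .
    moreover have "(C + ?n f) * (e / (C + ?n f + 1)) \<le> (C + ?n f + 1) * (e / (C + ?n f + 1))"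
      using p \<open>e > 0\<close> by (intro mult_right_mono) auto
    ultimately show "(?n f)\<^sup>2 \<le> C * ?n f + e" using p by simp
  qed
  then show ?thesis
    using C mult_le_cancel_right[of "?n f" "?n f" C] unfolding power2_eq_square[of "?n f"]
    by (metis less_le order_refl real_sqrt_ge_zero integral_nonneg_AE AE_I2 zero_le_power2)
qed

subsection \<open>Weak gradients and the nonlocal energy\<close>

lemma sqL2_mult_integrable:
  fixes u v :: "real^'n \<Rightarrow> real"
  assumes "sqL2 u" "sqL2 v" shows "integrable lborel (\<lambda>x. u x * v x)"
  using assms by (auto simp: sqL2_def intro!: integrable_mult_squares)

lemma sqL2_add: "sqL2 u \<Longrightarrow> sqL2 v \<Longrightarrow> sqL2 (\<lambda>x. u x + v x)"
  by (auto simp: sqL2_def intro!: integrable_add_square)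

lemma sqL2_diff: "sqL2 u \<Longrightarrow> sqL2 v \<Longrightarrow> sqL2 (\<lambda>x. u x - v x)"
  by (auto simp: sqL2_def intro!: integrable_diff_square)

lemma sqL2_cmult: "sqL2 u \<Longrightarrow> sqL2 (\<lambda>x. c * u x)"
  by (auto simp: sqL2_def power_mult_distrib)

lemma sqL2_zero: "sqL2 (\<lambda>x. 0)" by (simp add: sqL2_def)

lemma sqL2_sum: "finite I \<Longrightarrow> (\<And>i. i \<in> I \<Longrightarrow> sqL2 (f i)) \<Longrightarrow> sqL2 (\<lambda>x. \<Sum>i\<in>I. f i x)"
  by (induction I rule: finite_induct) (auto intro: sqL2_add sqL2_zero)

lemma sqL2_inner:
  fixes g :: "real^'n \<Rightarrow> real^'n"
  assumes "\<And>i. sqL2 (\<lambda>x. g x $ i)" shows "sqL2 (\<lambda>x. g x \<bullet> h)"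
proof -
  have "sqL2 (\<lambda>x. \<Sum>i\<in>UNIV. h $ i * (g x $ i))" by (intro sqL2_sum sqL2_cmult assms) auto
  then show ?thesis by (simp add: inner_vec_def mult.commute)
qed

lemma sqL2_translate:
  fixes u :: "real^'n \<Rightarrow> real"
  assumes "sqL2 u" shows "sqL2 (\<lambda>x. u (x + a))"
  using assms integrable_lborel_translate[of "\<lambda>x. (u x)\<^sup>2" a] by (auto simp: sqL2_def)

lemma sqL2_Cauchy_Schwarz:
  assumes "sqL2 u" "sqL2 v"
  shows "\<bar>\<integral>x. u x * v x \<partial>lborel\<bar> \<le> sqrt (\<integral>x. (u x)\<^sup>2 \<partial>lborel) * sqrt (\<integral>x. (v x)\<^sup>2 \<partial>lborel)"
  using assms by (intro Cauchy_Schwarz_integral) (auto simp: sqL2_def)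

lemma
  fixes g :: "real^'n \<Rightarrow> real^'n"
  assumes g: "\<And>i. sqL2 (\<lambda>x. g x $ i)"
  shows integrable_norm_square_vec: "integrable lborel (\<lambda>x. (norm (g x))\<^sup>2)"
    and integral_norm_square_vec: "(\<integral>x. (norm (g x))\<^sup>2 \<partial>lborel) = (\<Sum>i\<in>UNIV. \<integral>x. (g x $ i)\<^sup>2 \<partial>lborel)"
proof -
  have eq: "(norm (g x))\<^sup>2 = (\<Sum>i\<in>UNIV. (g x $ i)\<^sup>2)" for x
    unfolding power2_norm_eq_inner by (simp add: inner_vec_def power2_eq_square)
  have i: "integrable lborel (\<lambda>x. (g x $ i)\<^sup>2)" for i using g by (rule sqL2D)
  show "integrable lborel (\<lambda>x. (norm (g x))\<^sup>2)" unfolding eq using i by simp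
  show "(\<integral>x. (norm (g x))\<^sup>2 \<partial>lborel) = (\<Sum>i\<in>UNIV. \<integral>x. (g x $ i)\<^sup>2 \<partial>lborel)"
    unfolding eq using i by (subst Bochner_Integration.integral_sum) auto
qed

lemma measurable_vec_components:
  fixes g :: "'a \<Rightarrow> real^'n"
  assumes "\<And>i. (\<lambda>x. g x $ i) \<in> borel_measurable M" shows "g \<in> borel_measurable M"
  unfolding borel_measurable_euclidean_space[of g] by (auto simp: Basis_vec_def inner_axis assms)

lemma L2_tendsto_inner:
  assumes f: "\<And>n. sqL2 (f n)" "sqL2 g" and \<psi>: "sqL2 \<psi>"
    and lim: "(\<lambda>n. \<integral>x. (f n x - g x)\<^sup>2 \<partial>lborel) \<longlonglongrightarrow> 0"
  shows "(\<lambda>n. \<integral>x. f n x * \<psi> x \<partial>lborel) \<longlonglongrightarrow> (\<integral>x. g x * \<psi> x \<partial>lborel)"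
proof (rule Lim_null[THEN iffD2], rule Lim_null_comparison)
  let ?n = "sqrt (\<integral>x. (\<psi> x)\<^sup>2 \<partial>lborel)"
  show "\<forall>\<^sub>F n in sequentially. norm ((\<integral>x. f n x * \<psi> x \<partial>lborel) - (\<integral>x. g x * \<psi> x \<partial>lborel))
      \<le> sqrt (\<integral>x. (f n x - g x)\<^sup>2 \<partial>lborel) * ?n"
  proof (rule always_eventually, rule allI)
    fix n
    have "(\<integral>x. f n x * \<psi> x \<partial>lborel) - (\<integral>x. g x * \<psi> x \<partial>lborel) = (\<integral>x. (f n x - g x) * \<psi> x \<partial>lborel)"
      using sqL2_mult_integrable[OF f(1)[of n] \<psi>] sqL2_mult_integrable[OF f(2) \<psi>] by (simp add: left_diff_distrib)
    then show "norm ((\<integral>x. f n x * \<psi> x \<partial>lborel) - (\<integral>x. g x * \<psi> x \<partial>lborel))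
      \<le> sqrt (\<integral>x. (f n x - g x)\<^sup>2 \<partial>lborel) * ?n"
      using sqL2_Cauchy_Schwarz[OF sqL2_diff[OF f(1)[of n] f(2)] \<psi>] by simp
  qed
  have "(\<lambda>n. sqrt (\<integral>x. (f n x - g x)\<^sup>2 \<partial>lborel) * ?n) \<longlonglongrightarrow> sqrt 0 * ?n"
    by (intro tendsto_intros lim)
  then show "(\<lambda>n. sqrt (\<integral>x. (f n x - g x)\<^sup>2 \<partial>lborel) * ?n) \<longlonglongrightarrow> 0" by simp
qed

lemma L2_tendsto_square:
  assumes f: "\<And>n. sqL2 (f n)" "sqL2 g"
    and lim: "(\<lambda>n. \<integral>x. (f n x - g x)\<^sup>2 \<partial>lborel) \<longlonglongrightarrow> 0"
  shows "(\<lambda>n. \<integral>x. (f n x)\<^sup>2 \<partial>lborel) \<longlonglongrightarrow> (\<integral>x. (g x)\<^sup>2 \<partial>lborel)"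
proof -
  have "(\<integral>x. (f n x)\<^sup>2 \<partial>lborel) = (\<integral>x. (f n x - g x)\<^sup>2 \<partial>lborel) + 2 * (\<integral>x. f n x * g x \<partial>lborel) - (\<integral>x. (g x)\<^sup>2 \<partial>lborel)" for n
  proof -
    have "(\<integral>x. (f n x)\<^sup>2 \<partial>lborel) = (\<integral>x. (f n x - g x)\<^sup>2 + 2 * (f n x * g x) - (g x)\<^sup>2 \<partial>lborel)"
      by (rule Bochner_Integration.integral_cong) (auto simp: power2_eq_square algebra_simps)
    then show ?thesis
      using sqL2_diff[OF f(1)[of n] f(2)] sqL2_mult_integrable[OF f(1)[of n] f(2)] f(2) by (simp add: sqL2_def)
  qed
  moreover have "(\<lambda>n. (\<integral>x. (f n x - g x)\<^sup>2 \<partial>lborel) + 2 * (\<integral>x. f n x * g x \<partial>lborel) - (\<integral>x. (g x)\<^sup>2 \<partial>lborel))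
     \<longlonglongrightarrow> 0 + 2 * (\<integral>x. g x * g x \<partial>lborel) - (\<integral>x. (g x)\<^sup>2 \<partial>lborel)"
    by (intro tendsto_intros lim L2_tendsto_inner f)
  ultimately show ?thesis by (simp add: power2_eq_square)
qed

text \<open>The translation is put on the test function, so u only has to be square
  integrable.\<close>

lemma translate_derivative:
  fixes u :: "real^'n \<Rightarrow> real"
  assumes u: "sqL2 u" and t: "testfun \<phi> D"
  shows "((\<lambda>s. \<integral>x. u x * \<phi> (x - s *\<^sub>R y) \<partial>lborel) has_real_derivative
     - (\<integral>x. u x * (D (x - s *\<^sub>R y) \<bullet> y) \<partial>lborel)) (at s)"
proof -
  obtain R where R: "R > 0" "\<And>x. norm x \<ge> R \<Longrightarrow> D x = 0" using testfun_support[OF t] by metis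
  obtain B where B: "B > 0" "\<And>x. norm (D x) \<le> B" using testfun_bounded[OF t] by metis
  note [measurable] = sqL2D(1)[OF u] testfun_measurable[OF t]
  \<comment> \<open>The ball of this radius contains the supports of the derivatives of all
    translates with parameter within 1 of s, which gives one majorant for all of them.\<close>
  define \<rho> where "\<rho> = R + (\<bar>s\<bar> + 1) * norm y"
  have [measurable]: "ball (0::real^'n) \<rho> \<in> sets borel" by simp
  have "((\<lambda>s. \<integral>x. u x * \<phi> (x - s *\<^sub>R y) \<partial>lborel) has_real_derivative
     (\<integral>x. - (u x * (D (x - s *\<^sub>R y) \<bullet> y)) \<partial>lborel)) (at s)"
  proof (rule has_derivative_integral_param[where d=1 and G="\<lambda>x. \<bar>u x\<bar> * (indicator (ball 0 \<rho>) x * (B * norm y))"])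
    show "integrable lborel (\<lambda>x. u x * \<phi> (x - r *\<^sub>R y))" for r
      by (rule sqL2_mult_integrable[OF u testfun_sqL2(1)[OF testfun_translate[OF t]]])
    show "((\<lambda>r. u x * \<phi> (x - r *\<^sub>R y)) has_real_derivative - (u x * (D (x - r *\<^sub>R y) \<bullet> y))) (at r)" for r x
    proof -
      have "((\<lambda>r. x - r *\<^sub>R y) has_derivative (\<lambda>h. - (h *\<^sub>R y))) (at r)"
        by (auto intro!: derivative_eq_intros)
      from has_derivative_compose[OF this testfun_has_derivative[OF t]]
      have "((\<lambda>r. \<phi> (x - r *\<^sub>R y)) has_derivative (\<lambda>h. D (x - r *\<^sub>R y) \<bullet> (- (h *\<^sub>R y)))) (at r)" .
      then have "((\<lambda>r. \<phi> (x - r *\<^sub>R y)) has_real_derivative - (D (x - r *\<^sub>R y) \<bullet> y)) (at r)"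
        unfolding has_field_derivative_def by (rule has_derivative_eq_rhs) (auto simp: fun_eq_iff)
      from DERIV_cmult[OF this, of "u x"] show ?thesis by simp
    qed
    show "\<bar>- (u x * (D (x - r *\<^sub>R y) \<bullet> y))\<bar> \<le> \<bar>u x\<bar> * (indicator (ball 0 \<rho>) x * (B * norm y))" if r: "\<bar>r - s\<bar> < 1" for r x
    proof (cases "norm x < \<rho>")
      case True
      have "\<bar>D (x - r *\<^sub>R y) \<bullet> y\<bar> \<le> norm (D (x - r *\<^sub>R y)) * norm y" by (rule Cauchy_Schwarz_ineq2)
      also have "\<dots> \<le> B * norm y" using B by (intro mult_right_mono) auto
      finally have "\<bar>u x\<bar> * \<bar>D (x - r *\<^sub>R y) \<bullet> y\<bar> \<le> \<bar>u x\<bar> * (B * norm y)" by (intro mult_left_mono) auto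
      then show ?thesis using True by (simp add: abs_mult)
    next
      case False
      have "norm (r *\<^sub>R y) \<le> (\<bar>s\<bar> + 1) * norm y" using r by (auto intro!: mult_right_mono)
      then have "norm (x - r *\<^sub>R y) \<ge> R" using False norm_triangle_ineq2[of x "r *\<^sub>R y"] by (simp add: \<rho>_def)
      then show ?thesis using R(2) B(1) by simp
    qed
    have "sqL2 (\<lambda>x. \<bar>u x\<bar>)" using u by (simp add: sqL2_def)
    moreover have "sqL2 (\<lambda>x::real^'n. indicator (ball 0 \<rho>) x * (B * norm y))"
    proof -
      have "integrable lborel (\<lambda>x::real^'n. indicator (ball 0 \<rho>) x * (B * norm y)\<^sup>2 :: real)" by (rule integrable_indicator_ball) simp
      moreover have "(indicator (ball 0 \<rho>) x * (B * norm y))\<^sup>2 = indicator (ball 0 \<rho>) x * (B * norm y)\<^sup>2" for x :: "real^'n"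
        by (simp add: indicator_def)
      ultimately show ?thesis by (simp add: sqL2_def)
    qed
    ultimately show "integrable lborel (\<lambda>x. \<bar>u x\<bar> * (indicator (ball 0 \<rho>) x * (B * norm y)))"
      by (rule sqL2_mult_integrable)
  qed measurable
  then show ?thesis by simp
qed

lemma integral_translate_arg:
  fixes f :: "'a::euclidean_space \<Rightarrow> real"
  assumes "integrable lborel f" shows "(\<integral>x. f (x - a) \<partial>lborel) = (\<integral>x. f x \<partial>lborel)"
  using integral_lborel_translate[OF assms, of "- a"] by simp

lemma translation_difference:
  fixes u :: "real^'n \<Rightarrow> real"
  assumes u: "sqL2 u" and t: "testfun \<phi> D"
  shows "(\<integral>x. (u (x + h) - u x) * \<phi> x \<partial>lborel) = (\<integral>x. u x * \<phi> (x - h) \<partial>lborel) - (\<integral>x. u x * \<phi> x \<partial>lborel)"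
proof -
  have i: "integrable lborel (\<lambda>x. u (x + h) * \<phi> x)" "integrable lborel (\<lambda>x. u x * \<phi> x)"
    by (intro sqL2_mult_integrable sqL2_translate u testfun_sqL2(1)[OF t])+
  have "(\<integral>x. u x * \<phi> (x - h) \<partial>lborel) = (\<integral>x. u (x + h) * \<phi> x \<partial>lborel)"
    using integral_translate_arg[OF i(1), of h] by simp
  then show ?thesis using i by (simp add: left_diff_distrib)
qed

text \<open>By duality: against a test function the translation moves to \<phi>, the weak gradient
  computes the derivative along s h, and the mean value inequality on [0, 1] gives the
  bound.\<close>

lemma difference_le_weak_grad:
  fixes u :: "real^'n \<Rightarrow> real"
  assumes u: "sqL2 u" and g: "\<And>i. sqL2 (\<lambda>x. g x $ i)" and w: "weak_grad u g"
  shows "(\<integral>x. (u (x + h) - u x)\<^sup>2 \<partial>lborel) \<le> (\<integral>x. (g x \<bullet> h)\<^sup>2 \<partial>lborel)"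
proof -
  let ?C = "sqrt (\<integral>x. (g x \<bullet> h)\<^sup>2 \<partial>lborel)"
  have "sqrt (\<integral>x. (u (x + h) - u x)\<^sup>2 \<partial>lborel) \<le> ?C"
  proof (rule L2_norm_le_by_duality)
    show "sqL2 (\<lambda>x. u (x + h) - u x)" by (intro sqL2_diff sqL2_translate u)
    fix \<phi> :: "real^'n \<Rightarrow> real" and D assume t: "testfun \<phi> D"
    let ?n = "sqrt (\<integral>x. (\<phi> x)\<^sup>2 \<partial>lborel)"
    define \<theta> where "\<theta> s = (\<integral>x. u x * \<phi> (x - s *\<^sub>R h) \<partial>lborel)" for s
    have d: "(\<theta> has_real_derivative (\<integral>x. (g x \<bullet> h) * \<phi> (x - s *\<^sub>R h) \<partial>lborel)) (at s)" for s
    proof -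
      note ts = testfun_translate[OF t, of "s *\<^sub>R h"]
      have "(\<integral>x. u x * (D (x - s *\<^sub>R h) \<bullet> h) \<partial>lborel) = (\<integral>x. (\<Sum>i\<in>UNIV. h $ i * (u x * (D (x - s *\<^sub>R h) $ i))) \<partial>lborel)"
        by (simp add: inner_vec_def sum_distrib_left mult_ac)
      also have "\<dots> = (\<Sum>i\<in>UNIV. h $ i * (\<integral>x. u x * (D (x - s *\<^sub>R h) $ i) \<partial>lborel))"
        by (subst Bochner_Integration.integral_sum) (auto intro!: sqL2_mult_integrable u testfun_sqL2(2)[OF ts])
      also have "\<dots> = (\<Sum>i\<in>UNIV. h $ i * (- (\<integral>x. (g x $ i) * \<phi> (x - s *\<^sub>R h) \<partial>lborel)))"
        using w ts unfolding weak_grad_def by simp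
      also have "\<dots> = - (\<Sum>i\<in>UNIV. \<integral>x. h $ i * ((g x $ i) * \<phi> (x - s *\<^sub>R h)) \<partial>lborel)"
        by (simp add: sum_negf)
      also have "\<dots> = - (\<integral>x. (\<Sum>i\<in>UNIV. h $ i * ((g x $ i) * \<phi> (x - s *\<^sub>R h))) \<partial>lborel)"
        by (subst Bochner_Integration.integral_sum) (auto intro!: sqL2_mult_integrable g testfun_sqL2(1)[OF ts])
      also have "(\<lambda>x. \<Sum>i\<in>UNIV. h $ i * ((g x $ i) * \<phi> (x - s *\<^sub>R h))) = (\<lambda>x. (g x \<bullet> h) * \<phi> (x - s *\<^sub>R h))"
        unfolding inner_vec_def sum_distrib_right by (intro ext sum.cong) auto
      finally show ?thesis using translate_derivative[OF u t, of h s] unfolding \<theta>_def[abs_def] by simp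
    qed
    have bd: "\<bar>\<integral>x. (g x \<bullet> h) * \<phi> (x - s *\<^sub>R h) \<partial>lborel\<bar> \<le> ?C * ?n" for s
    proof -
      have "(\<integral>x. (\<phi> (x - s *\<^sub>R h))\<^sup>2 \<partial>lborel) = (\<integral>x. (\<phi> x)\<^sup>2 \<partial>lborel)"
        by (rule integral_translate_arg, rule sqL2D(2)[OF testfun_sqL2(1)[OF t]])
      then show ?thesis
        using sqL2_Cauchy_Schwarz[OF sqL2_inner[OF g, of h] testfun_sqL2(1)[OF testfun_translate[OF t, of "s *\<^sub>R h"]]] by simp
    qed
    have "norm (\<theta> 1 - \<theta> 0) \<le> ?C * ?n * norm (1 - 0 :: real)"
      by (rule field_differentiable_bound[where S=UNIV]) (use d bd in \<open>auto\<close>)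
    then show "\<bar>\<integral>x. (u (x + h) - u x) * \<phi> x \<partial>lborel\<bar> \<le> ?C * ?n"
      using translation_difference[OF u t, of h] by (simp add: \<theta>_def)
  qed simp
  then show ?thesis by simp
qed

text \<open>Necessity of the energy bound with the exact constant: the bound for a single increment
  is integrated over the ball, where the squares of \<open>g x \<bullet> y\<close> add up to
  \<open>ball_moment\<close> times the squared norm.\<close>

lemma weak_grad_energy_le:
  fixes u :: "real^'n \<Rightarrow> real"
  assumes u: "sqL2 u" and g: "\<And>i. sqL2 (\<lambda>x. g x $ i)" and w: "weak_grad u g"
  shows "energy_le u (\<integral>x. (norm (g x))\<^sup>2 \<partial>lborel)"
  unfolding energy_le_def
proof (intro allI impI)
  fix \<epsilon> :: real assume e: "\<epsilon> > 0"
  let ?c = "ball_moment TYPE(real^'n)"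
  have [measurable]: "ball (0::real^'n) 1 \<in> sets borel" by simp
  have [measurable]: "g \<in> borel_measurable borel" by (rule measurable_vec_components) (use sqL2D(1)[OF g] in simp)
  have c: "?c > 0" by (rule ball_moment_pos)
  have "avg_energy u \<epsilon> \<le> (\<integral>\<^sup>+y. \<integral>\<^sup>+x. ennreal (\<epsilon>\<^sup>2) * (indicator (ball 0 1) y * ennreal ((g x \<bullet> y)\<^sup>2)) \<partial>lborel \<partial>lborel)"
    unfolding avg_energy_def
  proof (rule nn_integral_mono)
    fix y :: "real^'n"
    have "(\<integral>\<^sup>+x. ennreal ((u (x + \<epsilon> *\<^sub>R y) - u x)\<^sup>2) \<partial>lborel) = ennreal (\<integral>x. (u (x + \<epsilon> *\<^sub>R y) - u x)\<^sup>2 \<partial>lborel)"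
      by (rule nn_integral_eq_integral) (auto intro!: sqL2D(2)[OF sqL2_diff[OF sqL2_translate[OF u] u]])
    also have "\<dots> \<le> ennreal (\<integral>x. (g x \<bullet> (\<epsilon> *\<^sub>R y))\<^sup>2 \<partial>lborel)"
      by (intro ennreal_leI difference_le_weak_grad[OF u g w])
    also have "\<dots> = (\<integral>\<^sup>+x. ennreal ((g x \<bullet> (\<epsilon> *\<^sub>R y))\<^sup>2) \<partial>lborel)"
      by (rule nn_integral_eq_integral[symmetric, OF sqL2D(2)[OF sqL2_inner[OF g]]]) simp
    also have "\<dots> = (\<integral>\<^sup>+x. ennreal (\<epsilon>\<^sup>2) * ennreal ((g x \<bullet> y)\<^sup>2) \<partial>lborel)"
      by (simp add: ennreal_mult[symmetric] power_mult_distrib)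
    finally have "(\<integral>\<^sup>+x. ennreal ((u (x + \<epsilon> *\<^sub>R y) - u x)\<^sup>2) \<partial>lborel) \<le> (\<integral>\<^sup>+x. ennreal (\<epsilon>\<^sup>2) * ennreal ((g x \<bullet> y)\<^sup>2) \<partial>lborel)" .
    then show "indicator (ball 0 1) y * (\<integral>\<^sup>+x. ennreal ((u (x + \<epsilon> *\<^sub>R y) - u x)\<^sup>2) \<partial>lborel)
        \<le> (\<integral>\<^sup>+x. ennreal (\<epsilon>\<^sup>2) * (indicator (ball 0 1) y * ennreal ((g x \<bullet> y)\<^sup>2)) \<partial>lborel)"
      by (cases "y \<in> ball 0 1") auto
  qed
  also have "\<dots> = (\<integral>\<^sup>+x. \<integral>\<^sup>+y. ennreal (\<epsilon>\<^sup>2) * (indicator (ball 0 1) y * ennreal ((g x \<bullet> y)\<^sup>2)) \<partial>lborel \<partial>lborel)"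
    by (rule lborel_pair.Fubini') measurable
  also have "\<dots> = (\<integral>\<^sup>+x. ennreal (?c * \<epsilon>\<^sup>2) * ennreal ((norm (g x))\<^sup>2) \<partial>lborel)"
  proof (rule nn_integral_cong)
    fix x
    have "(\<integral>\<^sup>+y. ennreal (\<epsilon>\<^sup>2) * (indicator (ball 0 1) y * ennreal ((g x \<bullet> y)\<^sup>2)) \<partial>lborel) = ennreal (\<epsilon>\<^sup>2) * ennreal (?c * (norm (g x))\<^sup>2)"
      by (subst nn_integral_cmult) (auto simp: nn_integral_ball_inner_square)
    then show "(\<integral>\<^sup>+y. ennreal (\<epsilon>\<^sup>2) * (indicator (ball 0 1) y * ennreal ((g x \<bullet> y)\<^sup>2)) \<partial>lborel) = ennreal (?c * \<epsilon>\<^sup>2) * ennreal ((norm (g x))\<^sup>2)"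
      using c by (simp add: ennreal_mult[symmetric] mult_ac)
  qed
  also have "\<dots> = ennreal (?c * \<epsilon>\<^sup>2) * ennreal (\<integral>x. (norm (g x))\<^sup>2 \<partial>lborel)"
    using integrable_norm_square_vec[OF g] by (simp add: nn_integral_cmult nn_integral_eq_integral)
  also have "\<dots> = ennreal (?c * \<epsilon>\<^sup>2 * (\<integral>x. (norm (g x))\<^sup>2 \<partial>lborel))"
    using c by (simp add: ennreal_mult)
  finally show "avg_energy u \<epsilon> \<le> ennreal (?c * \<epsilon>\<^sup>2 * (\<integral>x. (norm (g x))\<^sup>2 \<partial>lborel))" .
qed

text \<open>Difference quotients of u in direction y are paired with the component of the field in
  the same direction and averaged over the ball; as \<epsilon> tends to 0, isotropy leaves exactly
  the integral of u against the divergence. The estimate is Young's inequality with the energy bound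
  of u, kept in the quadratic form that a variational Riesz argument needs.\<close>

lemma energy_bounds_divergence:
  fixes u :: "real^'n \<Rightarrow> real"
  assumes u: "sqL2 u" and en: "energy_le u A" "A \<ge> 0" and t: "\<And>i. testfun (X i) (D i)"
  shows "\<bar>\<Sum>i\<in>UNIV. \<integral>x. u x * (D i x $ i) \<partial>lborel\<bar> \<le> (A + (\<Sum>i\<in>UNIV. \<integral>x. (X i x)\<^sup>2 \<partial>lborel)) / 2"
proof -
  let ?c = "ball_moment TYPE(real^'n)"
  have c: "?c > 0" by (rule ball_moment_pos)
  have [measurable]: "ball (0::real^'n) 1 \<in> sets borel" by simp
  note [measurable] = sqL2D(1)[OF u] testfun_measurable[OF t]
  define N where "N = (\<Sum>i\<in>UNIV. \<integral>x. (X i x)\<^sup>2 \<partial>lborel)"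
  have N0: "N \<ge> 0" unfolding N_def by (intro sum_nonneg) auto
  define Y where "Y x = (\<chi> i. X i x)" for x :: "real^'n"
  have Yi: "Y x $ i = X i x" for x i by (simp add: Y_def)
  have Ysq: "sqL2 (\<lambda>x. Y x $ i)" for i unfolding Yi by (rule testfun_sqL2(1)[OF t])
  have [measurable]: "Y \<in> borel_measurable borel" by (rule measurable_vec_components) (simp add: Yi)
  have NY: "N = (\<integral>x. (norm (Y x))\<^sup>2 \<partial>lborel)" by (simp add: N_def integral_norm_square_vec[OF Ysq] Yi)
  define \<theta> where "\<theta> i y s = (\<integral>x. u x * X i (x - s *\<^sub>R y) \<partial>lborel)" for i s and y :: "real^'n"
  \<comment> \<open>The quantity of \<open>q_int\<close>, written through \<theta> so that
    translations act on the test functions and the limit is a derivative.\<close>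
  define q where "q \<epsilon> y = (\<Sum>i\<in>UNIV. y $ i * ((\<theta> i y \<epsilon> - \<theta> i y 0) / \<epsilon>))" for \<epsilon> y
  have [measurable]: "(\<lambda>y. \<theta> i y s) \<in> borel_measurable borel" for i s
    unfolding \<theta>_def by measurable
  have qm[measurable]: "q \<epsilon> \<in> borel_measurable borel" for \<epsilon> unfolding q_def by measurable
  have q_int: "q \<epsilon> y = (\<integral>x. (u (x + \<epsilon> *\<^sub>R y) - u x) * (Y x \<bullet> y) \<partial>lborel) / \<epsilon>" for \<epsilon> y
  proof -
    have "(\<integral>x. (u (x + \<epsilon> *\<^sub>R y) - u x) * (Y x \<bullet> y) \<partial>lborel)
       = (\<integral>x. (\<Sum>i\<in>UNIV. y $ i * ((u (x + \<epsilon> *\<^sub>R y) - u x) * X i x)) \<partial>lborel)"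
      by (simp add: inner_vec_def sum_distrib_left Yi mult_ac)
    also have "\<dots> = (\<Sum>i\<in>UNIV. y $ i * (\<integral>x. (u (x + \<epsilon> *\<^sub>R y) - u x) * X i x \<partial>lborel))"
      by (subst Bochner_Integration.integral_sum)
         (auto intro!: sqL2_mult_integrable sqL2_diff sqL2_translate u testfun_sqL2(1)[OF t])
    finally show ?thesis
      by (simp add: q_def translation_difference[OF u t] \<theta>_def sum_divide_distrib)
  qed
  have q_le: "ennreal \<bar>q \<epsilon> y\<bar> \<le> ennreal (1 / (2 * \<epsilon>\<^sup>2)) * (\<integral>\<^sup>+x. ennreal ((u (x + \<epsilon> *\<^sub>R y) - u x)\<^sup>2) \<partial>lborel)
      + ennreal (1/2) * (\<integral>\<^sup>+x. ennreal ((Y x \<bullet> y)\<^sup>2) \<partial>lborel)" if e: "\<epsilon> > 0" for \<epsilon> y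
  proof -
    have i1: "integrable lborel (\<lambda>x. (u (x + \<epsilon> *\<^sub>R y) - u x)\<^sup>2)"
      by (rule sqL2D(2)[OF sqL2_diff[OF sqL2_translate[OF u] u]])
    have i2: "integrable lborel (\<lambda>x. (Y x \<bullet> y)\<^sup>2)" by (rule sqL2D(2)[OF sqL2_inner[OF Ysq]])
    have i3: "integrable lborel (\<lambda>x. (u (x + \<epsilon> *\<^sub>R y) - u x) * (Y x \<bullet> y))"
      by (intro sqL2_mult_integrable sqL2_diff sqL2_translate u sqL2_inner Ysq)
    have "q \<epsilon> y = (\<integral>x. (u (x + \<epsilon> *\<^sub>R y) - u x) * (Y x \<bullet> y) / \<epsilon> \<partial>lborel)" unfolding q_int by simp
    then have "\<bar>q \<epsilon> y\<bar> \<le> (\<integral>x. \<bar>(u (x + \<epsilon> *\<^sub>R y) - u x) * (Y x \<bullet> y) / \<epsilon>\<bar> \<partial>lborel)"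
      by (simp only: integral_abs_bound)
    also have "\<dots> \<le> (\<integral>x. 1 / (2 * \<epsilon>\<^sup>2) * (u (x + \<epsilon> *\<^sub>R y) - u x)\<^sup>2 + 1/2 * (Y x \<bullet> y)\<^sup>2 \<partial>lborel)"
    proof (rule integral_mono)
      fix x
      let ?a = "(u (x + \<epsilon> *\<^sub>R y) - u x) / \<epsilon>" and ?b = "Y x \<bullet> y"
      have "\<bar>a\<bar> * \<bar>b\<bar> \<le> a\<^sup>2 / 2 + b\<^sup>2 / 2" for a b :: real
        using sum_squares_bound[of "\<bar>a\<bar>" "\<bar>b\<bar>"] by simp
      from this[of ?a ?b] show "\<bar>(u (x + \<epsilon> *\<^sub>R y) - u x) * ?b / \<epsilon>\<bar> \<le> 1 / (2 * \<epsilon>\<^sup>2) * (u (x + \<epsilon> *\<^sub>R y) - u x)\<^sup>2 + 1/2 * ?b\<^sup>2"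
        by (simp add: abs_mult power_divide mult_ac)
    qed (use i1 i2 i3 in auto)
    also have "\<dots> = 1 / (2 * \<epsilon>\<^sup>2) * (\<integral>x. (u (x + \<epsilon> *\<^sub>R y) - u x)\<^sup>2 \<partial>lborel) + 1/2 * (\<integral>x. (Y x \<bullet> y)\<^sup>2 \<partial>lborel)"
      using i1 i2 by simp
    finally have "ennreal \<bar>q \<epsilon> y\<bar> \<le> ennreal (1 / (2 * \<epsilon>\<^sup>2) * (\<integral>x. (u (x + \<epsilon> *\<^sub>R y) - u x)\<^sup>2 \<partial>lborel) + 1/2 * (\<integral>x. (Y x \<bullet> y)\<^sup>2 \<partial>lborel))"
      by (rule ennreal_leI)
    also have "\<dots> = ennreal (1 / (2 * \<epsilon>\<^sup>2)) * ennreal (\<integral>x. (u (x + \<epsilon> *\<^sub>R y) - u x)\<^sup>2 \<partial>lborel) + ennreal (1/2) * ennreal (\<integral>x. (Y x \<bullet> y)\<^sup>2 \<partial>lborel)"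
    proof -
      have "ennreal (1 / (2 * \<epsilon>\<^sup>2) * (\<integral>x. (u (x + \<epsilon> *\<^sub>R y) - u x)\<^sup>2 \<partial>lborel)) = ennreal (1 / (2 * \<epsilon>\<^sup>2)) * ennreal (\<integral>x. (u (x + \<epsilon> *\<^sub>R y) - u x)\<^sup>2 \<partial>lborel)"
        "ennreal (1/2 * (\<integral>x. (Y x \<bullet> y)\<^sup>2 \<partial>lborel)) = ennreal (1/2) * ennreal (\<integral>x. (Y x \<bullet> y)\<^sup>2 \<partial>lborel)"
        by (rule ennreal_mult; simp)+
      then show ?thesis by (subst ennreal_plus) (simp_all only:, simp_all)
    qed
    finally show ?thesis
      by (simp only: nn_integral_eq_integral[OF i1 AE_I2] nn_integral_eq_integral[OF i2 AE_I2] zero_le_power2)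
  qed
  have q_tot: "(\<integral>\<^sup>+y. indicator (ball 0 1) y * ennreal \<bar>q \<epsilon> y\<bar> \<partial>lborel) \<le> ennreal (?c * (A + N) / 2)" if e: "\<epsilon> > 0" for \<epsilon>
  proof -
    have Yint: "(\<integral>\<^sup>+y. indicator (ball 0 1) y * (\<integral>\<^sup>+x. ennreal ((Y x \<bullet> y)\<^sup>2) \<partial>lborel) \<partial>lborel) = ennreal (?c * N)"
    proof -
      have "(\<integral>\<^sup>+y. indicator (ball 0 1) y * (\<integral>\<^sup>+x. ennreal ((Y x \<bullet> y)\<^sup>2) \<partial>lborel) \<partial>lborel)
        = (\<integral>\<^sup>+y. \<integral>\<^sup>+x. indicator (ball 0 1) y * ennreal ((Y x \<bullet> y)\<^sup>2) \<partial>lborel \<partial>lborel)"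
        by (simp add: nn_integral_cmult)
      also have "\<dots> = (\<integral>\<^sup>+x. \<integral>\<^sup>+y. indicator (ball 0 1) y * ennreal ((Y x \<bullet> y)\<^sup>2) \<partial>lborel \<partial>lborel)"
        by (rule lborel_pair.Fubini') measurable
      also have "\<dots> = (\<integral>\<^sup>+x. ennreal ?c * ennreal ((norm (Y x))\<^sup>2) \<partial>lborel)"
        using c by (simp add: nn_integral_ball_inner_square ennreal_mult)
      also have "\<dots> = ennreal ?c * ennreal N"
        using integrable_norm_square_vec[OF Ysq] by (simp add: nn_integral_cmult nn_integral_eq_integral NY)
      finally show ?thesis using c N0 by (simp add: ennreal_mult)
    qed
    have "(\<integral>\<^sup>+y. indicator (ball 0 1) y * ennreal \<bar>q \<epsilon> y\<bar> \<partial>lborel)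
      \<le> (\<integral>\<^sup>+y. ennreal (1 / (2 * \<epsilon>\<^sup>2)) * (indicator (ball 0 1) y * (\<integral>\<^sup>+x. ennreal ((u (x + \<epsilon> *\<^sub>R y) - u x)\<^sup>2) \<partial>lborel))
        + ennreal (1/2) * (indicator (ball 0 1) y * (\<integral>\<^sup>+x. ennreal ((Y x \<bullet> y)\<^sup>2) \<partial>lborel)) \<partial>lborel)"
      by (rule nn_integral_mono) (use q_le[OF e] in \<open>auto simp: indicator_def\<close>)
    also have "\<dots> = ennreal (1 / (2 * \<epsilon>\<^sup>2)) * avg_energy u \<epsilon> + ennreal (1/2) * ennreal (?c * N)"
      unfolding avg_energy_def Yint[symmetric] by (subst nn_integral_add) (auto simp: nn_integral_cmult)
    also have "\<dots> \<le> ennreal (1 / (2 * \<epsilon>\<^sup>2)) * ennreal (?c * \<epsilon>\<^sup>2 * A) + ennreal (1/2) * ennreal (?c * N)"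
      by (intro add_right_mono mult_left_mono energy_leD en e) auto
    also have "\<dots> = ennreal (1 / (2 * \<epsilon>\<^sup>2) * (?c * \<epsilon>\<^sup>2 * A) + 1/2 * (?c * N))"
    proof -
      have "ennreal (1 / (2 * \<epsilon>\<^sup>2) * (?c * \<epsilon>\<^sup>2 * A)) = ennreal (1 / (2 * \<epsilon>\<^sup>2)) * ennreal (?c * \<epsilon>\<^sup>2 * A)"
        "ennreal (1/2 * (?c * N)) = ennreal (1/2) * ennreal (?c * N)"
        by (rule ennreal_mult; use c en N0 in simp)+
      then show ?thesis using c en N0 by (subst ennreal_plus) (simp_all only:, simp_all)
    qed
    also have "1 / (2 * \<epsilon>\<^sup>2) * (?c * \<epsilon>\<^sup>2 * A) + 1/2 * (?c * N) = ?c * (A + N) / 2"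
      using e by (simp add: field_simps)
    finally show ?thesis .
  qed
  have q_abs: "\<bar>\<integral>y. indicator (ball 0 1) y * q \<epsilon> y \<partial>lborel\<bar> \<le> ?c * (A + N) / 2" if e: "\<epsilon> > 0" for \<epsilon>
  proof -
    have i: "integrable lborel (\<lambda>y. indicator (ball 0 1) y * q \<epsilon> y)"
    proof (rule integrableI_bounded)
      have "(\<integral>\<^sup>+y. ennreal (norm (indicator (ball 0 1) y * q \<epsilon> y)) \<partial>lborel) = (\<integral>\<^sup>+y. indicator (ball 0 1) y * ennreal \<bar>q \<epsilon> y\<bar> \<partial>lborel)"
        by (rule nn_integral_cong) (auto simp: indicator_def)
      also have "\<dots> \<le> ennreal (?c * (A + N) / 2)" by (rule q_tot[OF e])
      also have "\<dots> < \<infinity>" by simp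
      finally show "(\<integral>\<^sup>+y. ennreal (norm (indicator (ball 0 1) y * q \<epsilon> y)) \<partial>lborel) < \<infinity>" .
    qed measurable
    have "ennreal \<bar>\<integral>y. indicator (ball 0 1) y * q \<epsilon> y \<partial>lborel\<bar> \<le> (\<integral>\<^sup>+y. ennreal (norm (indicator (ball 0 1) y * q \<epsilon> y)) \<partial>lborel)"
      using integral_norm_bound_ennreal[OF i] by simp
    also have "\<dots> = (\<integral>\<^sup>+y. indicator (ball 0 1) y * ennreal \<bar>q \<epsilon> y\<bar> \<partial>lborel)"
      by (rule nn_integral_cong) (auto simp: indicator_def)
    also have "\<dots> \<le> ennreal (?c * (A + N) / 2)" by (rule q_tot[OF e])
    finally show ?thesis using c en N0 by (simp add: ennreal_le_iff)
  qed
  define V where "V i = (\<chi> j. \<integral>x. u x * (D i x $ j) \<partial>lborel)" for i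
  have V: "(\<integral>x. u x * (D i x \<bullet> y) \<partial>lborel) = V i \<bullet> y" for i y
  proof -
    have "(\<integral>x. u x * (D i x \<bullet> y) \<partial>lborel) = (\<integral>x. (\<Sum>j\<in>UNIV. y $ j * (u x * (D i x $ j))) \<partial>lborel)"
      by (simp add: inner_vec_def sum_distrib_left mult_ac)
    also have "\<dots> = (\<Sum>j\<in>UNIV. y $ j * (\<integral>x. u x * (D i x $ j) \<partial>lborel))"
      by (subst Bochner_Integration.integral_sum) (auto intro!: sqL2_mult_integrable u testfun_sqL2(2)[OF t])
    finally show ?thesis by (simp add: V_def inner_vec_def mult.commute)
  qed
  have \<theta>_der: "(\<theta> i y has_real_derivative - (\<integral>x. u x * (D i (x - s *\<^sub>R y) \<bullet> y) \<partial>lborel)) (at s)" for i y s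
    unfolding \<theta>_def[abs_def] by (rule translate_derivative[OF u t])
  \<comment> \<open>Bounds the derivatives of \<theta> uniformly in |y| < 1, which provides a
    constant majorant for the difference quotients.\<close>
  define K where "K i = sqrt (\<integral>x. (u x)\<^sup>2 \<partial>lborel) * sqrt (\<integral>x. (norm (D i x))\<^sup>2 \<partial>lborel)" for i
  have K0: "K i \<ge> 0" for i by (simp add: K_def)
  have \<theta>_bd: "\<bar>(\<theta> i y \<epsilon> - \<theta> i y 0) / \<epsilon>\<bar> \<le> K i" if y: "norm y < 1" and e: "\<epsilon> > 0" for i y \<epsilon>
  proof -
    have "norm (\<theta> i y \<epsilon> - \<theta> i y 0) \<le> K i * norm (\<epsilon> - 0)"
    proof (rule field_differentiable_bound[where S=UNIV, OF _ \<theta>_der])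
      fix s
      have sq: "sqL2 (\<lambda>x. D i (x - s *\<^sub>R y) \<bullet> y)"
        by (rule sqL2_inner, rule testfun_sqL2(2)[OF testfun_translate[OF t]])
      have "(\<integral>x. (D i (x - s *\<^sub>R y) \<bullet> y)\<^sup>2 \<partial>lborel) = (\<integral>x. (D i x \<bullet> y)\<^sup>2 \<partial>lborel)"
        by (rule integral_translate_arg, rule sqL2D(2), rule sqL2_inner, rule testfun_sqL2(2)[OF t])
      also have "\<dots> \<le> (\<integral>x. (norm (D i x))\<^sup>2 \<partial>lborel)"
      proof (rule integral_mono)
        show "integrable lborel (\<lambda>x. (D i x \<bullet> y)\<^sup>2)" by (rule sqL2D(2), rule sqL2_inner, rule testfun_sqL2(2)[OF t])
        show "integrable lborel (\<lambda>x. (norm (D i x))\<^sup>2)" by (rule integrable_norm_square_vec, rule testfun_sqL2(2)[OF t])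
        fix x
        have "\<bar>D i x \<bullet> y\<bar> \<le> norm (D i x) * norm y" by (rule Cauchy_Schwarz_ineq2)
        also have "\<dots> \<le> norm (D i x)" using y by (simp add: mult_left_le)
        finally have "\<bar>D i x \<bullet> y\<bar>\<^sup>2 \<le> (norm (D i x))\<^sup>2" by (rule power_mono) simp
        then show "(D i x \<bullet> y)\<^sup>2 \<le> (norm (D i x))\<^sup>2" by simp
      qed
      finally have "sqrt (\<integral>x. (u x)\<^sup>2 \<partial>lborel) * sqrt (\<integral>x. (D i (x - s *\<^sub>R y) \<bullet> y)\<^sup>2 \<partial>lborel) \<le> K i"
        unfolding K_def by (intro mult_left_mono) auto
      then show "norm (- (\<integral>x. u x * (D i (x - s *\<^sub>R y) \<bullet> y) \<partial>lborel)) \<le> K i"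
        using sqL2_Cauchy_Schwarz[OF u sq] by simp
    qed auto
    then show ?thesis using e by (simp add: field_simps)
  qed
  define \<epsilon> where "\<epsilon> n = 1 / real (Suc n)" for n
  have \<epsilon>0: "\<epsilon> n > 0" for n by (simp add: \<epsilon>_def)
  have \<epsilon>lim: "\<epsilon> \<longlonglongrightarrow> 0" unfolding \<epsilon>_def using LIMSEQ_inverse_real_of_nat by (simp add: inverse_eq_divide)
  have "(\<lambda>n. \<integral>y. indicator (ball 0 1) y * q (\<epsilon> n) y \<partial>lborel)
      \<longlonglongrightarrow> (\<integral>y. indicator (ball 0 1) y * (\<Sum>i\<in>UNIV. y $ i * (- (V i \<bullet> y))) \<partial>lborel)"
  proof (rule integral_dominated_convergence[where w="\<lambda>y. indicator (ball 0 1) y * (\<Sum>i\<in>UNIV. K i)"])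
    show "integrable lborel (\<lambda>y::real^'n. indicator (ball 0 1) y * (\<Sum>i\<in>UNIV. K i) :: real)" by (rule integrable_indicator_ball) simp
    show "AE y in lborel. (\<lambda>n. indicator (ball 0 1) y * q (\<epsilon> n) y) \<longlonglongrightarrow> indicator (ball 0 1) y * (\<Sum>i\<in>UNIV. y $ i * (- (V i \<bullet> y)))"
    proof (rule AE_I2)
      fix y :: "real^'n"
      have "(\<lambda>n. (\<theta> i y (\<epsilon> n) - \<theta> i y 0) / \<epsilon> n) \<longlonglongrightarrow> - (V i \<bullet> y)" for i
      proof -
        have "((\<lambda>s. (\<theta> i y s - \<theta> i y 0) / (s - 0)) \<longlongrightarrow> - (V i \<bullet> y)) (at 0)"
          using \<theta>_der[of i y 0] by (simp add: has_field_derivative_iff V)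
        then have "((\<lambda>s. (\<theta> i y s - \<theta> i y 0) / (s - 0)) \<circ> \<epsilon>) \<longlonglongrightarrow> - (V i \<bullet> y)"
          using \<epsilon>0 \<epsilon>lim less_imp_neq[OF \<epsilon>0] by (force simp: tendsto_at_iff_sequentially)
        then show ?thesis by (simp add: o_def)
      qed
      then show "(\<lambda>n. indicator (ball 0 1) y * q (\<epsilon> n) y) \<longlonglongrightarrow> indicator (ball 0 1) y * (\<Sum>i\<in>UNIV. y $ i * (- (V i \<bullet> y)))"
        unfolding q_def by (intro tendsto_intros)
    qed
    show "AE y in lborel. norm (indicator (ball 0 1) y * q (\<epsilon> n) y) \<le> indicator (ball 0 1) y * (\<Sum>i\<in>UNIV. K i)" for n
    proof (rule AE_I2)
      fix y :: "real^'n"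
      show "norm (indicator (ball 0 1) y * q (\<epsilon> n) y) \<le> indicator (ball 0 1) y * (\<Sum>i\<in>UNIV. K i)"
      proof (cases "norm y < 1")
        case True
        have "\<bar>q (\<epsilon> n) y\<bar> \<le> (\<Sum>i\<in>UNIV. \<bar>y $ i * ((\<theta> i y (\<epsilon> n) - \<theta> i y 0) / \<epsilon> n)\<bar>)"
          unfolding q_def by (rule sum_abs)
        also have "\<dots> \<le> (\<Sum>i\<in>UNIV. K i)"
        proof (rule sum_mono)
          fix i
          have "\<bar>y $ i\<bar> \<le> 1" using component_le_norm_cart[of y i] True by simp
          then have "\<bar>y $ i\<bar> * \<bar>(\<theta> i y (\<epsilon> n) - \<theta> i y 0) / \<epsilon> n\<bar> \<le> 1 * K i"
            using \<theta>_bd[OF True \<epsilon>0] by (intro mult_mono) auto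
          then show "\<bar>y $ i * ((\<theta> i y (\<epsilon> n) - \<theta> i y 0) / \<epsilon> n)\<bar> \<le> K i" by (simp add: abs_mult)
        qed
        finally show ?thesis using True by simp
      qed simp
    qed
  qed measurable
  moreover have "(\<integral>y. indicator (ball 0 1) y * (\<Sum>i\<in>UNIV. y $ i * (- (V i \<bullet> y))) \<partial>lborel) = - (?c * (\<Sum>i\<in>UNIV. V i $ i))"
  proof -
    have i: "integrable lborel (\<lambda>y. indicator (ball 0 1) y * ((axis i 1 \<bullet> y) * (V i \<bullet> y)))" for i
      by (rule integrable_indicator_ball) (intro continuous_intros)
    have "(\<integral>y. indicator (ball 0 1) y * (\<Sum>i\<in>UNIV. y $ i * (- (V i \<bullet> y))) \<partial>lborel)
       = (\<integral>y. - (\<Sum>i\<in>UNIV. indicator (ball 0 1) y * ((axis i 1 \<bullet> y) * (V i \<bullet> y))) \<partial>lborel)"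
      by (simp add: sum_distrib_left sum_negf inner_axis' mult_ac)
    also have "\<dots> = - (\<integral>y. (\<Sum>i\<in>UNIV. indicator (ball 0 1) y * ((axis i 1 \<bullet> y) * (V i \<bullet> y))) \<partial>lborel)"
      by (rule Bochner_Integration.integral_minus)
    also have "(\<integral>y. (\<Sum>i\<in>UNIV. indicator (ball 0 1) y * ((axis i 1 \<bullet> y) * (V i \<bullet> y))) \<partial>lborel)
       = (\<Sum>i\<in>UNIV. \<integral>y. indicator (ball 0 1) y * ((axis i 1 \<bullet> y) * (V i \<bullet> y)) \<partial>lborel)"
      by (rule Bochner_Integration.integral_sum[OF i])
    also have "(\<Sum>i\<in>UNIV. \<integral>y. indicator (ball 0 1) y * ((axis i 1 \<bullet> y) * (V i \<bullet> y)) \<partial>lborel) = (\<Sum>i\<in>UNIV. ?c * (V i $ i))"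
      unfolding integral_ball_inner_mult by (simp add: inner_axis')
    finally show ?thesis by (simp add: sum_distrib_left)
  qed
  ultimately have lim: "(\<lambda>n. \<bar>\<integral>y. indicator (ball 0 1) y * q (\<epsilon> n) y \<partial>lborel\<bar>) \<longlonglongrightarrow> \<bar>- (?c * (\<Sum>i\<in>UNIV. V i $ i))\<bar>"
    by (intro tendsto_rabs) simp
  have "\<bar>- (?c * (\<Sum>i\<in>UNIV. V i $ i))\<bar> \<le> ?c * (A + N) / 2"
    by (rule LIMSEQ_le_const2[OF lim]) (use q_abs[OF \<epsilon>0] in auto)
  then have "?c * \<bar>\<Sum>i\<in>UNIV. V i $ i\<bar> \<le> ?c * ((A + N) / 2)" using c by (simp add: abs_mult)
  then have "\<bar>\<Sum>i\<in>UNIV. V i $ i\<bar> \<le> (A + N) / 2" using c by (simp only: mult_le_cancel_left_pos)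
  then show ?thesis by (simp add: V_def N_def)
qed

lemma weak_gradI_energy_le:
  fixes u :: "real^'n \<Rightarrow> real"
  assumes u: "sqL2 u" and en: "energy_le u A" "A \<ge> 0"
  obtains g where "\<And>i. sqL2 (\<lambda>x. g x $ i)" "weak_grad u g" "(\<integral>x. (norm (g x))\<^sup>2 \<partial>lborel) \<le> A"
proof -
  \<comment> \<open>Riesz representation of the functional X \<open>\<mapsto>\<close> - \<open>\<integral>\<close> u div X: maximise it minus half the squared norm.\<close>
  define T where "T X D \<longleftrightarrow> (\<forall>i. testfun (X i) (D i))" for X :: "'n \<Rightarrow> real^'n \<Rightarrow> real" and D
  define l where "l D = - (\<Sum>i\<in>UNIV. \<integral>x. u x * (D i x $ i) \<partial>lborel)" for D :: "'n \<Rightarrow> real^'n \<Rightarrow> real^'n"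
  define N where "N X = (\<Sum>i\<in>UNIV. \<integral>x. (X i x)\<^sup>2 \<partial>lborel)" for X :: "'n \<Rightarrow> real^'n \<Rightarrow> real"
  define P where "P X Y = (\<Sum>i\<in>UNIV. \<integral>x. X i x * Y i x \<partial>lborel)" for X Y :: "'n \<Rightarrow> real^'n \<Rightarrow> real"
  define val where "val X D = l D - N X / 2" for X D
  have Tsq: "sqL2 (X i)" if "T X D" for X D i using that testfun_sqL2(1) unfolding T_def by blast
  have Tsq2: "sqL2 (\<lambda>x. D i x $ j)" if "T X D" for X D i j using that testfun_sqL2(2) unfolding T_def by blast
  have val_le: "val X D \<le> A / 2" if "T X D" for X D
    using energy_bounds_divergence[OF u en, of X D] that unfolding T_def val_def l_def N_def by (simp add: abs_le_iff field_simps)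
  have T0: "T (\<lambda>i x. 0) (\<lambda>i x. 0)" by (simp add: T_def testfun_zero)
  have Tcomb: "T (\<lambda>i x. a * X i x + b * Y i x) (\<lambda>i x. a *\<^sub>R D i x + b *\<^sub>R E i x)" if "T X D" "T Y E" for X Y D E a b
    using that unfolding T_def by (intro allI testfun_add testfun_cmult) auto
  have l_comb: "l (\<lambda>i x. a *\<^sub>R D i x + b *\<^sub>R E i x) = a * l D + b * l E" if "T X D" "T Y E" for X Y D E a b
  proof -
    have "(\<integral>x. u x * ((a *\<^sub>R D i x + b *\<^sub>R E i x) $ i) \<partial>lborel) = a * (\<integral>x. u x * (D i x $ i) \<partial>lborel) + b * (\<integral>x. u x * (E i x $ i) \<partial>lborel)" for i
    proof -
      have "(\<integral>x. u x * ((a *\<^sub>R D i x + b *\<^sub>R E i x) $ i) \<partial>lborel) = (\<integral>x. a * (u x * (D i x $ i)) + b * (u x * (E i x $ i)) \<partial>lborel)"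
        by (rule Bochner_Integration.integral_cong) (auto simp: algebra_simps)
      then show ?thesis
        using sqL2_mult_integrable[OF u Tsq2[OF that(1)]] sqL2_mult_integrable[OF u Tsq2[OF that(2)]] by simp
    qed
    then show ?thesis unfolding l_def by (simp add: sum.distrib sum_distrib_left)
  qed
  have N_comb: "N (\<lambda>i x. a * X i x + b * Y i x) = a\<^sup>2 * N X + 2 * a * b * P X Y + b\<^sup>2 * N Y" if "\<And>i. sqL2 (X i)" "\<And>i. sqL2 (Y i)" for X Y a b
  proof -
    have "(\<integral>x. (a * X i x + b * Y i x)\<^sup>2 \<partial>lborel) = a\<^sup>2 * (\<integral>x. (X i x)\<^sup>2 \<partial>lborel) + 2 * a * b * (\<integral>x. X i x * Y i x \<partial>lborel) + b\<^sup>2 * (\<integral>x. (Y i x)\<^sup>2 \<partial>lborel)" for i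
    proof -
      have "(\<integral>x. (a * X i x + b * Y i x)\<^sup>2 \<partial>lborel) = (\<integral>x. a\<^sup>2 * (X i x)\<^sup>2 + (2 * a * b) * (X i x * Y i x) + b\<^sup>2 * (Y i x)\<^sup>2 \<partial>lborel)"
        by (rule Bochner_Integration.integral_cong) (auto simp: power2_eq_square algebra_simps)
      then show ?thesis
        using sqL2D(2)[OF that(1)] sqL2D(2)[OF that(2)] sqL2_mult_integrable[OF that] by simp
    qed
    then show ?thesis unfolding N_def P_def by (simp add: sum.distrib sum_distrib_left)
  qed
  define Vs where "Vs = {val X D |X D. T X D}"
  define S where "S = Sup Vs"
  have bdd: "bdd_above Vs" unfolding Vs_def using val_le by (intro bdd_aboveI[of _ "A / 2"]) auto
  have ne: "Vs \<noteq> {}" unfolding Vs_def using T0 by blast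
  have val_S: "val X D \<le> S" if "T X D" for X D
    unfolding S_def using bdd that by (intro cSup_upper) (auto simp: Vs_def)
  have "\<exists>X D. T X D \<and> S - 1 / real (Suc n) < val X D" for n
  proof -
    have "\<exists>y\<in>Vs. S - 1 / real (Suc n) < y"
      unfolding S_def by (subst less_cSup_iff[symmetric]) (use bdd ne in auto)
    then show ?thesis unfolding Vs_def by blast
  qed
  then obtain X D where XD: "\<And>n. T (X n) (D n)" "\<And>n. S - 1 / real (Suc n) < val (X n) (D n)" by metis
  \<comment> \<open>Parallelogram argument: the midpoint of two near maximisers is again a test
    field, so its value is at most \<open>S\<close>, and strict concavity forces the two to be
    close.\<close>
  have N_diff: "N (\<lambda>i x. X m i x - X n i x) \<le> 4 / real (Suc m) + 4 / real (Suc n)" for m n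
  proof -
    have "val (\<lambda>i x. (1/2) * X m i x + (1/2) * X n i x) (\<lambda>i x. (1/2) *\<^sub>R D m i x + (1/2) *\<^sub>R D n i x) \<le> S"
      by (rule val_S[OF Tcomb[OF XD(1) XD(1)]])
    then have "(1/2) * l (D m) + (1/2) * l (D n) - ((1/2)\<^sup>2 * N (X m) + 2 * (1/2) * (1/2) * P (X m) (X n) + (1/2)\<^sup>2 * N (X n)) / 2 \<le> S"
      unfolding val_def l_comb[OF XD(1) XD(1)] N_comb[OF Tsq[OF XD(1)] Tsq[OF XD(1)]] .
    then have "4 * l (D m) + 4 * l (D n) - N (X m) - 2 * P (X m) (X n) - N (X n) \<le> 8 * S"
      by (simp add: power2_eq_square field_simps)
    moreover have "N (\<lambda>i x. 1 * X m i x + (-1) * X n i x) = N (X m) - 2 * P (X m) (X n) + N (X n)"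
      unfolding N_comb[OF Tsq[OF XD(1)] Tsq[OF XD(1)]] by simp
    moreover have "(\<lambda>i x. 1 * X m i x + (-1) * X n i x) = (\<lambda>i x. X m i x - X n i x)" by simp
    ultimately have "N (\<lambda>i x. X m i x - X n i x) \<le> 8 * S - 4 * val (X m) (D m) - 4 * val (X n) (D n)"
      unfolding val_def by (simp only:) (simp add: field_simps)
    moreover define a b where "a = 1 / real (Suc m)" and "b = 1 / real (Suc n)"
    moreover have "S - a < val (X m) (D m)" "S - b < val (X n) (D n)" using XD(2) by (auto simp: a_def b_def)
    ultimately have "N (\<lambda>i x. X m i x - X n i x) \<le> 4 * a + 4 * b" by linarith
    then show ?thesis by (simp add: a_def b_def)
  qed
  have comp_le: "(\<integral>x. (X m i x - X n i x)\<^sup>2 \<partial>lborel) \<le> N (\<lambda>i x. X m i x - X n i x)" for m n i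
    unfolding N_def by (rule member_le_sum) auto
  have "\<exists>g. sqL2 g \<and> (\<lambda>n. \<integral>x. (X n i x - g x)\<^sup>2 \<partial>lborel) \<longlonglongrightarrow> 0" for i
  proof (rule Riesz_Fischer[of "\<lambda>n. X n i" lborel])
    show "X n i \<in> borel_measurable lborel" for n using sqL2D(1)[OF Tsq[OF XD(1)]] by simp
    show "integrable lborel (\<lambda>x. (X n i x)\<^sup>2)" for n by (rule sqL2D(2)[OF Tsq[OF XD(1)]])
    show "\<exists>N0. \<forall>m\<ge>N0. \<forall>n\<ge>N0. (\<integral>x. (X m i x - X n i x)\<^sup>2 \<partial>lborel) < e" if e: "e > 0" for e
    proof -
      obtain N0 :: nat where N0: "8 / e < real N0" using reals_Archimedean2 by blast
      have small: "4 / real (Suc m) < e / 2" if "m \<ge> N0" for m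
      proof -
        have "8 / e < real (Suc m)" using N0 that by simp
        then show ?thesis using e by (simp add: field_simps)
      qed
      have "(\<integral>x. (X m i x - X n i x)\<^sup>2 \<partial>lborel) < e" if "m \<ge> N0" "n \<ge> N0" for m n
        using comp_le[of m i n] N_diff[of m n] small[OF that(1)] small[OF that(2)] by linarith
      then show ?thesis by blast
    qed
    fix g assume "g \<in> borel_measurable lborel" "integrable lborel (\<lambda>x. (g x)\<^sup>2)" "(\<lambda>n. \<integral>x. (X n i x - g x)\<^sup>2 \<partial>lborel) \<longlonglongrightarrow> 0"
    then show ?thesis by (intro exI[of _ g]) (simp add: sqL2_def)
  qed
  then have "\<forall>i. \<exists>g. sqL2 g \<and> (\<lambda>n. \<integral>x. (X n i x - g x)\<^sup>2 \<partial>lborel) \<longlonglongrightarrow> 0" by (rule allI)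
  from choice[OF this] obtain G where
    G': "\<forall>i. sqL2 (G i) \<and> (\<lambda>n. \<integral>x. (X n i x - G i x)\<^sup>2 \<partial>lborel) \<longlonglongrightarrow> 0" ..
  have G: "sqL2 (G i)" "(\<lambda>n. \<integral>x. (X n i x - G i x)\<^sup>2 \<partial>lborel) \<longlonglongrightarrow> 0" for i
    using G'[rule_format, of i] by simp_all
  have limP: "(\<lambda>n. P (X n) Y) \<longlonglongrightarrow> P G Y" if "\<And>i. sqL2 (Y i)" for Y
    unfolding P_def by (intro tendsto_sum L2_tendsto_inner[OF Tsq[OF XD(1)] G(1) that G(2)])
  have limN: "(\<lambda>n. N (X n)) \<longlonglongrightarrow> N G"
    unfolding N_def by (intro tendsto_sum L2_tendsto_square[OF Tsq[OF XD(1)] G(1) G(2)])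
  have lim0: "(\<lambda>n. 1 / real (Suc n)) \<longlonglongrightarrow> 0" using LIMSEQ_inverse_real_of_nat by (simp add: inverse_eq_divide)
  \<comment> \<open>The perturbation starts from the maximising sequence and not from its limit
    \<open>G\<close>, which need not be a test field; the error 1/(n + 1) disappears
    afterwards.\<close>
  have rep_le: "t * (l E - P G Y) \<le> t\<^sup>2 * N Y / 2" if TY: "T Y E" for Y E t
  proof -
    have "t * (l E - P (X n) Y) \<le> t\<^sup>2 * N Y / 2 + 1 / real (Suc n)" for n
    proof -
      have "val (\<lambda>i x. 1 * X n i x + t * Y i x) (\<lambda>i x. 1 *\<^sub>R D n i x + t *\<^sub>R E i x) \<le> S"
        by (rule val_S[OF Tcomb[OF XD(1) TY]])
      then have "1 * l (D n) + t * l E - (1\<^sup>2 * N (X n) + 2 * 1 * t * P (X n) Y + t\<^sup>2 * N Y) / 2 \<le> S"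
        unfolding val_def l_comb[OF XD(1) TY] N_comb[OF Tsq[OF XD(1)] Tsq[OF TY]] .
      then have "l (D n) + t * l E - N (X n) / 2 - t * P (X n) Y - t\<^sup>2 * N Y / 2 \<le> S"
        by (simp add: add_divide_distrib)
      moreover have "t * (l E - P (X n) Y) = t * l E - t * P (X n) Y" by (rule right_diff_distrib)
      ultimately show ?thesis using XD(2)[of n] unfolding val_def by linarith
    qed
    moreover have "(\<lambda>n. t * (l E - P (X n) Y)) \<longlonglongrightarrow> t * (l E - P G Y)"
      by (intro tendsto_intros limP Tsq[OF TY])
    moreover have "(\<lambda>n. t\<^sup>2 * N Y / 2 + 1 / real (Suc n)) \<longlonglongrightarrow> t\<^sup>2 * N Y / 2 + 0"
      by (intro tendsto_intros lim0)
    ultimately have "t * (l E - P G Y) \<le> t\<^sup>2 * N Y / 2 + 0" by (intro LIMSEQ_le) auto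
    then show ?thesis by simp
  qed
  have rep: "l E = P G Y" if TY: "T Y E" for Y E
  proof (rule ccontr)
    assume ne: "l E \<noteq> P G Y"
    define d where "d = l E - P G Y"
    have d: "d \<noteq> 0" using ne by (simp add: d_def)
    have NY: "N Y \<ge> 0" unfolding N_def by (intro sum_nonneg) auto
    \<comment> \<open>A step for which the linear gain t d beats the quadratic term.\<close>
    define t where "t = d / (N Y + 1)"
    have "t * d \<le> t\<^sup>2 * N Y / 2" unfolding d_def by (rule rep_le[OF TY])
    also have "\<dots> \<le> t\<^sup>2 * (N Y + 1) / 2" by (simp add: mult_left_mono)
    also have "\<dots> = t * d / 2" using NY by (simp add: t_def power2_eq_square)
    finally have "t * d \<le> 0" by linarith
    moreover have "t * d > 0" using d NY by (simp add: t_def power2_eq_square[symmetric])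
    ultimately show False by simp
  qed
  define g where "g x = (\<chi> i. G i x)" for x
  have gi: "g x $ i = G i x" for x i by (simp add: g_def)
  have wg: "weak_grad u g"
    unfolding weak_grad_def
  proof (intro allI impI)
    fix \<phi> :: "real^'n \<Rightarrow> real" and E and j :: 'n assume t: "testfun \<phi> E"
    \<comment> \<open>Fields with a single nonzero component extract the partial
      derivatives.\<close>
    let ?Y = "\<lambda>i. if i = j then \<phi> else (\<lambda>x. 0)" and ?E = "\<lambda>i. if i = j then E else (\<lambda>x. 0)"
    have "T ?Y ?E" unfolding T_def using t testfun_zero by auto
    then have eq: "l ?E = P G ?Y" by (rule rep)
    have "l ?E = - (\<Sum>i\<in>UNIV. if i = j then (\<integral>x. u x * (E x $ j) \<partial>lborel) else 0)"
      unfolding l_def by (intro arg_cong[where f=uminus] sum.cong) auto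
    moreover have "P G ?Y = (\<Sum>i\<in>UNIV. if i = j then (\<integral>x. G j x * \<phi> x \<partial>lborel) else 0)"
      unfolding P_def by (intro sum.cong) auto
    ultimately show "(\<integral>x. u x * (E x $ j) \<partial>lborel) = - (\<integral>x. (g x $ j) * \<phi> x \<partial>lborel)"
      using eq by (simp add: gi)
  qed
  have PN: "P G G = N G" by (simp add: P_def N_def power2_eq_square)
  \<comment> \<open>Along the sequence \<open>P (X n) G\<close> equals \<open>l (D n)\<close>, so
    these numbers are values of the functional and at most A/2; in the limit N G - N G / 2 <= A /
    2.\<close>
  have "(\<lambda>n. P (X n) G - N (X n) / 2) \<longlonglongrightarrow> P G G - N G / 2"
    by (intro tendsto_intros limP limN G) simp
  moreover have "P (X n) G - N (X n) / 2 \<le> A / 2" for n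
  proof -
    have "P (X n) G = P G (X n)" by (simp add: P_def mult.commute)
    also have "\<dots> = l (D n)" using rep[OF XD(1)] by simp
    finally show ?thesis using val_le[OF XD(1), of n] by (simp add: val_def)
  qed
  ultimately have "P G G - N G / 2 \<le> A / 2" by (intro LIMSEQ_le_const2) auto
  then have "N G \<le> A" using PN by simp
  moreover have gsq: "sqL2 (\<lambda>x. g x $ i)" for i unfolding gi by (rule G)
  ultimately have "(\<integral>x. (norm (g x))\<^sup>2 \<partial>lborel) \<le> A"
    unfolding integral_norm_square_vec[OF gsq] by (simp add: gi N_def)
  then show ?thesis using that gsq wg by blast
qed

section \<open>Uniqueness and calculus of weak gradients\<close>

lemma weak_grad_unique:
  fixes u :: "real^'n \<Rightarrow> real"
  assumes g: "\<And>i. sqL2 (\<lambda>x. g x $ i)" "weak_grad u g" and h: "\<And>i. sqL2 (\<lambda>x. h x $ i)" "weak_grad u h"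
  shows "AE x in lborel. g x = h x"
proof -
  have "AE x in lborel. g x $ i = h x $ i" for i
  proof -
    have sq: "sqL2 (\<lambda>x. g x $ i - h x $ i)" by (intro sqL2_diff g h)
    have "sqrt (\<integral>x. (g x $ i - h x $ i)\<^sup>2 \<partial>lborel) \<le> 0"
    proof (rule L2_norm_le_by_duality[OF sq])
      fix \<phi> :: "real^'n \<Rightarrow> real" and D assume t: "testfun \<phi> D"
      have "(\<integral>x. (g x $ i - h x $ i) * \<phi> x \<partial>lborel) = (\<integral>x. g x $ i * \<phi> x \<partial>lborel) - (\<integral>x. h x $ i * \<phi> x \<partial>lborel)"
        using sqL2_mult_integrable[OF g(1)[of i] testfun_sqL2(1)[OF t]] sqL2_mult_integrable[OF h(1)[of i] testfun_sqL2(1)[OF t]]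
        by (simp add: left_diff_distrib)
      also have "\<dots> = 0"
      proof -
        have "(\<integral>x. u x * (D x $ i) \<partial>lborel) = - (\<integral>x. g x $ i * \<phi> x \<partial>lborel)"
          "(\<integral>x. u x * (D x $ i) \<partial>lborel) = - (\<integral>x. h x $ i * \<phi> x \<partial>lborel)"
          using g(2) h(2) t unfolding weak_grad_def by blast+
        then show ?thesis by linarith
      qed
      finally show "\<bar>\<integral>x. (g x $ i - h x $ i) * \<phi> x \<partial>lborel\<bar> \<le> 0 * sqrt (\<integral>x. (\<phi> x)\<^sup>2 \<partial>lborel)" by simp
    qed simp
    moreover have "0 \<le> (\<integral>x. (g x $ i - h x $ i)\<^sup>2 \<partial>lborel)" by simp
    ultimately have "(\<integral>x. (g x $ i - h x $ i)\<^sup>2 \<partial>lborel) = 0" by (simp only: real_sqrt_le_0_iff)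
    then have "AE x in lborel. (g x $ i - h x $ i)\<^sup>2 = 0"
      using integral_nonneg_eq_0_iff_AE[OF sqL2D(2)[OF sq]] by simp
    then show ?thesis by simp
  qed
  then have "AE x in lborel. \<forall>i\<in>UNIV. g x $ i = h x $ i" by (intro AE_finite_allI) auto
  then show ?thesis by (simp add: vec_eq_iff)
qed

lemma H1_wgrad:
  assumes "u \<in> H1" shows "sqL2 u" "sqL2 (\<lambda>x. wgrad u x $ i)" "weak_grad u (wgrad u)"
proof -
  have ex: "\<exists>g. (\<forall>i. sqL2 (\<lambda>x. g x $ i)) \<and> weak_grad u g" using assms by (simp add: H1_def)
  show "sqL2 u" using assms by (simp add: H1_def)
  show "sqL2 (\<lambda>x. wgrad u x $ i)" "weak_grad u (wgrad u)" using someI_ex[OF ex] by (auto simp: wgrad_def)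
qed

text \<open>\<open>wgrad\<close> is an arbitrary choice; by uniqueness any square-integrable weak
  gradient may replace it under an integral.\<close>

lemma
  fixes u :: "real^'n \<Rightarrow> real"
  assumes "sqL2 u" "\<And>i. sqL2 (\<lambda>x. g x $ i)" "weak_grad u g"
  shows H1I: "u \<in> H1" and wgrad_AE_eq: "AE x in lborel. wgrad u x = g x"
proof -
  show u: "u \<in> H1" using assms by (auto simp: H1_def)
  show "AE x in lborel. wgrad u x = g x" by (rule weak_grad_unique[OF H1_wgrad(2,3)[OF u] assms(2,3)])
qed

text \<open>\<open>J\<close> integrates the whole density at once, so splitting it requires both
  summands to be integrable.\<close>

lemma J_eq:
  fixes u :: "real^'n \<Rightarrow> real"
  assumes u: "sqL2 u" and g: "\<And>i. sqL2 (\<lambda>x. g x $ i)" "weak_grad u g" and F: "integrable lborel (\<lambda>x. F (u x))"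
  shows "J F u = (\<integral>x. (norm (g x))\<^sup>2 \<partial>lborel) / 2 + (\<integral>x. F (u x) \<partial>lborel)"
proof -
  have uH: "u \<in> H1" and ae: "AE x in lborel. wgrad u x = g x" using H1I[OF u g] wgrad_AE_eq[OF u g] .
  have [measurable]: "g \<in> borel_measurable borel" "wgrad u \<in> borel_measurable borel"
    by (rule measurable_vec_components, use sqL2D(1)[OF g(1)] sqL2D(1)[OF H1_wgrad(2)[OF uH]] in simp)+
  have [measurable]: "(\<lambda>x. F (u x)) \<in> borel_measurable borel" using borel_measurable_integrable[OF F] by simp
  have "J F u = (\<integral>x. (norm (g x))\<^sup>2 / 2 + F (u x) \<partial>lborel)"
    unfolding J_def by (rule integral_cong_AE) (use ae in auto)
  then show ?thesis using integrable_norm_square_vec[OF g(1)] F by simp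
qed

lemma weak_grad_add:
  fixes u v :: "real^'n \<Rightarrow> real"
  assumes "sqL2 u" "\<And>i. sqL2 (\<lambda>x. g x $ i)" "weak_grad u g" "sqL2 v" "\<And>i. sqL2 (\<lambda>x. h x $ i)" "weak_grad v h"
  shows "weak_grad (\<lambda>x. u x + v x) (\<lambda>x. g x + h x)"
  unfolding weak_grad_def
proof (intro allI impI)
  fix \<phi> :: "real^'n \<Rightarrow> real" and D and i assume t: "testfun \<phi> D"
  have "(\<integral>x. (u x + v x) * (D x $ i) \<partial>lborel) = (\<integral>x. u x * (D x $ i) \<partial>lborel) + (\<integral>x. v x * (D x $ i) \<partial>lborel)"
    using sqL2_mult_integrable[OF assms(1) testfun_sqL2(2)[OF t]] sqL2_mult_integrable[OF assms(4) testfun_sqL2(2)[OF t]]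
    by (simp add: distrib_right)
  also have "\<dots> = - ((\<integral>x. (g x $ i) * \<phi> x \<partial>lborel) + (\<integral>x. (h x $ i) * \<phi> x \<partial>lborel))"
    using assms(3,6) t unfolding weak_grad_def by simp
  also have "\<dots> = - (\<integral>x. ((g x + h x) $ i) * \<phi> x \<partial>lborel)"
    using sqL2_mult_integrable[OF assms(2)[of i] testfun_sqL2(1)[OF t]] sqL2_mult_integrable[OF assms(5)[of i] testfun_sqL2(1)[OF t]]
    by (simp add: distrib_right)
  finally show "(\<integral>x. (u x + v x) * (D x $ i) \<partial>lborel) = - (\<integral>x. ((g x + h x) $ i) * \<phi> x \<partial>lborel)" .
qed

lemma weak_grad_cmult:
  assumes "weak_grad u g" shows "weak_grad (\<lambda>x. c * u x) (\<lambda>x. c *\<^sub>R g x)"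
  using assms unfolding weak_grad_def by (simp add: mult.assoc)

text \<open>Integration by parts from translation invariance: the integral of \<phi> against a
  translate of \<psi> can be differentiated through either factor, and the two derivatives
  agree.\<close>

lemma testfun_weak_grad:
  fixes \<phi> :: "real^'n \<Rightarrow> real"
  assumes p: "testfun \<phi> D" shows "weak_grad \<phi> D"
  unfolding weak_grad_def
proof (intro allI impI)
  fix \<psi> :: "real^'n \<Rightarrow> real" and E and i assume q: "testfun \<psi> E"
  let ?e = "axis i 1 :: real^'n"
  note sp = testfun_sqL2(1)[OF p] and sq = testfun_sqL2(1)[OF q]
  have a: "((\<lambda>s. \<integral>x. \<phi> x * \<psi> (x - s *\<^sub>R ?e) \<partial>lborel) has_real_derivative - (\<integral>x. \<phi> x * (E x \<bullet> ?e) \<partial>lborel)) (at 0)"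
    using translate_derivative[OF sp q, of ?e 0] by simp
  have b: "((\<lambda>s. \<integral>x. \<psi> x * \<phi> (x - s *\<^sub>R (- ?e)) \<partial>lborel) has_real_derivative - (\<integral>x. \<psi> x * (D x \<bullet> (- ?e)) \<partial>lborel)) (at 0)"
    using translate_derivative[OF sq p, of "- ?e" 0] by simp
  have "(\<integral>x. \<psi> x * \<phi> (x - s *\<^sub>R (- ?e)) \<partial>lborel) = (\<integral>x. \<phi> x * \<psi> (x - s *\<^sub>R ?e) \<partial>lborel)" for s
  proof -
    have i: "integrable lborel (\<lambda>x. \<psi> x * \<phi> (x + s *\<^sub>R ?e))"
      by (rule sqL2_mult_integrable[OF sq sqL2_translate[OF sp]])
    show ?thesis using integral_translate_arg[OF i, of "s *\<^sub>R ?e"] by (simp add: mult.commute)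
  qed
  then have "- (\<integral>x. \<phi> x * (E x \<bullet> ?e) \<partial>lborel) = - (\<integral>x. \<psi> x * (D x \<bullet> (- ?e)) \<partial>lborel)"
    using DERIV_unique[OF a] b by simp
  then show "(\<integral>x. \<phi> x * (E x $ i) \<partial>lborel) = - (\<integral>x. (D x $ i) * \<psi> x \<partial>lborel)"
    by (simp add: inner_axis mult.commute)
qed

text \<open>The integral formula assumes no integrability: if it fails for one side it fails for the
  other, and both integrals are then 0 by convention.\<close>

lemma integral_lborel_scale:
  fixes f :: "'a::euclidean_space \<Rightarrow> real"
  assumes t: "t > 0"
  shows "(\<integral>x. f (x /\<^sub>R t) \<partial>lborel) = t ^ DIM('a) * (\<integral>x. f x \<partial>lborel)"
    and "integrable lborel (\<lambda>x. f (x /\<^sub>R t)) \<longleftrightarrow> integrable lborel f"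
proof -
  have 1: "integrable lborel (\<lambda>x. f (x /\<^sub>R t))" if "integrable lborel f"
    using integrable_lborel_affine[OF _ that, of "inverse t" 0] t by simp
  have 2: "integrable lborel f" if "integrable lborel (\<lambda>x. f (x /\<^sub>R t))"
    using integrable_lborel_affine[OF _ that, of t 0] t by simp
  show "integrable lborel (\<lambda>x. f (x /\<^sub>R t)) \<longleftrightarrow> integrable lborel f" using 1 2 by blast
  show "(\<integral>x. f (x /\<^sub>R t) \<partial>lborel) = t ^ DIM('a) * (\<integral>x. f x \<partial>lborel)"
  proof (cases "integrable lborel f")
    case True
    then show ?thesis using integral_lborel_affine[OF _ True, of "inverse t" 0] t
      by (simp add: power_inverse divide_inverse mult.commute)
  next
    case False
    then have "\<not> integrable lborel (\<lambda>x. f (x /\<^sub>R t))" using 2 by blast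
    then show ?thesis using False by (simp add: not_integrable_integral_eq)
  qed
qed

lemma sqL2_dilate:
  fixes u :: "real^'n \<Rightarrow> real"
  assumes "sqL2 u" "t > 0" shows "sqL2 (\<lambda>x. u (x /\<^sub>R t))"
  using assms integral_lborel_scale(2)[of t "\<lambda>x. (u x)\<^sup>2"] by (auto simp: sqL2_def)

lemma weak_grad_dilate:
  fixes u :: "real^'n \<Rightarrow> real"
  assumes w: "weak_grad u g" and t: "t > 0"
  shows "weak_grad (\<lambda>x. u (x /\<^sub>R t)) (\<lambda>x. g (x /\<^sub>R t) /\<^sub>R t)"
  unfolding weak_grad_def
proof (intro allI impI)
  fix \<phi> :: "real^'n \<Rightarrow> real" and D and i assume tf: "testfun \<phi> D"
  let ?N = "DIM(real^'n)"
  note ts = testfun_scale_arg[OF tf t]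
  have wk: "t * (\<integral>x. u x * (D (t *\<^sub>R x) $ i) \<partial>lborel) = - (\<integral>x. (g x $ i) * \<phi> (t *\<^sub>R x) \<partial>lborel)"
  proof -
    have "(\<integral>x. u x * ((t *\<^sub>R D (t *\<^sub>R x)) $ i) \<partial>lborel) = - (\<integral>x. (g x $ i) * \<phi> (t *\<^sub>R x) \<partial>lborel)"
      using w ts unfolding weak_grad_def by blast
    moreover have "(\<lambda>x. u x * ((t *\<^sub>R D (t *\<^sub>R x)) $ i)) = (\<lambda>x. t * (u x * (D (t *\<^sub>R x) $ i)))" by (auto simp: mult_ac)
    ultimately show ?thesis by simp
  qed
  have "(\<integral>x. u (x /\<^sub>R t) * (D x $ i) \<partial>lborel) = t ^ ?N * (\<integral>x. u x * (D (t *\<^sub>R x) $ i) \<partial>lborel)"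
    using integral_lborel_scale(1)[OF t, of "\<lambda>x. u x * (D (t *\<^sub>R x) $ i)"] t by simp
  moreover have "(\<integral>x. ((g (x /\<^sub>R t) /\<^sub>R t) $ i) * \<phi> x \<partial>lborel) = t ^ ?N * (\<integral>x. (g x $ i) * \<phi> (t *\<^sub>R x) \<partial>lborel) / t"
  proof -
    have "(\<integral>x. ((g (x /\<^sub>R t) /\<^sub>R t) $ i) * \<phi> x \<partial>lborel) = (\<integral>x. (g (x /\<^sub>R t) $ i) * \<phi> x / t \<partial>lborel)"
      by (simp add: divide_inverse mult_ac)
    then show ?thesis using integral_lborel_scale(1)[OF t, of "\<lambda>x. (g x $ i) * \<phi> (t *\<^sub>R x)"] t by simp
  qed
  moreover have "t ^ ?N * (\<integral>x. u x * (D (t *\<^sub>R x) $ i) \<partial>lborel) = - (t ^ ?N * (\<integral>x. (g x $ i) * \<phi> (t *\<^sub>R x) \<partial>lborel) / t)"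
  proof -
    have "(\<integral>x. u x * (D (t *\<^sub>R x) $ i) \<partial>lborel) = - (\<integral>x. (g x $ i) * \<phi> (t *\<^sub>R x) \<partial>lborel) / t"
      using wk t by (simp add: field_simps)
    then show ?thesis by simp
  qed
  ultimately show "(\<integral>x. u (x /\<^sub>R t) * (D x $ i) \<partial>lborel) = - (\<integral>x. ((g (x /\<^sub>R t) /\<^sub>R t) $ i) * \<phi> x \<partial>lborel)" by simp
qed

subsection \<open>Radial functions\<close>

text \<open>Polar coordinates for radial integrands: both measures give a half-line
  \<open>{..r}\<close> the volume of the ball of radius r, and the half-lines generate the Borel
  sets.\<close>

lemma distr_norm_lborel:
  "distr lborel borel (norm :: 'a::euclidean_space \<Rightarrow> real)
    = density lborel (\<lambda>r. ennreal (real DIM('a) * unit_ball_vol (real DIM('a)) * r ^ (DIM('a) - 1)) * indicator {0..} r)"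
  (is "?\<mu> = ?\<nu>")
proof (rule measure_eqI_generator_eq[where E="range (\<lambda>r::real. {..r})" and \<Omega>=UNIV and A="\<lambda>i. {..real i}"])
  let ?w = "unit_ball_vol (real DIM('a))" and ?N = "DIM('a)"
  show "Int_stable (range (\<lambda>r::real. {..r}))"
    by (auto simp: Int_stable_def)
  have mu: "emeasure ?\<mu> {..r} = ennreal (if r < 0 then 0 else ?w * r ^ ?N)" for r
  proof -
    have "emeasure ?\<mu> {..r} = emeasure lborel (cball (0::'a) r)"
      by (subst emeasure_distr) (auto intro!: arg_cong[where f="emeasure lborel"])
    then show ?thesis by (simp add: emeasure_cball)
  qed
  have nu: "emeasure ?\<nu> {..r} = ennreal (if r < 0 then 0 else ?w * r ^ ?N)" for r
  proof -
    have "emeasure ?\<nu> {..r} = (\<integral>\<^sup>+t. ennreal (real ?N * ?w * t ^ (?N - 1)) * indicator {0..r} t \<partial>lborel)"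
      by (subst emeasure_density) (auto intro!: nn_integral_cong simp: indicator_def)
    also have "\<dots> = ennreal (if r < 0 then 0 else ?w * r ^ ?N)"
    proof (cases "r < 0")
      case False
      have "(\<integral>\<^sup>+t. ennreal (real ?N * ?w * t ^ (?N - 1)) * indicator {0..r} t \<partial>lborel) = ennreal (?w * r ^ ?N - ?w * 0 ^ ?N)"
        by (rule nn_integral_FTC_Icc) (use False in \<open>auto intro!: derivative_eq_intros\<close>)
      then show ?thesis using False by (simp add: power_0_left)
    qed auto
    finally show ?thesis .
  qed
  show "emeasure ?\<mu> X = emeasure ?\<nu> X" if "X \<in> range (\<lambda>r::real. {..r})" for X
    using that mu nu by auto
  show "sets ?\<mu> = sigma_sets UNIV (range (\<lambda>r::real. {..r}))"
    by (simp add: borel_eq_atMost)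
  show "sets ?\<nu> = sigma_sets UNIV (range (\<lambda>r::real. {..r}))"
    by (simp add: borel_eq_atMost)
  show "(\<Union>i. {..real i}) = UNIV" by (auto intro: real_arch_simple)
  show "emeasure ?\<mu> {..real i} \<noteq> \<infinity>" for i by (simp add: mu)
qed auto

lemma nn_integral_norm:
  fixes f :: "real \<Rightarrow> ennreal"
  assumes [measurable]: "f \<in> borel_measurable borel"
  shows "(\<integral>\<^sup>+x. f (norm (x::'a::euclidean_space)) \<partial>lborel)
    = (\<integral>\<^sup>+r. ennreal (real DIM('a) * unit_ball_vol (real DIM('a)) * r ^ (DIM('a) - 1)) * indicator {0..} r * f r \<partial>lborel)"
proof -
  have "(\<integral>\<^sup>+x. f (norm (x::'a)) \<partial>lborel) = (\<integral>\<^sup>+r. f r \<partial>distr lborel borel (norm :: 'a \<Rightarrow> real))"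
    by (simp add: nn_integral_distr)
  also have "\<dots> = (\<integral>\<^sup>+r. ennreal (real DIM('a) * unit_ball_vol (real DIM('a)) * r ^ (DIM('a) - 1)) * indicator {0..} r * f r \<partial>lborel)"
    unfolding distr_norm_lborel by (rule nn_integral_density) measurable
  finally show ?thesis .
qed

section \<open>Powers of the norm and radial decay\<close>

lemma has_integral_mult_indicator:
  fixes f :: "real \<Rightarrow> real"
  assumes "(f has_integral I) S" shows "((\<lambda>r. f r * indicator S r) has_integral I) UNIV"
proof -
  have "(\<lambda>r. f r * indicator S r) = (\<lambda>r. if r \<in> S then f r else 0)"
    by (auto simp: indicator_def fun_eq_iff)
  then show ?thesis using assms by (simp add: has_integral_restrict_UNIV)
qed

lemma integrable_norm_powr_inner:
  assumes a: "a < real DIM('a::euclidean_space)"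
  shows "integrable lborel (\<lambda>x::'a. indicator (ball 0 1) x * norm x powr (- a))"
proof (rule integrableI_bounded)
  have [measurable]: "ball (0::'a) 1 \<in> sets borel" by simp
  let ?w = "real DIM('a) * unit_ball_vol (real DIM('a))" and ?e = "real (DIM('a) - 1) - a"
  have e: "?e > -1" using a by (simp add: of_nat_diff)
  have D: "DIM('a) \<ge> 1" by simp
  have "((\<lambda>r. r powr ?e) has_integral (1 powr (?e + 1) / (?e + 1))) {0..1}"
    by (rule has_integral_powr_from_0) (use e in auto)
  then have "((\<lambda>r. ?w * r powr ?e) has_integral ?w * (1 powr (?e + 1) / (?e + 1))) {0..1}"
    by (rule has_integral_mult_right)
  then have hi: "((\<lambda>r. ?w * r powr ?e * indicator {0..1} r) has_integral ?w * (1 powr (?e + 1) / (?e + 1))) UNIV"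
    by (rule has_integral_mult_indicator)
  have "(\<integral>\<^sup>+x. ennreal (norm (indicator (ball 0 1) (x::'a) * norm x powr (- a))) \<partial>lborel)
      = (\<integral>\<^sup>+x. ennreal (indicator {..<1} (norm (x::'a)) * norm x powr (- a)) \<partial>lborel)"
    by (rule nn_integral_cong) (auto simp: indicator_def)
  also have "\<dots> = (\<integral>\<^sup>+r. ennreal (?w * r ^ (DIM('a) - 1)) * indicator {0..} r * ennreal (indicator {..<1} r * r powr (- a)) \<partial>lborel)"
    by (rule nn_integral_norm) measurable
  also have "\<dots> \<le> (\<integral>\<^sup>+r. ennreal (?w * r powr ?e * indicator {0..1} r) \<partial>lborel)"
  proof (rule nn_integral_mono)
    fix r :: real
    show "ennreal (?w * r ^ (DIM('a) - 1)) * indicator {0..} r * ennreal (indicator {..<1} r * r powr (- a)) \<le> ennreal (?w * r powr ?e * indicator {0..1} r)"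
    proof (cases "0 < r \<and> r < 1")
      case True
      then have "r ^ (DIM('a) - 1) * r powr (- a) = r powr ?e"
        by (simp add: powr_realpow[symmetric] powr_add[symmetric])
      then show ?thesis using True by (simp add: ennreal_mult'[symmetric] mult.assoc)
    next
      case False
      then show ?thesis by (cases "r = 0") (auto simp: indicator_def)
    qed
  qed
  also have "\<dots> = ennreal (?w * (1 powr (?e + 1) / (?e + 1)))"
    by (rule nn_integral_has_integral_lborel[OF _ _ hi]) auto
  also have "\<dots> < \<infinity>" by simp
  finally show "(\<integral>\<^sup>+x. ennreal (norm (indicator (ball 0 1) (x::'a) * norm x powr (- a))) \<partial>lborel) < \<infinity>" .
  show "(\<lambda>x::'a. indicator (ball 0 1) x * norm x powr (- a)) \<in> borel_measurable lborel" by measurable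
qed

lemma integrable_norm_powr_outer:
  assumes b: "b > real DIM('a::euclidean_space)"
  shows "integrable lborel (\<lambda>x::'a. indicator (- ball 0 1) x * norm x powr (- b))"
proof (rule integrableI_bounded)
  have [measurable]: "ball (0::'a) 1 \<in> sets borel" by simp
  let ?w = "real DIM('a) * unit_ball_vol (real DIM('a))" and ?e = "real (DIM('a) - 1) - b"
  have e: "?e < -1" using b by (simp add: of_nat_diff)
  have "((\<lambda>r. r powr ?e) has_integral - (1 powr (?e + 1)) / (?e + 1)) {1..}"
    by (rule has_integral_powr_to_inf) (use e in auto)
  then have "((\<lambda>r. ?w * r powr ?e) has_integral ?w * (- (1 powr (?e + 1)) / (?e + 1))) {1..}"
    by (rule has_integral_mult_right)
  then have hi: "((\<lambda>r. ?w * r powr ?e * indicator {1..} r) has_integral ?w * (- (1 powr (?e + 1)) / (?e + 1))) UNIV"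
    by (rule has_integral_mult_indicator)
  have "(\<integral>\<^sup>+x. ennreal (norm (indicator (- ball 0 1) (x::'a) * norm x powr (- b))) \<partial>lborel)
      = (\<integral>\<^sup>+x. ennreal (indicator {1..} (norm (x::'a)) * norm x powr (- b)) \<partial>lborel)"
    by (rule nn_integral_cong) (auto simp: indicator_def)
  also have "\<dots> = (\<integral>\<^sup>+r. ennreal (?w * r ^ (DIM('a) - 1)) * indicator {0..} r * ennreal (indicator {1..} r * r powr (- b)) \<partial>lborel)"
    by (rule nn_integral_norm) measurable
  also have "\<dots> \<le> (\<integral>\<^sup>+r. ennreal (?w * r powr ?e * indicator {1..} r) \<partial>lborel)"
  proof (rule nn_integral_mono)
    fix r :: real
    show "ennreal (?w * r ^ (DIM('a) - 1)) * indicator {0..} r * ennreal (indicator {1..} r * r powr (- b)) \<le> ennreal (?w * r powr ?e * indicator {1..} r)"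
    proof (cases "1 \<le> r")
      case True
      then have "r ^ (DIM('a) - 1) * r powr (- b) = r powr ?e"
        by (simp add: powr_realpow[symmetric] powr_add[symmetric])
      then show ?thesis using True by (simp add: ennreal_mult'[symmetric] mult.assoc)
    qed (auto simp: indicator_def)
  qed
  also have "\<dots> = ennreal (?w * (- (1 powr (?e + 1)) / (?e + 1)))"
    by (rule nn_integral_has_integral_lborel[OF _ _ hi]) auto
  also have "\<dots> < \<infinity>" by simp
  finally show "(\<integral>\<^sup>+x. ennreal (norm (indicator (- ball 0 1) (x::'a) * norm x powr (- b))) \<partial>lborel) < \<infinity>" .
  show "(\<lambda>x::'a. indicator (- ball 0 1) x * norm x powr (- b)) \<in> borel_measurable lborel" by measurable
qed

text \<open>On the ball whose boundary passes through x the function is at least v x. The mass thus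
  forces decay of order |x|^(-N/2).\<close>

lemma radial_L2_bound:
  fixes v :: "'a::euclidean_space \<Rightarrow> real"
  assumes v0: "\<And>x. 0 \<le> v x" and mono: "\<And>x y. norm x \<le> norm y \<Longrightarrow> v y \<le> v x"
    and v2: "integrable lborel (\<lambda>x. (v x)\<^sup>2)" and x: "x \<noteq> 0"
  shows "(v x)\<^sup>2 * (unit_ball_vol (real DIM('a)) * norm x ^ DIM('a)) \<le> (\<integral>x. (v x)\<^sup>2 \<partial>lborel)"
proof -
  let ?B = "ball (0::'a) (norm x)"
  have "(v x)\<^sup>2 * (unit_ball_vol (real DIM('a)) * norm x ^ DIM('a)) = (\<integral>y. indicator ?B y * (v x)\<^sup>2 \<partial>lborel)"
    by (simp add: content_ball)
  also have "\<dots> \<le> (\<integral>y. (v y)\<^sup>2 \<partial>lborel)"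
  proof (rule integral_mono[OF _ v2])
    show "integrable lborel (\<lambda>y. indicator ?B y * (v x)\<^sup>2)" by (rule integrable_indicator_ball) simp
    show "indicator ?B y * (v x)\<^sup>2 \<le> (v y)\<^sup>2" for y
      using mono[of y x] v0[of x] by (auto simp: indicator_def intro!: power_mono)
  qed
  finally show ?thesis .
qed

lemma testfun_radial_field:
  fixes P P' :: "real \<Rightarrow> real"
  assumes "\<And>t. (P has_real_derivative P' t) (at t)" "continuous_on UNIV P'" "\<And>t. t \<ge> b \<Longrightarrow> P t = 0"
  shows "testfun (\<lambda>x::real^'n. x $ i * P (x \<bullet> x)) (\<lambda>x. (2 * P' (x \<bullet> x) * (x $ i)) *\<^sub>R x + P (x \<bullet> x) *\<^sub>R axis i 1)"
proof -
  have d: "((\<lambda>x::real^'n. x $ i) has_derivative (\<lambda>h. axis i 1 \<bullet> h)) (at x)" for x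
    by (rule has_derivative_eq_rhs[OF bounded_linear_imp_has_derivative[OF bounded_linear_vec_nth]])
       (simp add: fun_eq_iff inner_axis')
  show ?thesis
    using testfun_mult[OF testfun_radial[OF assms] d] by (simp add: mult_ac)
qed

text \<open>The i-th component of the field x P(|x|^2) is tested against the i-th partial
  derivative; summing over i, the divergence 2 |x|^2 P' + N P appears on the side of u.\<close>

lemma weak_grad_radial_field:
  fixes u :: "real^'n \<Rightarrow> real" and P P' :: "real \<Rightarrow> real"
  assumes u: "sqL2 u" and g: "\<And>i. sqL2 (\<lambda>x. g x $ i)" "weak_grad u g"
    and P: "\<And>t. (P has_real_derivative P' t) (at t)" "continuous_on UNIV P'" "\<And>t. t \<ge> b \<Longrightarrow> P t = 0"
  shows "(\<integral>x. u x * (2 * (x \<bullet> x) * P' (x \<bullet> x) + real CARD('n) * P (x \<bullet> x)) \<partial>lborel)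
    = - (\<integral>x. P (x \<bullet> x) * (g x \<bullet> x) \<partial>lborel)"
    and "integrable lborel (\<lambda>x. P (x \<bullet> x) * (g x \<bullet> x))"
    and "integrable lborel (\<lambda>x. u x * (2 * (x \<bullet> x) * P' (x \<bullet> x) + real CARD('n) * P (x \<bullet> x)))"
proof -
  let ?X = "\<lambda>i (x::real^'n). x $ i * P (x \<bullet> x)"
  let ?D = "\<lambda>i (x::real^'n). (2 * P' (x \<bullet> x) * (x $ i)) *\<^sub>R x + P (x \<bullet> x) *\<^sub>R axis i 1"
  have t: "testfun (?X i) (?D i)" for i by (rule testfun_radial_field[OF P])
  have i1: "integrable lborel (\<lambda>x. u x * (?D i x $ i))" for i
    by (rule sqL2_mult_integrable[OF u testfun_sqL2(2)[OF t]])
  have i2: "integrable lborel (\<lambda>x. (g x $ i) * ?X i x)" for i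
    by (rule sqL2_mult_integrable[OF g(1) testfun_sqL2(1)[OF t]])
  have e1: "(\<Sum>i\<in>UNIV. u x * (?D i x $ i)) = u x * (2 * (x \<bullet> x) * P' (x \<bullet> x) + real CARD('n) * P (x \<bullet> x))" for x
  proof -
    have "(\<Sum>i\<in>UNIV. ?D i x $ i) = (\<Sum>i\<in>UNIV. 2 * P' (x \<bullet> x) * ((x $ i) * (x $ i)) + P (x \<bullet> x))"
      by (rule sum.cong) (auto simp: axis_def)
    also have "\<dots> = 2 * P' (x \<bullet> x) * (\<Sum>i\<in>UNIV. (x $ i) * (x $ i)) + real CARD('n) * P (x \<bullet> x)"
      by (simp add: sum.distrib sum_distrib_left)
    also have "(\<Sum>i\<in>UNIV. (x $ i) * (x $ i)) = x \<bullet> x" by (simp add: inner_vec_def)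
    finally show ?thesis unfolding sum_distrib_left[symmetric] by (simp add: mult_ac)
  qed
  have e2: "(\<Sum>i\<in>UNIV. (g x $ i) * ?X i x) = P (x \<bullet> x) * (g x \<bullet> x)" for x
    unfolding inner_vec_def[of "g x"] sum_distrib_left by (rule sum.cong) auto
  show "integrable lborel (\<lambda>x. P (x \<bullet> x) * (g x \<bullet> x))"
    unfolding e2[symmetric] by (rule Bochner_Integration.integrable_sum[OF i2])
  show "integrable lborel (\<lambda>x. u x * (2 * (x \<bullet> x) * P' (x \<bullet> x) + real CARD('n) * P (x \<bullet> x)))"
    unfolding e1[symmetric] by (rule Bochner_Integration.integrable_sum[OF i1])
  have "(\<integral>x. u x * (2 * (x \<bullet> x) * P' (x \<bullet> x) + real CARD('n) * P (x \<bullet> x)) \<partial>lborel) = (\<Sum>i\<in>UNIV. \<integral>x. u x * (?D i x $ i) \<partial>lborel)"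
    unfolding e1[symmetric] by (rule Bochner_Integration.integral_sum[OF i1])
  also have "\<dots> = (\<Sum>i\<in>UNIV. - (\<integral>x. (g x $ i) * ?X i x \<partial>lborel))"
  proof (rule sum.cong[OF refl])
    fix i
    show "(\<integral>x. u x * (?D i x $ i) \<partial>lborel) = - (\<integral>x. (g x $ i) * ?X i x \<partial>lborel)"
      using g(2)[unfolded weak_grad_def, rule_format, OF t[of i], of i] .
  qed
  also have "\<dots> = - (\<integral>x. P (x \<bullet> x) * (g x \<bullet> x) \<partial>lborel)"
    unfolding e2[symmetric] sum_negf by (subst Bochner_Integration.integral_sum[OF i2]) simp
  finally show "(\<integral>x. u x * (2 * (x \<bullet> x) * P' (x \<bullet> x) + real CARD('n) * P (x \<bullet> x)) \<partial>lborel)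
    = - (\<integral>x. P (x \<bullet> x) * (g x \<bullet> x) \<partial>lborel)" .
qed

text \<open>The class in which rearrangement takes place: continuous functions of u vanishing at 0
  are integrable, the energy is finite, and every bounded nonnegative square-integrable function of
  finite energy can be approximated from it.\<close>

definition lip_class :: "('a::euclidean_space \<Rightarrow> real) \<Rightarrow> bool" where
  "lip_class u \<longleftrightarrow> (\<forall>x. 0 \<le> u x) \<and> (\<exists>L\<ge>0. \<forall>x y. \<bar>u x - u y\<bar> \<le> L * dist x y) \<and> (\<exists>R>0. \<forall>x. norm x \<ge> R \<longrightarrow> u x = 0)"

definition radial_decr :: "('a::euclidean_space \<Rightarrow> real) \<Rightarrow> bool" where
  "radial_decr v \<longleftrightarrow> (\<forall>x y. norm x \<le> norm y \<longrightarrow> v y \<le> v x)"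

lemma lip_class_nonneg: "lip_class u \<Longrightarrow> 0 \<le> u x" by (simp add: lip_class_def)

lemma lip_class_continuous: "lip_class u \<Longrightarrow> continuous_on UNIV u"
  unfolding lip_class_def using Lipschitz_continuous_on by blast

lemma lip_class_measurable: "lip_class u \<Longrightarrow> u \<in> borel_measurable borel"
  by (rule borel_measurable_continuous_onI[OF lip_class_continuous])

lemma lip_class_support:
  assumes "lip_class u" obtains R where "R > 0" "\<And>x. norm x \<ge> R \<Longrightarrow> u x = 0"
  using assms unfolding lip_class_def by blast

lemma lip_class_integrable:
  fixes G :: "real \<Rightarrow> real"
  assumes u: "lip_class u" and G: "continuous_on UNIV G" "G 0 = 0"
  shows "integrable lborel (\<lambda>x. G (u x))"
proof -
  obtain R where R: "R > 0" "\<And>x. norm x \<ge> R \<Longrightarrow> u x = 0" using lip_class_support[OF u] by metis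
  show ?thesis
    by (rule integrable_continuous_support[of _ R])
       (use R G in \<open>auto intro: continuous_on_compose2[OF G(1) lip_class_continuous[OF u]]\<close>)
qed

lemma lip_class_square_integrable: "lip_class u \<Longrightarrow> integrable lborel (\<lambda>x. (u x)\<^sup>2)"
  by (rule lip_class_integrable) (auto intro!: continuous_intros)

lemma lip_class_sqL2: "lip_class u \<Longrightarrow> sqL2 u"
  using lip_class_measurable[of u] lip_class_square_integrable[of u] by (simp add: sqL2_def)

lemma lip_class_cmult:
  assumes "lip_class u" "c \<ge> 0" shows "lip_class (\<lambda>x. c * u x)"
proof -
  obtain L R where L: "L \<ge> 0" "\<And>x y. \<bar>u x - u y\<bar> \<le> L * dist x y" and R: "R > 0" "\<And>x. norm x \<ge> R \<Longrightarrow> u x = 0"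
    and u0: "\<And>x. 0 \<le> u x" using assms(1) unfolding lip_class_def by blast
  have "\<bar>c * u x - c * u y\<bar> \<le> (c * L) * dist x y" for x y
  proof -
    have "\<bar>c * u x - c * u y\<bar> = c * \<bar>u x - u y\<bar>" using assms(2) by (simp add: right_diff_distrib[symmetric] abs_mult)
    also have "\<dots> \<le> c * (L * dist x y)" by (intro mult_left_mono L assms)
    finally show ?thesis by (simp add: mult_ac)
  qed
  moreover have "c * L \<ge> 0" using L assms by simp
  ultimately show ?thesis unfolding lip_class_def using R u0 assms(2) by (intro conjI exI[of _ "c * L"] exI[of _ R]) auto
qed

lemma lip_class_energy:
  assumes "lip_class u" obtains A where "A \<ge> 0" "energy_le u A"
  using assms Lipschitz_energy_le[of u] unfolding lip_class_def by metis

lemma lip_class_rearrange: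
  fixes u :: "'a::euclidean_space \<Rightarrow> real"
  assumes "lip_class u"
  obtains v :: "'a \<Rightarrow> real" where "lip_class v" "radial_decr v"
    "\<And>G::real \<Rightarrow> real. continuous_on UNIV G \<Longrightarrow> G 0 = 0 \<Longrightarrow> (\<integral>x. G (v x) \<partial>lborel) = (\<integral>x. G (u x) \<partial>lborel)"
    "\<And>A. energy_le u A \<Longrightarrow> energy_le v A"
proof -
  obtain L R where L: "L \<ge> 0" "\<And>x y. \<bar>u x - u y\<bar> \<le> L * dist x y" and R: "R > 0" "\<And>x. norm x \<ge> R \<Longrightarrow> u x = 0"
    and u0: "\<And>x. 0 \<le> u x" using assms unfolding lip_class_def by blast
  show ?thesis
  proof (rule radial_rearrangement[OF u0 L(2) L(1) R(2) R(1)])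
    fix v :: "'a \<Rightarrow> real"
    assume v: "\<And>x. 0 \<le> v x" "\<And>x y. \<bar>v x - v y\<bar> \<le> L * dist x y" "\<And>x. R \<le> norm x \<Longrightarrow> v x = 0"
      "\<And>G::real \<Rightarrow> real. continuous_on UNIV G \<Longrightarrow> G 0 = 0 \<Longrightarrow> (\<integral>x. G (v x) \<partial>lborel) = (\<integral>x. G (u x) \<partial>lborel)"
      "\<And>x y. norm x \<le> norm y \<Longrightarrow> v y \<le> v x" "\<And>A. energy_le u A \<Longrightarrow> energy_le v A"
    have "lip_class v" unfolding lip_class_def using v(1-3) L(1) R(1) by blast
    moreover have "radial_decr v" unfolding radial_decr_def using v(5) by blast
    ultimately show ?thesis using that v(4,6) by blast
  qed
qed

text \<open>Testing the weak gradient with a field that behaves like the fundamental solution outside the ball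
  of radius \<open>norm x\<close>.\<close>

lemma radial_energy_bound:
  assumes N3: "CARD('n::finite) \<ge> 3"
  obtains C where "C > 0" "\<And>(v::real^'n \<Rightarrow> real) A x. lip_class v \<Longrightarrow> radial_decr v \<Longrightarrow> energy_le v A \<Longrightarrow> A \<ge> 0 \<Longrightarrow> x \<noteq> 0
      \<Longrightarrow> v x \<le> C * sqrt A * norm x powr (- (real CARD('n) - 2) / 2)"
proof -
  let ?N = "real CARD('n)" and ?w = "unit_ball_vol (real CARD('n))"
  have w: "?w > 0" by simp
  have N: "?N \<ge> 3" using N3 by simp
  \<comment> \<open>The squared length of the test field below for radius 1, before the cutoff; it
    is integrable at infinity because 2 N - 2 > N for N >= 3.\<close>
  define h where "h x = (norm x)\<^sup>2 * (1 + (x \<bullet> x)\<^sup>2) powr (- ?N / 2)" for x :: "real^'n"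
  have hc: "continuous_on UNIV h"
  proof -
    have "1 + (x \<bullet> x)\<^sup>2 \<noteq> 0" for x :: "real^'n" by (smt (verit) zero_le_power2)
    then show ?thesis unfolding h_def by (intro continuous_intros) auto
  qed
  have [measurable]: "h \<in> borel_measurable borel" by (rule borel_measurable_continuous_onI[OF hc])
  have h0: "h x \<ge> 0" for x by (simp add: h_def)
  have hi: "integrable lborel h"
  proof (rule Bochner_Integration.integrable_bound)
    show "integrable lborel (\<lambda>x::real^'n. indicator (ball 0 1) x * 1 + indicator (- ball 0 1) x * norm x powr (- (2 * ?N - 2)))"
      by (intro Bochner_Integration.integrable_add integrable_indicator_ball integrable_norm_powr_outer) (use N in auto)
    show "AE x in lborel. norm (h x) \<le> norm (indicator (ball 0 1) x * 1 + indicator (- ball 0 1) x * norm x powr (- (2 * ?N - 2)) :: real)"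
    proof (rule AE_I2)
      fix x :: "real^'n"
      have base: "1 + (x \<bullet> x)\<^sup>2 \<ge> 1" by simp
      have "h x \<le> indicator (ball 0 1) x * 1 + indicator (- ball 0 1) x * norm x powr (- (2 * ?N - 2))"
      proof (cases "norm x < 1")
        case True
        have "(1 + (x \<bullet> x)\<^sup>2) powr (- ?N / 2) \<le> (1 + (x \<bullet> x)\<^sup>2) powr 0"
          by (rule powr_mono) (use base N in auto)
        also have "\<dots> = 1" using base by (metis not_one_le_zero powr_zero_eq_one)
        finally have "h x \<le> 1 * 1" unfolding h_def using True by (intro mult_mono) (auto simp: power_le_one)
        then show ?thesis using True by simp
      next
        case False
        then have x1: "norm x \<ge> 1" by simp
        then have xp: "norm x > 0" by linarith
        have h1: "(1 + (x \<bullet> x)\<^sup>2) powr (- ?N / 2) \<le> ((x \<bullet> x)\<^sup>2) powr (- ?N / 2)"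
          by (rule powr_mono2') (use xp N in auto)
        have "(x \<bullet> x)\<^sup>2 = norm x powr 4"
          using xp by (simp add: dot_square_norm powr_numeral flip: power_mult)
        then have "((x \<bullet> x)\<^sup>2) powr (- ?N / 2) = norm x powr (4 * (- ?N / 2))" by (simp only: powr_powr)
        also have "4 * (- ?N / 2) = - (2 * ?N)" by simp
        finally have h2: "(1 + (x \<bullet> x)\<^sup>2) powr (- ?N / 2) \<le> norm x powr (- (2 * ?N))" using h1 by simp
        have "(norm x)\<^sup>2 = norm x powr 2" using xp by (simp add: powr_numeral)
        then have "h x \<le> norm x powr 2 * norm x powr (- (2 * ?N))"
          unfolding h_def using h2 by (simp only: mult_left_mono powr_ge_zero)
        also have "\<dots> = norm x powr (2 + - (2 * ?N))" by (rule powr_add[symmetric])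
        also have "2 + - (2 * ?N) = - (2 * ?N - 2)" by simp
        finally show ?thesis using False by simp
      qed
      then show "norm (h x) \<le> norm (indicator (ball 0 1) x * 1 + indicator (- ball 0 1) x * norm x powr (- (2 * ?N - 2)) :: real)"
        using h0[of x] by simp
    qed
  qed simp
  define K where "K = (\<integral>x. h x \<partial>lborel)"
  have K0: "K \<ge> 0" unfolding K_def using h0 by simp
  define c where "c = ?w * ?N * 2 powr (- ?N / 4 - 1)"
  have c: "c > 0" using w N by (simp add: c_def)
  have main: "v x \<le> (sqrt K + 1) / c * sqrt A * norm x powr (- (?N - 2) / 2)"
    if v: "lip_class v" and mono: "radial_decr v" and en: "energy_le v A" "A \<ge> 0" and x: "x \<noteq> 0" for v :: "real^'n \<Rightarrow> real" and A x
  proof -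
    define R where "R = norm x"
    have R: "R > 0" using x by (simp add: R_def)
    obtain S where S: "S > 0" "\<And>x. norm x \<ge> S \<Longrightarrow> v x = 0" using lip_class_support[OF v] by metis
    have v0: "0 \<le> v y" for y by (rule lip_class_nonneg[OF v])
    obtain g where g: "\<And>i. sqL2 (\<lambda>x. g x $ i)" "weak_grad v g" "(\<integral>x. (norm (g x))\<^sup>2 \<partial>lborel) \<le> A"
      using weak_gradI_energy_le[OF lip_class_sqL2[OF v] en] by metis
    have [measurable]: "g \<in> borel_measurable borel" by (rule measurable_vec_components) (use sqL2D(1)[OF g(1)] in simp)
    \<comment> \<open>The field is y times \<open>Q\<close> to the power -N/4. Far outside the ball
      of radius R it behaves like R^N y / |y|^N, it is regular at the origin, and its divergence N
      Q^(-N/4 - 1) is positive everywhere and bounded below inside the ball.\<close>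
    define Q where "Q t = 1 + (t / R\<^sup>2)\<^sup>2" for t
    have Q1: "Q t \<ge> 1" for t by (simp add: Q_def)
    have Qp: "Q t > 0" for t using Q1[of t] by linarith
    define P0 where "P0 t = Q t powr (- ?N / 4)" for t
    define P0' where "P0' t = (- ?N / 4) * Q t powr (- ?N / 4 - 1) * (2 * (t / R\<^sup>2) * (1 / R\<^sup>2))" for t
    have dQ: "(Q has_real_derivative 2 * (t / R\<^sup>2) * (1 / R\<^sup>2)) (at t)" for t
      unfolding Q_def[abs_def]
      by (rule DERIV_cong[OF DERIV_add[OF DERIV_const DERIV_power[OF DERIV_cdivide[OF DERIV_ident], where n=2]]]) simp
    have dP0: "(P0 has_real_derivative P0' t) (at t)" for t
      unfolding P0_def[abs_def] P0'_def 
      by (rule DERIV_chain2[where f="\<lambda>z. z powr (- ?N / 4)" and g=Q, OF has_real_derivative_powr[OF Qp] dQ])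
    have cQ: "continuous_on UNIV Q" unfolding Q_def using R by (intro continuous_intros) auto
    have Qn: "Q t \<noteq> 0" for t using Qp[of t] by simp
    have cP0: "continuous_on UNIV P0" unfolding P0_def by (intro continuous_intros cQ) (use Qn in auto)
    have cP0': "continuous_on UNIV P0'" unfolding P0'_def using R by (intro continuous_intros cQ) (use Qn in auto)
    \<comment> \<open>The cutoff provides compact support and acts only where v vanishes, so the
      pairing of v with the divergence is unchanged.\<close>
    define P where "P t = P0 t * cut (S\<^sup>2) t" for t
    define P' where "P' t = P0' t * cut (S\<^sup>2) t + cut' (S\<^sup>2) t * P0 t" for t
    have dP: "(P has_real_derivative P' t) (at t)" for t
      unfolding P_def[abs_def] P'_def by (rule DERIV_mult[OF dP0 DERIV_cut])
    have cP': "continuous_on UNIV P'" unfolding P'_def by (intro continuous_intros cP0 cP0')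
    have cP: "continuous_on UNIV P" unfolding P_def by (intro continuous_intros cP0)
    have P_out: "P t = 0" if "t \<ge> S\<^sup>2 + 1" for t using cut_eq_0(1)[OF that] by (simp add: P_def)
    have div0: "2 * t * P0' t + ?N * P0 t = ?N * Q t powr (- ?N / 4 - 1)" for t
    proof -
      have "P0 t = Q t powr (- ?N / 4 - 1) * Q t"
        unfolding P0_def using Qp[of t] by (simp add: powr_diff)
      then have "2 * t * P0' t + ?N * P0 t = ?N * Q t powr (- ?N / 4 - 1) * (Q t - (t / R\<^sup>2)\<^sup>2)"
        by (simp add: P0'_def power2_eq_square algebra_simps)
      then show ?thesis by (simp add: Q_def)
    qed
    have vdiv: "v y * (2 * (y \<bullet> y) * P' (y \<bullet> y) + ?N * P (y \<bullet> y)) = v y * (?N * Q (y \<bullet> y) powr (- ?N / 4 - 1))" for y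
    proof (cases "norm y < S")
      case True
      then have "y \<bullet> y \<le> S\<^sup>2" unfolding dot_square_norm by (intro power_mono) auto
      then show ?thesis by (simp add: P_def P'_def cut_eq_1 div0)
    qed (use S in auto)
    note W = weak_grad_radial_field[OF lip_class_sqL2[OF v] g(1,2) dP cP' P_out]
    \<comment> \<open>Inside the ball of radius R monotonicity gives v >= v x, and Q <= 2 bounds the
      divergence below; this is the origin of the constant \<open>c\<close>.\<close>
    have "v x * (?N * 2 powr (- ?N / 4 - 1)) * (?w * R ^ CARD('n)) = (\<integral>y. indicator (ball (0::real^'n) R) y * (v x * (?N * 2 powr (- ?N / 4 - 1))) \<partial>lborel)"
      using R by (simp add: content_ball)
    also have "\<dots> \<le> (\<integral>y. v y * (?N * Q (y \<bullet> y) powr (- ?N / 4 - 1)) \<partial>lborel)"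
    proof (rule integral_mono)
      show "integrable lborel (\<lambda>y. indicator (ball (0::real^'n) R) y * (v x * (?N * 2 powr (- ?N / 4 - 1))))"
        by (rule integrable_indicator_ball) simp
      show "integrable lborel (\<lambda>y. v y * (?N * Q (y \<bullet> y) powr (- ?N / 4 - 1)))"
        using W(3) unfolding vdiv .
      fix y :: "real^'n"
      show "indicator (ball 0 R) y * (v x * (?N * 2 powr (- ?N / 4 - 1))) \<le> v y * (?N * Q (y \<bullet> y) powr (- ?N / 4 - 1))"
      proof (cases "norm y < R")
        case True
        have "y \<bullet> y \<le> R\<^sup>2" unfolding dot_square_norm using True by (intro power_mono) auto
        then have "y \<bullet> y / R\<^sup>2 \<le> 1" using R by (simp add: field_simps)
        then have "(y \<bullet> y / R\<^sup>2)\<^sup>2 \<le> 1" by (intro power_le_one) auto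
        then have "Q (y \<bullet> y) \<le> 2" by (simp add: Q_def)
        then have "2 powr (- ?N / 4 - 1) \<le> Q (y \<bullet> y) powr (- ?N / 4 - 1)" using Qp N by (intro powr_mono2') auto
        moreover have "v x \<le> v y" using mono True by (auto simp: radial_decr_def R_def)
        ultimately have "v x * (?N * 2 powr (- ?N / 4 - 1)) \<le> v y * (?N * Q (y \<bullet> y) powr (- ?N / 4 - 1))"
          using v0 N by (intro mult_mono) auto
        then show ?thesis using True by simp
      qed (use v0 in auto)
    qed
    also have "\<dots> = - (\<integral>y. P (y \<bullet> y) * (g y \<bullet> y) \<partial>lborel)"
      using W(1) unfolding vdiv .
    also have "\<dots> \<le> \<bar>\<integral>y. P (y \<bullet> y) * (g y \<bullet> y) \<partial>lborel\<bar>" by simp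
    also have "\<dots> \<le> (\<integral>y. \<bar>P (y \<bullet> y) * (g y \<bullet> y)\<bar> \<partial>lborel)" by (rule integral_abs_bound)
    also have "\<dots> \<le> (\<integral>y. norm (g y) * (\<bar>P (y \<bullet> y)\<bar> * norm y) \<partial>lborel)"
    proof (rule integral_mono)
      show "integrable lborel (\<lambda>y. \<bar>P (y \<bullet> y) * (g y \<bullet> y)\<bar>)" using W(2) by simp
      have Pyc: "continuous_on UNIV (\<lambda>y::real^'n. \<bar>P (y \<bullet> y)\<bar> * norm y)"
        by (intro continuous_intros continuous_on_compose2[OF cP]) auto
      have Py2: "integrable lborel (\<lambda>y::real^'n. (\<bar>P (y \<bullet> y)\<bar> * norm y)\<^sup>2)"
      proof (rule integrable_continuous_support[of _ "S + 1"])
        show "continuous_on UNIV (\<lambda>y::real^'n. (\<bar>P (y \<bullet> y)\<bar> * norm y)\<^sup>2)" by (intro continuous_intros Pyc)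
        show "(\<bar>P (y \<bullet> y)\<bar> * norm y)\<^sup>2 = 0" if "S + 1 \<le> norm y" for y :: "real^'n"
        proof -
          have "(S + 1)\<^sup>2 \<le> (norm y)\<^sup>2" using that S by (intro power_mono) auto
          then have "S\<^sup>2 + 1 \<le> y \<bullet> y" using S unfolding dot_square_norm by (simp add: power2_sum)
          then show ?thesis using P_out by simp
        qed
      qed
      show "integrable lborel (\<lambda>y. norm (g y) * (\<bar>P (y \<bullet> y)\<bar> * norm y))"
        by (rule integrable_mult_squares)
           (use Py2 integrable_norm_square_vec[OF g(1)] borel_measurable_continuous_onI[OF Pyc] in auto)
      fix y
      have "\<bar>g y \<bullet> y\<bar> \<le> norm (g y) * norm y" by (rule Cauchy_Schwarz_ineq2)
      then have "\<bar>P (y \<bullet> y)\<bar> * \<bar>g y \<bullet> y\<bar> \<le> \<bar>P (y \<bullet> y)\<bar> * (norm (g y) * norm y)" by (rule mult_left_mono) simp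
      then show "\<bar>P (y \<bullet> y) * (g y \<bullet> y)\<bar> \<le> norm (g y) * (\<bar>P (y \<bullet> y)\<bar> * norm y)" by (simp add: abs_mult mult_ac)
    qed
    also have "\<dots> \<le> sqrt A * (sqrt K * sqrt (R\<^sup>2 * R ^ CARD('n)))"
    proof -
      have Pyc: "continuous_on UNIV (\<lambda>y::real^'n. \<bar>P (y \<bullet> y)\<bar> * norm y)"
        by (intro continuous_intros continuous_on_compose2[OF cP]) auto
      have hR: "integrable lborel (\<lambda>y. h (y /\<^sub>R R))" using integral_lborel_scale(2)[OF R] hi by blast
      have hRi: "(\<integral>y. h (y /\<^sub>R R) \<partial>lborel) = R ^ CARD('n) * K"
        using integral_lborel_scale(1)[OF R, of h] by (simp add: K_def)
      have le: "(\<bar>P (y \<bullet> y)\<bar> * norm y)\<^sup>2 \<le> R\<^sup>2 * h (y /\<^sub>R R)" for y :: "real^'n"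
      proof -
        have "R\<^sup>2 * h (y /\<^sub>R R) = (norm y)\<^sup>2 * (Q (y \<bullet> y)) powr (- ?N / 2)"
          using R by (simp add: h_def Q_def power2_eq_square field_simps)
        moreover have "(P0 (y \<bullet> y))\<^sup>2 = Q (y \<bullet> y) powr (- ?N / 2)"
          unfolding P0_def power2_eq_square by (simp add: powr_add[symmetric])
        moreover have "(P (y \<bullet> y))\<^sup>2 \<le> (P0 (y \<bullet> y))\<^sup>2"
        proof -
          have "(cut (S\<^sup>2) (y \<bullet> y))\<^sup>2 \<le> 1" by (intro power_le_one cut_bounds)
          then show ?thesis unfolding P_def power_mult_distrib by (simp add: mult_left_le)
        qed
        ultimately show ?thesis by (simp add: power_mult_distrib mult.commute mult_left_mono)
      qed
      have Py2: "integrable lborel (\<lambda>y::real^'n. (\<bar>P (y \<bullet> y)\<bar> * norm y)\<^sup>2)"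
      proof (rule Bochner_Integration.integrable_bound)
        show "integrable lborel (\<lambda>y. R\<^sup>2 * h (y /\<^sub>R R))" using hR by simp
        show "(\<lambda>y::real^'n. (\<bar>P (y \<bullet> y)\<bar> * norm y)\<^sup>2) \<in> borel_measurable lborel"
          using borel_measurable_continuous_onI[OF Pyc] by simp
        show "AE y in lborel. norm ((\<bar>P (y \<bullet> y)\<bar> * norm y)\<^sup>2) \<le> norm (R\<^sup>2 * h (y /\<^sub>R R))"
          using le h0 by (intro AE_I2) simp
      qed
      have "(\<integral>y. norm (g y) * (\<bar>P (y \<bullet> y)\<bar> * norm y) \<partial>lborel)
        \<le> sqrt (\<integral>y. (norm (g y))\<^sup>2 \<partial>lborel) * sqrt (\<integral>y. (\<bar>P (y \<bullet> y)\<bar> * norm (y::real^'n))\<^sup>2 \<partial>lborel)"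
        using Cauchy_Schwarz_integral[of "\<lambda>y. norm (g y)" lborel "\<lambda>y. \<bar>P (y \<bullet> y)\<bar> * norm y"]
          integrable_norm_square_vec[OF g(1)] Py2 borel_measurable_continuous_onI[OF Pyc] by simp
      also have "\<dots> \<le> sqrt A * sqrt (R\<^sup>2 * (R ^ CARD('n) * K))"
      proof (intro mult_mono real_sqrt_le_mono)
        have "(\<integral>y. (\<bar>P (y \<bullet> y)\<bar> * norm y)\<^sup>2 \<partial>(lborel :: (real^'n) measure)) \<le> (\<integral>y. R\<^sup>2 * h (y /\<^sub>R R) \<partial>lborel)"
          by (rule integral_mono[OF Py2]) (use hR le in auto)
        then show "(\<integral>y. (\<bar>P (y \<bullet> y)\<bar> * norm y)\<^sup>2 \<partial>(lborel :: (real^'n) measure)) \<le> R\<^sup>2 * (R ^ CARD('n) * K)" using hRi by simp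
      qed (use g(3) en in auto)
      also have "\<dots> = sqrt A * (sqrt K * sqrt (R\<^sup>2 * R ^ CARD('n)))" by (simp add: real_sqrt_mult mult_ac)
      finally show ?thesis .
    qed
    finally have fin: "v x * c * R ^ CARD('n) \<le> sqrt A * sqrt K * sqrt (R\<^sup>2 * R ^ CARD('n))"
      by (simp add: c_def mult_ac)
    have e1: "R ^ CARD('n) = R powr ?N" using R by (simp add: powr_realpow)
    have e2: "sqrt (R\<^sup>2 * R ^ CARD('n)) = R powr ((?N + 2) / 2)"
    proof -
      have "R\<^sup>2 * R ^ CARD('n) = R powr (?N + 2)" using R by (simp add: e1 powr_add powr_numeral mult.commute)
      then show ?thesis using R by (simp add: powr_half_sqrt[symmetric] powr_powr)
    qed
    \<comment> \<open>R^((N + 2)/2) stems from the norm of the field and R^N from the volume on the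
      left; the quotient has the exponent -(N - 2)/2.\<close>
    have e3: "R powr ((?N + 2) / 2) = R powr (- (?N - 2) / 2) * R powr ?N"
      by (simp add: powr_add[symmetric] field_simps)
    have "(v x * c) * R powr ?N \<le> (sqrt A * sqrt K * R powr (- (?N - 2) / 2)) * R powr ?N"
      using fin unfolding e1 e2 [unfolded e1] e3 by (simp add: mult_ac e1 e2 e3)
    then have "v x * c \<le> sqrt A * sqrt K * R powr (- (?N - 2) / 2)"
      using R by (simp add: mult_le_cancel_right_pos)
    also have "\<dots> \<le> (sqrt K + 1) * sqrt A * R powr (- (?N - 2) / 2)"
      using en by (intro mult_right_mono) (auto simp: algebra_simps)
    finally show ?thesis unfolding R_def[symmetric] using c by (simp add: field_simps)
  qed
  have "(sqrt K + 1) / c > 0" using K0 c by (simp add: add_nonneg_pos)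
  then show ?thesis using that main by blast
qed

section \<open>Bounds for powers between 2 and the critical exponent\<close>

lemma powr_continuous_abs:
  fixes s :: real assumes "s > 0" shows "continuous_on UNIV (\<lambda>r::real. \<bar>r\<bar> powr s)"
  using assms by (intro continuous_on_powr' continuous_intros) auto

text \<open>Beyond radius \<delta> the mass bounds v^(s-2) pointwise; inside, the decay given by the
  energy has an integrable s-th power because s is subcritical. The radius is left free, and
  choosing it later yields the Gagliardo-Nirenberg exponent.\<close>

lemma radial_Lp_bound:
  assumes N3: "CARD('n::finite) \<ge> 3" and s: "2 < s" "s < 2 * real CARD('n) / (real CARD('n) - 2)"
  obtains K where "K \<ge> 0" "\<And>(v::real^'n \<Rightarrow> real) A \<delta>. lip_class v \<Longrightarrow> energy_le v A \<Longrightarrow> A \<ge> 0 \<Longrightarrow> \<delta> > 0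
     \<Longrightarrow> (\<integral>x. \<bar>v x\<bar> powr s \<partial>lborel) \<le> K * ((\<integral>x. (v x)\<^sup>2 \<partial>lborel) powr (s/2) * \<delta> powr (- real CARD('n) * (s - 2) / 2)
         + A powr (s/2) * \<delta> powr (real CARD('n) - s * (real CARD('n) - 2) / 2))"
proof -
  let ?N = "real CARD('n)" and ?w = "unit_ball_vol (real CARD('n))"
  have w: "?w > 0" by simp
  have N: "?N \<ge> 3" using N3 by simp
  obtain C where C: "C > 0" "\<And>(v::real^'n \<Rightarrow> real) A x. lip_class v \<Longrightarrow> radial_decr v \<Longrightarrow> energy_le v A \<Longrightarrow> A \<ge> 0 \<Longrightarrow> x \<noteq> 0
      \<Longrightarrow> v x \<le> C * sqrt A * norm x powr (- (?N - 2) / 2)"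
    using radial_energy_bound[OF N3] by metis
  define a where "a = s * (?N - 2) / 2"
  have a: "a < ?N" using s N by (simp add: a_def field_simps)
  define I where "I = (\<integral>x. indicator (ball 0 1) (x::real^'n) * norm x powr (- a) \<partial>lborel)"
  have Ii: "integrable lborel (\<lambda>x::real^'n. indicator (ball 0 1) x * norm x powr (- a))"
    by (rule integrable_norm_powr_inner) (use a in simp)
  have I0: "I \<ge> 0" unfolding I_def by (intro integral_nonneg_AE) auto
  define K where "K = ?w powr (- (s - 2) / 2) + C powr s * I"
  have K0: "K \<ge> 0" unfolding K_def using I0 by (intro add_nonneg_nonneg mult_nonneg_nonneg) auto
  \<comment> \<open>The bound for radially decreasing v; the general case follows, since
    rearrangement preserves both integrals and every energy bound.\<close>
  have bd: "(\<integral>x. \<bar>v x\<bar> powr s \<partial>lborel) \<le> K * ((\<integral>x. (v x)\<^sup>2 \<partial>lborel) powr (s/2) * \<delta> powr (- ?N * (s - 2) / 2)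
         + A powr (s/2) * \<delta> powr (?N - s * (?N - 2) / 2))"
    if v: "lip_class v" and r: "radial_decr v" and en: "energy_le v A" "A \<ge> 0" and \<delta>: "\<delta> > 0" for v :: "real^'n \<Rightarrow> real" and A \<delta>
  proof -
    define U where "U = (\<integral>x. (v x)\<^sup>2 \<partial>lborel)"
    have U0: "U \<ge> 0" by (simp add: U_def)
    note v2 = lip_class_square_integrable[OF v] and v0 = lip_class_nonneg[OF v]
    \<comment> \<open>Bounds v^(s-2) outside the ball of radius \<delta>, by the decay that the mass
      gives.\<close>
    define m where "m = (U / (?w * \<delta> powr ?N)) powr ((s - 2) / 2)"
    have out: "\<bar>v x\<bar> powr s \<le> (v x)\<^sup>2 * m" if x: "norm x \<ge> \<delta>" for x
    proof (cases "v x = 0")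
      case False
      then have vp: "v x > 0" using v0[of x] by simp
      have x0: "x \<noteq> 0" using x \<delta> by auto
      have "(v x)\<^sup>2 * (?w * norm x ^ CARD('n)) \<le> U"
        using radial_L2_bound[of v x] v0 r v2 x0 by (simp add: U_def radial_decr_def)
      moreover have "(v x)\<^sup>2 * (?w * \<delta> ^ CARD('n)) \<le> (v x)\<^sup>2 * (?w * norm x ^ CARD('n))"
        using x \<delta> w by (intro mult_left_mono power_mono) auto
      ultimately have "(v x)\<^sup>2 \<le> U / (?w * \<delta> powr ?N)"
        using \<delta> w by (simp add: powr_realpow pos_le_divide_eq)
      then have "((v x)\<^sup>2) powr ((s - 2) / 2) \<le> m" unfolding m_def using s by (intro powr_mono2) auto
      moreover have "((v x)\<^sup>2) powr ((s - 2) / 2) = v x powr (s - 2)"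
      proof -
        have "(v x)\<^sup>2 = v x powr 2" using vp by (simp add: powr_numeral)
        then have "((v x)\<^sup>2) powr ((s - 2) / 2) = v x powr (2 * ((s - 2) / 2))" by (simp only: powr_powr)
        also have "2 * ((s - 2) / 2) = s - 2" by simp
        finally show ?thesis .
      qed
      moreover have "\<bar>v x\<bar> powr s = (v x)\<^sup>2 * v x powr (s - 2)"
        using vp by (simp add: powr_add[symmetric] flip: powr_numeral)
      ultimately show ?thesis by (simp add: mult_left_mono)
    qed simp
    have inn: "\<bar>v x\<bar> powr s \<le> C powr s * A powr (s/2) * norm x powr (- a)" if x0: "x \<noteq> 0" for x
    proof -
      have "\<bar>v x\<bar> \<le> C * sqrt A * norm x powr (- (?N - 2) / 2)" using C(2)[OF v r en x0] v0 by simp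
      then have "\<bar>v x\<bar> powr s \<le> (C * sqrt A * norm x powr (- (?N - 2) / 2)) powr s"
        using s by (intro powr_mono2) auto
      also have "\<dots> = C powr s * (sqrt A) powr s * (norm x powr (- (?N - 2) / 2)) powr s"
        using C(1) en by (simp add: powr_mult)
      also have "(sqrt A) powr s = A powr (s/2)" using en by (simp add: powr_half_sqrt[symmetric] powr_powr)
      also have "(norm x powr (- (?N - 2) / 2)) powr s = norm x powr (- a)"
      proof -
        have "- (?N - 2) / 2 * s = - a" by (simp add: a_def field_simps)
        then show ?thesis by (simp only: powr_powr)
      qed
      finally show ?thesis .
    qed
    \<comment> \<open>The integral over the ball of radius \<delta> is reduced to the unit ball by
      scaling, which produces \<delta>^(N - a).\<close>
    define k where "k x = indicator (ball 0 1) x * norm x powr (- a)" for x :: "real^'n"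
    have k\<delta>: "integrable lborel (\<lambda>x. k (x /\<^sub>R \<delta>))" "(\<integral>x. k (x /\<^sub>R \<delta>) \<partial>lborel) = \<delta> ^ CARD('n) * I"
      using integral_lborel_scale[OF \<delta>, of k] Ii by (auto simp: k_def[abs_def] I_def)
    have kx: "\<delta> powr (- a) * k (x /\<^sub>R \<delta>) = indicator (ball 0 \<delta>) x * norm x powr (- a)" for x
    proof -
      have "norm (x /\<^sub>R \<delta>) powr (- a) = norm x powr (- a) * \<delta> powr a"
      proof -
        have "inverse \<delta> powr (- a) = \<delta> powr a" using \<delta> by (simp add: inverse_powr powr_minus)
        then show ?thesis using \<delta> by (simp add: powr_mult)
      qed
      moreover have "\<delta> powr (- a) * \<delta> powr a = 1" using \<delta> by (simp add: powr_add[symmetric])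
      moreover have "indicator (ball 0 1) (x /\<^sub>R \<delta>) = (indicator (ball 0 \<delta>) x :: real)"
        using \<delta> by (simp add: indicator_def field_simps)
      ultimately show ?thesis unfolding k_def by (simp add: mult.left_commute mult.commute)
    qed
    define E where "E x = (v x)\<^sup>2 * m + C powr s * A powr (s/2) * (\<delta> powr (- a) * k (x /\<^sub>R \<delta>))" for x
    have Ei: "integrable lborel E" unfolding E_def using v2 k\<delta> by simp
    have vs: "integrable lborel (\<lambda>x. \<bar>v x\<bar> powr s)"
      by (rule lip_class_integrable[OF v powr_continuous_abs]) (use s in auto)
    have "(\<integral>x. \<bar>v x\<bar> powr s \<partial>lborel) \<le> (\<integral>x. E x \<partial>lborel)"
    proof (rule integral_mono_AE[OF vs Ei])
      show "AE x in lborel. \<bar>v x\<bar> powr s \<le> E x"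
        using AE_lborel_singleton[of "0::real^'n"]
      proof eventually_elim
        case (elim x)
        have m0: "(v x)\<^sup>2 * m \<ge> 0" by (simp add: m_def)
        have c0: "C powr s * A powr (s/2) * (indicator (ball 0 \<delta>) x * norm x powr (- a)) \<ge> 0" by simp
        show ?case
        proof (cases "norm x < \<delta>")
          case True
          then show ?thesis unfolding E_def kx using inn[OF elim] m0 by simp
        next
          case False
          then show ?thesis unfolding E_def kx using out[of x] c0 by simp
        qed
      qed
    qed
    also have "\<dots> = U * m + C powr s * A powr (s/2) * (\<delta> powr (- a) * (\<delta> ^ CARD('n) * I))"
      unfolding E_def using v2 k\<delta> by (simp add: U_def)
    also have "U * m = ?w powr (- (s - 2) / 2) * (U powr (s/2) * \<delta> powr (- ?N * (s - 2) / 2))"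
    proof (cases "U = 0")
      case False
      then have Up: "U > 0" using U0 by simp
      have "m = U powr ((s - 2) / 2) / (?w powr ((s - 2) / 2) * (\<delta> powr ?N) powr ((s - 2) / 2))"
        unfolding m_def using Up w \<delta> by (simp add: powr_divide powr_mult)
      also have "(\<delta> powr ?N) powr ((s - 2) / 2) = \<delta> powr (?N * (s - 2) / 2)" by (simp add: powr_powr)
      finally have meq: "m = U powr ((s - 2) / 2) / (?w powr ((s - 2) / 2) * \<delta> powr (?N * (s - 2) / 2))" .
      have m: "m = U powr ((s - 2) / 2) * ?w powr (- (s - 2) / 2) * \<delta> powr (- ?N * (s - 2) / 2)"
      proof -
        have "?w powr (- (s - 2) / 2) = inverse (?w powr ((s - 2) / 2))"
          using powr_minus[of ?w "(s - 2) / 2"] by (simp only: minus_divide_left)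
        moreover have "\<delta> powr (- ?N * (s - 2) / 2) = inverse (\<delta> powr (?N * (s - 2) / 2))"
          using powr_minus[of \<delta> "?N * (s - 2) / 2"] by (simp only: minus_divide_left minus_mult_left)
        ultimately show ?thesis using meq by (simp only: divide_inverse inverse_mult_distrib mult.assoc)
      qed
      have "U * U powr ((s - 2) / 2) = U powr (s/2)"
        using Up by (simp add: powr_add[symmetric] powr_mult_base field_simps)
      then show ?thesis unfolding m by (simp add: mult_ac)
    qed simp
    also have "\<delta> powr (- a) * (\<delta> ^ CARD('n) * I) = I * \<delta> powr (?N - s * (?N - 2) / 2)"
    proof -
      have "\<delta> ^ CARD('n) = \<delta> powr ?N" using \<delta> by (simp add: powr_realpow)
      then have "\<delta> powr (- a) * (\<delta> ^ CARD('n) * I) = I * (\<delta> powr (- a) * \<delta> powr ?N)" by simp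
      also have "\<delta> powr (- a) * \<delta> powr ?N = \<delta> powr (- a + ?N)" by (rule powr_add[symmetric])
      also have "- a + ?N = ?N - s * (?N - 2) / 2" by (simp add: a_def)
      finally show ?thesis .
    qed
    also have "?w powr (- (s - 2) / 2) * (U powr (s/2) * \<delta> powr (- ?N * (s - 2) / 2)) + C powr s * A powr (s/2) * (I * \<delta> powr (?N - s * (?N - 2) / 2))
       \<le> K * (U powr (s/2) * \<delta> powr (- ?N * (s - 2) / 2)) + K * (A powr (s/2) * \<delta> powr (?N - s * (?N - 2) / 2))"
    proof (rule add_mono)
      have "0 \<le> C powr s * I" using I0 by simp
      then show "?w powr (- (s - 2) / 2) * (U powr (s/2) * \<delta> powr (- ?N * (s - 2) / 2)) \<le> K * (U powr (s/2) * \<delta> powr (- ?N * (s - 2) / 2))"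
        unfolding K_def by (intro mult_right_mono) auto
      have "C powr s * I * (A powr (s/2) * \<delta> powr (?N - s * (?N - 2) / 2)) \<le> K * (A powr (s/2) * \<delta> powr (?N - s * (?N - 2) / 2))"
        unfolding K_def by (intro mult_right_mono) auto
      then show "C powr s * A powr (s/2) * (I * \<delta> powr (?N - s * (?N - 2) / 2)) \<le> K * (A powr (s/2) * \<delta> powr (?N - s * (?N - 2) / 2))"
        by (simp add: mult_ac)
    qed
    finally show ?thesis unfolding U_def by (simp add: distrib_left)
  qed
  show ?thesis
  proof (rule that[OF K0])
    fix u :: "real^'n \<Rightarrow> real" and A \<delta> :: real assume u: "lip_class u" "energy_le u A" "A \<ge> 0" "\<delta> > 0"
    obtain v :: "real^'n \<Rightarrow> real" where v: "lip_class v" "radial_decr v"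
      "\<And>G::real \<Rightarrow> real. continuous_on UNIV G \<Longrightarrow> G 0 = 0 \<Longrightarrow> (\<integral>x. G (v x) \<partial>lborel) = (\<integral>x. G (u x) \<partial>lborel)"
      "energy_le v A"
      using lip_class_rearrange[OF u(1)] u(2) by metis
    have "(\<integral>x. \<bar>v x\<bar> powr s \<partial>lborel) = (\<integral>x. \<bar>u x\<bar> powr s \<partial>lborel)"
      by (rule v(3)[OF powr_continuous_abs]) (use s in auto)
    moreover have "(\<integral>x. (v x)\<^sup>2 \<partial>lborel) = (\<integral>x. (u x)\<^sup>2 \<partial>lborel)"
      by (rule v(3)) (auto intro!: continuous_intros)
    ultimately show "(\<integral>x. \<bar>u x\<bar> powr s \<partial>lborel) \<le> K * ((\<integral>x. (u x)\<^sup>2 \<partial>lborel) powr (s/2) * \<delta> powr (- ?N * (s - 2) / 2)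
         + A powr (s/2) * \<delta> powr (?N - s * (?N - 2) / 2))"
      using bd[OF v(1,2,4) u(3,4)] by simp
  qed
qed

subsection \<open>Subcritical integrability\<close>

lemma lip_approx_seq:
  fixes w :: "'a::euclidean_space \<Rightarrow> real"
  assumes "w \<in> borel_measurable borel" "\<And>y. 0 \<le> w y" "\<And>y. w y \<le> B"
    "integrable lborel (\<lambda>x. (w x)\<^sup>2)" "energy_le w A" "A \<ge> 0"
  shows "\<exists>v. (\<forall>n::nat. lip_class (v n)) \<and> (\<forall>n y. v n y \<le> B) \<and>
    (\<lambda>n. \<integral>x. (v n x - w x)\<^sup>2 \<partial>lborel) \<longlonglongrightarrow> 0 \<and> (\<forall>n. energy_le (v n) (A + 1 / real (Suc n)))"
proof -
  have "\<exists>v. lip_class v \<and> (\<forall>y. v y \<le> B) \<and> (\<integral>x. (v x - w x)\<^sup>2 \<partial>lborel) < 1 / real (Suc n) \<and> energy_le v (A + 1 / real (Suc n))" for n :: nat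
  proof -
    have d: "1 / real (Suc n) > 0" by simp
    show ?thesis
    proof (rule Lipschitz_approximation[OF assms d])
      fix v L R assume "\<And>y. 0 \<le> v y" "\<And>y. v y \<le> B" "0 \<le> L" "\<And>x y. \<bar>v x - v y\<bar> \<le> L * dist x y" "0 < R"
        "\<And>x. R \<le> norm x \<Longrightarrow> v x = 0" "(\<integral>x. (v x - w x)\<^sup>2 \<partial>lborel) < 1 / real (Suc n)" "energy_le v (A + 1 / real (Suc n))"
      then show ?thesis unfolding lip_class_def by blast
    qed
  qed
  then have "\<forall>n. \<exists>v. lip_class v \<and> (\<forall>y. v y \<le> B) \<and> (\<integral>x. (v x - w x)\<^sup>2 \<partial>lborel) < 1 / real (Suc n) \<and> energy_le v (A + 1 / real (Suc n))" by blast
  from choice[OF this] obtain v where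
    v: "\<forall>n. lip_class (v n) \<and> (\<forall>y. v n y \<le> B) \<and> (\<integral>x. (v n x - w x)\<^sup>2 \<partial>lborel) < 1 / real (Suc n) \<and> energy_le (v n) (A + 1 / real (Suc n))" ..
  have "(\<lambda>n. \<integral>x. (v n x - w x)\<^sup>2 \<partial>lborel) \<longlonglongrightarrow> 0"
  proof (rule Lim_null_comparison)
    show "\<forall>\<^sub>F n in sequentially. norm (\<integral>x. (v n x - w x)\<^sup>2 \<partial>lborel) \<le> 1 / real (Suc n)"
      using v by (intro always_eventually allI) (simp add: less_imp_le)
    show "(\<lambda>n. 1 / real (Suc n)) \<longlonglongrightarrow> 0" using LIMSEQ_inverse_real_of_nat by (simp add: inverse_eq_divide)
  qed
  then show ?thesis using v by (intro exI[of _ v]) simp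
qed

text \<open>A derivative of at most linear size bounds differences by a product of a sum and a
  difference. To this form Cauchy-Schwarz applies, so L2 convergence of uniformly bounded functions
  suffices for convergence of the integrals of G.\<close>

lemma quadratic_Lipschitz_MVT:
  fixes G :: "real \<Rightarrow> real"
  assumes c: "continuous_on {0..M} G" and d: "\<And>r. 0 < r \<Longrightarrow> r < M \<Longrightarrow> (G has_real_derivative G' r) (at r)"
    and b: "\<And>r. 0 < r \<Longrightarrow> r < M \<Longrightarrow> \<bar>G' r\<bar> \<le> L * r" and L: "L \<ge> 0"
    and st: "0 \<le> s" "s \<le> M" "0 \<le> t" "t \<le> M"
  shows "\<bar>G s - G t\<bar> \<le> L * ((s + t) * \<bar>s - t\<bar>)"
proof -
  have main: "\<bar>G t - G s\<bar> \<le> L * ((s + t) * \<bar>t - s\<bar>)" if "0 \<le> s" "s < t" "t \<le> M" for s t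
  proof -
    have "\<exists>l z. s < z \<and> z < t \<and> (G has_real_derivative l) (at z) \<and> G t - G s = (t - s) * l"
    proof (rule MVT[OF that(2)])
      show "continuous_on {s..t} G" using that by (intro continuous_on_subset[OF c]) auto
      show "G differentiable (at x)" if "s < x" "x < t" for x
        using d[of x] that \<open>0 \<le> s\<close> \<open>t \<le> M\<close> by (auto simp: real_differentiable_def)
    qed
    then obtain l z where z: "s < z" "z < t" "(G has_real_derivative l) (at z)" "G t - G s = (t - s) * l" by blast
    have "l = G' z" using DERIV_unique[OF z(3) d] z that by simp
    then have "\<bar>l\<bar> \<le> L * z" using b[of z] z that by simp
    also have "\<dots> \<le> L * (s + t)" using z that L by (intro mult_left_mono) auto
    finally have "\<bar>t - s\<bar> * \<bar>l\<bar> \<le> \<bar>t - s\<bar> * (L * (s + t))" by (intro mult_left_mono) auto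
    then show ?thesis using z(4) by (simp add: abs_mult mult_ac)
  qed
  consider "s < t" | "t < s" | "s = t" by linarith
  then show ?thesis
  proof cases
    case 1 then show ?thesis using main[of s t] st by (simp add: abs_minus_commute)
  next
    case 2 then show ?thesis using main[of t s] st by (simp add: add.commute)
  qed simp
qed

lemma integral_tendsto_bounded_L2:
  fixes w :: "real^'n \<Rightarrow> real" and G :: "real \<Rightarrow> real"
  assumes v: "\<And>n::nat. sqL2 (v n)" "\<And>n x. 0 \<le> v n x" "\<And>n x. v n x \<le> M"
    and w: "sqL2 w" "\<And>x. 0 \<le> w x" "\<And>x. w x \<le> M"
    and lim: "(\<lambda>n. \<integral>x. (v n x - w x)\<^sup>2 \<partial>lborel) \<longlonglongrightarrow> 0"
    and G: "continuous_on UNIV G" "G 0 = 0" and L: "L \<ge> 0"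
    and lip: "\<And>s t. 0 \<le> s \<Longrightarrow> s \<le> M \<Longrightarrow> 0 \<le> t \<Longrightarrow> t \<le> M \<Longrightarrow> \<bar>G s - G t\<bar> \<le> L * ((s + t) * \<bar>s - t\<bar>)"
  shows "integrable lborel (\<lambda>x. G (w x))" "(\<lambda>n. \<integral>x. G (v n x) \<partial>lborel) \<longlonglongrightarrow> (\<integral>x. G (w x) \<partial>lborel)"
proof -
  have [measurable]: "G \<in> borel_measurable borel" by (rule borel_measurable_continuous_onI[OF G(1)])
  have M: "M \<ge> 0" using w(2,3)[of 0] by linarith
  have Gi: "integrable lborel (\<lambda>x. G (f x))" if f: "sqL2 f" "\<And>x. 0 \<le> f x" "\<And>x. f x \<le> M" for f :: "real^'n \<Rightarrow> real"
  proof (rule Bochner_Integration.integrable_bound)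
    note [measurable] = sqL2D(1)[OF f(1)]
    show "integrable lborel (\<lambda>x. L * (f x)\<^sup>2)" using sqL2D(2)[OF f(1)] by simp
    show "AE x in lborel. norm (G (f x)) \<le> norm (L * (f x)\<^sup>2)"
    proof (rule AE_I2)
      fix x
      have "\<bar>G (f x) - G 0\<bar> \<le> L * ((f x + 0) * \<bar>f x - 0\<bar>)" by (rule lip) (use f M in auto)
      then show "norm (G (f x)) \<le> norm (L * (f x)\<^sup>2)" using f(2)[of x] G(2) L by (simp add: power2_eq_square)
    qed
    show "(\<lambda>x. G (f x)) \<in> borel_measurable lborel" by measurable
  qed
  show "integrable lborel (\<lambda>x. G (w x))" by (rule Gi[OF w])
  let ?n = "\<lambda>f. \<integral>x. (f x)\<^sup>2 \<partial>(lborel::(real^'n) measure)"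
  have est: "\<bar>(\<integral>x. G (v n x) \<partial>lborel) - (\<integral>x. G (w x) \<partial>lborel)\<bar>
      \<le> L * (sqrt (2 * ?n (\<lambda>x. v n x - w x) + 8 * ?n w) * sqrt (?n (\<lambda>x. v n x - w x)))" for n
  proof -
    have sd: "sqL2 (\<lambda>x. v n x - w x)" by (rule sqL2_diff[OF v(1) w(1)])
    have sda: "sqL2 (\<lambda>x. \<bar>v n x - w x\<bar>)" using sd borel_measurable_abs[OF sqL2D(1)[OF sd]] by (simp add: sqL2_def)
    have ss: "sqL2 (\<lambda>x. v n x + w x)" by (rule sqL2_add[OF v(1) w(1)])
    have "\<bar>(\<integral>x. G (v n x) \<partial>lborel) - (\<integral>x. G (w x) \<partial>lborel)\<bar> = \<bar>\<integral>x. G (v n x) - G (w x) \<partial>lborel\<bar>"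
      using Gi[OF v] Gi[OF w] by simp
    also have "\<dots> \<le> (\<integral>x. \<bar>G (v n x) - G (w x)\<bar> \<partial>lborel)" by (rule integral_abs_bound)
    also have "\<dots> \<le> (\<integral>x. L * ((v n x + w x) * \<bar>v n x - w x\<bar>) \<partial>lborel)"
      by (rule integral_mono) (use Gi[OF v] Gi[OF w] sqL2_mult_integrable[OF ss sda] lip v w in auto)
    also have "\<dots> = L * (\<integral>x. (v n x + w x) * \<bar>v n x - w x\<bar> \<partial>lborel)" by simp
    also have "\<dots> \<le> L * (sqrt (?n (\<lambda>x. v n x + w x)) * sqrt (?n (\<lambda>x. v n x - w x)))"
      using sqL2_Cauchy_Schwarz[OF ss sda] L by (intro mult_left_mono) auto
    also have "\<dots> \<le> L * (sqrt (2 * ?n (\<lambda>x. v n x - w x) + 8 * ?n w) * sqrt (?n (\<lambda>x. v n x - w x)))"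
    proof (intro mult_left_mono mult_right_mono real_sqrt_le_mono L)
      have "?n (\<lambda>x. v n x + w x) \<le> (\<integral>x. 2 * (v n x - w x)\<^sup>2 + 8 * (w x)\<^sup>2 \<partial>lborel)"
      proof (rule integral_mono)
        show "(v n x + w x)\<^sup>2 \<le> 2 * (v n x - w x)\<^sup>2 + 8 * (w x)\<^sup>2" for x
        proof -
          \<comment> \<open>Expanding this square gives the inequality with the constants 2 and
            8.\<close>
          have "0 \<le> (v n x - 3 * w x)\<^sup>2" by simp
          then show ?thesis by (simp add: power2_eq_square algebra_simps)
        qed
      qed (use sqL2D(2)[OF ss] sqL2D(2)[OF sd] sqL2D(2)[OF w(1)] in auto)
      also have "\<dots> = 2 * ?n (\<lambda>x. v n x - w x) + 8 * ?n w" using sqL2D(2)[OF sd] sqL2D(2)[OF w(1)] by simp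
      finally show "?n (\<lambda>x. v n x + w x) \<le> 2 * ?n (\<lambda>x. v n x - w x) + 8 * ?n w" .
    qed auto
    finally show ?thesis .
  qed
  show "(\<lambda>n. \<integral>x. G (v n x) \<partial>lborel) \<longlonglongrightarrow> (\<integral>x. G (w x) \<partial>lborel)"
  proof (rule Lim_null[THEN iffD2], rule Lim_null_comparison)
    show "\<forall>\<^sub>F n in sequentially. norm ((\<integral>x. G (v n x) \<partial>lborel) - (\<integral>x. G (w x) \<partial>lborel))
      \<le> L * (sqrt (2 * ?n (\<lambda>x. v n x - w x) + 8 * ?n w) * sqrt (?n (\<lambda>x. v n x - w x)))"
      using est by (intro always_eventually) simp
    have "(\<lambda>n. L * (sqrt (2 * ?n (\<lambda>x. v n x - w x) + 8 * ?n w) * sqrt (?n (\<lambda>x. v n x - w x)))) \<longlonglongrightarrow> L * (sqrt (2 * 0 + 8 * ?n w) * sqrt 0)"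
      by (intro tendsto_intros lim)
    then show "(\<lambda>n. L * (sqrt (2 * ?n (\<lambda>x. v n x - w x) + 8 * ?n w) * sqrt (?n (\<lambda>x. v n x - w x)))) \<longlonglongrightarrow> 0" by simp
  qed
qed

text \<open>The absolute value is included because approximation and rearrangement work with
  nonnegative functions. It does not raise the energy, and both the mass and the even function F are
  blind to the sign.\<close>

definition trunc :: "real \<Rightarrow> real \<Rightarrow> real" where "trunc M t = min \<bar>t\<bar> M"

lemma trunc_bounds: "M \<ge> 0 \<Longrightarrow> 0 \<le> trunc M t" "trunc M t \<le> M" "trunc M t \<le> \<bar>t\<bar>"
  by (auto simp: trunc_def)

lemma trunc_contraction: "\<bar>trunc M s - trunc M t\<bar> \<le> \<bar>s - t\<bar>"
  by (auto simp: trunc_def min_def)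

lemma sqL2_trunc:
  assumes "sqL2 u" "M \<ge> 0" shows "sqL2 (\<lambda>x. trunc M (u x))"
proof -
  note [measurable] = sqL2D(1)[OF assms(1)]
  have "integrable lborel (\<lambda>x. (trunc M (u x))\<^sup>2)"
  proof (rule Bochner_Integration.integrable_bound[OF sqL2D(2)[OF assms(1)]])
    show "AE x in lborel. norm ((trunc M (u x))\<^sup>2) \<le> norm ((u x)\<^sup>2)"
      using trunc_bounds(1)[OF assms(2)] trunc_bounds(3) by (intro AE_I2) (simp add: abs_le_square_iff[symmetric])
  qed (simp add: trunc_def)
  then show ?thesis by (simp add: sqL2_def trunc_def)
qed

lemma quadratic_Lipschitz_powr:
  fixes r M :: real
  assumes r: "r > 2" and st: "0 \<le> s" "s \<le> M" "0 \<le> t" "t \<le> M"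
  shows "\<bar>\<bar>s\<bar> powr r - \<bar>t\<bar> powr r\<bar> \<le> r * M powr (r - 2) * ((s + t) * \<bar>s - t\<bar>)"
proof (rule quadratic_Lipschitz_MVT[where G'="\<lambda>z. r * z powr (r - 1)", OF _ _ _ _ st])
  show "continuous_on {0..M} (\<lambda>z. \<bar>z\<bar> powr r)"
    using powr_continuous_abs[of r] r by (auto intro: continuous_on_subset)
  show "((\<lambda>z. \<bar>z\<bar> powr r) has_real_derivative r * z powr (r - 1)) (at z)" if "0 < z" for z
  proof -
    have "((\<lambda>z. z powr r) has_real_derivative r * z powr (r - 1)) (at z)" using that by (rule has_real_derivative_powr)
    then show ?thesis
      by (rule has_field_derivative_transform_within_open[where S="{0<..}"]) (use that in auto)
  qed
  show "\<bar>r * z powr (r - 1)\<bar> \<le> r * M powr (r - 2) * z" if z: "0 < z" "z < M" for z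
  proof -
    have "z powr (r - 1) = z powr (r - 2) * z" using z powr_add[of z "r - 2" 1] by simp
    also have "\<dots> \<le> M powr (r - 2) * z" using z r by (auto intro!: mult_right_mono powr_mono2)
    finally show ?thesis using r z by (simp add: mult.assoc)
  qed
  show "0 \<le> r * M powr (r - 2)" using r by simp
qed

text \<open>Truncations are bounded and hence limits of Lipschitz functions, to which the radial
  bound applies. The resulting constant does not depend on the truncation level, and Fatou removes
  the truncation.\<close>

lemma energy_Lp_integrable:
  fixes u :: "real^'n \<Rightarrow> real"
  assumes N3: "CARD('n) \<ge> 3" and s: "2 < s" "s < 2 * real CARD('n) / (real CARD('n) - 2)"
    and u: "sqL2 u" and en: "energy_le u A" "A \<ge> 0"
  shows "integrable lborel (\<lambda>x. \<bar>u x\<bar> powr s)"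
proof -
  obtain K where K: "K \<ge> 0" "\<And>(v::real^'n \<Rightarrow> real) A \<delta>. lip_class v \<Longrightarrow> energy_le v A \<Longrightarrow> A \<ge> 0 \<Longrightarrow> \<delta> > 0
     \<Longrightarrow> (\<integral>x. \<bar>v x\<bar> powr s \<partial>lborel) \<le> K * ((\<integral>x. (v x)\<^sup>2 \<partial>lborel) powr (s/2) * \<delta> powr (- real CARD('n) * (s - 2) / 2)
         + A powr (s/2) * \<delta> powr (real CARD('n) - s * (real CARD('n) - 2) / 2))"
    using radial_Lp_bound[OF N3 s] by metis
  note um[measurable] = sqL2D(1)[OF u]
  define U where "U = (\<integral>x. (u x)\<^sup>2 \<partial>lborel)"
  \<comment> \<open>The radial bound with \<delta> = 1; the summands 1 leave room for the errors of
    the approximants in mass and energy.\<close>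
  define B where "B = K * ((U + 1) powr (s/2) + (A + 1) powr (s/2))"
  have wi: "integrable lborel (\<lambda>x. \<bar>trunc (real n) (u x)\<bar> powr s)" and wB: "(\<integral>x. \<bar>trunc (real n) (u x)\<bar> powr s \<partial>lborel) \<le> B" for n :: nat
  proof -
    let ?M = "real n" and ?w = "\<lambda>x. trunc (real n) (u x)"
    have w: "sqL2 ?w" by (rule sqL2_trunc[OF u]) simp
    have w0: "0 \<le> ?w x" "?w x \<le> ?M" for x by (auto simp: trunc_bounds)
    have wen: "energy_le ?w A" by (rule energy_le_contraction[OF en(1) trunc_contraction])
    obtain v where v: "\<And>k::nat. lip_class (v k)" "\<And>k y. v k y \<le> ?M" "(\<lambda>k. \<integral>x. (v k x - ?w x)\<^sup>2 \<partial>lborel) \<longlonglongrightarrow> 0"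
        "\<And>k. energy_le (v k) (A + 1 / real (Suc k))"
      using lip_approx_seq[OF sqL2D(1)[OF w] w0 sqL2D(2)[OF w] wen en(2)] by blast
    note T = integral_tendsto_bounded_L2[OF lip_class_sqL2[OF v(1)] lip_class_nonneg[OF v(1)] v(2) w w0 v(3), of "\<lambda>z. \<bar>z\<bar> powr s" "s * ?M powr (s - 2)"]
    have Tp: "continuous_on UNIV (\<lambda>z::real. \<bar>z\<bar> powr s)" "\<bar>0::real\<bar> powr s = 0" "s * ?M powr (s - 2) \<ge> 0"
      using s by (auto intro: powr_continuous_abs)
    show "integrable lborel (\<lambda>x. \<bar>?w x\<bar> powr s)" by (rule T(1)[OF Tp quadratic_Lipschitz_powr[OF s(1)]])
    have lim: "(\<lambda>k. \<integral>x. \<bar>v k x\<bar> powr s \<partial>lborel) \<longlonglongrightarrow> (\<integral>x. \<bar>?w x\<bar> powr s \<partial>lborel)"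
      by (rule T(2)[OF Tp quadratic_Lipschitz_powr[OF s(1)]])
    have "(\<lambda>k. \<integral>x. (v k x)\<^sup>2 \<partial>lborel) \<longlonglongrightarrow> (\<integral>x. (?w x)\<^sup>2 \<partial>lborel)"
      by (rule L2_tendsto_square[OF lip_class_sqL2[OF v(1)] w v(3)])
    moreover have "(\<integral>x. (?w x)\<^sup>2 \<partial>lborel) < U + 1"
    proof -
      have "(\<integral>x. (?w x)\<^sup>2 \<partial>lborel) \<le> U"
        unfolding U_def using sqL2D(2)[OF w] sqL2D(2)[OF u] w0 trunc_bounds(3)[of ?M]
        by (intro integral_mono) (auto simp: abs_le_square_iff[symmetric])
      then show ?thesis by simp
    qed
    ultimately have "\<forall>\<^sub>F k in sequentially. (\<integral>x. (v k x)\<^sup>2 \<partial>lborel) < U + 1" by (rule order_tendstoD(2))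
    then have "\<forall>\<^sub>F k in sequentially. (\<integral>x. \<bar>v k x\<bar> powr s \<partial>lborel) \<le> B"
    proof eventually_elim
      case (elim k)
      have "(\<integral>x. \<bar>v k x\<bar> powr s \<partial>lborel) \<le> K * ((\<integral>x. (v k x)\<^sup>2 \<partial>lborel) powr (s/2) * 1 powr (- real CARD('n) * (s - 2) / 2)
         + (A + 1 / real (Suc k)) powr (s/2) * 1 powr (real CARD('n) - s * (real CARD('n) - 2) / 2))"
        by (rule K(2)[OF v(1) v(4)]) (use en in auto)
      also have "\<dots> \<le> B"
        unfolding B_def using elim en s K(1) by (auto intro!: mult_left_mono add_mono powr_mono2)
      finally show ?case .
    qed
    then show "(\<integral>x. \<bar>?w x\<bar> powr s \<partial>lborel) \<le> B"
      using lim by (intro tendsto_upperbound[OF lim]) auto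
  qed
  have "(\<integral>\<^sup>+x. ennreal (\<bar>u x\<bar> powr s) \<partial>lborel) = (\<integral>\<^sup>+x. liminf (\<lambda>n. ennreal (\<bar>trunc (real n) (u x)\<bar> powr s)) \<partial>lborel)"
  proof (rule nn_integral_cong)
    fix x
    obtain N where N: "\<bar>u x\<bar> \<le> real N" using real_arch_simple by blast
    have "\<forall>\<^sub>F n in sequentially. ennreal (\<bar>trunc (real n) (u x)\<bar> powr s) = ennreal (\<bar>u x\<bar> powr s)"
      using eventually_ge_at_top[of N]
    proof eventually_elim
      case (elim n)
      then have "\<bar>u x\<bar> \<le> real n" using N by (meson of_nat_le_iff order_trans)
      then show ?case by (simp add: trunc_def)
    qed
    then have "(\<lambda>n. ennreal (\<bar>trunc (real n) (u x)\<bar> powr s)) \<longlonglongrightarrow> ennreal (\<bar>u x\<bar> powr s)" by (rule tendsto_eventually)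
    then show "ennreal (\<bar>u x\<bar> powr s) = liminf (\<lambda>n. ennreal (\<bar>trunc (real n) (u x)\<bar> powr s))"
      by (intro lim_imp_Liminf[symmetric]) auto
  qed
  also have "\<dots> \<le> liminf (\<lambda>n. \<integral>\<^sup>+x. ennreal (\<bar>trunc (real n) (u x)\<bar> powr s) \<partial>lborel)"
    by (rule nn_integral_liminf) (simp add: trunc_def)
  also have "\<dots> \<le> liminf (\<lambda>n. ennreal B)"
    by (intro Liminf_mono always_eventually allI) (use wi wB in \<open>simp add: nn_integral_eq_integral ennreal_leI\<close>)
  also have "\<dots> < \<infinity>" by (simp add: Liminf_const)
  finally show ?thesis by (intro integrableI_bounded) auto
qed

subsection \<open>The constrained variational problem\<close>

text \<open>\<open>dim\<close> ties the locale to the type 'n and thereby to the dimension.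
  \<open>c1\<close>, \<open>c2\<close> are the constants of the growth condition (i),
  \<open>d1\<close>, \<open>d2\<close> those of the lower bound (ii).\<close>

locale mass_constrained_problem =
  fixes F F' :: "real \<Rightarrow> real" and c1 c2 q p d1 d2 \<gamma> :: real and dim :: "'n::finite itself"
  assumes N3: "CARD('n) \<ge> 3"
    and F_deriv: "\<And>s. (F has_real_derivative F' s) (at s)"
    and F'_cont: "continuous_on UNIV F'"
    and F_even: "\<And>s. F (- s) = F s"
    and F0: "F 0 = 0" "F' 0 = 0"
    and c12: "c1 \<ge> 0" "c2 \<ge> 0"
    and qp: "2 < q" "q \<le> p" "p < 2 * real CARD('n) / (real CARD('n) - 2)"
    and growth: "\<And>s. \<bar>F' s\<bar> \<le> c1 * \<bar>s\<bar> powr (q - 1) + c2 * \<bar>s\<bar> powr (p - 1)"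
    and d12: "d1 \<ge> 0" "d2 \<ge> 0"
    and gam: "\<gamma> < 2 + 4 / real CARD('n)"
    and lower: "\<And>s. F s \<ge> - d1 * s^2 - d2 * \<bar>s\<bar> powr \<gamma>"
begin

section \<open>Growth of the nonlinearity and integrability of the energy density\<close>

lemma N_ge3: "real CARD('n) \<ge> 3" using N3 by simp

lemma q_less: "q < 2 * real CARD('n) / (real CARD('n) - 2)" using qp by simp

lemma F_continuous: "continuous_on UNIV F"
  using F_deriv by (intro continuous_at_imp_continuous_on ballI DERIV_isCont)

lemma F_measurable [measurable]: "F \<in> borel_measurable borel" "F' \<in> borel_measurable borel"
  using F_continuous F'_cont by (auto intro: borel_measurable_continuous_onI)

lemma F_abs: "F \<bar>s\<bar> = F s" by (cases "s \<ge> 0") (auto simp: F_even)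

lemma F_bound: "\<bar>F s\<bar> \<le> c1 * \<bar>s\<bar> powr q + c2 * \<bar>s\<bar> powr p"
proof -
  let ?K = "c1 * \<bar>s\<bar> powr (q - 1) + c2 * \<bar>s\<bar> powr (p - 1)"
  have "norm (F s - F 0) \<le> ?K * norm (s - 0)"
  proof (rule field_differentiable_bound[where S="cball 0 \<bar>s\<bar>" and f'=F'])
    show "norm (F' z) \<le> ?K" if "z \<in> cball 0 \<bar>s\<bar>" for z
    proof -
      have "\<bar>F' z\<bar> \<le> c1 * \<bar>z\<bar> powr (q - 1) + c2 * \<bar>z\<bar> powr (p - 1)" by (rule growth)
      also have "\<dots> \<le> ?K" using that qp c12 by (intro add_mono mult_left_mono powr_mono2) auto
      finally show ?thesis by simp
    qed
  qed (use F_deriv in \<open>auto intro: has_field_derivative_at_within\<close>)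
  then have "\<bar>F s\<bar> \<le> ?K * \<bar>s\<bar>" using F0 by simp
  also have "\<dots> = c1 * \<bar>s\<bar> powr q + c2 * \<bar>s\<bar> powr p"
  proof (cases "s = 0")
    case False
    then have "\<bar>s\<bar> powr (r - 1) * \<bar>s\<bar> = \<bar>s\<bar> powr r" for r
      using powr_add[of "\<bar>s\<bar>" "r - 1" 1] by simp
    then show ?thesis by (simp add: distrib_right mult.assoc)
  qed simp
  finally show ?thesis .
qed

lemma F'_linear_bound:
  assumes "0 < r" "r \<le> M"
  shows "\<bar>F' r\<bar> \<le> (c1 * M powr (q - 2) + c2 * M powr (p - 2)) * r"
proof -
  have e: "\<bar>r\<bar> powr (x - 1) \<le> M powr (x - 2) * r" if "x > 2" for x
  proof -
    have "\<bar>r\<bar> powr (x - 1) = r powr (x - 2) * r" using assms powr_add[of r "x - 2" 1] by simp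
    also have "\<dots> \<le> M powr (x - 2) * r" using assms that by (intro mult_right_mono powr_mono2) auto
    finally show ?thesis .
  qed
  have "\<bar>F' r\<bar> \<le> c1 * \<bar>r\<bar> powr (q - 1) + c2 * \<bar>r\<bar> powr (p - 1)" by (rule growth)
  also have "\<dots> \<le> c1 * (M powr (q - 2) * r) + c2 * (M powr (p - 2) * r)"
    using c12 qp by (intro add_mono mult_left_mono e) auto
  finally show ?thesis by (simp add: distrib_right mult.assoc)
qed

lemma F_quadratic_Lipschitz:
  assumes st: "0 \<le> s" "s \<le> M" "0 \<le> t" "t \<le> M"
  shows "\<bar>F s - F t\<bar> \<le> (c1 * M powr (q - 2) + c2 * M powr (p - 2)) * ((s + t) * \<bar>s - t\<bar>)"
  by (rule quadratic_Lipschitz_MVT[where G'=F', OF _ _ _ _ st])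
     (use F_continuous F_deriv F'_linear_bound c12 in \<open>auto intro: continuous_on_subset\<close>)

lemma F_integrable:
  fixes u :: "real^'n \<Rightarrow> real"
  assumes u: "sqL2 u" "energy_le u A" "A \<ge> 0"
  shows "integrable lborel (\<lambda>x. \<bar>u x\<bar> powr q)" "integrable lborel (\<lambda>x. \<bar>u x\<bar> powr p)" "integrable lborel (\<lambda>x. F (u x))"
proof -
  note [measurable] = sqL2D(1)[OF u(1)]
  show 1: "integrable lborel (\<lambda>x. \<bar>u x\<bar> powr q)" by (rule energy_Lp_integrable[OF N3 _ q_less u]) (use qp in simp)
  show 2: "integrable lborel (\<lambda>x. \<bar>u x\<bar> powr p)" by (rule energy_Lp_integrable[OF N3 _ qp(3) u]) (use qp in simp)
  show "integrable lborel (\<lambda>x. F (u x))"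
  proof (rule Bochner_Integration.integrable_bound)
    show "integrable lborel (\<lambda>x. c1 * \<bar>u x\<bar> powr q + c2 * \<bar>u x\<bar> powr p)" using 1 2 by simp
    show "AE x in lborel. norm (F (u x)) \<le> norm (c1 * \<bar>u x\<bar> powr q + c2 * \<bar>u x\<bar> powr p)"
      using F_bound c12 by (intro AE_I2) simp
  qed measurable
qed

lemma J_H1:
  fixes v :: "real^'n \<Rightarrow> real"
  assumes "v \<in> H1"
  shows "energy_le v (\<integral>x. (norm (wgrad v x))\<^sup>2 \<partial>lborel)" "integrable lborel (\<lambda>x. F (v x))"
    "J F v = (\<integral>x. (norm (wgrad v x))\<^sup>2 \<partial>lborel) / 2 + (\<integral>x. F (v x) \<partial>lborel)"
proof -
  note H = H1_wgrad[OF assms]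
  show en: "energy_le v (\<integral>x. (norm (wgrad v x))\<^sup>2 \<partial>lborel)" by (rule weak_grad_energy_le[OF H])
  show i: "integrable lborel (\<lambda>x. F (v x))" by (rule F_integrable(3)[OF H(1) en]) simp
  show "J F v = (\<integral>x. (norm (wgrad v x))\<^sup>2 \<partial>lborel) / 2 + (\<integral>x. F (v x) \<partial>lborel)"
    by (rule J_eq[OF H i])
qed

text \<open>A is any admissible bound and not the Dirichlet integral itself, so a minimising
  sequence consists of pairs whose bounds pass to the limit. The infimum turns out to be a lower
  bound for J on the whole sphere of radius \<rho> in \<open>H1\<close>.\<close>

definition lip_values :: "real \<Rightarrow> real set" where
  "lip_values \<rho> = {A / 2 + (\<integral>x. F (w x) \<partial>lborel) |A (w::real^'n \<Rightarrow> real). lip_class w \<and> (\<integral>x. (w x)\<^sup>2 \<partial>lborel) = \<rho>\<^sup>2 \<and> energy_le w A \<and> A \<ge> 0}"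

lemma lip_valuesI:
  fixes w :: "real^'n \<Rightarrow> real"
  assumes "lip_class w" "(\<integral>x. (w x)\<^sup>2 \<partial>lborel) = \<rho>\<^sup>2" "energy_le w A" "A \<ge> 0"
  shows "A / 2 + (\<integral>x. F (w x) \<partial>lborel) \<in> lip_values \<rho>"
  using assms unfolding lip_values_def by blast

text \<open>For fixed mass the g-th power of w is bounded by a constant times max(A, 1)^\<theta>
  with \<theta> = N (g - 2) / 4. That \<theta> < 1 says exactly g < 2 + 4/N, and then A/4 plus a
  constant absorbs the term.\<close>

lemma coercive:
  obtains C where "\<And>(w::real^'n \<Rightarrow> real) A. lip_class w \<Longrightarrow> (\<integral>x. (w x)\<^sup>2 \<partial>lborel) = \<rho>\<^sup>2 \<Longrightarrow> energy_le w A \<Longrightarrow> A \<ge> 0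
     \<Longrightarrow> A / 2 + (\<integral>x. F (w x) \<partial>lborel) \<ge> A / 4 - C"
proof -
  \<comment> \<open>\<gamma> may be 2 or less, where the radial bounds do not apply; it is replaced
    by an exponent strictly between 2 and 2 + 4/N.\<close>
  define g where "g = max \<gamma> (2 + 2 / real CARD('n))"
  have "0 < 2 / real CARD('n)" using N_ge3 by simp
  moreover have "2 / real CARD('n) < 4 / real CARD('n)" using N_ge3 by (intro divide_strict_right_mono) auto
  ultimately have g2: "g > 2" "g < 2 + 4 / real CARD('n)" using gam unfolding g_def by linarith+
  have gc: "g < 2 * real CARD('n) / (real CARD('n) - 2)"
  proof -
    have "2 + 4 / real CARD('n) \<le> 2 * real CARD('n) / (real CARD('n) - 2)" using N_ge3 by (simp add: field_simps)
    then show ?thesis using g2 by linarith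
  qed
  \<comment> \<open>For |s| <= 1 raising the exponent makes the power smaller, so there the growth
    condition is used instead: both of its powers are at most s^2.\<close>
  have low: "F s \<ge> - (d1 + c1 + c2) * s\<^sup>2 - d2 * \<bar>s\<bar> powr g" for s
  proof (cases "\<bar>s\<bar> \<le> 1")
    case True
    have le: "\<bar>s\<bar> powr r \<le> s\<^sup>2" if "r \<ge> 2" for r
    proof (cases "s = 0")
      case False
      then have "\<bar>s\<bar> powr r \<le> \<bar>s\<bar> powr 2" using True that by (intro powr_mono') auto
      then show ?thesis using False by (simp add: powr_numeral)
    qed simp
    have "\<bar>F s\<bar> \<le> c1 * s\<^sup>2 + c2 * s\<^sup>2"
      using F_bound[of s] mult_left_mono[OF le[of q] c12(1)] mult_left_mono[OF le[of p] c12(2)] qp by linarith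
    then have "F s \<ge> - (c1 * s\<^sup>2 + c2 * s\<^sup>2)" by linarith
    moreover have "0 \<le> d1 * s\<^sup>2" "0 \<le> d2 * \<bar>s\<bar> powr g" using d12 by auto
    ultimately show ?thesis by (simp add: algebra_simps)
  next
    case False
    then have "\<bar>s\<bar> powr \<gamma> \<le> \<bar>s\<bar> powr g" by (intro powr_mono) (auto simp: g_def)
    then have "d2 * \<bar>s\<bar> powr \<gamma> \<le> d2 * \<bar>s\<bar> powr g" using d12 by (intro mult_left_mono)
    moreover have "0 \<le> (c1 + c2) * s\<^sup>2" using c12 by simp
    ultimately show ?thesis using lower[of s] by (simp add: algebra_simps)
  qed
  obtain K where K: "K \<ge> 0" "\<And>(v::real^'n \<Rightarrow> real) A \<delta>. lip_class v \<Longrightarrow> energy_le v A \<Longrightarrow> A \<ge> 0 \<Longrightarrow> \<delta> > 0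
     \<Longrightarrow> (\<integral>x. \<bar>v x\<bar> powr g \<partial>lborel) \<le> K * ((\<integral>x. (v x)\<^sup>2 \<partial>lborel) powr (g/2) * \<delta> powr (- real CARD('n) * (g - 2) / 2)
         + A powr (g/2) * \<delta> powr (real CARD('n) - g * (real CARD('n) - 2) / 2))"
    using radial_Lp_bound[OF N3 g2(1) gc] by metis
  define \<theta> where "\<theta> = real CARD('n) * (g - 2) / 4"
  have \<theta>: "\<theta> > 0" "\<theta> < 1" using g2 N_ge3 by (auto simp: \<theta>_def field_simps)
  define D where "D = d2 * (K * ((\<rho>\<^sup>2) powr (g/2) + 1))"
  have D0: "D \<ge> 0" using d12 K by (simp add: D_def add_nonneg_nonneg)
  \<comment> \<open>From \<open>a0\<close> on the sublinear term D a^\<theta> is at most a/4; before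
    it, the term is at most its value at \<open>a0\<close>.\<close>
  define a0 where "a0 = (4 * D + 1) powr (1 / (1 - \<theta>))"
  define C where "C = (d1 + c1 + c2) * \<rho>\<^sup>2 + D * a0 powr \<theta> + 1/4"
  have Young: "D * a powr \<theta> \<le> a / 4 + D * a0 powr \<theta>" if a: "a \<ge> 1" for a
  proof (cases "a \<ge> a0")
    case True
    have "4 * D + 1 = a0 powr (1 - \<theta>)" unfolding a0_def using D0 \<theta> by (simp add: powr_powr)
    also have "\<dots> \<le> a powr (1 - \<theta>)" using True \<theta> by (intro powr_mono2) (auto simp: a0_def)
    finally have "4 * D * a powr \<theta> \<le> a powr (1 - \<theta>) * a powr \<theta>" by (intro mult_right_mono) auto
    also have "\<dots> = a" using a by (simp add: powr_add[symmetric])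
    finally show ?thesis using D0 by (simp add: add_increasing2)
  next
    case False
    then have "D * a powr \<theta> \<le> D * a0 powr \<theta>" using a \<theta> D0 by (intro mult_left_mono powr_mono2) auto
    then show ?thesis using a by linarith
  qed
  show ?thesis
  proof (rule that[of C])
    fix w :: "real^'n \<Rightarrow> real" and A assume w: "lip_class w" "(\<integral>x. (w x)\<^sup>2 \<partial>lborel) = \<rho>\<^sup>2" "energy_le w A" "A \<ge> 0"
    define a where "a = max A 1"
    have a: "a \<ge> 1" "a \<le> A + 1" using w by (auto simp: a_def)
    have en: "energy_le w a" by (rule energy_le_mono[OF w(3)]) (simp add: a_def)
    \<comment> \<open>This radius balances the radial bound: both of its terms become multiples of
      a^\<theta>. Taking a = max(A, 1) keeps the radius well defined for A = 0.\<close>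
    define \<delta> where "\<delta> = a powr (- 1/2)"
    have \<delta>: "\<delta> > 0" using a by (simp add: \<delta>_def)
    have "(\<integral>x. \<bar>w x\<bar> powr g \<partial>lborel) \<le> K * ((\<rho>\<^sup>2) powr (g/2) * \<delta> powr (- real CARD('n) * (g - 2) / 2) + a powr (g/2) * \<delta> powr (real CARD('n) - g * (real CARD('n) - 2) / 2))"
      using K(2)[OF w(1) en _ \<delta>] a w(2) by simp
    also have "\<delta> powr (- real CARD('n) * (g - 2) / 2) = a powr \<theta>"
    proof -
      have "(- 1/2) * (- real CARD('n) * (g - 2) / 2) = \<theta>" by (simp add: \<theta>_def)
      then show ?thesis unfolding \<delta>_def by (simp only: powr_powr)
    qed
    also have "a powr (g/2) * \<delta> powr (real CARD('n) - g * (real CARD('n) - 2) / 2) = a powr \<theta>"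
    proof -
      have "g/2 + (- 1/2) * (real CARD('n) - g * (real CARD('n) - 2) / 2) = \<theta>" by (simp add: \<theta>_def field_simps)
      then show ?thesis unfolding \<delta>_def by (simp only: powr_powr powr_add[symmetric])
    qed
    finally have "(\<integral>x. \<bar>w x\<bar> powr g \<partial>lborel) \<le> K * ((\<rho>\<^sup>2) powr (g/2) + 1) * a powr \<theta>" by (simp add: algebra_simps)
    then have "d2 * (\<integral>x. \<bar>w x\<bar> powr g \<partial>lborel) \<le> d2 * (K * ((\<rho>\<^sup>2) powr (g/2) + 1) * a powr \<theta>)"
      using d12 by (intro mult_left_mono)
    also have "\<dots> = D * a powr \<theta>" by (simp add: D_def mult_ac)
    also have "\<dots> \<le> a / 4 + D * a0 powr \<theta>" by (rule Young[OF a(1)])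
    finally have pw: "d2 * (\<integral>x. \<bar>w x\<bar> powr g \<partial>lborel) \<le> a / 4 + D * a0 powr \<theta>" .
    have w2: "integrable lborel (\<lambda>x. (w x)\<^sup>2)" by (rule lip_class_square_integrable[OF w(1)])
    have wg: "integrable lborel (\<lambda>x. \<bar>w x\<bar> powr g)"
      by (rule lip_class_integrable[OF w(1) powr_continuous_abs]) (use g2 in auto)
    have wF: "integrable lborel (\<lambda>x. F (w x))" by (rule lip_class_integrable[OF w(1) F_continuous F0(1)])
    have "- (d1 + c1 + c2) * \<rho>\<^sup>2 - d2 * (\<integral>x. \<bar>w x\<bar> powr g \<partial>lborel) = (\<integral>x. - (d1 + c1 + c2) * (w x)\<^sup>2 - d2 * \<bar>w x\<bar> powr g \<partial>lborel)"
      using w2 wg w(2) by simp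
    also have "\<dots> \<le> (\<integral>x. F (w x) \<partial>lborel)"
      by (rule integral_mono) (use w2 wg wF low in auto)
    finally show "A / 2 + (\<integral>x. F (w x) \<partial>lborel) \<ge> A / 4 - C"
      using pw a(2) unfolding C_def by (simp add: algebra_simps)
  qed
qed

lemma lip_values_bdd: "bdd_below (lip_values \<rho>)"
proof -
  obtain C where C: "\<And>(w::real^'n \<Rightarrow> real) A. lip_class w \<Longrightarrow> (\<integral>x. (w x)\<^sup>2 \<partial>lborel) = \<rho>\<^sup>2 \<Longrightarrow> energy_le w A \<Longrightarrow> A \<ge> 0
     \<Longrightarrow> A / 2 + (\<integral>x. F (w x) \<partial>lborel) \<ge> A / 4 - C"
    using coercive by blast
  show ?thesis
  proof (rule bdd_belowI)
    fix y assume "y \<in> lip_values \<rho>"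
    then show "- C \<le> y" unfolding lip_values_def using C by fastforce
  qed
qed

text \<open>The Lipschitz approximants of w do not have mass \<rho>; each is multiplied by the
  factor that restores it, and these factors converge to a.\<close>

lemma Inf_lip_values_le_bounded:
  fixes w :: "real^'n \<Rightarrow> real"
  assumes \<rho>: "\<rho> > 0" and w: "sqL2 w" "\<And>x. 0 \<le> w x" "\<And>x. w x \<le> M" and en: "energy_le w A" "A \<ge> 0"
    and pos: "(\<integral>x. (w x)\<^sup>2 \<partial>lborel) > 0"
  defines "a \<equiv> \<rho> / sqrt (\<integral>x. (w x)\<^sup>2 \<partial>lborel)"
  shows "Inf (lip_values \<rho>) \<le> a\<^sup>2 * A / 2 + (\<integral>x. F (a * w x) \<partial>lborel)"
proof -
  let ?n = "\<lambda>f. \<integral>x. (f x)\<^sup>2 \<partial>(lborel::(real^'n) measure)"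
  obtain v where v: "\<And>k::nat. lip_class (v k)" "\<And>k y. v k y \<le> M" "(\<lambda>k. ?n (\<lambda>x. v k x - w x)) \<longlonglongrightarrow> 0"
      "\<And>k. energy_le (v k) (A + 1 / real (Suc k))"
    using lip_approx_seq[OF sqL2D(1)[OF w(1)] w(2,3) sqL2D(2)[OF w(1)] en] by blast
  have M: "M \<ge> 0" using w(2,3)[of 0] by linarith
  have a: "a > 0" using \<rho> pos by (simp add: a_def)
  have vn: "(\<lambda>k. ?n (v k)) \<longlonglongrightarrow> ?n w" by (rule L2_tendsto_square[OF lip_class_sqL2[OF v(1)] w(1) v(3)])
  define b where "b k = \<rho> / sqrt (?n (v k))" for k
  have b: "b \<longlonglongrightarrow> a" unfolding b_def a_def using pos by (intro tendsto_intros vn) auto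
  have ev: "\<forall>\<^sub>F k in sequentially. ?n (v k) > 0 \<and> b k < a + 1"
    by (intro eventually_conj order_tendstoD(1)[OF vn pos] order_tendstoD(2)[OF b]) auto
  then obtain k0 where k0: "\<And>k. k \<ge> k0 \<Longrightarrow> ?n (v k) > 0 \<and> b k < a + 1" by (auto simp: eventually_sequentially)
  \<comment> \<open>The shift by \<open>k0\<close> discards the finitely many approximants whose
    mass may vanish or whose factor may be large.\<close>
  define V where "V k x = b (k + k0) * v (k + k0) x" for k x
  have bp: "b (k + k0) > 0" "b (k + k0) < a + 1" for k using k0[of "k + k0"] \<rho> by (auto simp: b_def)
  have V: "lip_class (V k)" for k unfolding V_def using bp[of k] by (intro lip_class_cmult v) auto
  have Vn: "?n (V k) = \<rho>\<^sup>2" for k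
  proof -
    have "?n (V k) = (b (k + k0))\<^sup>2 * ?n (v (k + k0))" by (simp add: V_def power_mult_distrib)
    then show ?thesis using k0[of "k + k0"] by (simp add: b_def power_divide)
  qed
  have Ven: "energy_le (V k) ((b (k + k0))\<^sup>2 * (A + 1 / real (Suc (k + k0))))" for k
    unfolding V_def by (rule energy_le_cmult[OF lip_class_measurable[OF v(1)] v(4)])
  have VM: "0 \<le> V k x" "V k x \<le> (a + 1) * M" for k x
    unfolding V_def using bp[of k] v(2)[of "k + k0" x] lip_class_nonneg[OF v(1), of "k + k0" x] M by (auto intro!: mult_mono)
  have aw: "sqL2 (\<lambda>x. a * w x)" "\<And>x. 0 \<le> a * w x" "\<And>x. a * w x \<le> (a + 1) * M"
    using w a M by (auto intro!: sqL2_cmult mult_mono)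
  have Vlim: "(\<lambda>k. ?n (\<lambda>x. V k x - a * w x)) \<longlonglongrightarrow> 0"
  proof (rule Lim_null_comparison)
    let ?e = "\<lambda>k. 2 * (b (k + k0))\<^sup>2 * ?n (\<lambda>x. v (k + k0) x - w x) + 2 * (b (k + k0) - a)\<^sup>2 * ?n w"
    show "\<forall>\<^sub>F k in sequentially. norm (?n (\<lambda>x. V k x - a * w x)) \<le> ?e k"
    proof (rule always_eventually, rule allI)
      fix k
      have i: "integrable lborel (\<lambda>x. (v (k + k0) x - w x)\<^sup>2)" by (rule sqL2D(2)[OF sqL2_diff[OF lip_class_sqL2[OF v(1)] w(1)]])
      have "?n (\<lambda>x. V k x - a * w x) \<le> (\<integral>x. 2 * (b (k + k0))\<^sup>2 * (v (k + k0) x - w x)\<^sup>2 + 2 * (b (k + k0) - a)\<^sup>2 * (w x)\<^sup>2 \<partial>lborel)"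
      proof (rule integral_mono)
        show "integrable lborel (\<lambda>x. (V k x - a * w x)\<^sup>2)" by (rule sqL2D(2)[OF sqL2_diff[OF lip_class_sqL2[OF V] aw(1)]])
        show "(V k x - a * w x)\<^sup>2 \<le> 2 * (b (k + k0))\<^sup>2 * (v (k + k0) x - w x)\<^sup>2 + 2 * (b (k + k0) - a)\<^sup>2 * (w x)\<^sup>2" for x
        proof -
          define y z where "y = b (k + k0) * (v (k + k0) x - w x)" and "z = (b (k + k0) - a) * w x"
          have "V k x - a * w x = y + z" by (simp add: V_def y_def z_def algebra_simps)
          moreover have "(y + z)\<^sup>2 \<le> 2 * y\<^sup>2 + 2 * z\<^sup>2" using sum_squares_bound[of y z] by (simp add: power2_sum)
          ultimately show ?thesis by (simp add: y_def z_def power_mult_distrib)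
        qed
      qed (use i sqL2D(2)[OF w(1)] in auto)
      also have "\<dots> = ?e k" using i sqL2D(2)[OF w(1)] by simp
      finally show "norm (?n (\<lambda>x. V k x - a * w x)) \<le> ?e k" by simp
    qed
    have "?e \<longlonglongrightarrow> 2 * a\<^sup>2 * 0 + 2 * (a - a)\<^sup>2 * ?n w"
      by (intro tendsto_intros LIMSEQ_ignore_initial_segment[OF b] LIMSEQ_ignore_initial_segment[OF v(3)])
    then show "?e \<longlonglongrightarrow> 0" by simp
  qed
  let ?M = "(a + 1) * M" and ?L = "c1 * ((a + 1) * M) powr (q - 2) + c2 * ((a + 1) * M) powr (p - 2)"
  have FV: "(\<lambda>k. \<integral>x. F (V k x) \<partial>lborel) \<longlonglongrightarrow> (\<integral>x. F (a * w x) \<partial>lborel)"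
    by (rule integral_tendsto_bounded_L2(2)[OF lip_class_sqL2[OF V] VM aw Vlim F_continuous F0(1) _ F_quadratic_Lipschitz]) (use c12 in auto)
  have "(\<lambda>k. (b (k + k0))\<^sup>2 * (A + 1 / real (Suc (k + k0))) / 2 + (\<integral>x. F (V k x) \<partial>lborel)) \<longlonglongrightarrow> a\<^sup>2 * (A + 0) / 2 + (\<integral>x. F (a * w x) \<partial>lborel)"
  proof (intro tendsto_intros FV LIMSEQ_ignore_initial_segment[OF b])
    show "(\<lambda>k. 1 / real (Suc (k + k0))) \<longlonglongrightarrow> 0"
      by (rule LIMSEQ_ignore_initial_segment[of "\<lambda>k. 1 / real (Suc k)"])
         (use LIMSEQ_inverse_real_of_nat in \<open>simp add: inverse_eq_divide\<close>)
  qed auto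
  moreover have "Inf (lip_values \<rho>) \<le> (b (k + k0))\<^sup>2 * (A + 1 / real (Suc (k + k0))) / 2 + (\<integral>x. F (V k x) \<partial>lborel)" for k
    by (rule cInf_lower[OF lip_valuesI[OF V Vn Ven] lip_values_bdd]) (use en in simp)
  ultimately have "Inf (lip_values \<rho>) \<le> a\<^sup>2 * (A + 0) / 2 + (\<integral>x. F (a * w x) \<partial>lborel)"
    by (intro LIMSEQ_le_const) auto
  then show ?thesis by simp
qed

text \<open>The truncations of |v| are bounded and keep the energy bound of v, so the preceding
  lemma applies to them; truncation and normalising factor disappear in the limit, and F(|v|) =
  F(v).\<close>

lemma Inf_lip_values_le_J:
  fixes v :: "real^'n \<Rightarrow> real"
  assumes \<rho>: "\<rho> > 0" and v: "v \<in> H1" "L2norm v = \<rho>"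
  shows "Inf (lip_values \<rho>) \<le> J F v"
proof -
  note H = H1_wgrad[OF v(1)] and JH = J_H1[OF v(1)]
  note vm[measurable] = sqL2D(1)[OF H(1)]
  define A where "A = (\<integral>x. (norm (wgrad v x))\<^sup>2 \<partial>lborel)"
  have A: "A \<ge> 0" "energy_le v A" using JH(1) by (auto simp: A_def)
  let ?n = "\<lambda>f. \<integral>x. (f x)\<^sup>2 \<partial>(lborel::(real^'n) measure)"
  have vn: "?n v = \<rho>\<^sup>2" using v(2) unfolding L2norm_def by (metis real_sqrt_pow2 integral_nonneg_AE AE_I2 zero_le_power2)
  define w where "w n x = trunc (real n) (v x)" for n :: nat and x
  have w: "sqL2 (w n)" for n unfolding w_def by (rule sqL2_trunc[OF H(1)]) simp
  have w0: "0 \<le> w n x" "w n x \<le> real n" "w n x \<le> \<bar>v x\<bar>" for n x by (auto simp: w_def trunc_bounds)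
  have wen: "energy_le (w n) A" for n unfolding w_def by (rule energy_le_contraction[OF A(2) trunc_contraction])
  have wlim: "(\<lambda>n. w n x) \<longlonglongrightarrow> \<bar>v x\<bar>" for x
  proof (rule tendsto_eventually)
    obtain n0 where n0: "\<bar>v x\<bar> \<le> real n0" using real_arch_simple by blast
    show "\<forall>\<^sub>F n in sequentially. w n x = \<bar>v x\<bar>"
      using eventually_ge_at_top[of n0]
    proof eventually_elim
      case (elim n)
      then have "\<bar>v x\<bar> \<le> real n" using n0 by (meson of_nat_le_iff order_trans)
      then show ?case by (simp add: w_def trunc_def)
    qed
  qed
  have wn: "(\<lambda>n. ?n (w n)) \<longlonglongrightarrow> \<rho>\<^sup>2"
    unfolding vn[symmetric]
  proof (rule integral_dominated_convergence[where w="\<lambda>x. (v x)\<^sup>2"])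
    show "AE x in lborel. (\<lambda>n. (w n x)\<^sup>2) \<longlonglongrightarrow> (v x)\<^sup>2"
      using tendsto_power[OF wlim, of _ 2] by simp
    show "AE x in lborel. norm ((w n x)\<^sup>2) \<le> (v x)\<^sup>2" for n
      using w0 by (intro AE_I2) (simp add: abs_le_square_iff[symmetric])
  qed (use sqL2D[OF w] sqL2D[OF H(1)] in auto)
  define a where "a n = \<rho> / sqrt (?n (w n))" for n
  have "a \<longlonglongrightarrow> \<rho> / sqrt (\<rho>\<^sup>2)" unfolding a_def using \<rho> by (intro tendsto_intros wn) auto
  then have a: "a \<longlonglongrightarrow> 1" using \<rho> by simp
  have \<rho>2: "\<rho>\<^sup>2 > 0" using \<rho> by simp
  have "\<forall>\<^sub>F n in sequentially. ?n (w n) > 0 \<and> a n < 2"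
    by (intro eventually_conj order_tendstoD(1)[OF wn \<rho>2] order_tendstoD(2)[OF a]) auto
  then obtain n0 where n0: "\<And>n. n \<ge> n0 \<Longrightarrow> ?n (w n) > 0 \<and> a n < 2" by (auto simp: eventually_sequentially)
  have le: "Inf (lip_values \<rho>) \<le> (a (n + n0))\<^sup>2 * A / 2 + (\<integral>x. F (a (n + n0) * w (n + n0) x) \<partial>lborel)" for n
    unfolding a_def using n0[of "n + n0"] by (intro Inf_lip_values_le_bounded[OF \<rho> w w0(1,2) wen A(1)]) auto
  note Fi = F_integrable[OF H(1) A(2,1)]
  have "(\<lambda>n. \<integral>x. F (a (n + n0) * w (n + n0) x) \<partial>lborel) \<longlonglongrightarrow> (\<integral>x. F (v x) \<partial>lborel)"
  \<comment> \<open>The factors \<open>2 powr q\<close> and \<open>2 powr p\<close> come from the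
    bound 2 on the normalising factors.\<close>
  proof (rule integral_dominated_convergence[where w="\<lambda>x. c1 * 2 powr q * \<bar>v x\<bar> powr q + c2 * 2 powr p * \<bar>v x\<bar> powr p"])
    show "integrable lborel (\<lambda>x. c1 * 2 powr q * \<bar>v x\<bar> powr q + c2 * 2 powr p * \<bar>v x\<bar> powr p)" using Fi by simp
    show "(\<lambda>x. F (a (n + n0) * w (n + n0) x)) \<in> borel_measurable lborel" for n
      using sqL2D(1)[OF w] by measurable
    show "AE x in lborel. (\<lambda>n. F (a (n + n0) * w (n + n0) x)) \<longlonglongrightarrow> F (v x)"
    proof (rule AE_I2)
      fix x
      have "(\<lambda>n. a (n + n0) * w (n + n0) x) \<longlonglongrightarrow> 1 * \<bar>v x\<bar>"
        by (intro tendsto_intros LIMSEQ_ignore_initial_segment[OF a] LIMSEQ_ignore_initial_segment[OF wlim])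
      moreover have "isCont F (1 * \<bar>v x\<bar>)" using F_deriv by (rule DERIV_isCont)
      ultimately have "(\<lambda>n. F (a (n + n0) * w (n + n0) x)) \<longlonglongrightarrow> F (1 * \<bar>v x\<bar>)" by (metis isCont_tendsto_compose)
      then show "(\<lambda>n. F (a (n + n0) * w (n + n0) x)) \<longlonglongrightarrow> F (v x)" by (simp add: F_abs)
    qed
    show "AE x in lborel. norm (F (a (n + n0) * w (n + n0) x)) \<le> c1 * 2 powr q * \<bar>v x\<bar> powr q + c2 * 2 powr p * \<bar>v x\<bar> powr p" for n
    proof (rule AE_I2)
      fix x
      have a2: "0 < a (n + n0)" "a (n + n0) < 2" using n0[of "n + n0"] \<rho> by (auto simp: a_def)
      have "\<bar>a (n + n0) * w (n + n0) x\<bar> \<le> 2 * \<bar>v x\<bar>"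
        using a2 w0[of "n + n0" x] by (auto simp: abs_mult intro!: mult_mono)
      then have "\<bar>a (n + n0) * w (n + n0) x\<bar> powr r \<le> (2 * \<bar>v x\<bar>) powr r" if "r > 0" for r
        using that by (intro powr_mono2) auto
      then have *: "\<bar>a (n + n0) * w (n + n0) x\<bar> powr r \<le> 2 powr r * \<bar>v x\<bar> powr r" if "r > 0" for r
        using that by (simp add: powr_mult)
      have "\<bar>F (a (n + n0) * w (n + n0) x)\<bar> \<le> c1 * \<bar>a (n + n0) * w (n + n0) x\<bar> powr q + c2 * \<bar>a (n + n0) * w (n + n0) x\<bar> powr p"
        by (rule F_bound)
      also have "\<dots> \<le> c1 * (2 powr q * \<bar>v x\<bar> powr q) + c2 * (2 powr p * \<bar>v x\<bar> powr p)"
        using c12 qp by (intro add_mono mult_left_mono *) auto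
      finally show "norm (F (a (n + n0) * w (n + n0) x)) \<le> c1 * 2 powr q * \<bar>v x\<bar> powr q + c2 * 2 powr p * \<bar>v x\<bar> powr p"
        by (simp add: mult.assoc)
    qed
  qed measurable
  then have "(\<lambda>n. (a (n + n0))\<^sup>2 * A / 2 + (\<integral>x. F (a (n + n0) * w (n + n0) x) \<partial>lborel)) \<longlonglongrightarrow> 1\<^sup>2 * A / 2 + (\<integral>x. F (v x) \<partial>lborel)"
    by (intro tendsto_intros LIMSEQ_ignore_initial_segment[OF a]) auto
  then have "Inf (lip_values \<rho>) \<le> 1\<^sup>2 * A / 2 + (\<integral>x. F (v x) \<partial>lborel)"
    by (rule LIMSEQ_le_const) (use le in auto)
  then show ?thesis unfolding JH(3) by (simp add: A_def)
qed

end

section \<open>Compactness of radially decreasing functions\<close>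

lemma lip_class_tent: "lip_class (tent :: 'a::euclidean_space \<Rightarrow> real)"
  unfolding lip_class_def
proof (intro conjI exI[of _ 1])
  show "\<forall>x. 1 \<le> norm x \<longrightarrow> tent (x::'a) = 0" by (simp add: tent_def)
qed (use tent_Lipschitz in auto)

text \<open>Makes the exceptional radii in Helly's theorem, the discontinuities of a monotone
  function, negligible.\<close>

lemma AE_norm_not_countable:
  assumes "countable D" shows "AE x in lborel. norm (x::'a::euclidean_space) \<notin> D"
proof -
  have [measurable]: "D \<in> sets borel" by (rule sets.countable[OF _ assms]) simp
  have "(\<integral>\<^sup>+x. indicator D (norm (x::'a)) \<partial>lborel)
    = (\<integral>\<^sup>+r. ennreal (real DIM('a) * unit_ball_vol (real DIM('a)) * r ^ (DIM('a) - 1)) * indicator {0..} r * indicator D r \<partial>lborel)"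
    by (rule nn_integral_norm) measurable
  also have "\<dots> = (\<integral>\<^sup>+r. 0 \<partial>(lborel::real measure))"
  proof (rule nn_integral_cong_AE)
    have "AE r in lborel. r \<notin> D" by (rule AE_not_in[OF countable_imp_null_set_lborel[OF assms]])
    then show "AE r in lborel. ennreal (real DIM('a) * unit_ball_vol (real DIM('a)) * r ^ (DIM('a) - 1)) * indicator {0..} r * indicator D r = 0"
      by eventually_elim simp
  qed
  finally have "(\<integral>\<^sup>+x. indicator D (norm (x::'a)) \<partial>lborel) = 0" by simp
  then have "AE x in lborel. indicator D (norm (x::'a)) = (0::ennreal)"
    by (subst (asm) nn_integral_0_iff_AE) auto
  then show ?thesis by eventually_elim (auto simp: indicator_def split: if_splits)
qed

lemma exists_notin_countable_interval:
  fixes a b :: real assumes "countable D" "a < b" obtains t where "a < t" "t < b" "t \<notin> D"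
  using assms uncountable_open_interval[of a b] countable_subset[of "{a<..<b}" D] by fastforce

text \<open>Helly's selection theorem, transported to possibly unbounded functions by s \<open>\<mapsto>\<close> s / (1 + s).\<close>

lemma radial_Helly:
  fixes V :: "nat \<Rightarrow> 'a::euclidean_space \<Rightarrow> real" and B :: "real \<Rightarrow> real"
  assumes lip: "\<And>n. lip_class (V n)" and rad: "\<And>n. radial_decr (V n)"
    and bd: "\<And>n x. x \<noteq> 0 \<Longrightarrow> V n x \<le> B (norm x)"
  shows "\<exists>s u. strict_mono (s::nat \<Rightarrow> nat) \<and> u \<in> borel_measurable borel \<and> (\<forall>x. 0 \<le> u x) \<and>
    (\<forall>x y. x \<noteq> 0 \<longrightarrow> norm x \<le> norm y \<longrightarrow> u y \<le> u x) \<and> (AE x in lborel. (\<lambda>n. V (s n) x) \<longlonglongrightarrow> u x)"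
proof -
  obtain e :: 'a where e: "norm e = 1" using norm_Basis SOME_Basis by blast
  \<comment> \<open>The profile along one ray. \<open>max t 0\<close> extends it by a constant to
    negative t, because the selection theorem concerns functions on the whole line.\<close>
  define h where "h n t = V n (max t 0 *\<^sub>R e)" for n t
  have h0: "h n t \<ge> 0" for n t unfolding h_def by (rule lip_class_nonneg[OF lip])
  have hV: "V n x = h n (norm x)" for n x
  proof -
    have eq: "norm (norm x *\<^sub>R e) = norm x" using e by simp
    have "V n x \<le> V n (norm x *\<^sub>R e)" "V n (norm x *\<^sub>R e) \<le> V n x"
      by (rule rad[of n, unfolded radial_decr_def, rule_format], simp only: eq)+
    then show ?thesis unfolding h_def by simp
  qed
  have hmono: "h n t' \<le> h n t" if "t \<le> t'" for n t t'
    unfolding h_def using rad[of n] e that by (simp add: radial_decr_def)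
  have hc: "continuous_on UNIV (h n)" for n
    unfolding h_def by (intro continuous_on_compose2[OF lip_class_continuous[OF lip]] continuous_intros) auto
  \<comment> \<open>The sign turns decreasing profiles into increasing ones; the values lie in (-1,
    0].\<close>
  define f where "f n t = - (h n t / (1 + h n t))" for n t
  have f1: "- 1 < f n t" "f n t \<le> 0" for n t using h0[of n t] by (auto simp: f_def field_simps)
  have T_mono: "s / (1 + s) \<le> s' / (1 + s')" if "0 \<le> s" "s \<le> s'" for s s' :: real
    using that by (simp add: field_simps)
  have "\<exists>s. strict_mono (s::nat \<Rightarrow> nat) \<and> (\<exists>G. (\<forall>x. continuous (at_right x) G) \<and> mono G \<and> (\<forall>x. \<bar>G x\<bar> \<le> 1) \<and>
    (\<forall>x. continuous (at x) G \<longrightarrow> (\<lambda>n. f (s n) x) \<longlonglongrightarrow> G x))"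
  proof (rule Helly_selection)
    show "continuous (at_right x) (f n)" for n x
    proof -
      have "1 + h n t \<noteq> 0" for t using h0[of n t] by linarith
      then have "continuous_on UNIV (f n)" unfolding f_def by (intro continuous_intros hc) auto
      then show ?thesis by (simp add: continuous_on_eq_continuous_at continuous_at_imp_continuous_at_within)
    qed
    show "mono (f n)" for n unfolding f_def by (intro monoI le_imp_neg_le T_mono h0 hmono)
    show "\<bar>f n x\<bar> \<le> 1" for n x using f1[of n x] by auto
  qed
  then obtain s G where s: "strict_mono (s::nat \<Rightarrow> nat)" and G: "mono G" "\<And>x. continuous (at x) G \<Longrightarrow> (\<lambda>n. f (s n) x) \<longlonglongrightarrow> G x"
    by blast
  define D where "D = {t. \<not> continuous (at t) G}"
  have D: "countable D" unfolding D_def using mono_ctble_discont[OF G(1)] by (simp add: continuous_at)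
  have Glim: "(\<lambda>n. f (s n) t) \<longlonglongrightarrow> G t" if "t \<notin> D" for t using that G(2) by (simp add: D_def)
  have G0: "G t \<le> 0" for t
  proof -
    obtain t' where "t < t'" "t' \<notin> D" using exists_notin_countable_interval[OF D, of t "t + 1"] by auto
    then have "G t \<le> G t'" "G t' \<le> 0" using monoD[OF G(1)] f1 by (auto intro!: LIMSEQ_le_const2[OF Glim])
    then show ?thesis by linarith
  qed
  \<comment> \<open>The value -1 would correspond to an infinite limit. The common bound B at a
    smaller radius where G is continuous excludes it.\<close>
  have Gm1: "- 1 < G t" if t: "t > 0" for t
  proof -
    obtain t' where t': "0 < t'" "t' < t" "t' \<notin> D" using exists_notin_countable_interval[OF D t] by blast
    define b where "b = max 0 (B t')"
    have "- (b / (1 + b)) \<le> f (s n) t'" for n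
    proof -
      have "h (s n) t' = V (s n) (t' *\<^sub>R e)" using t' by (simp add: h_def)
      also have "\<dots> \<le> B (norm (t' *\<^sub>R e))" by (rule bd) (use t' e in auto)
      finally have "h (s n) t' \<le> b" using e t' by (simp add: b_def)
      then show ?thesis unfolding f_def by (intro le_imp_neg_le T_mono h0)
    qed
    then have "- (b / (1 + b)) \<le> G t'" by (intro LIMSEQ_le_const[OF Glim[OF t'(3)]]) auto
    moreover have "b / (1 + b) < 1" by (simp add: b_def field_simps)
    moreover have "G t' \<le> G t" using monoD[OF G(1)] t' by simp
    ultimately show ?thesis by linarith
  qed
  \<comment> \<open>Inverts s / (1 + s). The 0 at the origin is a default value, since nothing
    bounds the sequence there.\<close>
  define u where "u x = (if x = 0 then 0 else - G (norm x) / (1 + G (norm x)))" for x :: 'a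
  have [measurable]: "G \<in> borel_measurable borel" by (rule borel_measurable_mono[OF G(1)])
  have "u \<in> borel_measurable borel" unfolding u_def by measurable
  moreover have "0 \<le> u x" for x
  proof (cases "x = 0")
    case False
    then show ?thesis using G0[of "norm x"] Gm1[of "norm x"] by (simp add: u_def divide_nonpos_pos)
  qed (simp add: u_def)
  moreover have "u y \<le> u x" if x: "x \<noteq> 0" and xy: "norm x \<le> norm y" for x y
  proof -
    have y: "y \<noteq> 0" using x xy by auto
    have g: "- 1 < G (norm x)" "G (norm x) \<le> G (norm y)" using Gm1 x monoD[OF G(1) xy] by auto
    then have "- G (norm y) / (1 + G (norm y)) \<le> - G (norm x) / (1 + G (norm x))" by (simp add: field_simps)
    then show ?thesis using x y by (simp add: u_def)
  qed
  moreover have "AE x in lborel. (\<lambda>n. V (s n) x) \<longlonglongrightarrow> u x"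
    using AE_norm_not_countable[OF D] AE_lborel_singleton[of "0::'a"]
  proof eventually_elim
    case (elim x)
    have lim: "(\<lambda>n. - f (s n) (norm x) / (1 + f (s n) (norm x))) \<longlonglongrightarrow> - G (norm x) / (1 + G (norm x))"
      using Gm1[of "norm x"] elim by (intro tendsto_intros Glim) auto
    have "- f (s n) (norm x) / (1 + f (s n) (norm x)) = V (s n) x" for n
      using h0[of "s n" "norm x"] unfolding hV f_def by (simp add: field_simps)
    then show ?case using lim elim by (simp add: u_def)
  qed
  ultimately show ?thesis using s by blast
qed

context mass_constrained_problem
begin

section \<open>A relaxed minimiser\<close>

lemma lip_values_nonempty:
  assumes "\<rho> > 0" shows "lip_values \<rho> \<noteq> {}"
proof -
  let ?t = "tent :: real^'n \<Rightarrow> real"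
  let ?T = "\<integral>x. (?t x)\<^sup>2 \<partial>lborel"
  have i: "integrable lborel (\<lambda>x. (?t x)\<^sup>2)" by (rule lip_class_square_integrable[OF lip_class_tent])
  have "?T \<noteq> 0"
  proof
    assume "?T = 0"
    then have "AE x in lborel. (?t x)\<^sup>2 = 0" using integral_nonneg_eq_0_iff_AE[OF i] by simp
    then have "AE x in lborel. ?t x = 0" by simp
    then have "?t 0 = 0" by (intro continuous_AE_eq_0[OF continuous_tent])
    then show False by (simp add: tent_def)
  qed
  moreover have "?T \<ge> 0" by simp
  ultimately have T: "?T > 0" by linarith
  define c where "c = \<rho> / sqrt ?T"
  have c: "c > 0" using T assms by (simp add: c_def)
  have l: "lip_class (\<lambda>x. c * ?t x)" using c by (intro lip_class_cmult lip_class_tent) simp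
  obtain A where A: "A \<ge> 0" "energy_le (\<lambda>x. c * ?t x) A" using lip_class_energy[OF l] by blast
  have "(\<integral>x. (c * ?t x)\<^sup>2 \<partial>lborel) = \<rho>\<^sup>2" using T by (simp add: power_mult_distrib c_def power_divide)
  from lip_valuesI[OF l this A(2,1)] show ?thesis by blast
qed

text \<open>The limit of a rearranged minimising sequence. Fatou controls its mass from one side
  only, which is why the constraint is relaxed here; the potential converges by domination and the
  energy bound is lower semicontinuous.\<close>

lemma exists_radial_relaxed_minimizer:
  assumes \<rho>: "\<rho> > 0"
  obtains u :: "real^'n \<Rightarrow> real" and A where "sqL2 u" "\<And>x. 0 \<le> u x" "\<And>x y. x \<noteq> 0 \<Longrightarrow> norm x \<le> norm y \<Longrightarrow> u y \<le> u x"
    "energy_le u A" "A \<ge> 0" "(\<integral>x. (u x)\<^sup>2 \<partial>lborel) \<le> \<rho>\<^sup>2" "A / 2 + (\<integral>x. F (u x) \<partial>lborel) \<le> Inf (lip_values \<rho>)"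
proof -
  let ?N = "real CARD('n)"
  define m where "m = Inf (lip_values \<rho>)"
  have "\<exists>(v::real^'n \<Rightarrow> real) A. lip_class v \<and> radial_decr v \<and> (\<integral>x. (v x)\<^sup>2 \<partial>lborel) = \<rho>\<^sup>2 \<and> energy_le v A \<and> A \<ge> 0
      \<and> A / 2 + (\<integral>x. F (v x) \<partial>lborel) < m + 1 / real (Suc n)" for n :: nat
  proof -
    have "\<exists>y\<in>lip_values \<rho>. y < m + 1 / real (Suc n)"
      unfolding m_def by (subst cInf_less_iff[symmetric]) (use lip_values_nonempty[OF \<rho>] lip_values_bdd in auto)
    then obtain A and w :: "real^'n \<Rightarrow> real" where w: "lip_class w" "(\<integral>x. (w x)\<^sup>2 \<partial>lborel) = \<rho>\<^sup>2" "energy_le w A" "A \<ge> 0"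
      "A / 2 + (\<integral>x. F (w x) \<partial>lborel) < m + 1 / real (Suc n)"
      unfolding lip_values_def by blast
    show ?thesis
    proof (rule lip_class_rearrange[OF w(1)])
      fix v :: "real^'n \<Rightarrow> real"
      assume v: "lip_class v" "radial_decr v"
        "\<And>G::real \<Rightarrow> real. continuous_on UNIV G \<Longrightarrow> G 0 = 0 \<Longrightarrow> (\<integral>x. G (v x) \<partial>lborel) = (\<integral>x. G (w x) \<partial>lborel)"
        "\<And>A. energy_le w A \<Longrightarrow> energy_le v A"
      have "(\<integral>x. (v x)\<^sup>2 \<partial>lborel) = (\<integral>x. (w x)\<^sup>2 \<partial>lborel)" by (rule v(3)) (auto intro!: continuous_intros)
      moreover have "(\<integral>x. F (v x) \<partial>lborel) = (\<integral>x. F (w x) \<partial>lborel)" by (rule v(3)[OF F_continuous F0(1)])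
      ultimately show ?thesis using w v(1,2) v(4)[OF w(3)] by (intro exI[of _ v] exI[of _ A]) simp
    qed
  qed
  then have "\<forall>n. \<exists>vA::(real^'n \<Rightarrow> real) \<times> real. lip_class (fst vA) \<and> radial_decr (fst vA) \<and> (\<integral>x. (fst vA x)\<^sup>2 \<partial>lborel) = \<rho>\<^sup>2
      \<and> energy_le (fst vA) (snd vA) \<and> snd vA \<ge> 0 \<and> snd vA / 2 + (\<integral>x. F (fst vA x) \<partial>lborel) < m + 1 / real (Suc n)" by auto
  from choice[OF this] obtain W :: "nat \<Rightarrow> (real^'n \<Rightarrow> real) \<times> real" where
    W: "\<forall>n. lip_class (fst (W n)) \<and> radial_decr (fst (W n)) \<and> (\<integral>x. (fst (W n) x)\<^sup>2 \<partial>lborel) = \<rho>\<^sup>2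
      \<and> energy_le (fst (W n)) (snd (W n)) \<and> snd (W n) \<ge> 0 \<and> snd (W n) / 2 + (\<integral>x. F (fst (W n) x) \<partial>lborel) < m + 1 / real (Suc n)" ..
  define V where "V n = fst (W n)" for n
  define A where "A n = snd (W n)" for n
  have V: "lip_class (V n)" "radial_decr (V n)" "(\<integral>x. (V n x)\<^sup>2 \<partial>lborel) = \<rho>\<^sup>2" "energy_le (V n) (A n)" "A n \<ge> 0"
    "A n / 2 + (\<integral>x. F (V n x) \<partial>lborel) < m + 1 / real (Suc n)" for n
    using W unfolding V_def A_def by blast+
  obtain C where C: "\<And>(w::real^'n \<Rightarrow> real) A. lip_class w \<Longrightarrow> (\<integral>x. (w x)\<^sup>2 \<partial>lborel) = \<rho>\<^sup>2 \<Longrightarrow> energy_le w A \<Longrightarrow> A \<ge> 0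
     \<Longrightarrow> A / 2 + (\<integral>x. F (w x) \<partial>lborel) \<ge> A / 4 - C" using coercive by blast
  \<comment> \<open>Values below m + 1 and coercivity bound the energies along the sequence.\<close>
  define A0 where "A0 = 4 * (m + 1 + C)"
  have A0: "A n \<le> A0" for n
  proof -
    have "m + 1 / real (Suc n) \<le> m + 1" by simp
    with V(6)[of n] have "A n / 2 + (\<integral>x. F (V n x) \<partial>lborel) < m + 1" by (rule less_le_trans)
    moreover have "A n / 4 - C \<le> A n / 2 + (\<integral>x. F (V n x) \<partial>lborel)" by (rule C[OF V(1,3,4,5)])
    ultimately have "A n / 4 - C < m + 1" by (rule le_less_trans[rotated])
    then show ?thesis by (simp add: A0_def field_simps)
  qed
  have A00: "A0 \<ge> 0" using A0[of 0] V(5)[of 0] by linarith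
  obtain r A' where r: "strict_mono (r::nat \<Rightarrow> nat)" "(A \<circ> r) \<longlonglongrightarrow> A'" "A' \<in> {0..A0}"
    \<comment> \<open>The energy bounds converge along a first subsequence; the functions will
      converge along a second one chosen inside it.\<close>
    using compact_Icc[of 0 A0, THEN compact_imp_seq_compact] V(5) A0 unfolding seq_compact_def by (metis atLeastAtMost_iff)
  obtain C2 where C2: "C2 > 0" "\<And>(v::real^'n \<Rightarrow> real) A x. lip_class v \<Longrightarrow> radial_decr v \<Longrightarrow> energy_le v A \<Longrightarrow> A \<ge> 0 \<Longrightarrow> x \<noteq> 0
      \<Longrightarrow> v x \<le> C2 * sqrt A * norm x powr (- (?N - 2) / 2)"
    using radial_energy_bound[OF N3] by metis
  define b1 where "b1 = C2 * sqrt A0"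
  have b1: "b1 \<ge> 0" using C2 A00 by (simp add: b1_def)
  have bd1: "V n x \<le> b1 * norm x powr (- (?N - 2) / 2)" if "x \<noteq> 0" for n x
    unfolding b1_def by (rule C2(2)[OF V(1,2) energy_le_mono[OF V(4) A0] A00 that])
  define b2 where "b2 = \<rho> / sqrt (unit_ball_vol ?N)"
  have w: "unit_ball_vol ?N > 0" by simp
  have b2: "b2 \<ge> 0" using \<rho> w by (simp add: b2_def)
  have bd2: "V n x \<le> b2 * norm x powr (- ?N / 2)" if x: "x \<noteq> 0" for n x
  proof -
    have "(V n x)\<^sup>2 * (unit_ball_vol ?N * norm x ^ CARD('n)) \<le> \<rho>\<^sup>2"
      using radial_L2_bound[of "V n" x] lip_class_nonneg[OF V(1)] V(2)[of n] lip_class_square_integrable[OF V(1)[of n]] x V(3)[of n]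
      by (simp add: radial_decr_def)
    then have "sqrt ((V n x)\<^sup>2 * (unit_ball_vol ?N * norm x ^ CARD('n))) \<le> sqrt (\<rho>\<^sup>2)" by (rule real_sqrt_le_mono)
    then have le: "V n x * (sqrt (unit_ball_vol ?N) * sqrt (norm x ^ CARD('n))) \<le> \<rho>"
      using \<rho> lip_class_nonneg[OF V(1), of n x] by (simp add: real_sqrt_mult)
    have "sqrt (norm x ^ CARD('n)) = norm x powr (?N / 2)"
      using x by (simp add: powr_half_sqrt[symmetric] powr_powr flip: powr_realpow)
    then have le2: "V n x * (sqrt (unit_ball_vol ?N) * norm x powr (?N / 2)) \<le> \<rho>" using le by simp
    have e: "norm x powr (- ?N / 2) = inverse (norm x powr (?N / 2))"
      using powr_minus[of "norm x" "?N / 2"] by (simp only: minus_divide_left)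
    have pp: "sqrt (unit_ball_vol ?N) * norm x powr (?N / 2) > 0" using w x by simp
    have "V n x \<le> \<rho> / (sqrt (unit_ball_vol ?N) * norm x powr (?N / 2))" using le2 by (simp only: pos_le_divide_eq[OF pp])
    then show ?thesis unfolding e b2_def by (simp only: divide_inverse inverse_mult_distrib mult.assoc)
  qed
  obtain s u where s: "strict_mono (s::nat \<Rightarrow> nat)" and u: "u \<in> borel_measurable borel" "\<And>x. 0 \<le> u x"
    "\<And>x y. x \<noteq> 0 \<Longrightarrow> norm x \<le> norm y \<Longrightarrow> u y \<le> u x" and lim: "AE x in lborel. (\<lambda>n. V (r (s n)) x) \<longlonglongrightarrow> u x"
    using radial_Helly[of "\<lambda>n. V (r n)" "\<lambda>t. b1 * t powr (- (?N - 2) / 2)", OF V(1) V(2) bd1] by blast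
  note um[measurable] = u(1)
  define k where "k n = r (s n)" for n
  have k: "strict_mono k" unfolding k_def using strict_mono_o[OF r(1) s] by (simp add: o_def)
  have Vm[measurable]: "V n \<in> borel_measurable borel" for n by (rule lip_class_measurable[OF V(1)])
  have lim: "AE x in lborel. (\<lambda>n. V (k n) x) \<longlonglongrightarrow> u x" using lim by (simp add: k_def)
  have Ak: "(\<lambda>n. A (k n)) \<longlonglongrightarrow> A'"
    using LIMSEQ_subseq_LIMSEQ[OF r(2) s] by (simp add: o_def k_def)
  have en: "energy_le u A'" by (rule energy_le_limit[OF Vm um lim V(4) Ak])
  have nn: "(\<integral>\<^sup>+x. ennreal ((u x)\<^sup>2) \<partial>lborel) \<le> ennreal (\<rho>\<^sup>2)"
  proof -
    have "(\<integral>\<^sup>+x. ennreal ((u x)\<^sup>2) \<partial>lborel) = (\<integral>\<^sup>+x. liminf (\<lambda>n. ennreal ((V (k n) x)\<^sup>2)) \<partial>lborel)"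
    proof (rule nn_integral_cong_AE, use lim in eventually_elim)
      fix x assume "(\<lambda>n. V (k n) x) \<longlonglongrightarrow> u x"
      then have "(\<lambda>n. ennreal ((V (k n) x)\<^sup>2)) \<longlonglongrightarrow> ennreal ((u x)\<^sup>2)" by (intro tendsto_intros tendsto_ennrealI)
      then show "ennreal ((u x)\<^sup>2) = liminf (\<lambda>n. ennreal ((V (k n) x)\<^sup>2))" by (intro lim_imp_Liminf[symmetric]) auto
    qed
    also have "\<dots> \<le> liminf (\<lambda>n. \<integral>\<^sup>+x. ennreal ((V (k n) x)\<^sup>2) \<partial>lborel)" by (rule nn_integral_liminf) measurable
    also have "\<dots> = liminf (\<lambda>n. ennreal (\<rho>\<^sup>2))"
      using V(3) lip_class_square_integrable[OF V(1)] by (simp add: nn_integral_eq_integral)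
    finally show ?thesis by (simp add: Liminf_const)
  qed
  have u2: "integrable lborel (\<lambda>x. (u x)\<^sup>2)"
    by (rule integrableI_bounded) (use nn in \<open>auto intro: le_less_trans\<close>)
  have sq: "sqL2 u" using u2 u(1) by (simp add: sqL2_def)
  have mass: "(\<integral>x. (u x)\<^sup>2 \<partial>lborel) \<le> \<rho>\<^sup>2"
  proof -
    have "ennreal (\<integral>x. (u x)\<^sup>2 \<partial>lborel) \<le> ennreal (\<rho>\<^sup>2)" using nn u2 by (simp add: nn_integral_eq_integral)
    then show ?thesis by (simp add: ennreal_le_iff)
  qed
  \<comment> \<open>A majorant for the z-th powers: the decay from the energy is used in the unit
    ball, the decay from the mass outside. The first is integrable for z below the critical
    exponent, the second for z > 2.\<close>
  define e where "e z x = b1 powr z * (indicator (ball 0 1) x * norm x powr (- (z * (?N - 2) / 2)))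
     + b2 powr z * (indicator (- ball 0 1) x * norm x powr (- (z * ?N / 2)))" for z and x :: "real^'n"
  have ei: "integrable lborel (e z)" if z: "2 < z" "z < 2 * ?N / (?N - 2)" for z
    unfolding e_def
  proof (intro Bochner_Integration.integrable_add integrable_mult_right)
    show "integrable lborel (\<lambda>x::real^'n. indicator (ball 0 1) x * norm x powr (- (z * (?N - 2) / 2)))"
      by (rule integrable_norm_powr_inner) (use z N_ge3 in \<open>simp add: field_simps\<close>)
    show "integrable lborel (\<lambda>x::real^'n. indicator (- ball 0 1) x * norm x powr (- (z * ?N / 2)))"
    proof (rule integrable_norm_powr_outer)
      have "2 * ?N < z * ?N" using z N_ge3 by (intro mult_strict_right_mono) auto
      then show "real DIM(real^'n) < z * ?N / 2" by simp
    qed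
  qed
  have eb: "\<bar>V n x\<bar> powr z \<le> e z x" if z: "z > 2" and x: "x \<noteq> 0" for n z x
  proof (cases "norm x < 1")
    case True
    have "\<bar>V n x\<bar> powr z \<le> (b1 * norm x powr (- (?N - 2) / 2)) powr z"
      using bd1[OF x] lip_class_nonneg[OF V(1)] z by (intro powr_mono2) auto
    also have "\<dots> = b1 powr z * norm x powr (- (?N - 2) / 2 * z)" using b1 by (simp add: powr_mult powr_powr)
    also have "- (?N - 2) / 2 * z = - (z * (?N - 2) / 2)" by (simp add: field_simps)
    finally show ?thesis using True by (simp add: e_def)
  next
    case False
    have "\<bar>V n x\<bar> powr z \<le> (b2 * norm x powr (- ?N / 2)) powr z"
      using bd2[OF x] lip_class_nonneg[OF V(1)] z by (intro powr_mono2) auto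
    also have "\<dots> = b2 powr z * norm x powr (- ?N / 2 * z)" using b2 by (simp add: powr_mult powr_powr)
    also have "- ?N / 2 * z = - (z * ?N / 2)" by simp
    finally show ?thesis using False by (simp add: e_def)
  qed
  have p2: "p > 2" using qp by simp
  have Flim: "(\<lambda>n. \<integral>x. F (V (k n) x) \<partial>lborel) \<longlonglongrightarrow> (\<integral>x. F (u x) \<partial>lborel)"
  proof (rule integral_dominated_convergence[where w="\<lambda>x. c1 * e q x + c2 * e p x"])
    show "integrable lborel (\<lambda>x. c1 * e q x + c2 * e p x)" using ei[OF qp(1) q_less] ei[OF p2 qp(3)] by simp
    show "AE x in lborel. (\<lambda>n. F (V (k n) x)) \<longlonglongrightarrow> F (u x)"
      using lim
    proof eventually_elim
      case (elim x)
      have "isCont F (u x)" using F_deriv by (rule DERIV_isCont)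
      then show ?case using elim by (rule isCont_tendsto_compose)
    qed
    show "AE x in lborel. norm (F (V (k n) x)) \<le> c1 * e q x + c2 * e p x" for n
      using AE_lborel_singleton[of "0::real^'n"]
    proof eventually_elim
      case (elim x)
      have "\<bar>F (V (k n) x)\<bar> \<le> c1 * \<bar>V (k n) x\<bar> powr q + c2 * \<bar>V (k n) x\<bar> powr p" by (rule F_bound)
      also have "\<dots> \<le> c1 * e q x + c2 * e p x" using c12 elim by (intro add_mono mult_left_mono eb qp(1) p2) auto
      finally show ?case by simp
    qed
  qed measurable
  have "(\<lambda>n. A (k n) / 2 + (\<integral>x. F (V (k n) x) \<partial>lborel)) \<longlonglongrightarrow> A' / 2 + (\<integral>x. F (u x) \<partial>lborel)"
    by (intro tendsto_intros Ak Flim) auto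
  moreover have "(\<lambda>n. m + 1 / real (Suc (k n))) \<longlonglongrightarrow> m + 0"
    by (intro tendsto_intros LIMSEQ_subseq_LIMSEQ[OF _ k, unfolded o_def, of "\<lambda>n. 1 / real (Suc n)"])
       (use LIMSEQ_inverse_real_of_nat in \<open>simp add: inverse_eq_divide\<close>)
  ultimately have "A' / 2 + (\<integral>x. F (u x) \<partial>lborel) \<le> m + 0"
    by (rule LIMSEQ_le) (use V(6) in \<open>auto intro: less_imp_le\<close>)
  then show ?thesis using that[of u A'] sq u(2,3) en r(3) mass by (simp add: m_def)
qed

end

section \<open>Dilations and the recovery of mass\<close>

lemma weak_grad_dilate_facts:
  fixes u :: "real^'n \<Rightarrow> real" and b t :: real
  assumes u: "sqL2 u" and g: "\<And>i. sqL2 (\<lambda>x. g x $ i)" "weak_grad u g" and t: "t > 0"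
  defines "v \<equiv> \<lambda>x. b * u (x /\<^sub>R t)" and "h \<equiv> \<lambda>x. b *\<^sub>R (g (x /\<^sub>R t) /\<^sub>R t)"
  shows "sqL2 v" "sqL2 (\<lambda>x. h x $ i)" "weak_grad v h"
    "(\<integral>x. (norm (h x))\<^sup>2 \<partial>lborel) = b\<^sup>2 * (t ^ CARD('n) / t\<^sup>2 * (\<integral>x. (norm (g x))\<^sup>2 \<partial>lborel))"
proof -
  show "sqL2 v" unfolding v_def by (intro sqL2_cmult sqL2_dilate u t)
  have "sqL2 (\<lambda>x. b / t * (g (x /\<^sub>R t) $ i))"
    by (rule sqL2_cmult, rule sqL2_dilate[OF g(1) t])
  then show "sqL2 (\<lambda>x. h x $ i)" by (simp add: h_def divide_inverse mult_ac)
  show "weak_grad v h" unfolding v_def h_def by (intro weak_grad_cmult weak_grad_dilate g t)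
  have "(\<integral>x. (norm (h x))\<^sup>2 \<partial>lborel) = (\<integral>x. (b\<^sup>2 / t\<^sup>2) * (norm (g (x /\<^sub>R t)))\<^sup>2 \<partial>lborel)"
    using t by (simp add: h_def power_mult_distrib divide_inverse power_inverse mult_ac)
  also have "\<dots> = (b\<^sup>2 / t\<^sup>2) * (t ^ CARD('n) * (\<integral>x. (norm (g x))\<^sup>2 \<partial>lborel))"
    using integral_lborel_scale(1)[OF t, of "\<lambda>x. (norm (g x))\<^sup>2"] by simp
  finally show "(\<integral>x. (norm (h x))\<^sup>2 \<partial>lborel) = b\<^sup>2 * (t ^ CARD('n) / t\<^sup>2 * (\<integral>x. (norm (g x))\<^sup>2 \<partial>lborel))"
    by simp
qed

lemma L2normI:
  fixes v :: "real^'n \<Rightarrow> real"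
  assumes "(\<integral>x. (v x)\<^sup>2 \<partial>lborel) = \<rho>\<^sup>2" "\<rho> \<ge> 0" shows "L2norm v = \<rho>"
  using assms by (simp add: L2norm_def)

context mass_constrained_problem
begin

text \<open>Two instances are used: b = 1 changes the mass and leaves the values of u alone, while
  \<open>b\<^sup>2 * t ^ CARD('n) = 1\<close> keeps the mass.\<close>

lemma J_dilate:
  fixes u :: "real^'n \<Rightarrow> real" and b t :: real
  assumes u: "sqL2 u" and g: "\<And>i. sqL2 (\<lambda>x. g x $ i)" "weak_grad u g" and t: "t > 0"
  defines "v \<equiv> \<lambda>x. b * u (x /\<^sub>R t)"
  shows "v \<in> H1" "(\<integral>x. (v x)\<^sup>2 \<partial>lborel) = b\<^sup>2 * (t ^ CARD('n) * (\<integral>x. (u x)\<^sup>2 \<partial>lborel))"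
    "J F v = t ^ CARD('n) * (b\<^sup>2 * (\<integral>x. (norm (g x))\<^sup>2 \<partial>lborel) / (2 * t\<^sup>2) + (\<integral>x. F (b * u x) \<partial>lborel))"
proof -
  let ?h = "\<lambda>x. b *\<^sub>R (g (x /\<^sub>R t) /\<^sub>R t)"
  note W = weak_grad_dilate_facts[OF u g t, of b, folded v_def]
  show vH: "v \<in> H1" by (rule H1I[OF W(1-3)])
  have "(\<integral>x. (v x)\<^sup>2 \<partial>lborel) = (\<integral>x. b\<^sup>2 * (u (x /\<^sub>R t))\<^sup>2 \<partial>lborel)" by (simp add: v_def power_mult_distrib)
  then show "(\<integral>x. (v x)\<^sup>2 \<partial>lborel) = b\<^sup>2 * (t ^ CARD('n) * (\<integral>x. (u x)\<^sup>2 \<partial>lborel))"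
    using integral_lborel_scale(1)[OF t, of "\<lambda>x. (u x)\<^sup>2"] by simp
  have "J F v = (\<integral>x. (norm (?h x))\<^sup>2 \<partial>lborel) / 2 + (\<integral>x. F (v x) \<partial>lborel)"
    by (rule J_eq[OF W(1-3) J_H1(2)[OF vH]])
  also have "(\<integral>x. F (v x) \<partial>lborel) = t ^ CARD('n) * (\<integral>x. F (b * u x) \<partial>lborel)"
    using integral_lborel_scale(1)[OF t, of "\<lambda>x. F (b * u x)"] by (simp add: v_def)
  finally show "J F v = t ^ CARD('n) * (b\<^sup>2 * (\<integral>x. (norm (g x))\<^sup>2 \<partial>lborel) / (2 * t\<^sup>2) + (\<integral>x. F (b * u x) \<partial>lborel))"
    unfolding W(4) by (simp add: algebra_simps)
qed

text \<open>A plateau of height |s0| has negative potential. Dilating it makes the Dirichlet term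
  negligible against the potential, and every sufficiently large mass is reached by such a
  dilation.\<close>

lemma exists_negative_level:
  assumes neg: "\<exists>s0. F s0 < 0"
  obtains \<rho>b where "\<rho>b > 0" "\<And>\<rho>. \<rho> > \<rho>b \<Longrightarrow> Inf (lip_values \<rho>) < 0"
proof -
  obtain s0 where s0: "F s0 < 0" using neg by blast
  \<comment> \<open>Lipschitz approximations of |s0| times the indicator of the unit ball; F is
    even, so |s0| can replace \<open>s0\<close>.\<close>
  define w where "w k x = \<bar>s0\<bar> * min 1 (real k * tent x)" for k :: nat and x :: "real^'n"
  have w: "lip_class (w k)" for k
    unfolding w_def
  proof (rule lip_class_cmult)
    have "\<bar>min 1 (real k * tent x) - min 1 (real k * tent y)\<bar> \<le> real k * dist x y" for x y :: "real^'n"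
    proof -
      have "\<bar>min 1 (real k * tent x) - min 1 (real k * tent y)\<bar> \<le> \<bar>real k * tent x - real k * tent y\<bar>" by (auto simp: min_def)
      also have "\<dots> = real k * \<bar>tent x - tent y\<bar>" by (simp add: right_diff_distrib[symmetric] abs_mult)
      also have "\<dots> \<le> real k * dist x y" by (intro mult_left_mono tent_Lipschitz) simp
      finally show ?thesis .
    qed
    then have L: "\<exists>L\<ge>0. \<forall>x y :: real^'n. \<bar>min 1 (real k * tent x) - min 1 (real k * tent y)\<bar> \<le> L * dist x y"
      by (intro exI[of _ "real k"]) auto
    have "\<exists>R>0. \<forall>x :: real^'n. norm x \<ge> R \<longrightarrow> min 1 (real k * tent x) = 0"
      by (intro exI[of _ "1::real"]) (auto simp: tent_def)
    then show "lip_class (\<lambda>x::real^'n. min 1 (real k * tent x))"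
      using L unfolding lip_class_def by (auto simp: tent_def)
  qed simp
  note wm[measurable] = lip_class_measurable[OF w]
  have [measurable]: "ball (0::real^'n) 1 \<in> sets borel" by simp
  obtain B where B: "\<And>s. s \<in> {0..\<bar>s0\<bar>} \<Longrightarrow> norm (F s) \<le> B"
    using compact_continuous_image[of "{0..\<bar>s0\<bar>}" F] continuous_on_subset[OF F_continuous] compact_imp_bounded
    by (metis bounded_iff compact_Icc imageI subset_UNIV)
  have "(\<lambda>k. \<integral>x. F (w k x) \<partial>lborel) \<longlonglongrightarrow> (\<integral>x. indicator (ball (0::real^'n) 1) x * F s0 \<partial>lborel)"
  proof (rule integral_dominated_convergence[where w="\<lambda>x. indicator (ball 0 1) x * B"])
    show "integrable lborel (\<lambda>x::real^'n. indicator (ball 0 1) x * B)" by (rule integrable_indicator_ball) simp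
    show "AE x in lborel. (\<lambda>k. F (w k x)) \<longlonglongrightarrow> indicator (ball 0 1) x * F s0"
    proof (rule AE_I2, rule tendsto_eventually)
      fix x :: "real^'n"
      show "\<forall>\<^sub>F k in sequentially. F (w k x) = indicator (ball 0 1) x * F s0"
      proof (cases "norm x < 1")
        case True
        then have tp: "tent x > 0" by (simp add: tent_def)
        obtain k0 :: nat where k0: "1 / tent x \<le> real k0" using real_arch_simple by blast
        show ?thesis
          using eventually_ge_at_top[of k0]
        proof eventually_elim
          case (elim k)
          then have "1 / tent x \<le> real k" using k0 by (meson of_nat_le_iff order_trans)
          then have "1 \<le> real k * tent x" using tp by (simp add: field_simps)
          then show ?case using True by (simp add: w_def F_abs)
        qed
      next
        case False
        then show ?thesis by (simp add: w_def tent_def F0)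
      qed
    qed
    show "AE x in lborel. norm (F (w k x)) \<le> indicator (ball 0 1) x * B" for k
    proof (rule AE_I2)
      fix x :: "real^'n"
      show "norm (F (w k x)) \<le> indicator (ball 0 1) x * B"
      proof (cases "norm x < 1")
        case True
        have "w k x \<le> \<bar>s0\<bar> * 1" unfolding w_def by (intro mult_left_mono) auto
        then show ?thesis using B[of "w k x"] lip_class_nonneg[OF w, of k x] True by simp
      next
        case False
        then show ?thesis by (simp add: w_def tent_def F0)
      qed
    qed
  qed measurable
  moreover have "(\<integral>x. indicator (ball (0::real^'n) 1) x * F s0 \<partial>lborel) < 0"
    using s0 by (simp add: content_ball mult_pos_neg)
  ultimately have "\<forall>\<^sub>F k in sequentially. (\<integral>x. F (w k x) \<partial>lborel) < 0" by (rule order_tendstoD(2))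
  then obtain k where k: "(\<integral>x. F (w k x) \<partial>lborel) < 0" using eventually_happens by force
  define \<beta> where "\<beta> = - (\<integral>x. F (w k x) \<partial>lborel)"
  have \<beta>: "\<beta> > 0" using k by (simp add: \<beta>_def)
  define \<mu> where "\<mu> = (\<integral>x. (w k x)\<^sup>2 \<partial>lborel)"
  have "\<mu> \<noteq> 0"
  proof
    assume "\<mu> = 0"
    then have "AE x in lborel. (w k x)\<^sup>2 = 0"
      using integral_nonneg_eq_0_iff_AE[OF lip_class_square_integrable[OF w]] by (simp add: \<mu>_def)
    then have "AE x in lborel. F (w k x) = 0" by eventually_elim (simp add: F0)
    then have "(\<integral>x. F (w k x) \<partial>lborel) = (\<integral>x. 0 \<partial>(lborel::(real^'n) measure))" by (intro integral_cong_AE) auto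
    then show False using k by simp
  qed
  moreover have "\<mu> \<ge> 0" by (simp add: \<mu>_def)
  ultimately have \<mu>: "\<mu> > 0" by linarith
  obtain A where A: "A \<ge> 0" "energy_le (w k) A" using lip_class_energy[OF w] by blast
  obtain g where g: "\<And>i. sqL2 (\<lambda>x. g x $ i)" "weak_grad (w k) g"
    using weak_gradI_energy_le[OF lip_class_sqL2[OF w] A(2,1)] by metis
  define a where "a = (\<integral>x. (norm (g x))\<^sup>2 \<partial>lborel)"
  have a: "a \<ge> 0" by (simp add: a_def)
  \<comment> \<open>From this scale on the Dirichlet term is smaller than \<beta>; adding 1 makes
    the inequality strict and ensures \<tau> >= 1.\<close>
  define \<tau> where "\<tau> = sqrt (a / (2 * \<beta>)) + 1"
  have \<tau>: "\<tau> \<ge> 1" "a / (2 * \<beta>) < \<tau>\<^sup>2"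
  proof -
    have "0 \<le> a / (2 * \<beta>)" using a \<beta> by simp
    then have s: "sqrt (a / (2 * \<beta>)) \<ge> 0" "(sqrt (a / (2 * \<beta>)))\<^sup>2 = a / (2 * \<beta>)" by simp_all
    show "\<tau> \<ge> 1" using s by (simp add: \<tau>_def)
    have "r\<^sup>2 < (r + 1)\<^sup>2" if "r \<ge> 0" for r :: real using that by (simp add: power2_eq_square algebra_simps)
    from this[OF s(1)] show "a / (2 * \<beta>) < \<tau>\<^sup>2" unfolding s(2) \<tau>_def .
  qed
  \<comment> \<open>The L2 norm of the plateau dilated by \<tau>.\<close>
  define \<rho>b where "\<rho>b = sqrt (\<tau> ^ CARD('n) * \<mu>)"
  have "\<rho>b > 0" using \<tau>(1) \<mu> by (simp add: \<rho>b_def)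
  moreover have "Inf (lip_values \<rho>) < 0" if \<rho>: "\<rho> > \<rho>b" for \<rho>
  proof -
    have \<rho>0: "\<rho> > 0" using \<rho> \<open>\<rho>b > 0\<close> by linarith
    have "\<tau> ^ CARD('n) * \<mu> = \<rho>b\<^sup>2" using \<tau>(1) \<mu> by (simp add: \<rho>b_def)
    also have "\<dots> < \<rho>\<^sup>2" using \<rho> \<open>\<rho>b > 0\<close> by (intro power_strict_mono) auto
    finally have lt: "\<tau> ^ CARD('n) < \<rho>\<^sup>2 / \<mu>" using \<mu> by (simp add: pos_less_divide_eq)
    define t where "t = root CARD('n) (\<rho>\<^sup>2 / \<mu>)"
    have tn: "t ^ CARD('n) = \<rho>\<^sup>2 / \<mu>" unfolding t_def using \<mu> by (intro real_root_pow_pos2) auto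
    have t0: "t \<ge> 0" unfolding t_def using \<mu> by simp
    have "\<tau> < t"
    proof (rule ccontr)
      assume "\<not> \<tau> < t"
      then have "t ^ CARD('n) \<le> \<tau> ^ CARD('n)" using t0 by (intro power_mono) auto
      then show False using lt tn by simp
    qed
    then have tp: "t > 0" and "\<tau>\<^sup>2 < t\<^sup>2" using \<tau>(1) by (auto intro!: power_strict_mono)
    then have "a / (2 * \<beta>) < t\<^sup>2" using \<tau>(2) by linarith
    then have neg: "a / (2 * t\<^sup>2) - \<beta> < 0" using \<beta> tp by (simp add: field_simps)
    note D = J_dilate[OF lip_class_sqL2[OF w] g tp, of 1]
    let ?v = "\<lambda>x. 1 * w k (x /\<^sub>R t)"
    have "L2norm ?v = \<rho>"
      by (rule L2normI) (use D(2) tn \<mu> \<rho>0 in \<open>simp_all add: \<mu>_def[symmetric]\<close>)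
    then have "Inf (lip_values \<rho>) \<le> J F ?v" by (rule Inf_lip_values_le_J[OF \<rho>0 D(1)])
    also have "J F ?v = t ^ CARD('n) * (a / (2 * t\<^sup>2) - \<beta>)" using D(3) by (simp add: a_def \<beta>_def)
    also have "\<dots> < 0" using neg tp by (simp add: mult_pos_neg)
    finally show ?thesis .
  qed
  ultimately show ?thesis using that by blast
qed

lemma exists_radial_minimizer:
  assumes \<rho>: "\<rho> > 0" and m: "Inf (lip_values \<rho>) < 0"
  obtains u :: "real^'n \<Rightarrow> real" where "u \<in> H1" "L2norm u = \<rho>" "\<And>x. 0 \<le> u x" "u 0 = 1"
    "\<And>x y. x \<noteq> 0 \<Longrightarrow> y \<noteq> 0 \<Longrightarrow> norm x \<le> norm y \<Longrightarrow> u y \<le> u x" "J F u < 0"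
    "\<And>v::real^'n \<Rightarrow> real. v \<in> H1 \<Longrightarrow> L2norm v = \<rho> \<Longrightarrow> J F u \<le> J F v"
proof -
  define m where "m = Inf (lip_values \<rho>)"
  obtain u0 :: "real^'n \<Rightarrow> real" and A where u0: "sqL2 u0" "\<And>x. 0 \<le> u0 x" "\<And>x y. x \<noteq> 0 \<Longrightarrow> norm x \<le> norm y \<Longrightarrow> u0 y \<le> u0 x"
    "energy_le u0 A" "A \<ge> 0" "(\<integral>x. (u0 x)\<^sup>2 \<partial>lborel) \<le> \<rho>\<^sup>2" "A / 2 + (\<integral>x. F (u0 x) \<partial>lborel) \<le> m"
    using exists_radial_relaxed_minimizer[OF \<rho>] unfolding m_def by blast
  \<comment> \<open>Positivity is asserted at every point, but the relaxed minimiser has no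
    controlled value at the origin, so that value is prescribed; a single point is a null
    set.\<close>
  define u where "u x = (if x = 0 then 1 else u0 x)" for x
  note [measurable] = sqL2D(1)[OF u0(1)]
  have um[measurable]: "u \<in> borel_measurable borel" unfolding u_def by measurable
  have ae: "AE x in lborel. u x = u0 x"
    using AE_lborel_singleton[of "0::real^'n"] by eventually_elim (simp add: u_def)
  have "integrable lborel (\<lambda>x. (u x)\<^sup>2)"
    by (rule integrable_cong_AE_imp[OF sqL2D(2)[OF u0(1)]]) (use ae in auto)
  then have sq: "sqL2 u" using um by (simp add: sqL2_def)
  have n0: "(\<integral>x. (u x)\<^sup>2 \<partial>lborel) = (\<integral>x. (u0 x)\<^sup>2 \<partial>lborel)" by (rule integral_cong_AE) (use ae in auto)
  have f0: "(\<integral>x. F (u x) \<partial>lborel) = (\<integral>x. F (u0 x) \<partial>lborel)" by (rule integral_cong_AE) (use ae in auto)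
  \<comment> \<open>\<open>u\<close> is an almost everywhere limit of the constant sequence
    \<open>u0\<close>.\<close>
  have en: "energy_le u A"
  proof (rule energy_le_limit[of "\<lambda>_. u0" u "\<lambda>_. A" A])
    show "AE x in lborel. (\<lambda>n. u0 x) \<longlonglongrightarrow> u x" using ae by eventually_elim simp
  qed (use u0 in auto)
  obtain g where g: "\<And>i. sqL2 (\<lambda>x. g x $ i)" "weak_grad u g" "(\<integral>x. (norm (g x))\<^sup>2 \<partial>lborel) \<le> A"
    using weak_gradI_energy_le[OF sq en u0(5)] by metis
  define a where "a = (\<integral>x. (norm (g x))\<^sup>2 \<partial>lborel)"
  have a: "a \<ge> 0" by (simp add: a_def)
  define I where "I = (\<integral>x. F (u x) \<partial>lborel)"
  have uH: "u \<in> H1" by (rule H1I[OF sq g(1,2)])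
  have Ju: "J F u = a / 2 + I" unfolding a_def I_def by (rule J_eq[OF sq g(1,2) J_H1(2)[OF uH]])
  have Jm: "J F u \<le> m" unfolding Ju using u0(7) g(3) f0 by (simp add: a_def I_def)
  have m0: "m < 0" using m by (simp add: m_def)
  define \<mu> where "\<mu> = (\<integral>x. (u x)\<^sup>2 \<partial>lborel)"
  \<comment> \<open>The limit is not trivial: a function vanishing almost everywhere would have
    nonnegative energy, against m < 0.\<close>
  have "\<mu> \<noteq> 0"
  proof
    assume "\<mu> = 0"
    then have "AE x in lborel. (u x)\<^sup>2 = 0" using integral_nonneg_eq_0_iff_AE[OF sqL2D(2)[OF sq]] by (simp add: \<mu>_def)
    then have "AE x in lborel. F (u x) = 0" by eventually_elim (simp add: F0)
    then have "I = (\<integral>x. 0 \<partial>(lborel::(real^'n) measure))" unfolding I_def by (intro integral_cong_AE) auto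
    then show False using Jm Ju a m0 by simp
  qed
  moreover have "\<mu> \<ge> 0" by (simp add: \<mu>_def)
  ultimately have \<mu>: "\<mu> > 0" by linarith
  have \<mu>le: "\<mu> \<le> \<rho>\<^sup>2" using u0(6) n0 by (simp add: \<mu>_def)
  \<comment> \<open>Otherwise a dilation with the right mass would have energy below the infimum.\<close>
  have "\<mu> = \<rho>\<^sup>2"
  proof (rule ccontr)
    assume "\<mu> \<noteq> \<rho>\<^sup>2"
    then have gt: "\<rho>\<^sup>2 / \<mu> > 1" using \<mu>le \<mu> by simp
    define t where "t = root CARD('n) (\<rho>\<^sup>2 / \<mu>)"
    have tn: "t ^ CARD('n) = \<rho>\<^sup>2 / \<mu>" unfolding t_def using \<mu> by (intro real_root_pow_pos2) auto
    have t1: "t > 1" unfolding t_def using gt by simp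
    then have tp: "t > 0" by simp
    note D = J_dilate[OF sq g(1,2) tp, of 1]
    let ?v = "\<lambda>x. 1 * u (x /\<^sub>R t)"
    have "L2norm ?v = \<rho>" by (rule L2normI) (use D(2) tn \<mu> \<rho> in \<open>simp_all add: \<mu>_def[symmetric]\<close>)
    then have "m \<le> J F ?v" unfolding m_def by (rule Inf_lip_values_le_J[OF \<rho> D(1)])
    also have "J F ?v = t ^ CARD('n) * (a / (2 * t\<^sup>2) + I)" using D(3) by (simp add: a_def I_def)
    also have "\<dots> \<le> t ^ CARD('n) * (a / 2 + I)"
    proof -
      have "1 \<le> t\<^sup>2" using t1 by (simp add: one_le_power)
      then have "a / (2 * t\<^sup>2) \<le> a / 2" using a by (intro divide_left_mono) auto
      then show ?thesis using tp by (intro mult_left_mono) auto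
    qed
    also have "\<dots> \<le> t ^ CARD('n) * m" using Jm Ju tp by (intro mult_left_mono) auto
    also have "\<dots> < 1 * m" unfolding tn using gt m0 by (intro mult_strict_right_mono_neg)
    finally show False by simp
  qed
  then have Lu: "L2norm u = \<rho>" using \<rho> by (intro L2normI) (auto simp: \<mu>_def)
  show ?thesis
  proof (rule that[of u])
    show "J F u < 0" using Jm m0 by linarith
    show "J F u \<le> J F v" if "v \<in> H1" "L2norm v = \<rho>" for v :: "real^'n \<Rightarrow> real"
      using Inf_lip_values_le_J[OF \<rho> that] Jm by (simp add: m_def)
    show "u y \<le> u x" if "x \<noteq> 0" "y \<noteq> 0" "norm x \<le> norm y" for x y using that u0(3) by (simp add: u_def)
  qed (use uH Lu u0(2) in \<open>auto simp: u_def\<close>)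
qed

end

section \<open>Differentiating the functional\<close>

lemma integrable_inner_vec:
  fixes g h :: "real^'n \<Rightarrow> real^'n"
  assumes "\<And>i. sqL2 (\<lambda>x. g x $ i)" "\<And>i. sqL2 (\<lambda>x. h x $ i)"
  shows "integrable lborel (\<lambda>x. g x \<bullet> h x)"
proof -
  have "integrable lborel (\<lambda>x. \<Sum>i\<in>UNIV. g x $ i * h x $ i)"
    by (intro Bochner_Integration.integrable_sum sqL2_mult_integrable assms)
  then show ?thesis by (simp add: inner_vec_def)
qed

lemma DERIV_divide_sqrt:
  fixes N :: "real \<Rightarrow> real"
  assumes N: "(N has_real_derivative N') (at t)" and pos: "N t > 0"
  shows "((\<lambda>t. r / sqrt (N t)) has_real_derivative - (r * N' / (2 * N t * sqrt (N t)))) (at t)"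
proof -
  define s where "s = sqrt (N t)"
  have s: "s \<noteq> 0" "N t = s * s" using pos by (auto simp: s_def)
  have "((\<lambda>t. sqrt (N t)) has_real_derivative N' * (inverse s / 2)) (at t)"
    using N pos unfolding s_def by (auto intro!: derivative_eq_intros)
  from DERIV_divide[OF DERIV_const[of r] this]
  have "((\<lambda>t. r / sqrt (N t)) has_real_derivative (0 * sqrt (N t) - r * (N' * (inverse s / 2))) / (sqrt (N t) * sqrt (N t))) (at t)"
    using s(1) unfolding s_def by blast
  moreover have "(0 * s - r * (N' * (inverse s / 2))) / (s * s) = - (r * N' / (2 * (s * s) * s))"
    using s(1) by (simp add: field_simps)
  ultimately have "((\<lambda>t. r / sqrt (N t)) has_real_derivative - (r * N' / (2 * (s * s) * s))) (at t)"
    by (simp only: s_def[symmetric])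
  then show ?thesis by (simp only: s_def[symmetric] s(2)[symmetric])
qed

lemma powr_sum_le:
  fixes x y r :: real
  assumes "x \<ge> 0" "y \<ge> 0" "r > 0" shows "(x + y) powr r \<le> 2 powr r * (x powr r + y powr r)"
proof -
  have "(x + y) powr r \<le> (2 * max x y) powr r" using assms by (intro powr_mono2) auto
  also have "\<dots> = 2 powr r * (max x y) powr r" using assms by (simp add: powr_mult)
  also have "\<dots> \<le> 2 powr r * (x powr r + y powr r)" by (intro mult_left_mono) (auto simp: max_def)
  finally show ?thesis .
qed

context mass_constrained_problem
begin

text \<open>A common majorant w of the argument and the factor takes the place of Hoelder's
  inequality: everything reduces to the integrability of powers of a multiple of |u| +
  |\<phi>|.\<close>

lemma F'_mult_bound:
  assumes "\<bar>s\<bar> \<le> w" "\<bar>r\<bar> \<le> w"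
  shows "\<bar>F' s * r\<bar> \<le> c1 * w powr q + c2 * w powr p"
proof -
  have w: "w \<ge> 0" using assms by linarith
  have e: "w powr (z - 1) * w = w powr z" for z
    using w powr_add[of w "z - 1" 1] by (cases "w = 0") auto
  have "\<bar>F' s\<bar> \<le> c1 * \<bar>s\<bar> powr (q - 1) + c2 * \<bar>s\<bar> powr (p - 1)" by (rule growth)
  also have "\<dots> \<le> c1 * w powr (q - 1) + c2 * w powr (p - 1)"
    using assms qp c12 by (intro add_mono mult_left_mono powr_mono2) auto
  finally have "\<bar>F' s\<bar> * \<bar>r\<bar> \<le> (c1 * w powr (q - 1) + c2 * w powr (p - 1)) * w"
    using assms c12 by (intro mult_mono) auto
  also have "\<dots> = c1 * w powr q + c2 * w powr p" by (simp add: distrib_right mult.assoc e)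
  finally show ?thesis by (simp add: abs_mult)
qed

lemma F_domination_integrable:
  fixes u \<phi> :: "real^'n \<Rightarrow> real"
  assumes [measurable]: "u \<in> borel_measurable borel" "\<phi> \<in> borel_measurable borel"
    and u: "integrable lborel (\<lambda>x. \<bar>u x\<bar> powr q)" "integrable lborel (\<lambda>x. \<bar>u x\<bar> powr p)"
    and \<phi>: "integrable lborel (\<lambda>x. \<bar>\<phi> x\<bar> powr q)" "integrable lborel (\<lambda>x. \<bar>\<phi> x\<bar> powr p)"
    and k: "k \<ge> 0"
  shows "integrable lborel (\<lambda>x. c1 * (k * (\<bar>u x\<bar> + \<bar>\<phi> x\<bar>)) powr q + c2 * (k * (\<bar>u x\<bar> + \<bar>\<phi> x\<bar>)) powr p)"
proof -
  have "integrable lborel (\<lambda>x. (k * (\<bar>u x\<bar> + \<bar>\<phi> x\<bar>)) powr r)"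
    if r: "r > 0" and i: "integrable lborel (\<lambda>x. \<bar>u x\<bar> powr r)" "integrable lborel (\<lambda>x. \<bar>\<phi> x\<bar> powr r)" for r
  proof (rule Bochner_Integration.integrable_bound)
    show "integrable lborel (\<lambda>x. k powr r * (2 powr r * (\<bar>u x\<bar> powr r + \<bar>\<phi> x\<bar> powr r)))" using i by simp
    show "AE x in lborel. norm ((k * (\<bar>u x\<bar> + \<bar>\<phi> x\<bar>)) powr r) \<le> norm (k powr r * (2 powr r * (\<bar>u x\<bar> powr r + \<bar>\<phi> x\<bar> powr r)))"
    proof (rule AE_I2)
      fix x
      have "(k * (\<bar>u x\<bar> + \<bar>\<phi> x\<bar>)) powr r = k powr r * (\<bar>u x\<bar> + \<bar>\<phi> x\<bar>) powr r" by (rule powr_mult)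
      also have "\<dots> \<le> k powr r * (2 powr r * (\<bar>u x\<bar> powr r + \<bar>\<phi> x\<bar> powr r))"
        using r by (intro mult_left_mono powr_sum_le) auto
      finally show "norm ((k * (\<bar>u x\<bar> + \<bar>\<phi> x\<bar>)) powr r) \<le> norm (k powr r * (2 powr r * (\<bar>u x\<bar> powr r + \<bar>\<phi> x\<bar> powr r)))" by simp
    qed
  qed measurable
  from this[of q] this[of p] show ?thesis
    using u \<phi> qp by (intro Bochner_Integration.integrable_add integrable_mult_right) simp_all
qed

lemma F'_mult_integrable:
  fixes u \<phi> :: "real^'n \<Rightarrow> real"
  assumes [measurable]: "u \<in> borel_measurable borel" "\<phi> \<in> borel_measurable borel"
    and u: "integrable lborel (\<lambda>x. \<bar>u x\<bar> powr q)" "integrable lborel (\<lambda>x. \<bar>u x\<bar> powr p)"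
    and \<phi>: "integrable lborel (\<lambda>x. \<bar>\<phi> x\<bar> powr q)" "integrable lborel (\<lambda>x. \<bar>\<phi> x\<bar> powr p)"
  shows "integrable lborel (\<lambda>x. F' (u x) * \<phi> x)"
proof (rule Bochner_Integration.integrable_bound[OF F_domination_integrable[OF assms, of 1]])
  show "AE x in lborel. norm (F' (u x) * \<phi> x) \<le> norm (c1 * (1 * (\<bar>u x\<bar> + \<bar>\<phi> x\<bar>)) powr q + c2 * (1 * (\<bar>u x\<bar> + \<bar>\<phi> x\<bar>)) powr p)"
  proof (rule AE_I2)
    fix x
    have "\<bar>F' (u x) * \<phi> x\<bar> \<le> c1 * (1 * (\<bar>u x\<bar> + \<bar>\<phi> x\<bar>)) powr q + c2 * (1 * (\<bar>u x\<bar> + \<bar>\<phi> x\<bar>)) powr p"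
      by (rule F'_mult_bound) auto
    then show "norm (F' (u x) * \<phi> x) \<le> norm (c1 * (1 * (\<bar>u x\<bar> + \<bar>\<phi> x\<bar>)) powr q + c2 * (1 * (\<bar>u x\<bar> + \<bar>\<phi> x\<bar>)) powr p)" by simp
  qed
  show "(\<lambda>x. F' (u x) * \<phi> x) \<in> borel_measurable lborel" by measurable
qed simp

text \<open>One curve covers both variations: in the Euler-Lagrange equation b normalises the
  perturbation u + t \<phi>, and for the dilations \<phi> is 0 and b is a power of 1 + t.\<close>

lemma DERIV_integral_F:
  fixes u \<phi> :: "real^'n \<Rightarrow> real" and b b' :: "real \<Rightarrow> real"
  assumes m[measurable]: "u \<in> borel_measurable borel" "\<phi> \<in> borel_measurable borel"
    and u: "integrable lborel (\<lambda>x. \<bar>u x\<bar> powr q)" "integrable lborel (\<lambda>x. \<bar>u x\<bar> powr p)"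
    and \<phi>: "integrable lborel (\<lambda>x. \<bar>\<phi> x\<bar> powr q)" "integrable lborel (\<lambda>x. \<bar>\<phi> x\<bar> powr p)"
    and d0: "d0 > 0" and b: "\<And>t. \<bar>t\<bar> < d0 \<Longrightarrow> (b has_real_derivative b' t) (at t)"
    and b'0: "isCont b' 0" and b0: "b 0 = 1"
  shows "((\<lambda>t. \<integral>x. F (b t * (u x + t * \<phi> x)) \<partial>lborel) has_real_derivative (\<integral>x. F' (u x) * (b' 0 * u x + \<phi> x) \<partial>lborel)) (at 0)"
proof -
  have "isCont b 0" by (rule DERIV_isCont[OF b]) (use d0 in simp)
  then have "\<forall>\<^sub>F t in nhds 0. dist (b t) (b 0) < 1" unfolding isCont_def tendsto_at_iff_tendsto_nhds by (rule tendstoD) simp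
  then obtain d1 where d1: "d1 > 0" "\<And>t. dist t 0 < d1 \<Longrightarrow> dist (b t) (b 0) < 1" unfolding eventually_nhds_metric by blast
  have "\<forall>\<^sub>F t in nhds 0. dist (b' t) (b' 0) < 1" using b'0 unfolding isCont_def tendsto_at_iff_tendsto_nhds by (rule tendstoD) simp
  then obtain d2 where d2: "d2 > 0" "\<And>t. dist t 0 < d2 \<Longrightarrow> dist (b' t) (b' 0) < 1" unfolding eventually_nhds_metric by blast
  define d where "d = min (min d0 1) (min d1 d2)"
  have d: "d > 0" using d0 d1 d2 by (simp add: d_def)
  have bt: "\<bar>b t\<bar> \<le> 2" "\<bar>b' t\<bar> \<le> \<bar>b' 0\<bar> + 1" "\<bar>t\<bar> \<le> 1" "\<bar>t\<bar> < d0" if "\<bar>t\<bar> < d" for t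
    using d1(2)[of t] d2(2)[of t] that b0 by (auto simp: d_def dist_real_def)
  \<comment> \<open>Near 0 one has |b| <= 2 and |b'| <= |b' 0| + 1; the sum of these bounds serves
    both for the argument of F' and for its derivative in t.\<close>
  define k where "k = \<bar>b' 0\<bar> + 3"
  have k: "k \<ge> 2" by (simp add: k_def)
  let ?W = "\<lambda>x. \<bar>u x\<bar> + \<bar>\<phi> x\<bar>"
  let ?G = "\<lambda>x. c1 * (k * ?W x) powr q + c2 * (k * ?W x) powr p"
  let ?f = "\<lambda>t x. F (b t * (u x + t * \<phi> x))"
  let ?f' = "\<lambda>t x. F' (b t * (u x + t * \<phi> x)) * (b' t * (u x + t * \<phi> x) + b t * \<phi> x)"
  have G: "integrable lborel ?G" by (rule F_domination_integrable[OF m u \<phi>]) (use k in simp)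
  have Wt: "\<bar>b t * (u x + t * \<phi> x)\<bar> \<le> k * ?W x" "\<bar>b' t * (u x + t * \<phi> x) + b t * \<phi> x\<bar> \<le> k * ?W x" if t: "\<bar>t\<bar> < d" for t x
  proof -
    have "\<bar>t * \<phi> x\<bar> \<le> 1 * \<bar>\<phi> x\<bar>" unfolding abs_mult by (intro mult_right_mono bt t) simp
    then have s: "\<bar>u x + t * \<phi> x\<bar> \<le> ?W x" by linarith
    have "\<bar>b t * (u x + t * \<phi> x)\<bar> \<le> 2 * ?W x" unfolding abs_mult by (intro mult_mono bt t s) auto
    also have "\<dots> \<le> k * ?W x" by (intro mult_right_mono k) auto
    finally show "\<bar>b t * (u x + t * \<phi> x)\<bar> \<le> k * ?W x" .
    have 1: "\<bar>b' t * (u x + t * \<phi> x)\<bar> \<le> (\<bar>b' 0\<bar> + 1) * ?W x" unfolding abs_mult by (intro mult_mono bt t s) auto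
    have 2: "\<bar>b t * \<phi> x\<bar> \<le> 2 * ?W x" unfolding abs_mult by (intro mult_mono bt t) auto
    have "(\<bar>b' 0\<bar> + 1) * ?W x + 2 * ?W x = k * ?W x" by (simp add: k_def algebra_simps)
    then show "\<bar>b' t * (u x + t * \<phi> x) + b t * \<phi> x\<bar> \<le> k * ?W x" using 1 2 by linarith
  qed
  have "((\<lambda>t. \<integral>x. ?f t x \<partial>lborel) has_real_derivative (\<integral>x. ?f' 0 x \<partial>lborel)) (at 0)"
  proof (rule has_derivative_integral_param[OF d, where G="?G"])
    show "integrable lborel (?f t)" if "\<bar>t - 0\<bar> < d" for t
    proof (rule Bochner_Integration.integrable_bound[OF G])
      show "AE x in lborel. norm (?f t x) \<le> norm (?G x)"
      proof (rule AE_I2)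
        fix x
        let ?s = "b t * (u x + t * \<phi> x)"
        have "\<bar>F ?s\<bar> \<le> c1 * \<bar>?s\<bar> powr q + c2 * \<bar>?s\<bar> powr p" by (rule F_bound)
        also have "\<dots> \<le> ?G x" using Wt(1)[of t x] that c12 qp by (intro add_mono mult_left_mono powr_mono2) auto
        finally show "norm (?f t x) \<le> norm (?G x)" by simp
      qed
    qed measurable
    show "((\<lambda>t. ?f t x) has_real_derivative ?f' t x) (at t)" if "\<bar>t - 0\<bar> < d" for t x
    proof (rule DERIV_chain2[OF F_deriv])
      have "((\<lambda>t. u x + t * \<phi> x) has_real_derivative 0 + 1 * \<phi> x) (at t)"
        by (intro DERIV_add DERIV_const DERIV_cmult_right DERIV_ident)
      from DERIV_mult[OF b[of t] this] bt(4)[of t] that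
      show "((\<lambda>t. b t * (u x + t * \<phi> x)) has_real_derivative b' t * (u x + t * \<phi> x) + b t * \<phi> x) (at t)"
        by (simp add: mult_ac)
    qed
    show "\<bar>?f' t x\<bar> \<le> ?G x" if "\<bar>t - 0\<bar> < d" for t x
      using Wt[of t x] that by (intro F'_mult_bound) auto
    show "integrable lborel ?G" by (rule G)
  qed measurable
  then show ?thesis using b0 by simp
qed


section \<open>The equation, the sign of the multiplier and positivity\<close>

lemma H1_powr_integrable:
  fixes v :: "real^'n \<Rightarrow> real"
  assumes "v \<in> H1"
  shows "integrable lborel (\<lambda>x. \<bar>v x\<bar> powr q)" "integrable lborel (\<lambda>x. \<bar>v x\<bar> powr p)"
  by (rule F_integrable[OF H1_wgrad(1)[OF assms] J_H1(1)[OF assms]], simp)+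

lemma H1_measurable:
  fixes v :: "real^'n \<Rightarrow> real"
  assumes "v \<in> H1" shows "v \<in> borel_measurable borel"
  using sqL2D(1)[OF H1_wgrad(1)[OF assms]] by simp

lemma testfun_H1:
  fixes \<phi> :: "real^'n \<Rightarrow> real"
  assumes "testfun \<phi> D" shows "\<phi> \<in> H1"
  by (rule H1I[OF testfun_sqL2[OF assms] testfun_weak_grad[OF assms]])

lemma F'_testfun_integrable:
  fixes u \<phi> :: "real^'n \<Rightarrow> real"
  assumes "u \<in> H1" "\<phi> \<in> H1" shows "integrable lborel (\<lambda>x. F' (u x) * \<phi> x)"
  by (rule F'_mult_integrable[OF H1_measurable H1_measurable H1_powr_integrable H1_powr_integrable]) (fact assms)+

text \<open>Perturbations are rescaled back to the sphere, so the energy along the curve is minimal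
  at 0. The derivative -\<kappa> / \<rho>^2 of the scaling factor turns the vanishing derivative
  into the equation and yields the multiplier.\<close>

lemma Euler_Lagrange:
  fixes u :: "real^'n \<Rightarrow> real"
  assumes \<rho>: "\<rho> > 0" and uH: "u \<in> H1" and Lu: "L2norm u = \<rho>"
    and min: "\<And>v::real^'n \<Rightarrow> real. v \<in> H1 \<Longrightarrow> L2norm v = \<rho> \<Longrightarrow> J F u \<le> J F v"
  shows "weak_solution F' (((\<integral>x. (norm (wgrad u x))\<^sup>2 \<partial>lborel) + (\<integral>x. F' (u x) * u x \<partial>lborel)) / \<rho>\<^sup>2) u"
  unfolding weak_solution_def
proof (intro allI impI)
  fix \<phi> :: "real^'n \<Rightarrow> real" and D assume tf: "testfun \<phi> D"
  note H = H1_wgrad[OF uH] and T = testfun_sqL2[OF tf]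
  have \<phi>H: "\<phi> \<in> H1" by (rule testfun_H1[OF tf])
  define g where "g = wgrad u"
  note g = H(2,3)[folded g_def]
  define a where "a = (\<integral>x. (norm (g x))\<^sup>2 \<partial>lborel)"
  define B where "B = (\<integral>x. g x \<bullet> D x \<partial>lborel)"
  define C where "C = (\<integral>x. (norm (D x))\<^sup>2 \<partial>lborel)"
  define \<kappa> where "\<kappa> = (\<integral>x. u x * \<phi> x \<partial>lborel)"
  define \<sigma> where "\<sigma> = (\<integral>x. (\<phi> x)\<^sup>2 \<partial>lborel)"
  have u2: "(\<integral>x. (u x)\<^sup>2 \<partial>lborel) = \<rho>\<^sup>2" using Lu \<rho> by (auto simp: L2norm_def)
  have gD: "integrable lborel (\<lambda>x. g x \<bullet> D x)" by (rule integrable_inner_vec[OF g(1) T(2)])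
  \<comment> \<open>The squared L2 norm along the line u + t \<phi>; it stays positive near 0, so
    the line can be normalised there.\<close>
  define N where "N t = \<rho>\<^sup>2 + 2 * t * \<kappa> + t\<^sup>2 * \<sigma>" for t
  have N_int: "(\<integral>x. (u x + t * \<phi> x)\<^sup>2 \<partial>lborel) = N t" for t
  proof -
    have "(u x + t * \<phi> x)\<^sup>2 = (u x)\<^sup>2 + (2 * t) * (u x * \<phi> x) + t\<^sup>2 * (\<phi> x)\<^sup>2" for x
      by (simp add: power2_eq_square algebra_simps)
    then show ?thesis
      using sqL2D(2)[OF H(1)] sqL2D(2)[OF T(1)] sqL2_mult_integrable[OF H(1) T(1)] u2
      by (simp add: N_def \<kappa>_def \<sigma>_def)
  qed
  have g_int: "(\<integral>x. (norm (g x + t *\<^sub>R D x))\<^sup>2 \<partial>lborel) = a + 2 * t * B + t\<^sup>2 * C" for t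
  proof -
    have "(norm (g x + t *\<^sub>R D x))\<^sup>2 = (norm (g x))\<^sup>2 + (2 * t) * (g x \<bullet> D x) + t\<^sup>2 * (norm (D x))\<^sup>2" for x
      unfolding power2_norm_eq_inner
      by (simp add: inner_add_left inner_add_right inner_commute power2_eq_square algebra_simps)
    then show ?thesis
      using integrable_norm_square_vec[OF g(1)] integrable_norm_square_vec[OF T(2)] gD
      by (simp add: a_def B_def C_def)
  qed
  have Nd: "(N has_real_derivative (2 * \<kappa> + 2 * t * \<sigma>)) (at t)" for t
    unfolding N_def by (auto intro!: derivative_eq_intros)
  have N0: "N 0 = \<rho>\<^sup>2" by (simp add: N_def)
  have "isCont N 0" by (rule DERIV_isCont[OF Nd])
  then have "\<forall>\<^sub>F t in nhds 0. N t > 0" unfolding isCont_def tendsto_at_iff_tendsto_nhds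
    by (rule order_tendstoD(1)) (use N0 \<rho> in simp)
  then obtain d where d: "d > 0" and "\<And>t. dist t 0 < d \<Longrightarrow> N t > 0" unfolding eventually_nhds_metric by blast
  then have Np: "N t > 0" if "\<bar>t\<bar> < d" for t using that by (simp add: dist_real_def)
  define b where "b t = \<rho> / sqrt (N t)" for t
  define b' where "b' t = - (\<rho> * (2 * \<kappa> + 2 * t * \<sigma>) / (2 * N t * sqrt (N t)))" for t
  have bd: "(b has_real_derivative b' t) (at t)" if "\<bar>t\<bar> < d" for t
    unfolding b_def[abs_def] b'_def by (rule DERIV_divide_sqrt[OF Nd Np[OF that]])
  have b0: "b 0 = 1" using \<rho> by (simp add: b_def N0)
  have b'0: "b' 0 = - \<kappa> / \<rho>\<^sup>2" using \<rho> by (simp add: b'_def N0 field_simps)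
  have cb': "isCont b' 0"
    unfolding b'_def[abs_def] using \<open>isCont N 0\<close> N0 \<rho> by (intro continuous_intros) auto
  define j where "j t = (b t)\<^sup>2 * (a + 2 * t * B + t\<^sup>2 * C) / 2 + (\<integral>x. F (b t * (u x + t * \<phi> x)) \<partial>lborel)" for t
  have le: "J F u \<le> j t" if t: "\<bar>t\<bar> < d" for t
  proof -
    let ?v = "\<lambda>x. b t * (u x + t * \<phi> x)" and ?h = "\<lambda>x. b t *\<^sub>R (g x + t *\<^sub>R D x)"
    have tD: "sqL2 (\<lambda>x. (t *\<^sub>R D x) $ i)" for i using sqL2_cmult[OF T(2)] by simp
    have v: "sqL2 ?v" by (intro sqL2_cmult sqL2_add H(1) T(1))
    have "sqL2 (\<lambda>x. b t * (g x $ i + (t *\<^sub>R D x) $ i))" for i by (intro sqL2_cmult sqL2_add g(1) tD)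
    then have h: "sqL2 (\<lambda>x. ?h x $ i)" for i by simp
    have w: "weak_grad ?v ?h"
      by (intro weak_grad_cmult weak_grad_add H(1) g sqL2_cmult T(1) tD testfun_weak_grad tf)
    have vH: "?v \<in> H1" by (rule H1I[OF v h w])
    have "(\<integral>x. (?v x)\<^sup>2 \<partial>lborel) = (b t)\<^sup>2 * N t" by (simp add: power_mult_distrib N_int)
    also have "\<dots> = \<rho>\<^sup>2" using Np[OF t] by (simp add: b_def power_divide)
    finally have "L2norm ?v = \<rho>" using \<rho> by (intro L2normI) auto
    then have "J F u \<le> J F ?v" by (rule min[OF vH])
    also have "J F ?v = (\<integral>x. (norm (?h x))\<^sup>2 \<partial>lborel) / 2 + (\<integral>x. F (?v x) \<partial>lborel)"
      by (rule J_eq[OF v h w J_H1(2)[OF vH]])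
    also have "(\<integral>x. (norm (?h x))\<^sup>2 \<partial>lborel) = (b t)\<^sup>2 * (a + 2 * t * B + t\<^sup>2 * C)"
      by (simp add: power_mult_distrib g_int)
    finally show ?thesis by (simp add: j_def)
  qed
  have j0: "j 0 = J F u" using J_H1(3)[OF uH] b0 by (simp add: j_def a_def g_def)
  have I: "integrable lborel (\<lambda>x. F' (u x) * u x)" "integrable lborel (\<lambda>x. F' (u x) * \<phi> x)"
    by (rule F'_testfun_integrable[OF uH uH], rule F'_testfun_integrable[OF uH \<phi>H])
  define U where "U = (\<integral>x. F' (u x) * u x \<partial>lborel)"
  define V where "V = (\<integral>x. F' (u x) * \<phi> x \<partial>lborel)"
  have FI: "(\<integral>x. F' (u x) * (b' 0 * u x + \<phi> x) \<partial>lborel) = b' 0 * U + V"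
  proof -
    have "F' (u x) * (b' 0 * u x + \<phi> x) = b' 0 * (F' (u x) * u x) + F' (u x) * \<phi> x" for x by (simp add: algebra_simps)
    then show ?thesis using I by (simp add: U_def V_def)
  qed
  have dF: "((\<lambda>t. \<integral>x. F (b t * (u x + t * \<phi> x)) \<partial>lborel) has_real_derivative b' 0 * U + V) (at 0)"
    unfolding FI[symmetric]
    by (rule DERIV_integral_F[OF H1_measurable[OF uH] H1_measurable[OF \<phi>H] H1_powr_integrable[OF uH] H1_powr_integrable[OF \<phi>H] d bd cb' b0])
  have "((\<lambda>t. (b t)\<^sup>2 * (a + 2 * t * B + t\<^sup>2 * C) / 2) has_real_derivative (b' 0 * a + B)) (at 0)"
    using bd[of 0] d b0 by (auto intro!: derivative_eq_intros)
  from DERIV_add[OF this dF] have "(j has_real_derivative (b' 0 * a + B) + (b' 0 * U + V)) (at 0)"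
    unfolding j_def[abs_def] .
  then have "(b' 0 * a + B) + (b' 0 * U + V) = 0"
    by (rule DERIV_local_min[OF _ d]) (use le j0 in auto)
  then have "B + V = - b' 0 * (a + U)" by (simp add: algebra_simps)
  also have "\<dots> = (a + U) / \<rho>\<^sup>2 * \<kappa>" by (simp add: b'0)
  finally have "B + V = (a + U) / \<rho>\<^sup>2 * \<kappa>" .
  moreover have "(\<integral>x. g x \<bullet> D x + F' (u x) * \<phi> x \<partial>lborel) = B + V" using gD I(2) by (simp add: B_def V_def)
  ultimately show "(\<integral>x. wgrad u x \<bullet> D x + F' (u x) * \<phi> x \<partial>lborel)
      = ((\<integral>x. (norm (wgrad u x))\<^sup>2 \<partial>lborel) + (\<integral>x. F' (u x) * u x \<partial>lborel)) / \<rho>\<^sup>2 * (\<integral>x. u x * \<phi> x \<partial>lborel)"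
    by (simp add: a_def U_def \<kappa>_def g_def)
qed

text \<open>Stationarity along the mass-preserving dilations \<open>s\<^sup>N\<^sup>/\<^sup>2 u (s x)\<close>.\<close>

lemma virial_identity:
  fixes u :: "real^'n \<Rightarrow> real"
  assumes \<rho>: "\<rho> > 0" and uH: "u \<in> H1" and Lu: "L2norm u = \<rho>"
    and min: "\<And>v::real^'n \<Rightarrow> real. v \<in> H1 \<Longrightarrow> L2norm v = \<rho> \<Longrightarrow> J F u \<le> J F v"
  shows "(\<integral>x. (norm (wgrad u x))\<^sup>2 \<partial>lborel) - real CARD('n) * (\<integral>x. F (u x) \<partial>lborel)
    + real CARD('n) / 2 * (\<integral>x. F' (u x) * u x \<partial>lborel) = 0"
proof -
  note H = H1_wgrad[OF uH]
  define a where "a = (\<integral>x. (norm (wgrad u x))\<^sup>2 \<partial>lborel)"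
  define n where "n = real CARD('n)"
  have u2: "(\<integral>x. (u x)\<^sup>2 \<partial>lborel) = \<rho>\<^sup>2" using Lu \<rho> by (auto simp: L2norm_def)
  define b where "b t = (1 + t) powr (n / 2)" for t :: real
  define b' where "b' t = n / 2 * (1 + t) powr (n / 2 - 1)" for t :: real
  define h where "h t = (\<integral>x. F (b t * (u x + t * 0)) \<partial>lborel)" for t
  have bd: "(b has_real_derivative b' t) (at t)" if "\<bar>t\<bar> < 1" for t
    unfolding b_def[abs_def] b'_def using that
    by (auto intro!: derivative_eq_intros simp: powr_diff)
  have cb': "isCont b' 0" unfolding b'_def[abs_def] by (intro continuous_intros) auto
  have b0: "b 0 = 1" "b' 0 = n / 2" by (simp_all add: b_def b'_def)
  have z: "integrable (lborel :: (real^'n) measure) (\<lambda>x. \<bar>0\<bar> powr q)" "integrable (lborel :: (real^'n) measure) (\<lambda>x. \<bar>0\<bar> powr p)"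
    by simp_all
  have "(h has_real_derivative (\<integral>x. F' (u x) * (b' 0 * u x + 0) \<partial>lborel)) (at 0)"
    unfolding h_def[abs_def]
    by (rule DERIV_integral_F[OF H1_measurable[OF uH] _ H1_powr_integrable[OF uH] z zero_less_one bd cb' b0(1)]) simp
  moreover have "(\<integral>x. F' (u x) * (b' 0 * u x + 0) \<partial>lborel) = n / 2 * (\<integral>x. F' (u x) * u x \<partial>lborel)"
  proof -
    have e: "(\<lambda>x. F' (u x) * (b' 0 * u x + 0)) = (\<lambda>x. n / 2 * (F' (u x) * u x))" by (simp add: b0 fun_eq_iff)
    show ?thesis unfolding e by simp
  qed
  ultimately have dh: "(h has_real_derivative n / 2 * (\<integral>x. F' (u x) * u x \<partial>lborel)) (at 0)" by (simp only:)
  \<comment> \<open>With s = 1 + t the amplitude is s^(N/2) and the dilation factor 1/s: the mass is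
    fixed, the Dirichlet term scales by s^2, and the potential by s^(-N) with F taken at the raised
    amplitude.\<close>
  define j where "j t = a * (1 + t)\<^sup>2 / 2 + inverse ((1 + t) ^ CARD('n)) * h t" for t
  have le: "J F u \<le> j t" if t: "\<bar>t\<bar> < 1" for t
  proof -
    have s: "1 + t > 0" "inverse (1 + t) > 0" using t by auto
    have bb: "(b t)\<^sup>2 = (1 + t) ^ CARD('n)"
    proof -
      have "(b t)\<^sup>2 = (1 + t) powr (n / 2 + n / 2)" unfolding b_def powr_add by (simp add: power2_eq_square)
      also have "\<dots> = (1 + t) ^ CARD('n)" using s by (simp add: n_def powr_realpow)
      finally show ?thesis .
    qed
    note D = J_dilate[OF H s(2), of "b t"]
    let ?v = "\<lambda>x. b t * u (x /\<^sub>R inverse (1 + t))"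
    have e: "inverse (1 + t) ^ CARD('n) = inverse ((1 + t) ^ CARD('n))" by (rule power_inverse)
    have "(\<integral>x. (?v x)\<^sup>2 \<partial>lborel) = \<rho>\<^sup>2" unfolding D(2) bb u2 e using s by simp
    then have "L2norm ?v = \<rho>" using \<rho> by (intro L2normI) auto
    then have "J F u \<le> J F ?v" by (rule min[OF D(1)])
    also have "J F ?v = j t"
    proof -
      have "X \<noteq> 0 \<Longrightarrow> s \<noteq> 0 \<Longrightarrow> inverse X * (X * a / (2 * (inverse s)\<^sup>2) + k) = a * s\<^sup>2 / 2 + inverse X * k" for X s k :: real
        by (simp add: field_simps)
      then show ?thesis unfolding D(3) bb e j_def a_def[symmetric] h_def using s by simp
    qed
    finally show ?thesis .
  qed
  have j0: "j 0 = J F u" using J_H1(3)[OF uH] b0 by (simp add: j_def a_def h_def)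
  have "(j has_real_derivative a + (- n * h 0 + n / 2 * (\<integral>x. F' (u x) * u x \<partial>lborel))) (at 0)"
  proof -
    have 1: "((\<lambda>t. a * (1 + t)\<^sup>2 / 2) has_real_derivative a) (at 0)" by (auto intro!: derivative_eq_intros)
    have "((\<lambda>t::real. (1 + t) ^ CARD('n)) has_real_derivative n) (at 0)"
      by (auto intro!: derivative_eq_intros simp: n_def)
    then have "((\<lambda>t::real. inverse ((1 + t) ^ CARD('n))) has_real_derivative - n) (at 0)"
      using DERIV_inverse'[of "\<lambda>t::real. (1 + t) ^ CARD('n)" n 0 UNIV] by simp
    from DERIV_mult[OF this dh] have "((\<lambda>t. inverse ((1 + t) ^ CARD('n)) * h t) has_real_derivative (- n * h 0 + n / 2 * (\<integral>x. F' (u x) * u x \<partial>lborel))) (at 0)"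
      by simp
    from DERIV_add[OF 1 this] show ?thesis unfolding j_def[abs_def] .
  qed
  then have "a + (- n * h 0 + n / 2 * (\<integral>x. F' (u x) * u x \<partial>lborel)) = 0"
    by (rule DERIV_local_min[OF _ zero_less_one]) (use le j0 in auto)
  then show ?thesis by (simp add: h_def a_def n_def b0)
qed

lemma multiplier_negative:
  fixes u :: "real^'n \<Rightarrow> real"
  assumes \<rho>: "\<rho> > 0" and uH: "u \<in> H1" and Lu: "L2norm u = \<rho>" and Ju: "J F u < 0"
    and min: "\<And>v::real^'n \<Rightarrow> real. v \<in> H1 \<Longrightarrow> L2norm v = \<rho> \<Longrightarrow> J F u \<le> J F v"
  shows "((\<integral>x. (norm (wgrad u x))\<^sup>2 \<partial>lborel) + (\<integral>x. F' (u x) * u x \<partial>lborel)) / \<rho>\<^sup>2 < 0"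
proof -
  define a where "a = (\<integral>x. (norm (wgrad u x))\<^sup>2 \<partial>lborel)"
  define I where "I = (\<integral>x. F (u x) \<partial>lborel)"
  define U where "U = (\<integral>x. F' (u x) * u x \<partial>lborel)"
  have a: "a \<ge> 0" by (simp add: a_def)
  have "a - real CARD('n) * I + real CARD('n) / 2 * U = 0"
    using virial_identity[OF \<rho> uH Lu min] by (simp add: a_def I_def U_def)
  then have "a + U = 2 * (a / 2 + I) - 2 * a / real CARD('n)" using N_ge3 by (simp add: field_simps)
  also have "a / 2 + I = J F u" using J_H1(3)[OF uH] by (simp add: a_def I_def)
  finally have "a + U < 0" using Ju a divide_nonneg_nonneg[of "2 * a" "real CARD('n)"] by linarith
  then show ?thesis using \<rho> by (simp add: a_def U_def divide_neg_pos)
qed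


text \<open>If \<open>u\<close> vanished at radius \<open>R\<close> first, then testing with \<open>(|x|\<^sup>2 - a)\<^sub>+\<^sup>3\<close>
  for \<open>a\<close> slightly below \<open>R\<^sup>2\<close> makes the Laplacian term dominate the zero-order terms.\<close>

lemma radial_solution_positive:
  fixes u :: "real^'n \<Rightarrow> real"
  assumes uH: "u \<in> H1" and sol: "weak_solution F' lam u" and nn: "\<And>x. 0 \<le> u x"
    and mono: "\<And>x y. x \<noteq> 0 \<Longrightarrow> y \<noteq> 0 \<Longrightarrow> norm x \<le> norm y \<Longrightarrow> u y \<le> u x"
    and nz: "\<not> (AE x in lborel. u x = 0)" and x0: "x0 \<noteq> 0"
  shows "u x0 > 0"
proof (rule ccontr)
  assume "\<not> u x0 > 0"
  then have ux0: "u x0 = 0" using nn[of x0] by simp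
  note H = H1_wgrad[OF uH]
  define Z where "Z = {norm x |x. x \<noteq> 0 \<and> u x = 0}"
  \<comment> \<open>The first radius at which u vanishes: by monotonicity u is 0 beyond it and
    positive inside it away from the origin. It is not 0, since u is not almost everywhere
    0.\<close>
  define R0 where "R0 = Inf Z"
  have Zne: "Z \<noteq> {}" using ux0 x0 by (auto simp: Z_def)
  have Zb: "bdd_below Z" by (rule bdd_belowI[of _ 0]) (auto simp: Z_def)
  have R00: "R0 \<ge> 0" unfolding R0_def by (rule cInf_greatest[OF Zne]) (auto simp: Z_def)
  have above: "u x = 0" if nx: "norm x > R0" for x
  proof -
    obtain z where "z \<in> Z" "z < norm x" using cInf_lessD[OF Zne nx[unfolded R0_def]] by blast
    then obtain y where y: "y \<noteq> 0" "u y = 0" "norm y < norm x" by (auto simp: Z_def)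
    have "u x \<le> u y" using y nx R00 by (intro mono) auto
    then show ?thesis using y nn[of x] by simp
  qed
  have below: "u x > 0" if "x \<noteq> 0" "norm x < R0" for x
  proof (rule ccontr)
    assume "\<not> u x > 0"
    then have "norm x \<in> Z" using that nn[of x] by (auto simp: Z_def)
    then have "R0 \<le> norm x" unfolding R0_def by (rule cInf_lower[OF _ Zb])
    then show False using that by simp
  qed
  have R0: "R0 > 0"
  proof (rule ccontr)
    assume "\<not> R0 > 0"
    then have "R0 = 0" using R00 by simp
    then have "AE x in lborel. u x = 0"
      using AE_lborel_singleton[of "0::real^'n"] by (auto elim!: eventually_mono intro!: above)
    then show False using nz by simp
  qed
  define S where "S = R0\<^sup>2"
  have S: "S > 0" using R0 by (simp add: S_def)
  have above': "u x = 0" if "x \<bullet> x > S" for x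
  proof (rule above, rule power2_less_imp_less)
    show "R0\<^sup>2 < (norm x)\<^sup>2" using that by (simp add: S_def power2_norm_eq_inner)
  qed simp
  have below': "u x > 0" if "0 < x \<bullet> x" "x \<bullet> x < S" for x
  proof (rule below)
    show "norm x < R0"
      by (rule power2_less_imp_less) (use that R0 in \<open>simp_all add: S_def power2_norm_eq_inner\<close>)
  qed (use that in auto)
  \<comment> \<open>A sample point of prescribed squared norm; the coordinate
    \<open>undefined\<close> stands for an arbitrary one.\<close>
  define pt where "pt r = sqrt r *\<^sub>R (axis undefined 1 :: real^'n)" for r :: real
  have pt: "pt r \<bullet> pt r = r" if "r \<ge> 0" for r using that by (simp add: pt_def inner_axis)
  define M where "M = u (pt (S / 2))"
  have uM: "u x \<le> M" if "x \<bullet> x \<ge> S / 2" for x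
    unfolding M_def
  proof (rule mono)
    have pp: "pt (S / 2) \<bullet> pt (S / 2) = S / 2" using S by (intro pt) simp
    then show "pt (S / 2) \<noteq> 0" using S by auto
    show "x \<noteq> 0" using that S by auto
    show "norm (pt (S / 2)) \<le> norm x" unfolding norm_eq_sqrt_inner using that pp by simp
  qed
  have M0: "M \<ge> 0" by (simp add: M_def nn)
  \<comment> \<open>F'(u) - lam u is at most K u where |x|^2 >= S/2, since there u <= M.\<close>
  define K where "K = \<bar>lam\<bar> + (c1 * M powr (q - 2) + c2 * M powr (p - 2))"
  have K: "K \<ge> 0" using c12 by (simp add: K_def)
  \<comment> \<open>Gives a >= S/2, which keeps the shell away from the origin where u may be
    unbounded, and K \<delta>^2 <= S, which makes the zero-order terms small.\<close>
  define \<delta> where "\<delta> = min (S / 2) (sqrt (S / (K + 1)))"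
  define a where "a = S - \<delta>"
  have \<delta>: "\<delta> > 0" "\<delta> \<le> S / 2" using S K by (auto simp: \<delta>_def)
  have "\<delta>\<^sup>2 \<le> (sqrt (S / (K + 1)))\<^sup>2" using \<delta> by (intro power_mono) (auto simp: \<delta>_def)
  also have "\<dots> = S / (K + 1)" using S K by simp
  finally have "(K + 1) * \<delta>\<^sup>2 \<le> S" using K by (simp add: field_simps)
  moreover have "K * \<delta>\<^sup>2 \<le> (K + 1) * \<delta>\<^sup>2" by (intro mult_right_mono) auto
  ultimately have K\<delta>: "K * \<delta>\<^sup>2 \<le> S" by linarith
  \<comment> \<open>The cutoff starts at S, beyond which u vanishes; its purpose is compact
    support.\<close>
  define P where "P t = pos3 (t - a) * cut S t" for t
  define P' where "P' t = pos2 (t - a) * cut S t + pos3 (t - a) * cut' S t" for t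
  define P'' where "P'' t = (pos1 (t - a) * cut S t + pos2 (t - a) * cut' S t) + (pos2 (t - a) * cut' S t + pos3 (t - a) * cut'' S t)" for t
  have sh: "((\<lambda>t. t - a) has_real_derivative 1) (at t)" for t by (auto intro!: derivative_eq_intros)
  have dp3: "((\<lambda>t. pos3 (t - a)) has_real_derivative pos2 (t - a)) (at t)" for t
    using DERIV_chain2[OF DERIV_pos3[of "t - a"] sh] by simp
  have dp2: "((\<lambda>t. pos2 (t - a)) has_real_derivative pos1 (t - a)) (at t)" for t
    using DERIV_chain2[OF DERIV_pos2[of "t - a"] sh] by simp
  have dP: "(P has_real_derivative P' t) (at t)" for t
    using DERIV_mult'[OF dp3[of t] DERIV_cut[of S t]] unfolding P_def[abs_def] P'_def by (simp add: add.commute)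
  have dP': "(P' has_real_derivative P'' t) (at t)" for t
    using DERIV_add[OF DERIV_mult'[OF dp2[of t] DERIV_cut[of S t]] DERIV_mult'[OF dp3[of t] DERIV_cut'[of S t]]]
    unfolding P'_def[abs_def] P''_def by (simp add: add_ac)
  have cP': "continuous_on UNIV P'" "continuous_on UNIV P''"
    unfolding P'_def[abs_def] P''_def[abs_def] by (intro continuous_intros)+
  have P0: "P t = 0" "P' t = 0" if "t \<ge> S + 1" for t using cut_eq_0[OF that] by (simp_all add: P_def P'_def)
  have tf: "testfun (\<lambda>x::real^'n. P (x \<bullet> x)) (\<lambda>x. (2 * P' (x \<bullet> x)) *\<^sub>R x)"
    by (rule testfun_radial[OF dP cP'(1) P0(1)])
  have \<Phi>H: "(\<lambda>x::real^'n. P (x \<bullet> x)) \<in> H1" by (rule testfun_H1[OF tf])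
  have d2: "((\<lambda>t. 2 * P' t) has_real_derivative 2 * P'' t) (at t)" for t by (rule DERIV_cmult[OF dP'])
  have c2P: "continuous_on UNIV (\<lambda>t. 2 * P'' t)" by (intro continuous_intros cP')
  have z2: "2 * P' t = 0" if "t \<ge> S + 1" for t using P0(2)[OF that] by simp
  \<comment> \<open>The gradient of the test function is again a radial field, with profile 2 P'. A
    second integration by parts moves all derivatives onto it and leaves u itself.\<close>
  note W = weak_grad_radial_field[OF H d2 c2P z2]
  define h where "h x = u x * (2 * (x \<bullet> x) * (2 * P'' (x \<bullet> x)) + real CARD('n) * (2 * P' (x \<bullet> x)))" for x
  define k where "k x = F' (u x) * P (x \<bullet> x) - lam * (u x * P (x \<bullet> x))" for x
  have FI: "integrable lborel (\<lambda>x. F' (u x) * P (x \<bullet> x))" by (rule F'_testfun_integrable[OF uH \<Phi>H])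
  have uI: "integrable lborel (\<lambda>x. u x * P (x \<bullet> x))" by (rule sqL2_mult_integrable[OF H(1) testfun_sqL2(1)[OF tf]])
  have hI: "integrable lborel h" unfolding h_def[abs_def] by (rule W(3))
  have kI: "integrable lborel k" unfolding k_def[abs_def] using FI uI by simp
  have "(\<integral>x. wgrad u x \<bullet> ((2 * P' (x \<bullet> x)) *\<^sub>R x) + F' (u x) * P (x \<bullet> x) \<partial>lborel) = lam * (\<integral>x. u x * P (x \<bullet> x) \<partial>lborel)"
    using sol tf unfolding weak_solution_def by blast
  moreover have "(\<integral>x. wgrad u x \<bullet> ((2 * P' (x \<bullet> x)) *\<^sub>R x) + F' (u x) * P (x \<bullet> x) \<partial>lborel)
     = (\<integral>x. 2 * P' (x \<bullet> x) * (wgrad u x \<bullet> x) \<partial>lborel) + (\<integral>x. F' (u x) * P (x \<bullet> x) \<partial>lborel)"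
    using Bochner_Integration.integral_add[OF W(2) FI] by simp
  moreover have "(\<integral>x. h x \<partial>lborel) = - (\<integral>x. 2 * P' (x \<bullet> x) * (wgrad u x \<bullet> x) \<partial>lborel)"
    unfolding h_def by (rule W(1))
  moreover have "(\<integral>x. k x \<partial>lborel) = (\<integral>x. F' (u x) * P (x \<bullet> x) \<partial>lborel) - lam * (\<integral>x. u x * P (x \<bullet> x) \<partial>lborel)"
    unfolding k_def using FI uI by simp
  ultimately have "(\<integral>x. h x - k x \<partial>lborel) = 0" using hI kI by simp
  \<comment> \<open>In the shell, with m = |x|^2 - a, the Laplacian of the test function contributes
    at least 24 |x|^2 u m >= 12 S u m, while the zero-order terms are at most K m^2 u m <= S u m. A
    surplus of S u m is all that is kept.\<close>
  have key: "S * (u x * max 0 (x \<bullet> x - a)) \<le> h x - k x" for x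
  proof (cases "a < x \<bullet> x \<and> x \<bullet> x \<le> S \<and> u x > 0")
    case True
    define m where "m = x \<bullet> x - a"
    have m: "m > 0" "m \<le> \<delta>" using True by (auto simp: m_def a_def)
    have mm: "max 0 (x \<bullet> x - a) = m" using m by (simp add: m_def)
    have t: "x \<bullet> x \<ge> S / 2" using True \<delta> by (simp add: a_def)
    have Pm: "P (x \<bullet> x) = m ^ 3" "P' (x \<bullet> x) = 3 * m\<^sup>2" "P'' (x \<bullet> x) = 6 * m"
      using True mm cut_eq_1[of "x \<bullet> x" S] unfolding P_def P'_def P''_def pos3_def pos2_def pos1_def by simp_all
    have "F' (u x) - lam * u x \<le> \<bar>F' (u x)\<bar> + \<bar>lam * u x\<bar>" by linarith
    also have "\<bar>F' (u x)\<bar> \<le> (c1 * M powr (q - 2) + c2 * M powr (p - 2)) * u x"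
      using True uM[OF t] by (intro F'_linear_bound) auto
    finally have "F' (u x) - lam * u x \<le> K * u x" using True by (simp add: K_def abs_mult algebra_simps)
    then have "(F' (u x) - lam * u x) * m ^ 3 \<le> K * u x * m ^ 3" using m by (intro mult_right_mono) auto
    also have "\<dots> = K * m\<^sup>2 * (u x * m)" by (simp add: power2_eq_square power3_eq_cube)
    also have "\<dots> \<le> S * (u x * m)"
    proof (rule mult_right_mono)
      have "K * m\<^sup>2 \<le> K * \<delta>\<^sup>2" using K m by (intro mult_left_mono power_mono) auto
      then show "K * m\<^sup>2 \<le> S" using K\<delta> by linarith
    qed (use True m in simp)
    finally have k1: "k x \<le> S * (u x * m)" unfolding k_def Pm by (simp add: algebra_simps)
    have "2 * S * (u x * m) \<le> 24 * (x \<bullet> x) * (u x * m)" using True m t S by (intro mult_right_mono) auto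
    also have "\<dots> \<le> h x"
    proof -
      have "h x = 24 * (x \<bullet> x) * (u x * m) + 6 * real CARD('n) * (u x * m\<^sup>2)" unfolding h_def Pm by (simp add: algebra_simps)
      moreover have "0 \<le> 6 * real CARD('n) * (u x * m\<^sup>2)" using True by simp
      ultimately show ?thesis by linarith
    qed
    finally show ?thesis unfolding mm using k1 by linarith
  next
    case False
    then consider "x \<bullet> x \<le> a" | "u x = 0" using above'[of x] nn[of x] by fastforce
    then show ?thesis
    proof cases
      case 1
      then have "P (x \<bullet> x) = 0" "P' (x \<bullet> x) = 0" "P'' (x \<bullet> x) = 0"
        by (simp_all add: P_def P'_def P''_def pos3_def pos2_def pos1_def)
      then show ?thesis using 1 by (simp add: h_def k_def)
    qed (simp add: h_def k_def F0)
  qed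
  have ge0: "0 \<le> h x - k x" for x
    by (rule order_trans[OF _ key]) (use S nn in simp)
  have "AE x in lborel. h x - k x = 0"
    using integral_nonneg_eq_0_iff_AE[of lborel "\<lambda>x. h x - k x"] hI kI ge0 \<open>(\<integral>x. h x - k x \<partial>lborel) = 0\<close> by simp
  then have "AE x :: real^'n in lborel. max 0 (min (x \<bullet> x - a) (S - x \<bullet> x)) = 0"
  proof eventually_elim
    case (elim x)
    show ?case
    proof (rule ccontr)
      assume "max 0 (min (x \<bullet> x - a) (S - x \<bullet> x)) \<noteq> 0"
      then have x: "a < x \<bullet> x" "x \<bullet> x < S" by (auto simp: max_def min_def split: if_splits)
      then have "u x > 0" using \<delta> S by (intro below') (auto simp: a_def)
      then have "S * (u x * max 0 (x \<bullet> x - a)) > 0" using x S by simp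
      then show False using key[of x] elim by linarith
    qed
  qed
  moreover have "continuous_on UNIV (\<lambda>x::real^'n. max 0 (min (x \<bullet> x - a) (S - x \<bullet> x)))" by (intro continuous_intros)
  \<comment> \<open>Evaluated in the middle of the shell, where both entries of the minimum equal
    \<delta>/2.\<close>
  ultimately have "max 0 (min (pt ((a + S) / 2) \<bullet> pt ((a + S) / 2) - a) (S - pt ((a + S) / 2) \<bullet> pt ((a + S) / 2))) = 0"
    by (intro continuous_AE_eq_0[of "\<lambda>x::real^'n. max 0 (min (x \<bullet> x - a) (S - x \<bullet> x))"])
  moreover have "(a + S) / 2 \<ge> 0" using \<delta> S by (simp add: a_def)
  ultimately have "max 0 (min ((a + S) / 2 - a) (S - (a + S) / 2)) = 0" using pt by simp
  moreover have "(a + S) / 2 - a > 0" "S - (a + S) / 2 > 0" using \<delta> by (simp_all add: a_def field_simps)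
  ultimately show False by (simp add: max_def min_def split: if_splits)
qed

lemma exists_ground_state:
  assumes \<rho>: "\<rho> > 0" and m: "Inf (lip_values \<rho>) < 0"
  obtains lam and u :: "real^'n \<Rightarrow> real" where "lam < 0" "u \<in> H1" "L2norm u = \<rho>"
    "\<And>v::real^'n \<Rightarrow> real. v \<in> H1 \<Longrightarrow> L2norm v = \<rho> \<Longrightarrow> J F u \<le> J F v"
    "\<And>x. u x > 0" "\<And>x y. norm x = norm y \<Longrightarrow> u x = u y" "weak_solution F' lam u"
proof (rule exists_radial_minimizer[OF \<rho> m])
  fix u :: "real^'n \<Rightarrow> real"
  assume u: "u \<in> H1" "L2norm u = \<rho>" "\<And>x. 0 \<le> u x" "u 0 = 1"
    "\<And>x y. x \<noteq> 0 \<Longrightarrow> y \<noteq> 0 \<Longrightarrow> norm x \<le> norm y \<Longrightarrow> u y \<le> u x" "J F u < 0"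
    "\<And>v::real^'n \<Rightarrow> real. v \<in> H1 \<Longrightarrow> L2norm v = \<rho> \<Longrightarrow> J F u \<le> J F v"
  define lam where "lam = ((\<integral>x. (norm (wgrad u x))\<^sup>2 \<partial>lborel) + (\<integral>x. F' (u x) * u x \<partial>lborel)) / \<rho>\<^sup>2"
  have sol: "weak_solution F' lam u" unfolding lam_def by (rule Euler_Lagrange[OF \<rho> u(1,2,7)])
  have lam: "lam < 0" unfolding lam_def by (rule multiplier_negative[OF \<rho> u(1,2,6,7)])
  have nz: "\<not> (AE x in lborel. u x = 0)"
  proof
    assume "AE x in lborel. u x = 0"
    then have "(\<integral>x. (u x)\<^sup>2 \<partial>lborel) = (\<integral>x. 0 \<partial>(lborel :: (real^'n) measure))"
      using H1_measurable[OF u(1)] by (intro integral_cong_AE) auto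
    then show False using u(2) \<rho> by (simp add: L2norm_def)
  qed
  have pos: "u x > 0" for x
  proof (cases "x = 0")
    case False
    show ?thesis by (rule radial_solution_positive[OF u(1) sol _ _ nz False]) (fact u)+
  qed (simp add: u(4))
  have rad: "u x = u y" if "norm x = norm y" for x y
  proof (cases "x = 0")
    case False
    then have "y \<noteq> 0" using that by auto
    then show ?thesis using False that u(5)[of x y] u(5)[of y x] by simp
  qed (use that in simp)
  show ?thesis by (rule that[OF lam u(1,2,7) pos rad sol])
qed

end

theorem theorem2:
  fixes F F' F'' :: "real \<Rightarrow> real"
    and c1 c2 q p d1 d2 \<gamma> :: real
  assumes N3: "CARD('n::finite) \<ge> 3"
    and F_deriv: "\<And>s. (F has_real_derivative F' s) (at s)"
    and F'_deriv: "\<And>s. (F' has_real_derivative F'' s) (at s)"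
    and F''_cont: "continuous_on UNIV F''"
    and F_even: "\<And>s. F (- s) = F s"
    and F0: "F 0 = 0" "F' 0 = 0" "F'' 0 = 0"
    and c12: "c1 \<ge> 0" "c2 \<ge> 0"
    and qp: "2 < q" "q \<le> p" "p < 2 * real CARD('n) / (real CARD('n) - 2)"
    and growth: "\<And>s. \<bar>F' s\<bar> \<le> c1 * \<bar>s\<bar> powr (q - 1) + c2 * \<bar>s\<bar> powr (p - 1)"
    and d12: "d1 \<ge> 0" "d2 \<ge> 0"
    and gam: "\<gamma> < 2 + 4 / real CARD('n)"
    and lower: "\<And>s. F s \<ge> - d1 * s^2 - d2 * \<bar>s\<bar> powr \<gamma>"
    and neg: "\<exists>s0. F s0 < 0"
  shows "\<exists>\<rho>bar>0. \<forall>\<rho>>\<rho>bar.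
           (\<exists>ubar::real^'n \<Rightarrow> real. ubar \<in> H1 \<and> L2norm ubar = \<rho> \<and>
               (\<forall>v::real^'n \<Rightarrow> real. v \<in> H1 \<longrightarrow> L2norm v = \<rho> \<longrightarrow> J F ubar \<le> J F v)) \<and>
           (\<exists>lam<0. \<exists>ubar::real^'n \<Rightarrow> real. ubar \<in> H1 \<and> L2norm ubar = \<rho> \<and>
               (\<forall>v::real^'n \<Rightarrow> real. v \<in> H1 \<longrightarrow> L2norm v = \<rho> \<longrightarrow> J F ubar \<le> J F v) \<and>
               (\<forall>x. ubar x > 0) \<and>
               (\<forall>x y. norm x = norm y \<longrightarrow> ubar x = ubar y) \<and>
               weak_solution F' lam ubar)"
proof -
  have F'_cont: "continuous_on UNIV F'"
    using F'_deriv by (intro continuous_at_imp_continuous_on ballI DERIV_isCont)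
  interpret mass_constrained_problem F F' c1 c2 q p d1 d2 \<gamma> "TYPE('n)"
    by unfold_locales (use N3 F_deriv F'_cont F_even F0 c12 qp growth d12 gam lower in auto)
  obtain \<rho>bar where \<rho>bar: "\<rho>bar > 0" "\<And>\<rho>. \<rho> > \<rho>bar \<Longrightarrow> Inf (lip_values \<rho>) < 0"
    using exists_negative_level[OF neg] by blast
  show ?thesis
  proof (intro exI[of _ \<rho>bar] conjI[OF \<rho>bar(1)] allI impI)
    fix \<rho> assume \<rho>: "\<rho> > \<rho>bar"
    then have "\<rho> > 0" using \<rho>bar(1) by simp
    then show "(\<exists>ubar::real^'n \<Rightarrow> real. ubar \<in> H1 \<and> L2norm ubar = \<rho> \<and>
               (\<forall>v::real^'n \<Rightarrow> real. v \<in> H1 \<longrightarrow> L2norm v = \<rho> \<longrightarrow> J F ubar \<le> J F v)) \<and>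
           (\<exists>lam<0. \<exists>ubar::real^'n \<Rightarrow> real. ubar \<in> H1 \<and> L2norm ubar = \<rho> \<and>
               (\<forall>v::real^'n \<Rightarrow> real. v \<in> H1 \<longrightarrow> L2norm v = \<rho> \<longrightarrow> J F ubar \<le> J F v) \<and>
               (\<forall>x. ubar x > 0) \<and>
               (\<forall>x y. norm x = norm y \<longrightarrow> ubar x = ubar y) \<and>
               weak_solution F' lam ubar)"
    proof (rule exists_ground_state[OF _ \<rho>bar(2)[OF \<rho>]])
      fix lam and u :: "real^'n \<Rightarrow> real"
      assume u: "lam < 0" "u \<in> H1" "L2norm u = \<rho>"
        "\<And>v::real^'n \<Rightarrow> real. v \<in> H1 \<Longrightarrow> L2norm v = \<rho> \<Longrightarrow> J F u \<le> J F v"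
        "\<And>x. u x > 0" "\<And>x y. norm x = norm y \<Longrightarrow> u x = u y" "weak_solution F' lam u"
      \<comment> \<open>The same function witnesses both conjuncts.\<close>
      then show ?thesis by blast
    qed
  qed
qed

end
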